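(* The measure $\mu_0$ is infinitesimally conformally invariant, in the sense that for any $L\in\mathcal W\times\overline{\mathcal W}$, $$\int L(F)\,d\mu_0(\gamma)=0$$ for any test function $F$ of the form $$F=p\left(u_1,u_2,\dots,\overline{u_1},\overline{u_2},\dots,l_1,l_2,\dots,\overline{l_1},\overline{l_2},\dots\right)f(\rho_0,\rho_\infty),$$ where $p$ is a polynomial (in finitely many of the variables) and $f$ is a smooth function with compact support in $\mathbb R^+\times\mathbb R^+$.
   Context: For a Riemann surface $S$, $\mathrm{Loop}(S)$ is the set of compact subsets of $S$ homeomorphic to the circle $S^1$, with the Vietoris topology. A family of positive Borel measures $\mu_S$ on $\mathrm{Loop}(S)$, one for each Riemann surface $S$, satisfies conformal restriction if for each conformal embedding $S_1\to S_2$ the restriction of $\mu_{S_2}$ to $\mathrm{Loop}(S_1)$ equals $\mu_{S_1}$. It is nontrivial if for some $0<\alpha<A$ the set of loops $\gamma\in \mathrm{Loop}(\{0<|z|<A\})\setminus \mathrm{Loop}(\{|z|<\alpha\})$ surrounding $0$ has finite positive measure. By a theorem of Werner such a nontrivial family exists and is unique up to a positive constant. $\mathrm{Loop}^1(\mathbb C\setminus\{0\})$ is the set of loops in $\mathbb C\setminus\{0\}$ which surround $0$, and $\mu_0$ is the restriction of Werner's measure to $\mathrm{Loop}^1(\mathbb C\setminus\{0\})$. Let $\Delta=\{|z|<1\}$, $\Delta^*=\{|z|>1\}\cup\{\infty\}$. For $\gamma\in\mathrm{Loop}^1(\mathbb C\setminus\{0\})$ let $U_+\ni 0$ and $U_-\ni\infty$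 be the components of $(\mathbb C\cup\{\infty\})\setminus\gamma$. Let $\phi_+:(\Delta,0)\to(U_+,0)$ be the conformal isomorphism normalized by $\phi_+(z)=\rho_0 u(z)$, $u(z)=z(1+\sum_{n\ge1}u_nz^n)$, $\rho_0>0$, and $\phi_-:(\Delta^*,\infty)\to(U_-,\infty)$ the conformal isomorphism normalized by $\phi_-(z)=\rho_\infty z(1+\sum_{n\ge1}b_nz^{-n})$, $\rho_\infty>0$; write $\frac1{\phi_-(1/w)}=\frac1{\rho_\infty}w(1+\sum_{n\ge1}l_nw^n)$. The Witt algebra $\mathcal W$ is the complex span of $L_n=-z^{n+1}\frac{\partial}{\partial z}$, $n\in\mathbb Z$; $\overline{\mathcal W}$ is the complex span of the antiholomorphic fields $\overline L_n$. For a Laurent polynomial $v(z)$ let $\overset{\rightarrow}{v}=v_1\partial_x+v_2\partial_y$ ($v=v_1+iv_2$), acting on functions of $\gamma$ by $(\pi_0(\overset{\rightarrow}{v})F)(\gamma)=\frac{d}{dt}\big|_{t=0}F(\exp(-t\overset{\rightarrow}{v})(\gamma))$ with $\exp(t\overset{\rightarrow}{v})$ the flow. With $\overset{\rightarrow}{L}_n,\overset{\longrightarrow}{iL}_n$ corresponding to $v=-z^{n+1},-iz^{n+1}$, $L_n$ acts by $\frac12(\pi_0(\overset{\rightarrow}{L}_n)-i\pi_0(\overset{\longrightarrow}{iL}_n))$ and $\overline L_n$ by $\frac12(\pi_0(\overset{\rightarrow}{L}_n)+i\pi_0(\overset{\longrightarrow}{iL}_n))$, extended complex linearly to $\mathcal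 W\times\overline{\mathcal W}$ (with $(A,B)$ acting as the sum of the actions of $A$ and $B$). *)

theory Defs
  imports "HOL-Complex_Analysis.Complex_Analysis" "HOL-Library.Poly_Mapping"
begin

section \<open>Riemann surfaces and conformal embeddings\<close>

text \<open>
  A complex structure is a topology together with an atlas; a chart is an open set with a
  complex-valued coordinate, of which only the values on that open set matter.
\<close>

type_synonym 'a complex_structure = "'a topology \<times> ('a set \<times> ('a \<Rightarrow> complex)) set"

definition chart :: "'a topology \<Rightarrow> 'a set \<times> ('a \<Rightarrow> complex) \<Rightarrow> bool" where
  "chart X c \<longleftrightarrow> (case c of (U, \<phi>) \<Rightarrow>
     openin X U \<and> open (\<phi> ` U) \<and>
     homeomorphic_map (subtopology X U) (top_of_set (\<phi> ` U)) \<phi>)"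

definition riemann_surface :: "'a complex_structure \<Rightarrow> bool" where
  "riemann_surface S \<longleftrightarrow>
     Hausdorff_space (fst S) \<and> connected_space (fst S) \<and> topspace (fst S) \<noteq> {} \<and>
     (\<forall>c\<in>snd S. chart (fst S) c) \<and>
     (\<Union>c\<in>snd S. fst c) = topspace (fst S) \<and>
     (\<forall>(U, \<phi>)\<in>snd S. \<forall>(V, \<psi>)\<in>snd S.
        (\<lambda>z. \<psi> (inv_into U \<phi> z)) holomorphic_on \<phi> ` (U \<inter> V))"

definition conformal_embedding ::
    "'a complex_structure \<Rightarrow> 'b complex_structure \<Rightarrow> ('a \<Rightarrow> 'b) \<Rightarrow> bool" where
  "conformal_embedding S T f \<longleftrightarrow>
     continuous_map (fst S) (fst T) f \<and> inj_on f (topspace (fst S)) \<and>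
     (\<forall>(U, \<phi>)\<in>snd S. \<forall>(V, \<psi>)\<in>snd T.
        (\<lambda>z. \<psi> (f (inv_into U \<phi> z))) holomorphic_on \<phi> ` {x\<in>U. f x \<in> V})"

definition plane_domain :: "complex set \<Rightarrow> complex complex_structure" where
  "plane_domain D = (top_of_set D, {(D, \<lambda>z. z)})"


section \<open>Loops and Werner's measure\<close>

definition loops :: "'a topology \<Rightarrow> 'a set set" where
  "loops X = {K. compactin X K \<and>
     subtopology X K homeomorphic_space top_of_set (sphere (0::complex) 1)}"

definition vietoris :: "'a topology \<Rightarrow> 'a set topology" where
  "vietoris X = topology_generated_by
     ({{K. compactin X K \<and> K \<subseteq> U} |U. openin X U} \<union>
      {{K. compactin X K \<and> K \<inter> U \<noteq> {}} |U. openin X U})"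

definition loop_space :: "'a topology \<Rightarrow> 'a set topology" where
  "loop_space X = subtopology (vietoris X) (loops X)"

definition borel_measure_on :: "'b topology \<Rightarrow> 'b measure \<Rightarrow> bool" where
  "borel_measure_on T M \<longleftrightarrow>
     space M = topspace T \<and> sets M = sigma_sets (topspace T) {U. openin T U}"

text \<open>
  A family indexed by all Riemann surfaces is rendered as a function on the Riemann surfaces
  whose points are elements of the type \<open>complex\<close> (the topology and atlas being arbitrary).
  This loses nothing: a connected Riemann surface has at most the cardinality of the continuum,
  hence is conformally isomorphic to one of these, and conformal restriction includes
  invariance under conformal isomorphism.
\<close>

type_synonym loop_measures = "complex complex_structure \<Rightarrow> complex set measure"

definition borel_family :: "loop_measures \<Rightarrow> bool" where
  "borel_family \<mu> \<longleftrightarrow>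
     (\<forall>S. riemann_surface S \<longrightarrow> borel_measure_on (loop_space (fst S)) (\<mu> S))"

definition conformal_restriction :: "loop_measures \<Rightarrow> bool" where
  "conformal_restriction \<mu> \<longleftrightarrow>
     (\<forall>S T \<iota>. riemann_surface S \<longrightarrow> riemann_surface T \<longrightarrow> conformal_embedding S T \<iota> \<longrightarrow>
        (\<forall>E\<in>sets (\<mu> S). emeasure (\<mu> S) E = emeasure (\<mu> T) ((\<lambda>\<gamma>. \<iota> ` \<gamma>) ` E)))"

definition surrounds_zero :: "complex set \<Rightarrow> bool" where
  "surrounds_zero \<gamma> \<longleftrightarrow> 0 \<in> inside \<gamma>"

definition nontrivial :: "loop_measures \<Rightarrow> bool" where
  "nontrivial \<mu> \<longleftrightarrow> (\<exists>\<alpha> A::real. 0 < \<alpha> \<and> \<alpha> < A \<and>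
     (let D = {z. 0 < cmod z \<and> cmod z < A};
          E = {\<gamma> \<in> loops (top_of_set D) - loops (top_of_set {z. cmod z < \<alpha>}). surrounds_zero \<gamma>}
      in 0 < emeasure (\<mu> (plane_domain D)) E \<and> emeasure (\<mu> (plane_domain D)) E < \<infinity>))"

definition werner_family :: "loop_measures \<Rightarrow> bool" where
  "werner_family \<mu> \<longleftrightarrow> borel_family \<mu> \<and> conformal_restriction \<mu> \<and> nontrivial \<mu>"

definition Loop1 :: "complex set set" where
  "Loop1 = {\<gamma> \<in> loops (top_of_set (- {0})). surrounds_zero \<gamma>}"

definition mu0 :: "loop_measures \<Rightarrow> complex set measure" where
  "mu0 \<mu> = restrict_space (\<mu> (plane_domain (- {0}))) Loop1"


section \<open>The uniformizing maps and their coefficients\<close>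

definition U_plus :: "complex set \<Rightarrow> complex set" where
  "U_plus \<gamma> = connected_component_set (- \<gamma>) 0"

text \<open>
  The component of the complement of the loop in the Riemann sphere that contains \<open>\<infinity>\<close> is
  \<open>outside \<gamma>\<close> with \<open>\<infinity>\<close> added. An isomorphism fixing \<open>\<infinity>\<close> is given by its
  restriction to the finite points; the expansion required below makes \<open>\<infinity>\<close> its
  value at \<open>\<infinity>\<close>.
\<close>

definition U_minus :: "complex set \<Rightarrow> complex set" where
  "U_minus \<gamma> = outside \<gamma>"

text \<open>
  In the three expansions below the leading coefficient 1 is stored at index 0.
\<close>

definition phi_plus_normalized ::
    "complex set \<Rightarrow> (complex \<Rightarrow> complex) \<Rightarrow> real \<Rightarrow> (nat \<Rightarrow> complex) \<Rightarrow> bool" where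
  "phi_plus_normalized \<gamma> \<phi> \<rho> u \<longleftrightarrow>
     \<phi> holomorphic_on ball 0 1 \<and> bij_betw \<phi> (ball 0 1) (U_plus \<gamma>) \<and> \<rho> > 0 \<and> u 0 = 1 \<and>
     (\<forall>z. cmod z < 1 \<longrightarrow> (\<lambda>n. of_real \<rho> * z * (u n * z ^ n)) sums \<phi> z)"

definition phi_minus_normalized ::
    "complex set \<Rightarrow> (complex \<Rightarrow> complex) \<Rightarrow> real \<Rightarrow> (nat \<Rightarrow> complex) \<Rightarrow> bool" where
  "phi_minus_normalized \<gamma> \<phi> \<rho> b \<longleftrightarrow>
     \<phi> holomorphic_on {z. cmod z > 1} \<and> bij_betw \<phi> {z. cmod z > 1} (U_minus \<gamma>) \<and>
     \<rho> > 0 \<and> b 0 = 1 \<and>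
     (\<forall>z. cmod z > 1 \<longrightarrow> (\<lambda>n. of_real \<rho> * z * (b n / z ^ n)) sums \<phi> z)"

definition inverted_expansion ::
    "(complex \<Rightarrow> complex) \<Rightarrow> real \<Rightarrow> (nat \<Rightarrow> complex) \<Rightarrow> bool" where
  "inverted_expansion \<phi> \<rho> l \<longleftrightarrow> l 0 = 1 \<and>
     (\<forall>w. 0 < cmod w \<and> cmod w < 1 \<longrightarrow>
        (\<lambda>n. 1 / of_real \<rho> * w * (l n * w ^ n)) sums (1 / \<phi> (1 / w)))"

definition rho_zero :: "complex set \<Rightarrow> real" where
  "rho_zero \<gamma> = (THE \<rho>. \<exists>\<phi> u. phi_plus_normalized \<gamma> \<phi> \<rho> u)"

definition u_coeff :: "complex set \<Rightarrow> nat \<Rightarrow> complex" where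
  "u_coeff \<gamma> = (THE u. \<exists>\<phi> \<rho>. phi_plus_normalized \<gamma> \<phi> \<rho> u)"

definition rho_inf :: "complex set \<Rightarrow> real" where
  "rho_inf \<gamma> = (THE \<rho>. \<exists>\<phi> b. phi_minus_normalized \<gamma> \<phi> \<rho> b)"

definition l_coeff :: "complex set \<Rightarrow> nat \<Rightarrow> complex" where
  "l_coeff \<gamma> = (THE l. \<exists>\<phi> \<rho> b. phi_minus_normalized \<gamma> \<phi> \<rho> b \<and> inverted_expansion \<phi> \<rho> l)"


section \<open>Test functions\<close>

text \<open>
  The variables of the polynomial, numbered from 0: \<open>Var_u n\<close> stands for the coefficient
  of index \<open>n + 1\<close>, and likewise for the other three families.
\<close>

datatype coord = Var_u nat | Var_u_bar nat | Var_l nat | Var_l_bar nat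

fun coord_val :: "complex set \<Rightarrow> coord \<Rightarrow> complex" where
  "coord_val \<gamma> (Var_u n) = u_coeff \<gamma> (Suc n)"
| "coord_val \<gamma> (Var_u_bar n) = cnj (u_coeff \<gamma> (Suc n))"
| "coord_val \<gamma> (Var_l n) = l_coeff \<gamma> (Suc n)"
| "coord_val \<gamma> (Var_l_bar n) = cnj (l_coeff \<gamma> (Suc n))"

type_synonym coord_poly = "(coord \<Rightarrow>\<^sub>0 nat) \<Rightarrow>\<^sub>0 complex"

definition eval_poly :: "(coord \<Rightarrow> complex) \<Rightarrow> coord_poly \<Rightarrow> complex" where
  "eval_poly x p = (\<Sum>m\<in>Poly_Mapping.keys p. Poly_Mapping.lookup p m *
     (\<Prod>c\<in>Poly_Mapping.keys m. x c ^ Poly_Mapping.lookup m c))"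

fun times_differentiable_on ::
    "nat \<Rightarrow> 'a::real_normed_vector set \<Rightarrow> ('a \<Rightarrow> 'b::real_normed_vector) \<Rightarrow> bool" where
  "times_differentiable_on 0 S f \<longleftrightarrow> continuous_on S f"
| "times_differentiable_on (Suc k) S f \<longleftrightarrow> (\<forall>x\<in>S. f differentiable (at x)) \<and>
     (\<forall>h. times_differentiable_on k S (\<lambda>x. frechet_derivative f (at x) h))"

definition smooth_on_open ::
    "'a::real_normed_vector set \<Rightarrow> ('a \<Rightarrow> 'b::real_normed_vector) \<Rightarrow> bool" where
  "smooth_on_open S f \<longleftrightarrow> open S \<and> (\<forall>k. times_differentiable_on k S f)"

definition smooth_compact_support ::
    "'a::real_normed_vector set \<Rightarrow> ('a \<Rightarrow> 'b::real_normed_vector) \<Rightarrow> bool" where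
  "smooth_compact_support S f \<longleftrightarrow> smooth_on_open S f \<and>
     (\<exists>K. compact K \<and> K \<subseteq> S \<and> (\<forall>x\<in>S - K. f x = 0))"

definition test_function ::
    "coord_poly \<Rightarrow> (real \<times> real \<Rightarrow> complex) \<Rightarrow> complex set \<Rightarrow> complex" where
  "test_function p f \<gamma> = eval_poly (coord_val \<gamma>) p * f (rho_zero \<gamma>, rho_inf \<gamma>)"


section \<open>The action of the Witt algebra\<close>

text \<open>
  A vector field on the punctured plane is identified with a complex-valued function
  \<open>v = v\<^sub>1 + \<i> v\<^sub>2\<close>. The point \<open>flow v t z\<close> is meaningful only if the
  solution starting at \<open>z\<close> exists in the punctured plane up to time \<open>t\<close> (of either
  sign).
\<close>

definition flow :: "(complex \<Rightarrow> complex) \<Rightarrow> real \<Rightarrow> complex \<Rightarrow> complex" where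
  "flow v t z = (THE w. \<exists>x. x 0 = z \<and> x t = w \<and>
     (\<forall>s\<in>closed_segment 0 t. x s \<noteq> 0 \<and>
        (x has_vector_derivative v (x s)) (at s within closed_segment 0 t)))"

definition moved :: "(complex \<Rightarrow> complex) \<Rightarrow> (complex set \<Rightarrow> complex) \<Rightarrow> complex set \<Rightarrow> real \<Rightarrow> complex"
  where "moved v F \<gamma> t = F (flow v (- t) ` \<gamma>)"

definition pi0 :: "(complex \<Rightarrow> complex) \<Rightarrow> (complex set \<Rightarrow> complex) \<Rightarrow> complex set \<Rightarrow> complex" where
  "pi0 v F \<gamma> = vector_derivative (moved v F \<gamma>) (at 0)"

definition vec_L :: "int \<Rightarrow> complex \<Rightarrow> complex" where
  "vec_L n z = - (z powi (n + 1))"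

definition vec_iL :: "int \<Rightarrow> complex \<Rightarrow> complex" where
  "vec_iL n z = - \<i> * z powi (n + 1)"

definition act_L :: "int \<Rightarrow> (complex set \<Rightarrow> complex) \<Rightarrow> complex set \<Rightarrow> complex" where
  "act_L n F \<gamma> = 1/2 * (pi0 (vec_L n) F \<gamma> - \<i> * pi0 (vec_iL n) F \<gamma>)"

definition act_L_bar :: "int \<Rightarrow> (complex set \<Rightarrow> complex) \<Rightarrow> complex set \<Rightarrow> complex" where
  "act_L_bar n F \<gamma> = 1/2 * (pi0 (vec_L n) F \<gamma> + \<i> * pi0 (vec_iL n) F \<gamma>)"

text \<open>
  Both Witt algebras have a basis indexed by the integers; an element is given by its
  finitely supported coordinates with respect to it.
\<close>

type_synonym witt = "int \<Rightarrow>\<^sub>0 complex"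

definition witt_action ::
    "witt \<times> witt \<Rightarrow> (complex set \<Rightarrow> complex) \<Rightarrow> complex set \<Rightarrow> complex" where
  "witt_action L F \<gamma> =
     (\<Sum>n\<in>Poly_Mapping.keys (fst L). Poly_Mapping.lookup (fst L) n * act_L n F \<gamma>) +
     (\<Sum>n\<in>Poly_Mapping.keys (snd L). Poly_Mapping.lookup (snd L) n * act_L_bar n F \<gamma>)"

text \<open>The derivatives that enter \<open>witt_action L F \<gamma>\<close> exist.\<close>

definition witt_action_defined ::
    "witt \<times> witt \<Rightarrow> (complex set \<Rightarrow> complex) \<Rightarrow> complex set \<Rightarrow> bool" where
  "witt_action_defined L F \<gamma> \<longleftrightarrow>
     (\<forall>n \<in> Poly_Mapping.keys (fst L) \<union> Poly_Mapping.keys (snd L).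
        moved (vec_L n) F \<gamma> differentiable (at 0) \<and>
        moved (vec_iL n) F \<gamma> differentiable (at 0))"

end

theory Submission
  imports Defs
begin

text \<open>
  Let \<open>\<phi>\<close> be the normalized Riemann map of the interior of \<open>\<gamma>\<close>, and let
  \<open>\<gamma>\<close> move with a velocity \<open>v\<close> holomorphic near it. Write
  \<open>v \<circ> \<phi> = z * \<phi>' * (\<omega> + k)\<close> near the unit circle, where \<open>k\<close> is
  holomorphic in the disc and \<open>Re \<omega> = 0\<close> on the circle. Since \<open>\<omega>\<close>
  moves the circle along itself, the Riemann map varies by \<open>z * k * \<phi>'\<close>; for
  \<open>v = c * z powi (n + 1)\<close> the function \<open>k\<close> is explicit in the Taylor
  coefficients. The inversion \<open>z \<mapsto> 1 / z\<close> treats the exterior in the same way.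
  A test function is therefore differentiable along the flows, with bounds that are uniform
  over the loops in a fixed annulus, and kernel convergence makes it continuous.

  By Koebe's theorem the test function lives on the loops in a fixed annulus. There the flow is
  a conformal embedding for small times, so conformal restriction makes the integral of the test
  function constant along the flow. The loops in question have finite total measure, because
  finitely many dilates of the set in the nontriviality condition cover them, and dominated
  convergence allows differentiation under the integral.
\<close>

section \<open>Normalized Riemann maps\<close>

text \<open>A loop has no boundary regularity, so the variation formula cannot be read off from
  boundary values on the unit circle. The comparison takes place inside the disc. Let
  \<open>\<xi>\<close> be the predicted Riemann map followed by the inverse of the true one. On a
  compact annulus \<open>ln |\<xi> z / z|\<close> agrees, up to \<open>o(t)\<close>, with a harmonic
  function that tends to 0 at the unit circle, and a maximum principle makes both
  \<open>o(t)\<close>. Boundary behaviour enters only through the properness of Riemann maps, and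
  \<open>k 0\<close> is taken real so that the harmonic conjugate carries no stray constant.
  Uniformity has a separate source. The existence of the derivative is proved with constants that
  depend on the loop, while its size is read off from the formula for \<open>k\<close> on a circle
  whose radius depends only on the annulus. The group law spreads this bound from time 0 to nearby
  times, which yields the dominating function. For nonzero \<open>n\<close> the flow exists for no
  common positive time on the punctured plane, so conformal restriction is applied to an annulus
  that is wider than the support of the test function.\<close>

text \<open>Compactness and connectedness make the component of 0 simply connected, and the class is
  stable under the flows and under inversion. That the set is a circle matters only for the measure
  theory.\<close>

definition encircling :: "complex set \<Rightarrow> bool" where
  "encircling \<gamma> \<longleftrightarrow> compact \<gamma> \<and> connected \<gamma> \<and> 0 \<in> inside \<gamma>"

definition is_rmap :: "complex set \<Rightarrow> (complex \<Rightarrow> complex) \<Rightarrow> bool" where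
  "is_rmap U \<phi> \<longleftrightarrow> \<phi> holomorphic_on ball 0 1 \<and> bij_betw \<phi> (ball 0 1) U \<and>
     \<phi> 0 = 0 \<and> deriv \<phi> 0 = of_real (Re (deriv \<phi> 0)) \<and> Re (deriv \<phi> 0) > 0"

definition rmap :: "complex set \<Rightarrow> complex \<Rightarrow> complex" where
  "rmap \<gamma> = (SOME \<phi>. is_rmap (U_plus \<gamma>) \<phi>)"

definition rinv :: "complex set \<Rightarrow> complex \<Rightarrow> complex" where
  "rinv \<gamma> = the_inv_into (ball 0 1) (rmap \<gamma>)"

definition cradius :: "complex set \<Rightarrow> real" where
  "cradius \<gamma> = Re (deriv (rmap \<gamma>) 0)"

lemma encircling_zero_notin: "encircling \<gamma> \<Longrightarrow> 0 \<notin> \<gamma>"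
  by (auto simp: encircling_def inside_def)

lemma encircling_nonempty: "encircling \<gamma> \<Longrightarrow> \<gamma> \<noteq> {}"
  by (auto simp: encircling_def)

lemma open_U_plus: "encircling \<gamma> \<Longrightarrow> open (U_plus \<gamma>)"
  unfolding U_plus_def encircling_def
  by (intro open_connected_component) (simp add: compact_imp_closed open_Compl)

lemma connected_U_plus: "connected (U_plus \<gamma>)"
  by (simp add: U_plus_def)

lemma zero_in_U_plus: "encircling \<gamma> \<Longrightarrow> 0 \<in> U_plus \<gamma>"
  using encircling_zero_notin by (simp add: U_plus_def)

lemma U_plus_disjoint: "U_plus \<gamma> \<inter> \<gamma> = {}"
  using connected_component_subset[of "- \<gamma>" 0] by (auto simp: U_plus_def)

lemma bounded_U_plus: "encircling \<gamma> \<Longrightarrow> bounded (U_plus \<gamma>)"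
  by (auto simp: U_plus_def encircling_def inside_def)

lemma frontier_U_plus: "encircling \<gamma> \<Longrightarrow> frontier (U_plus \<gamma>) \<subseteq> \<gamma>"
  unfolding U_plus_def using frontier_of_connected_component_subset[of "- \<gamma>" 0]
  by (metis encircling_def frontier_complement frontier_subset_compact subset_trans)

lemma connected_subset_U_plus:
  assumes "connected S" "S \<inter> \<gamma> = {}" "x \<in> S" "x \<in> U_plus \<gamma>"
  shows "S \<subseteq> U_plus \<gamma>"
proof -
  have "S \<subseteq> connected_component_set (- \<gamma>) x"
    using assms by (intro connected_component_maximal) auto
  also have "\<dots> = U_plus \<gamma>"
    using assms(4) unfolding U_plus_def by (metis connected_component_eq mem_Collect_eq)
  finally show ?thesis .
qed

lemma U_plus_in_components: "encircling \<gamma> \<Longrightarrow> U_plus \<gamma> \<in> components (- \<gamma>)"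
  using encircling_zero_notin by (auto simp: U_plus_def componentsI)

lemma simply_connected_U_plus: "encircling \<gamma> \<Longrightarrow> simply_connected (U_plus \<gamma>)"
  using component_complement_connected[OF _ U_plus_in_components]
  by (simp add: simply_connected_iff_simple open_U_plus bounded_U_plus connected_U_plus
      encircling_def)

lemma rmap_exists:
  assumes "encircling \<gamma>"
  shows "\<exists>\<phi>. is_rmap (U_plus \<gamma>) \<phi>"
proof -
  let ?D = "ball (0::complex) 1"
  let ?U = "U_plus \<gamma>"
  have "?U \<noteq> UNIV" using bounded_U_plus[OF assms] not_bounded_UNIV by metis
  moreover have "?U \<noteq> {}" using zero_in_U_plus[OF assms] by auto
  ultimately have "\<exists>f g. f holomorphic_on ?U \<and> g holomorphic_on ?D \<and>
      (\<forall>z\<in>?U. f z \<in> ?D \<and> g (f z) = z) \<and> (\<forall>z\<in>?D. g z \<in> ?U \<and> f (g z) = z)"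
    using simply_connected_eq_biholomorphic_to_disc[OF open_U_plus[OF assms]]
      simply_connected_U_plus[OF assms] by argo
  then obtain f g where fg: "f holomorphic_on ?U" "g holomorphic_on ?D"
     "\<And>z. z \<in> ?U \<Longrightarrow> f z \<in> ?D \<and> g (f z) = z" "\<And>z. z \<in> ?D \<Longrightarrow> g z \<in> ?U \<and> f (g z) = z"
    by blast
  define a where "a = f 0"
  have a: "cmod a < 1" using fg(3)[OF zero_in_U_plus[OF assms]] by (simp add: a_def)
  \<comment> \<open>\<open>M\<close> sends 0 to \<open>a = f 0\<close>, so
    \<open>g \<circ> M\<close> is still a bijection of the disc onto the domain and now fixes
    0.\<close>
  define M where "M = Moebius_function 0 (- a)"
  define M' where "M' = Moebius_function 0 a"
  have M: "M holomorphic_on ?D" "\<And>z. z \<in> ?D \<Longrightarrow> M z \<in> ?D" "\<And>z. z \<in> ?D \<Longrightarrow> M' z \<in> ?D"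
      "\<And>z. z \<in> ?D \<Longrightarrow> M (M' z) = z" "\<And>z. z \<in> ?D \<Longrightarrow> M' (M z) = z" "M 0 = a"
    using a Moebius_function_holomorphic[of "- a" 0] Moebius_function_norm_lt_1
      Moebius_function_compose[of "- a" a] Moebius_function_compose[of a "- a"]
    by (auto simp: M_def M'_def Moebius_function_of_zero)
  define h where "h = g \<circ> M"
  have bh: "bij_betw h ?D ?U"
    by (rule bij_betw_byWitness[where f' = "M' \<circ> f"]) (use fg(3,4) M in \<open>auto simp: h_def\<close>)
  have hh: "h holomorphic_on ?D"
    unfolding h_def using M fg(2) by (intro holomorphic_on_compose_gen[of M _ g ?D]) auto
  have h0: "h 0 = 0" using fg(3)[OF zero_in_U_plus[OF assms]] by (simp add: h_def M a_def)
  have d: "deriv h 0 \<noteq> 0"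
    using holomorphic_injective_imp_regular[OF hh] bh by (auto simp: bij_betw_def)
  \<comment> \<open>Rotating by the conjugate phase turns the derivative at 0 into its
    modulus.\<close>
  define e where "e = cnj (deriv h 0) / of_real (cmod (deriv h 0))"
  have e: "cmod e = 1" using d by (simp add: e_def norm_divide)
  define k where "k = h \<circ> (\<lambda>z. e * z)"
  have rot: "bij_betw (\<lambda>z. e * z) ?D ?D"
    by (rule bij_betw_byWitness[where f' = "\<lambda>z. z / e"]) (use e in \<open>auto simp: norm_mult norm_divide\<close>)
  have bk: "bij_betw k ?D ?U" unfolding k_def by (rule bij_betw_trans[OF rot bh])
  have hk: "k holomorphic_on ?D"
    unfolding k_def
    by (rule holomorphic_on_compose_gen[OF _ hh]) (auto intro!: holomorphic_intros simp: norm_mult e)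
  have "(h has_field_derivative deriv h 0) (at (e * 0))"
    using hh by (simp add: holomorphic_derivI)
  then have "(k has_field_derivative deriv h 0 * e) (at 0)"
    unfolding k_def by (intro DERIV_chain) (auto intro!: derivative_eq_intros)
  then have "deriv k 0 = deriv h 0 * e" by (rule DERIV_imp_deriv)
  also have "\<dots> = of_real (cmod (deriv h 0))"
    using d by (simp add: e_def complex_norm_square[symmetric] power2_eq_square field_simps)
  finally have "deriv k 0 = of_real (cmod (deriv h 0))" .
  then have "is_rmap ?U k" using bk hk h0 d by (simp add: is_rmap_def k_def)
  then show ?thesis by blast
qed

lemma is_rmap_rmap: "encircling \<gamma> \<Longrightarrow> is_rmap (U_plus \<gamma>) (rmap \<gamma>)"
  unfolding rmap_def using rmap_exists by (rule someI_ex)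

context
  fixes \<gamma> :: "complex set"
  assumes enc: "encircling \<gamma>"
begin

lemma rmap_holomorphic: "rmap \<gamma> holomorphic_on ball 0 1"
  and rmap_bij: "bij_betw (rmap \<gamma>) (ball 0 1) (U_plus \<gamma>)"
  and rmap_0: "rmap \<gamma> 0 = 0"
  and deriv_rmap_0: "deriv (rmap \<gamma>) 0 = of_real (cradius \<gamma>)"
  and cradius_pos: "cradius \<gamma> > 0"
  using is_rmap_rmap[OF enc] unfolding is_rmap_def cradius_def by blast+

lemma rmap_inj: "inj_on (rmap \<gamma>) (ball 0 1)"
  using rmap_bij by (simp add: bij_betw_def)

lemma rmap_image: "rmap \<gamma> ` ball 0 1 = U_plus \<gamma>"
  using rmap_bij by (simp add: bij_betw_def)

lemma rmap_in: "cmod z < 1 \<Longrightarrow> rmap \<gamma> z \<in> U_plus \<gamma>"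
  using rmap_image by auto

lemma rmap_has_deriv: "cmod z < 1 \<Longrightarrow> (rmap \<gamma> has_field_derivative deriv (rmap \<gamma>) z) (at z)"
  using rmap_holomorphic by (simp add: holomorphic_derivI)

lemma deriv_rmap_nz: "cmod z < 1 \<Longrightarrow> deriv (rmap \<gamma>) z \<noteq> 0"
  using holomorphic_injective_imp_regular[OF rmap_holomorphic _ rmap_inj] by simp

lemma rmap_eq_0_iff: "cmod z < 1 \<Longrightarrow> rmap \<gamma> z = 0 \<longleftrightarrow> z = 0"
  using inj_onD[OF rmap_inj, of z 0] rmap_0 by auto

lemma rinv_rmap: "cmod z < 1 \<Longrightarrow> rinv \<gamma> (rmap \<gamma> z) = z"
  using the_inv_into_f_f[OF rmap_inj] by (simp add: rinv_def)

lemma rmap_rinv: "w \<in> U_plus \<gamma> \<Longrightarrow> rmap \<gamma> (rinv \<gamma> w) = w"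
  using f_the_inv_into_f[OF rmap_inj] rmap_image by (simp add: rinv_def)

lemma rinv_in: "w \<in> U_plus \<gamma> \<Longrightarrow> cmod (rinv \<gamma> w) < 1"
  using the_inv_into_into[OF rmap_inj, of w "ball 0 1"] rmap_image by (auto simp: rinv_def)

lemma rinv_0: "rinv \<gamma> 0 = 0"
  using rinv_rmap[of 0] rmap_0 by simp

lemma rinv_holomorphic: "rinv \<gamma> holomorphic_on U_plus \<gamma>"
proof -
  obtain g where g: "g holomorphic_on rmap \<gamma> ` ball 0 1" "\<And>z. z \<in> ball 0 1 \<Longrightarrow> g (rmap \<gamma> z) = z"
    using holomorphic_has_inverse[OF rmap_holomorphic open_ball rmap_inj] by metis
  show ?thesis
  proof (rule holomorphic_transform)
    show "g holomorphic_on U_plus \<gamma>" using g(1) by (simp add: rmap_image)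
    show "g w = rinv \<gamma> w" if "w \<in> U_plus \<gamma>" for w
      using g(2)[of "rinv \<gamma> w"] rinv_in[OF that] rmap_rinv[OF that] by simp
  qed
qed

lemma rinv_has_deriv:
  assumes "w \<in> U_plus \<gamma>"
  shows "(rinv \<gamma> has_field_derivative inverse (deriv (rmap \<gamma>) (rinv \<gamma> w))) (at w)"
proof -
  have 1: "(rinv \<gamma> has_field_derivative deriv (rinv \<gamma>) w) (at w)"
    using rinv_holomorphic assms enc by (simp add: holomorphic_derivI open_U_plus)
  have 2: "(rmap \<gamma> has_field_derivative deriv (rmap \<gamma>) (rinv \<gamma> w)) (at (rinv \<gamma> w))"
    using rmap_has_deriv rinv_in assms by simp
  have "((rmap \<gamma> \<circ> rinv \<gamma>) has_field_derivative deriv (rmap \<gamma>) (rinv \<gamma> w) * deriv (rinv \<gamma>) w) (at w)"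
    by (rule DERIV_chain[OF 2 1])
  moreover have "((rmap \<gamma> \<circ> rinv \<gamma>) has_field_derivative 1) (at w)"
    by (rule has_field_derivative_transform_within_open[OF DERIV_ident open_U_plus[OF enc] assms])
       (simp add: rmap_rinv)
  ultimately have "deriv (rmap \<gamma>) (rinv \<gamma> w) * deriv (rinv \<gamma>) w = 1"
    by (rule DERIV_unique)
  then show ?thesis using 1 inverse_unique by metis
qed

end

section \<open>Schwarz's lemma and uniqueness of the normalized map\<close>

lemma Schwarz_radius:
  assumes "h holomorphic_on ball 0 r" "h 0 = 0" "\<And>z. cmod z < r \<Longrightarrow> cmod (h z) < 1" "r > 0"
  shows "r * cmod (deriv h 0) \<le> 1"
proof -
  define k where "k = h \<circ> (\<lambda>z. of_real r * z)"
  have sc: "cmod (of_real r * z) < r" if "cmod z < 1" for z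
    using mult_strict_left_mono[OF that assms(4)] assms(4) by (simp add: norm_mult)
  have 1: "k holomorphic_on ball 0 1"
    unfolding k_def
  proof (rule holomorphic_on_compose_gen[OF _ assms(1)])
    show "(*) (of_real r) holomorphic_on ball (0::complex) 1" by (intro holomorphic_intros)
    show "(*) (of_real r) ` ball (0::complex) 1 \<subseteq> ball 0 r" using sc by auto
  qed
  have 2: "cmod (k z) < 1" if "cmod z < 1" for z
    unfolding k_def o_def by (rule assms(3)[OF sc[OF that]])
  have "(h has_field_derivative deriv h 0) (at (of_real r * 0))"
    using holomorphic_derivI[OF assms(1) open_ball, of 0 UNIV] assms(4) by simp
  moreover have "((\<lambda>z. of_real r * z) has_field_derivative of_real r) (at (0::complex))"
    by (rule DERIV_cmult_Id)
  ultimately have "(k has_field_derivative deriv h 0 * of_real r) (at 0)"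
    unfolding k_def by (rule DERIV_chain[where f = h and g = "(*) (of_real r)" and x = 0])
  then have "deriv k 0 = deriv h 0 * of_real r" by (rule DERIV_imp_deriv)
  moreover have "cmod (deriv k 0) \<le> 1"
    using Schwarz_Lemma(2)[where f = k and \<xi> = 0, OF 1 _ 2] assms(2) by (simp add: k_def o_def)
  ultimately show ?thesis using assms(4) by (simp add: norm_mult mult.commute)
qed

text \<open>Schwarz's lemma forces \<open>c = 1\<close>, and its equality case makes
  \<open>h\<close> a rotation, here by the factor 1. The form \<open>c \<ge> 1\<close> suits the
  uses, where \<open>c\<close> is a quotient of two radii that is only known from below.\<close>

lemma Schwarz_identity:
  assumes "h holomorphic_on ball 0 1" "h 0 = 0" "\<And>z. cmod z < 1 \<Longrightarrow> cmod (h z) < 1"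
    and "deriv h 0 = of_real c" "c \<ge> 1" "cmod z < 1"
  shows "h z = z"
proof -
  have "c \<le> 1" using Schwarz_Lemma(2)[where f = h and \<xi> = 0, OF assms(1-3)] assms(4,5) by simp
  then have c: "c = 1" using assms(5) by simp
  then obtain \<alpha> where \<alpha>: "\<And>z. norm z < 1 \<Longrightarrow> h z = \<alpha> * z"
    using Schwarz_Lemma(3)[where f = h and \<xi> = 0, OF assms(1-3)] assms(4) by auto
  have "((\<lambda>z. \<alpha> * z) has_field_derivative \<alpha>) (at 0)" by (auto intro!: derivative_eq_intros)
  then have "(h has_field_derivative \<alpha>) (at 0)"
    by (rule has_field_derivative_transform_within_open[of _ _ _ "ball 0 1"]) (auto simp: \<alpha>)
  then have "\<alpha> = 1" using assms(4) c by (auto dest: DERIV_imp_deriv)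
  then show ?thesis using \<alpha> assms(6) by simp
qed

text \<open>Schwarz's lemma is applied to both transition maps. The inverse of \<open>h\<close>
  after \<open>rmap \<gamma>\<close> shows that the derivative of \<open>h\<close> at 0 is at least
  \<open>cradius \<gamma>\<close>; then \<open>rinv \<gamma> \<circ> h\<close> has derivative at
  least 1 at 0 and is the identity.\<close>

lemma is_rmap_unique:
  assumes enc: "encircling \<gamma>" and h: "is_rmap (U_plus \<gamma>) h" and z: "cmod z < 1"
  shows "h z = rmap \<gamma> z"
proof -
  let ?p = "rmap \<gamma>"
  have sub: "k z = z" if "h' holomorphic_on ball 0 1" "bij_betw h' (ball 0 1) (U_plus \<gamma>)"
     "h' 0 = 0" "deriv h' 0 = of_real c" "c \<ge> cradius \<gamma>" "k = rinv \<gamma> \<circ> h'" "cmod z < 1" for h' c z k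
  proof -
    have im: "h' ` ball 0 1 = U_plus \<gamma>" using that by (simp add: bij_betw_def)
    have 1: "k holomorphic_on ball 0 1"
      unfolding that(6) by (rule holomorphic_on_compose_gen[OF that(1) rinv_holomorphic[OF enc]]) (simp add: im)
    have "(h' has_field_derivative deriv h' 0) (at 0)" using that(1) by (simp add: holomorphic_derivI)
    moreover have "(rinv \<gamma> has_field_derivative inverse (deriv ?p 0)) (at (h' 0))"
      using rinv_has_deriv[OF enc zero_in_U_plus[OF enc]] by (simp add: rinv_0[OF enc] that)
    ultimately have "(k has_field_derivative inverse (deriv ?p 0) * deriv h' 0) (at 0)"
      unfolding that(6) by (intro DERIV_chain)
    then have "deriv k 0 = inverse (deriv ?p 0) * deriv h' 0" by (rule DERIV_imp_deriv)
    then have "deriv k 0 = of_real (c / cradius \<gamma>)"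
      by (simp add: that deriv_rmap_0[OF enc] field_simps)
    moreover have "cmod (k z) < 1" if "cmod z < 1" for z
      using \<open>cmod z < 1\<close> im rinv_in[OF enc, of "h' z"] \<open>k = _\<close> by force
    ultimately show ?thesis
      using Schwarz_identity[where h = k and z = z, OF 1, of "c / cradius \<gamma>"] that rinv_0[OF enc] cradius_pos[OF enc]
      by (simp add: le_divide_eq)
  qed
  have hh: "h holomorphic_on ball 0 1" "bij_betw h (ball 0 1) (U_plus \<gamma>)" "h 0 = 0"
    "deriv h 0 = of_real (Re (deriv h 0))" "0 < Re (deriv h 0)"
    using h unfolding is_rmap_def by blast+
  have inj: "inj_on h (ball 0 1)" and im: "h ` ball 0 1 = U_plus \<gamma>"
    using hh by (auto simp: bij_betw_def)
  obtain g where g: "g holomorphic_on U_plus \<gamma>" "\<And>z. z \<in> ball 0 1 \<Longrightarrow> deriv h z * deriv g (h z) = 1"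
      "\<And>z. z \<in> ball 0 1 \<Longrightarrow> g (h z) = z"
    using holomorphic_has_inverse[OF hh(1) open_ball inj] im by metis
  have ge: "Re (deriv h 0) \<ge> cradius \<gamma>"
  proof -
    let ?k = "g \<circ> ?p"
    have 1: "?k holomorphic_on ball 0 1"
      by (rule holomorphic_on_compose_gen[OF rmap_holomorphic[OF enc] g(1)]) (simp add: rmap_image[OF enc])
    have in1: "cmod (?k z) < 1" if "cmod z < 1" for z
    proof -
      have "?p z \<in> h ` ball 0 1" using rmap_in[OF enc that] im by simp
      then show ?thesis using g(3) by auto
    qed
    have g0: "g 0 = 0" using g(3)[of 0] hh(3) by simp
    have "(?p has_field_derivative deriv ?p 0) (at 0)" using rmap_has_deriv[OF enc] by simp
    moreover have "(g has_field_derivative deriv g 0) (at (?p 0))"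
      using g(1) zero_in_U_plus[OF enc] open_U_plus[OF enc] rmap_0[OF enc] by (simp add: holomorphic_derivI)
    ultimately have "(?k has_field_derivative deriv g 0 * deriv ?p 0) (at 0)"
      by (intro DERIV_chain)
    then have "deriv ?k 0 = deriv g 0 * deriv ?p 0" by (rule DERIV_imp_deriv)
    moreover have "deriv g 0 = inverse (deriv h 0)"
      using g(2)[of 0] hh(3) by (simp add: inverse_unique[symmetric])
    ultimately have "deriv ?k 0 = inverse (deriv h 0) * of_real (cradius \<gamma>)"
      by (simp add: deriv_rmap_0[OF enc])
    also have "\<dots> = of_real (cradius \<gamma> / Re (deriv h 0))"
      by (subst hh(4)) (simp add: field_simps)
    finally have "deriv ?k 0 = of_real (cradius \<gamma> / Re (deriv h 0))" .
    moreover have "cmod (deriv ?k 0) \<le> 1"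
      using Schwarz_Lemma(2)[where f = ?k and \<xi> = 0, OF 1 _ in1] rmap_0[OF enc] g0 by (simp add: o_def)
    ultimately show ?thesis using hh(5) cradius_pos[OF enc] by (simp add: norm_divide)
  qed
  have "(rinv \<gamma> \<circ> h) z = z" by (rule sub[OF hh(1-4) ge refl z])
  then show ?thesis using rmap_rinv[OF enc, of "h z"] im z by force
qed


section \<open>Distortion bounds and kernel convergence\<close>

lemma compact_subset_cball_less:
  fixes K :: "complex set"
  assumes "compact K" "K \<subseteq> ball 0 1"
  obtains r where "0 < r" "r < 1" "K \<subseteq> cball 0 r"
proof (cases "K = {}")
  case True then show ?thesis using that[of "1/2"] by auto
next
  case False
  obtain x where x: "x \<in> K" "\<And>y. y \<in> K \<Longrightarrow> cmod y \<le> cmod x"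
    using continuous_attains_sup[OF assms(1) False, of cmod] continuous_on_norm_id by blast
  have "cmod x < 1" using x(1) assms(2) by auto
  then show ?thesis using that[of "max (1/2) (cmod x)"] x(2) by fastforce
qed

text \<open>A point of the component beyond the ball would draw the whole connected exterior of the
  ball into it, against boundedness.\<close>

lemma U_plus_subset_cball:
  assumes enc: "encircling \<gamma>" and "\<gamma> \<subseteq> cball 0 b"
  shows "U_plus \<gamma> \<subseteq> cball 0 b"
proof
  fix w assume w: "w \<in> U_plus \<gamma>"
  show "w \<in> cball 0 b"
  proof (rule ccontr)
    assume n: "w \<notin> cball 0 b"
    have "connected (- cball 0 b :: complex set)"
      by (rule connected_complement_bounded_convex) auto
    then have "- cball 0 b \<subseteq> U_plus \<gamma>"
      using n w assms(2) by (intro connected_subset_U_plus[of _ _ w]) auto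
    then have "bounded (- cball 0 b :: complex set)"
      using bounded_U_plus[OF enc] bounded_subset by blast
    then show False using cobounded_imp_unbounded[of "cball (0::complex) b"] by simp
  qed
qed

lemma rmap_bound:
  assumes "encircling \<gamma>" "\<gamma> \<subseteq> cball 0 b" "cmod z < 1"
  shows "cmod (rmap \<gamma> z) \<le> b"
  using U_plus_subset_cball[OF assms(1,2)] rmap_in[OF assms(1,3)] by auto

text \<open>Cauchy's estimate on the circle of radius 1/2. The bound depends on \<open>b\<close> and
  \<open>n\<close> only, hence is uniform over all loops in the ball.\<close>

lemma rmap_coeff_bound:
  assumes "encircling \<gamma>" "\<gamma> \<subseteq> cball 0 b"
  shows "cmod ((deriv ^^ n) (rmap \<gamma>) 0) \<le> fact n * b * 2 ^ n"
proof -
  have sub: "cball 0 (1/2) \<subseteq> ball (0::complex) 1" by auto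
  have "rmap \<gamma> holomorphic_on ball 0 (1/2)"
    by (rule holomorphic_on_subset[OF rmap_holomorphic[OF assms(1)]]) auto
  moreover have "continuous_on (cball 0 (1/2)) (rmap \<gamma>)"
    using continuous_on_subset[OF holomorphic_on_imp_continuous_on[OF rmap_holomorphic[OF assms(1)]] sub] .
  ultimately have "cmod ((deriv ^^ n) (rmap \<gamma>) 0) \<le> fact n * b / (1/2) ^ n"
    by (rule Cauchy_inequality) (auto intro!: rmap_bound[OF assms])
  then show ?thesis by (simp add: power_divide)
qed

lemma ball_subset_U_plus:
  assumes enc: "encircling \<gamma>" and "\<gamma> \<inter> ball 0 a = {}"
  shows "ball 0 a \<subseteq> U_plus \<gamma>"
proof (cases "a > 0")
  case True
  then show ?thesis
    using assms zero_in_U_plus[OF enc] by (intro connected_subset_U_plus[of _ _ 0]) auto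
qed (simp add: ball_empty)

text \<open>Monotonicity of the conformal radius: \<open>rinv \<gamma> \<circ> h\<close> maps the
  disc of radius \<open>r\<close> into the unit disc and fixes 0. It is used with the identity for a
  lower bound, and with the Riemann map of a limit loop for semicontinuity.\<close>

lemma cradius_ge:
  assumes enc: "encircling \<gamma>" and h: "h holomorphic_on ball 0 r" "h 0 = 0" "r > 0"
    and in_U: "\<And>z. cmod z < r \<Longrightarrow> h z \<in> U_plus \<gamma>"
  shows "r * cmod (deriv h 0) \<le> cradius \<gamma>"
proof -
  define k where "k = rinv \<gamma> \<circ> h"
  have kh: "k holomorphic_on ball 0 r"
    unfolding k_def
  proof (rule holomorphic_on_compose_gen[OF h(1) rinv_holomorphic[OF enc]])
    show "h ` ball 0 r \<subseteq> U_plus \<gamma>" using in_U by auto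
  qed
  have k1: "cmod (k z) < 1" if "cmod z < r" for z
    using rinv_in[OF enc in_U[OF that]] by (simp add: k_def)
  have k0: "k 0 = 0" by (simp add: k_def h rinv_0[OF enc])
  have "(h has_field_derivative deriv h 0) (at 0)"
    using h by (intro holomorphic_derivI[OF h(1)]) auto
  moreover have "(rinv \<gamma> has_field_derivative inverse (of_real (cradius \<gamma>))) (at (h 0))"
    using rinv_has_deriv[OF enc zero_in_U_plus[OF enc]]
    by (simp add: h(2) rinv_0[OF enc] deriv_rmap_0[OF enc])
  ultimately have "(k has_field_derivative inverse (of_real (cradius \<gamma>)) * deriv h 0) (at 0)"
    unfolding k_def by (intro DERIV_chain[where f = "rinv \<gamma>" and g = h and x = 0])
  then have "deriv k 0 = inverse (of_real (cradius \<gamma>)) * deriv h 0"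
    by (rule DERIV_imp_deriv)
  then have "cmod (deriv k 0) = cmod (deriv h 0) / cradius \<gamma>"
    using cradius_pos[OF enc] by (simp only: norm_mult norm_inverse norm_of_real) (simp add: field_simps)
  then have "r * cmod (deriv h 0) / cradius \<gamma> \<le> 1"
    using Schwarz_radius[where h = k, OF kh k0 k1 h(3)] by simp
  then show ?thesis using cradius_pos[OF enc] by (simp add: divide_le_eq)
qed

lemma cradius_lower:
  assumes enc: "encircling \<gamma>" and "\<gamma> \<inter> ball 0 a = {}" "a > 0"
  shows "a \<le> cradius \<gamma>"
proof -
  have "a * cmod (deriv (\<lambda>z. z) 0) \<le> cradius \<gamma>"
    using ball_subset_U_plus[OF assms(1,2)] assms(3)
    by (intro cradius_ge[where h = "\<lambda>z. z", OF enc]) auto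
  then show ?thesis by simp
qed

lemma cradius_upper:
  assumes "encircling \<gamma>" "\<gamma> \<subseteq> cball 0 b"
  shows "cradius \<gamma> \<le> 2 * b"
proof -
  have "cmod (of_real (cradius \<gamma>)) \<le> b * 2"
    using rmap_coeff_bound[OF assms, of 1] deriv_rmap_0[OF assms(1)] by simp
  then show ?thesis by simp
qed

text \<open>
  Koebe's theorem with a non-sharp constant. If \<open>\<phi>\<close> omits \<open>w\<close>, then
  \<open>1 - \<phi> / w\<close> has a holomorphic square root \<open>s\<close>; by injectivity \<open>-s\<close> omits not only
  0 but also \<open>s 0\<close>, and Schottky's theorem bounds its derivative.
\<close>

lemma Koebe_nonsharp:
  obtains K where "K > 0" "\<And>\<gamma> w. encircling \<gamma> \<Longrightarrow> w \<in> \<gamma> \<Longrightarrow> cradius \<gamma> \<le> K * cmod w"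
proof -
  \<comment> \<open>Schottky's constant at modulus 1/2 for functions that omit 0 and 1 and have
    modulus at most 1 at 0.\<close>
  define C where "C = exp (pi * exp (pi * (2 + 2 * 1 + 12 * (1/2) / (1 - 1/2))))"
  have C: "C > 0" by (simp add: C_def)
  have "cradius \<gamma> \<le> 8 * C * cmod w" if enc: "encircling \<gamma>" and w: "w \<in> \<gamma>" for \<gamma> w
  proof -
    have w0: "w \<noteq> 0" using w encircling_zero_notin[OF enc] by auto
    define F where "F = (\<lambda>z. 1 - rmap \<gamma> z / w)"
    have Fh: "F holomorphic_on ball 0 1"
      unfolding F_def by (intro holomorphic_intros rmap_holomorphic[OF enc] w0)
    have Fnz: "F z \<noteq> 0" if "z \<in> ball 0 1" for z
      using rmap_in[OF enc, of z] that U_plus_disjoint[of \<gamma>] w w0 by (auto simp: F_def)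
    have "contractible (ball (0::complex) 1)" by (simp add: convex_imp_contractible)
    then obtain s where s: "s holomorphic_on ball 0 1" "\<And>z. z \<in> ball 0 1 \<Longrightarrow> F z = s z ^ 2"
      using contractible_imp_holomorphic_sqrt[OF Fh _ Fnz] by metis
    have s0: "s 0 \<noteq> 0" "s 0 ^ 2 = 1"
      using s(2)[of 0] Fnz[of 0] by (auto simp: F_def rmap_0[OF enc])
    \<comment> \<open>Halving the argument makes \<open>T\<close> holomorphic on the closed disc.
      Dividing by \<open>- s 0\<close> moves the two values 0 and \<open>- s 0\<close> that
      \<open>s\<close> omits to 0 and 1.\<close>
    define T where "T = (\<lambda>z. - s (z / 2) / s 0)"
    have "(s \<circ> (\<lambda>z. z / 2)) holomorphic_on cball 0 1"
    proof (rule holomorphic_on_compose_gen[OF _ s(1)])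
      show "(\<lambda>z. z / 2) holomorphic_on cball (0::complex) 1" by (intro holomorphic_intros) auto
      show "(\<lambda>z. z / 2) ` cball (0::complex) 1 \<subseteq> ball 0 1" by (auto simp: norm_divide)
    qed
    then have Th: "T holomorphic_on cball 0 1"
      unfolding T_def o_def by (intro holomorphic_intros s0) auto
    have T0: "T 0 = -1" using s0 by (simp add: T_def)
    have T2: "T z ^ 2 = 1 - rmap \<gamma> (z / 2) / w" if "cmod z \<le> 1" for z
    proof -
      have "z / 2 \<in> ball 0 1" using that by (simp add: norm_divide)
      from s(2)[OF this] show ?thesis using s0 by (simp add: T_def power_divide F_def)
    qed
    have T01: "\<not> (T z = 0 \<or> T z = 1)" if "z \<in> cball 0 1" for z
    proof -
      have z: "cmod z \<le> 1" "cmod (z / 2) < 1" using that by (auto simp: norm_divide)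
      have "T z ^ 2 = F (z / 2)" using T2[OF z(1)] by (simp add: F_def)
      then have "T z \<noteq> 0" using Fnz[of "z / 2"] z by auto
      moreover have "T z \<noteq> 1"
      proof
        assume "T z = 1"
        then have "rmap \<gamma> (z / 2) = 0" using T2[OF z(1)] w0 by simp
        then have "z = 0" using rmap_eq_0_iff[OF enc z(2)] by simp
        then show False using T0 \<open>T z = 1\<close> by simp
      qed
      ultimately show ?thesis by simp
    qed
    have TC: "cmod (T z) \<le> C" if "cmod z \<le> 1/2" for z
      unfolding C_def by (rule Schottky[OF Th _ T01]) (use that T0 in auto)
    have sub: "cball 0 (1/2) \<subseteq> cball (0::complex) 1" "ball 0 (1/2) \<subseteq> cball (0::complex) 1" by auto
    have "cmod ((deriv ^^ 1) T 0) \<le> fact 1 * C / (1/2) ^ 1"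
      using holomorphic_on_subset[OF Th sub(2)]
        continuous_on_subset[OF holomorphic_on_imp_continuous_on[OF Th] sub(1)]
      by (rule Cauchy_inequality) (auto intro: TC)
    then have dT: "cmod (deriv T 0) \<le> 2 * C" by simp
    have "(T has_field_derivative deriv T 0) (at 0)"
      by (rule holomorphic_derivI[OF holomorphic_on_subset[OF Th ball_subset_cball]]) auto
    then have 1: "((\<lambda>z. T z ^ 2) has_field_derivative - 2 * deriv T 0) (at 0)"
      by (auto intro!: derivative_eq_intros simp: T0)
    have "((\<lambda>z. rmap \<gamma> (z / 2)) has_field_derivative deriv (rmap \<gamma>) 0 * (1/2)) (at 0)"
    proof (rule DERIV_chain2[where f = "rmap \<gamma>" and g = "\<lambda>z. z / 2"])
      show "(rmap \<gamma> has_field_derivative deriv (rmap \<gamma>) 0) (at (0 / 2))"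
        using rmap_has_deriv[OF enc, of 0] by simp
      show "((\<lambda>z. z / 2) has_field_derivative 1 / 2) (at (0::complex))"
        by (auto intro!: derivative_eq_intros)
    qed
    then have 2: "((\<lambda>z. 1 - rmap \<gamma> (z / 2) / w) has_field_derivative - (deriv (rmap \<gamma>) 0 * (1/2) / w)) (at 0)"
      using w0 by (auto intro!: derivative_eq_intros)
    have "((\<lambda>z. 1 - rmap \<gamma> (z / 2) / w) has_field_derivative - 2 * deriv T 0) (at 0)"
      by (rule has_field_derivative_transform_within_open[OF 1, of "ball 0 1"]) (auto simp: T2)
    \<comment> \<open>Comparing the two derivatives of \<open>T z ^ 2\<close> at 0 expresses
      \<open>cradius \<gamma>\<close> as \<open>4 * w\<close> times the derivative of
      \<open>T\<close>. Cauchy's bound \<open>2 * C\<close> for the latter gives the constant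
      \<open>8 * C\<close>.\<close>
    with 2 have "- (deriv (rmap \<gamma>) 0 * (1/2) / w) = - 2 * deriv T 0" by (rule DERIV_unique)
    then have "of_real (cradius \<gamma>) = 4 * w * deriv T 0"
      using w0 by (simp add: deriv_rmap_0[OF enc] field_simps)
    then have "cmod (of_real (cradius \<gamma>)) = 4 * cmod w * cmod (deriv T 0)"
      by (simp add: norm_mult)
    also have "\<dots> \<le> 4 * cmod w * (2 * C)" using dT by (intro mult_left_mono) auto
    finally show ?thesis using cradius_pos[OF enc] by (simp add: algebra_simps)
  qed
  then show ?thesis using that[of "8 * C"] C by auto
qed

text \<open>The substitute for boundary values: the part of the closed domain outside
  \<open>W\<close> is a compact subset of the open domain, so \<open>rinv \<gamma>\<close> confines
  it to a smaller disc.\<close>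

lemma rmap_near_boundary:
  assumes enc: "encircling \<gamma>" and W: "open W" "\<gamma> \<subseteq> W"
  obtains r where "0 < r" "r < 1" "\<And>z. r < cmod z \<Longrightarrow> cmod z < 1 \<Longrightarrow> rmap \<gamma> z \<in> W"
proof -
  have cl: "closure (U_plus \<gamma>) \<subseteq> U_plus \<gamma> \<union> \<gamma>"
    using frontier_U_plus[OF enc] closure_Un_frontier[of "U_plus \<gamma>"] by auto
  have "compact (closure (U_plus \<gamma>) - W)"
    using bounded_U_plus[OF enc] W(1) by (simp add: compact_diff compact_closure)
  moreover have sub: "closure (U_plus \<gamma>) - W \<subseteq> U_plus \<gamma>" using cl W(2) by auto
  ultimately have "compact (rinv \<gamma> ` (closure (U_plus \<gamma>) - W))"
    by (intro compact_continuous_image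
        continuous_on_subset[OF holomorphic_on_imp_continuous_on[OF rinv_holomorphic[OF enc]]])
  moreover have "rinv \<gamma> ` (closure (U_plus \<gamma>) - W) \<subseteq> ball 0 1"
    using rinv_in[OF enc] sub by fastforce
  ultimately obtain r where r: "0 < r" "r < 1" "rinv \<gamma> ` (closure (U_plus \<gamma>) - W) \<subseteq> cball 0 r"
    using compact_subset_cball_less by blast
  have "rmap \<gamma> z \<in> W" if z: "r < cmod z" "cmod z < 1" for z
  proof (rule ccontr)
    assume "rmap \<gamma> z \<notin> W"
    moreover have "rmap \<gamma> z \<in> closure (U_plus \<gamma>)"
      using rmap_in[OF enc z(2)] closure_subset by blast
    ultimately have "rinv \<gamma> (rmap \<gamma> z) \<in> cball 0 r" using r(3) by blast
    then show False using rinv_rmap[OF enc z(2)] z(1) by simp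
  qed
  then show ?thesis using that r by blast
qed

text \<open>The sequential form of Vietoris convergence. The first half keeps compact parts of the
  limit domain inside the domains of late loops; the second half prevents a limit of Riemann maps
  from crossing \<open>\<gamma>\<close>.\<close>

definition vconv :: "(nat \<Rightarrow> complex set) \<Rightarrow> complex set \<Rightarrow> bool" where
  "vconv g \<gamma> \<longleftrightarrow> (\<forall>W. open W \<longrightarrow> \<gamma> \<subseteq> W \<longrightarrow> (\<forall>\<^sub>F n in sequentially. g n \<subseteq> W)) \<and>
     (\<forall>w\<in>\<gamma>. \<forall>e>0. \<forall>\<^sub>F n in sequentially. g n \<inter> ball w e \<noteq> {})"

lemma vconv_subseq:
  assumes "vconv g \<gamma>" "strict_mono r"
  shows "vconv (\<lambda>n. g (r n)) \<gamma>"
  using assms(1) eventually_subseq[OF assms(2), of "\<lambda>n. g n \<subseteq> W" for W]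
    eventually_subseq[OF assms(2), of "\<lambda>n. g n \<inter> ball w e \<noteq> {}" for w e]
  unfolding vconv_def by blast

lemma vconv_image_subset:
  assumes v: "vconv g \<gamma>" and enc: "encircling \<gamma>" "\<And>n. encircling (g n)" and r: "r < 1" "0 < r"
  shows "\<forall>\<^sub>F n in sequentially. rmap \<gamma> ` cball 0 r \<subseteq> U_plus (g n)"
proof -
  let ?C = "rmap \<gamma> ` cball 0 r"
  have sub: "cball 0 r \<subseteq> ball (0::complex) 1" using r by auto
  have cont: "continuous_on (cball 0 r) (rmap \<gamma>)"
    by (rule continuous_on_subset[OF holomorphic_on_imp_continuous_on[OF rmap_holomorphic[OF enc(1)]] sub])
  have co: "compact ?C" "connected ?C"
    by (auto intro!: compact_continuous_image connected_continuous_image cont)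
  have 0: "0 \<in> ?C" using rmap_0[OF enc(1)] r by force
  have "?C \<subseteq> U_plus \<gamma>" using rmap_image[OF enc(1)] sub by blast
  then have "\<gamma> \<subseteq> - ?C" using U_plus_disjoint[of \<gamma>] by auto
  then have "\<forall>\<^sub>F n in sequentially. g n \<subseteq> - ?C"
    using v co(1) unfolding vconv_def by (simp add: compact_imp_closed open_Compl)
  then show ?thesis
  proof eventually_elim
    case (elim n)
    then show ?case
      using zero_in_U_plus[OF enc(2)] by (intro connected_subset_U_plus[OF co(2) _ 0]) auto
  qed
qed

lemma uniform_limit_seq_const:
  assumes "(c \<longlongrightarrow> (l::complex)) F"
  shows "uniform_limit S (\<lambda>n x. c n) (\<lambda>x. l) F"
  unfolding uniform_limit_iff using tendstoD[OF assms] by (auto elim: eventually_mono)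

text \<open>A Montel limit \<open>\<psi>\<close> is identified by the equality case of Schwarz's
  lemma. The first half of \<open>vconv\<close> bounds its derivative at 0 below by
  \<open>cradius \<gamma>\<close>; the second half and Hurwitz's theorem keep \<open>\<psi>\<close>
  off \<open>\<gamma>\<close>, so \<open>rinv \<gamma> \<circ> \<psi>\<close> is a self-map of the
  disc.\<close>

lemma kernel_convergence_subseq:
  assumes v: "vconv g \<gamma>" and enc: "encircling \<gamma>" "\<And>n. encircling (g n)"
    and bd: "\<And>n. g n \<subseteq> cball 0 b"
  shows "\<exists>r. strict_mono r \<and> (\<forall>K. compact K \<longrightarrow> K \<subseteq> ball 0 1 \<longrightarrow>
    uniform_limit K (\<lambda>n. rmap (g (r n))) (rmap \<gamma>) sequentially)"
proof -
  let ?D = "ball (0::complex) 1"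
  obtain \<psi> r where \<psi>: "\<psi> holomorphic_on ?D" and r: "strict_mono r"
    and pw: "\<And>x. x \<in> ?D \<Longrightarrow> ((\<lambda>n. rmap (g (r n)) x) \<longlongrightarrow> \<psi> x) sequentially"
    and ul: "\<And>K. compact K \<Longrightarrow> K \<subseteq> ?D \<Longrightarrow> uniform_limit K ((\<lambda>n. rmap (g n)) \<circ> r) \<psi> sequentially"
  proof (rule Montel[of ?D "{h. h holomorphic_on ?D \<and> (\<forall>z\<in>?D. cmod (h z) \<le> b)}" "\<lambda>n. rmap (g n)"])
    show "range (\<lambda>n. rmap (g n)) \<subseteq> {h. h holomorphic_on ?D \<and> (\<forall>z\<in>?D. cmod (h z) \<le> b)}"
      using rmap_bound[OF enc(2) bd] rmap_holomorphic[OF enc(2)] by auto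
    show "\<exists>B. \<forall>h\<in>{h. h holomorphic_on ?D \<and> (\<forall>z\<in>?D. cmod (h z) \<le> b)}. \<forall>z\<in>K. cmod (h z) \<le> B"
      if "compact K" "K \<subseteq> ?D" for K
      using that by (intro exI[of _ b]) blast
  qed auto
  define p where "p n = rmap (g (r n))" for n
  have encp: "encircling (g (r n))" for n by (rule enc)
  have ul: "uniform_limit K p \<psi> sequentially" if "compact K" "K \<subseteq> ?D" for K
    using ul[OF that] by (simp add: o_def p_def[abs_def])
  have \<psi>0: "\<psi> 0 = 0"
    using LIMSEQ_unique[OF pw[of 0]] rmap_0[OF encp] by simp
  have vr: "vconv (\<lambda>n. g (r n)) \<gamma>" by (rule vconv_subseq[OF v r])
  have "((\<lambda>n. (deriv ^^ 1) (p n) 0) \<longlongrightarrow> (deriv ^^ 1) \<psi> 0) sequentially"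
  proof (rule higher_deriv_complex_uniform_limit)
    show "uniform_limit (ball 0 (1/2)) p \<psi> sequentially"
      by (rule uniform_limit_on_subset[OF ul[of "cball 0 (1/2)"]]) auto
    show "\<forall>\<^sub>F n in sequentially. p n holomorphic_on ball 0 (1 / 2)"
      by (intro always_eventually allI holomorphic_on_subset[OF rmap_holomorphic[OF encp], folded p_def]) auto
  qed auto
  then have lim: "(\<lambda>n. complex_of_real (cradius (g (r n)))) \<longlonglongrightarrow> deriv \<psi> 0"
    by (simp add: p_def deriv_rmap_0[OF encp])
  then have "deriv \<psi> 0 \<in> \<real>"
    using Lim_in_closed_set[of "\<real> :: complex set" "\<lambda>n. complex_of_real (cradius (g (r n)))" sequentially] 
    by (simp add: closed_complex_Reals)
  then obtain c where c: "deriv \<psi> 0 = of_real c" by (auto elim: Reals_cases)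
  have limc: "(\<lambda>n. cradius (g (r n))) \<longlonglongrightarrow> c"
    using lim unfolding c by (simp only: tendsto_of_real_iff)
  \<comment> \<open>The image of the disc of radius \<open>s < 1\<close> under
    \<open>rmap \<gamma>\<close> lies in all late domains, so \<open>cradius_ge\<close> applies to
    them; afterwards \<open>s\<close> tends to 1.\<close>
  have ge_s: "s * cradius \<gamma> \<le> c" if s: "0 < s" "s < 1" for s
  proof (rule tendsto_lowerbound[OF limc])
    show "\<forall>\<^sub>F n in sequentially. s * cradius \<gamma> \<le> cradius (g (r n))"
      using vconv_image_subset[OF vr enc(1) encp s(2,1)]
    proof eventually_elim
      case (elim n)
      have "s * cmod (deriv (rmap \<gamma>) 0) \<le> cradius (g (r n))"
      proof (rule cradius_ge[OF encp])
        show "rmap \<gamma> holomorphic_on ball 0 s"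
          using s by (intro holomorphic_on_subset[OF rmap_holomorphic[OF enc(1)]]) auto
      qed (use elim s rmap_0[OF enc(1)] in auto)
      then show ?case using cradius_pos[OF enc(1)] by (simp add: deriv_rmap_0[OF enc(1)])
    qed
  qed auto
  have ge: "cradius \<gamma> \<le> c"
  proof (rule tendsto_upperbound)
    show "((\<lambda>s. s * cradius \<gamma>) \<longlongrightarrow> cradius \<gamma>) (at_left 1)"
      by (auto intro!: tendsto_eq_intros)
    have "eventually (\<lambda>s. s \<in> {0<..<1}) (at_left (1::real))"
      by (rule eventually_at_left_real) simp
    then show "\<forall>\<^sub>F s in at_left 1. s * cradius \<gamma> \<le> c"
      by eventually_elim (use ge_s in auto)
  qed auto
  have cpos: "c > 0" using ge cradius_pos[OF enc(1)] by simp
  \<comment> \<open>Hurwitz's theorem requires a nonconstant limit, which the positive derivative at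
    0 provides.\<close>
  have nc: "\<not> (\<lambda>z. \<psi> z - w) constant_on ?D" for w
  proof
    assume "(\<lambda>z. \<psi> z - w) constant_on ?D"
    then obtain k where k: "\<And>z. z \<in> ?D \<Longrightarrow> \<psi> z - w = k" by (auto simp: constant_on_def)
    have eq: "\<psi> z = w + k" if "z \<in> ?D" for z using k[OF that] by (simp add: algebra_simps)
    have "((\<lambda>z. w + k) has_field_derivative 0) (at 0)" by auto
    then have "(\<psi> has_field_derivative 0) (at 0)"
      by (rule has_field_derivative_transform_within_open[of _ _ _ ?D]) (auto simp: eq)
    then show False using c cpos by (auto dest: DERIV_imp_deriv)
  qed
  have avoid: "\<psi> z \<notin> \<gamma>" if z: "z \<in> ?D" for z
  proof
    assume w: "\<psi> z \<in> \<gamma>"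
    let ?w = "\<psi> z"
    \<comment> \<open>Nearest points \<open>x n\<close> of the moved loops tend to
      \<open>?w\<close>. The functions \<open>p n - x n\<close> have no zeros, so Hurwitz's theorem
      forbids the limit \<open>\<psi> - ?w\<close> to vanish, yet it does so at
      \<open>z\<close>.\<close>
    have "\<exists>x. x \<in> g (r n) \<and> infdist ?w (g (r n)) = dist ?w x" for n
      using infdist_attains_inf[of "g (r n)" ?w] encp[of n] encircling_nonempty[OF encp]
      by (metis encircling_def compact_imp_closed)
    then obtain x where x: "\<And>n. x n \<in> g (r n)" "\<And>n. infdist ?w (g (r n)) = dist ?w (x n)"
      by metis
    have "x \<longlonglongrightarrow> ?w"
    proof (rule tendstoI)
      fix e :: real assume e: "e > 0"
      have "\<forall>\<^sub>F n in sequentially. g (r n) \<inter> ball ?w e \<noteq> {}"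
        using vr w e unfolding vconv_def by blast
      then show "\<forall>\<^sub>F n in sequentially. dist (x n) ?w < e"
      proof eventually_elim
        case (elim n)
        then obtain y where "y \<in> g (r n)" "dist ?w y < e" by auto
        then show ?case using infdist_le[of y "g (r n)" ?w] x(2)[of n] by (simp add: dist_commute)
      qed
    qed
    then have xl: "uniform_limit K (\<lambda>n z. x n) (\<lambda>z. ?w) sequentially" for K :: "complex set"
      by (rule uniform_limit_seq_const)
    have "\<psi> z - ?w \<noteq> 0"
    proof (rule Hurwitz_no_zeros[of ?D "\<lambda>n z. p n z - x n" "\<lambda>z. \<psi> z - ?w" z])
      show "(\<lambda>z. p n z - x n) holomorphic_on ?D" for n
        unfolding p_def by (intro holomorphic_intros rmap_holomorphic encp)
      show "uniform_limit K (\<lambda>n z. p n z - x n) (\<lambda>z. \<psi> z - ?w) sequentially"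
        if "compact K" "K \<subseteq> ?D" for K
        by (intro uniform_limit_minus ul that xl)
      show "p n z - x n \<noteq> 0" if "z \<in> ?D" for n z
        using rmap_in[OF encp, of z n] that U_plus_disjoint[of "g (r n)"] x(1)[of n]
        by (auto simp: p_def)
    qed (use z nc in \<open>auto intro!: holomorphic_intros \<psi>\<close>)
    then show False by simp
  qed
  have in_U: "\<psi> z \<in> U_plus \<gamma>" if "z \<in> ?D" for z
  proof -
    have "connected (\<psi> ` ?D)"
      by (intro connected_continuous_image holomorphic_on_imp_continuous_on \<psi>) simp
    moreover have "0 \<in> \<psi> ` ?D" using \<psi>0 by force
    ultimately have "\<psi> ` ?D \<subseteq> U_plus \<gamma>"
      using avoid zero_in_U_plus[OF enc(1)] by (intro connected_subset_U_plus[of _ _ 0]) auto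
    then show ?thesis using that by auto
  qed
  define k where "k = rinv \<gamma> \<circ> \<psi>"
  have kh: "k holomorphic_on ?D"
    unfolding k_def
  proof (rule holomorphic_on_compose_gen[OF \<psi> rinv_holomorphic[OF enc(1)]])
    show "\<psi> ` ?D \<subseteq> U_plus \<gamma>" using in_U by blast
  qed
  have "(\<psi> has_field_derivative of_real c) (at 0)"
    using holomorphic_derivI[OF \<psi> open_ball, of 0 UNIV] c by simp
  moreover have "(rinv \<gamma> has_field_derivative inverse (of_real (cradius \<gamma>))) (at (\<psi> 0))"
    using rinv_has_deriv[OF enc(1) zero_in_U_plus[OF enc(1)]]
    by (simp add: \<psi>0 rinv_0[OF enc(1)] deriv_rmap_0[OF enc(1)])
  ultimately have "(k has_field_derivative inverse (of_real (cradius \<gamma>)) * of_real c) (at 0)"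
    unfolding k_def by (intro DERIV_chain[where f = "rinv \<gamma>" and g = \<psi> and x = 0])
  then have "deriv k 0 = inverse (of_real (cradius \<gamma>)) * of_real c" by (rule DERIV_imp_deriv)
  also have "\<dots> = of_real (c / cradius \<gamma>)" by (simp add: field_simps)
  finally have dk: "deriv k 0 = of_real (c / cradius \<gamma>)" .
  have k1: "cmod (k z) < 1" if "cmod z < 1" for z
    using rinv_in[OF enc(1) in_U[of z]] that by (simp add: k_def)
  have c1: "c / cradius \<gamma> \<ge> 1" using ge cradius_pos[OF enc(1)] by simp
  have k0: "k 0 = 0" by (simp add: k_def \<psi>0 rinv_0[OF enc(1)])
  have eq: "\<psi> z = rmap \<gamma> z" if "z \<in> ?D" for z
    using Schwarz_identity[where h = k, OF kh k0 k1 dk c1, of z] that rmap_rinv[OF enc(1) in_U[OF that]]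
    by (simp add: k_def)
  have "uniform_limit K p (rmap \<gamma>) sequentially" if "compact K" "K \<subseteq> ?D" for K
    using ul[OF that] by (rule uniform_limit_cong'[THEN iffD1, rotated -1]) (use that eq in auto)
  then show ?thesis using r unfolding p_def by blast
qed

theorem kernel_convergence:
  assumes v: "vconv g \<gamma>" and enc: "encircling \<gamma>" "\<And>n. encircling (g n)"
    and K: "compact K" "K \<subseteq> ball 0 1"
  shows "uniform_limit K (\<lambda>n. rmap (g n)) (rmap \<gamma>) sequentially"
proof (rule ccontr)
  assume "\<not> ?thesis"
  then obtain e where e: "e > 0"
    "\<not> (\<forall>\<^sub>F n in sequentially. \<forall>x\<in>K. dist (rmap (g n) x) (rmap \<gamma> x) < e)"
    unfolding uniform_limit_iff by blast
  obtain b where b: "\<gamma> \<subseteq> ball 0 b"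
    using enc(1) bounded_subset_ballD[of \<gamma> 0] by (auto simp: encircling_def compact_imp_bounded)
  then have "\<forall>\<^sub>F n in sequentially. g n \<subseteq> ball 0 b"
    using v unfolding vconv_def by blast
  then obtain N where N: "\<And>n. n \<ge> N \<Longrightarrow> g n \<subseteq> ball 0 b" by (auto simp: eventually_sequentially)
  \<comment> \<open>The indices at which uniform closeness fails, beyond an \<open>N\<close> from
    which on all loops lie in one ball, as Montel's theorem requires. A subsequence inside
    \<open>S\<close> contradicts the preceding lemma.\<close>
  define S where "S = {n. n \<ge> N \<and> \<not> (\<forall>x\<in>K. dist (rmap (g n) x) (rmap \<gamma> x) < e)}"
  have "infinite S"
    unfolding infinite_nat_iff_unbounded_le S_def using e(2)
    by (auto simp: eventually_sequentially) (meson max.cobounded1 max.cobounded2 order_trans)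
  then obtain s :: "nat \<Rightarrow> nat" where s: "strict_mono s" "\<And>n. s n \<in> S"
    using infinite_enumerate[OF \<open>infinite S\<close>] by metis
  have "\<exists>r. strict_mono r \<and> (\<forall>K. compact K \<longrightarrow> K \<subseteq> ball 0 1 \<longrightarrow>
    uniform_limit K (\<lambda>n. rmap (g (s (r n)))) (rmap \<gamma>) sequentially)"
    by (rule kernel_convergence_subseq[OF vconv_subseq[OF v s(1)] enc(1) enc(2), of b])
      (use s(2) N ball_subset_cball in \<open>fastforce simp: S_def\<close>)
  then obtain r where "uniform_limit K (\<lambda>n. rmap (g (s (r n)))) (rmap \<gamma>) sequentially"
    using K by blast
  then have "\<forall>\<^sub>F n in sequentially. \<forall>x\<in>K. dist (rmap (g (s (r n))) x) (rmap \<gamma> x) < e"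
    using e(1) unfolding uniform_limit_iff by blast
  then show False using s(2) unfolding S_def eventually_sequentially by blast
qed


section \<open>Estimates for holomorphic and harmonic functions\<close>

text \<open>Harmonicity, phrased so that \<open>ln |g|\<close> qualifies without a global branch of
  the logarithm and so that the maximum modulus principle can be applied to
  \<open>exp f\<close>.\<close>

definition locally_Re :: "(complex \<Rightarrow> real) \<Rightarrow> complex set \<Rightarrow> bool" where
  "locally_Re u S \<longleftrightarrow> (\<forall>z\<in>S. \<exists>d>0. ball z d \<subseteq> S \<and>
     (\<exists>f. f holomorphic_on ball z d \<and> (\<forall>y\<in>ball z d. u y = Re (f y))))"

lemma locally_Re_lincomb:
  assumes "locally_Re u S" "locally_Re v S"
  shows "locally_Re (\<lambda>z. a * u z + b * v z) S"
  unfolding locally_Re_def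
proof
  fix z assume z: "z \<in> S"
  obtain d f where 1: "d > 0" "ball z d \<subseteq> S" "f holomorphic_on ball z d" "\<forall>y\<in>ball z d. u y = Re (f y)"
    using assms(1) z unfolding locally_Re_def by blast
  obtain e g where 2: "e > 0" "ball z e \<subseteq> S" "g holomorphic_on ball z e" "\<forall>y\<in>ball z e. v y = Re (g y)"
    using assms(2) z unfolding locally_Re_def by blast
  have "(\<lambda>y. of_real a * f y + of_real b * g y) holomorphic_on ball z (min d e)"
    by (intro holomorphic_intros holomorphic_on_subset[OF 1(3)] holomorphic_on_subset[OF 2(3)]) auto
  then show "\<exists>d>0. ball z d \<subseteq> S \<and> (\<exists>f. f holomorphic_on ball z d \<and> (\<forall>y\<in>ball z d. a * u y + b * v y = Re (f y)))"
    using 1 2 by (intro exI[of _ "min d e"] conjI exI[of _ "\<lambda>y. of_real a * f y + of_real b * g y"]) auto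
qed

lemma locally_Re_Re:
  assumes "f holomorphic_on S" "open S"
  shows "locally_Re (\<lambda>z. Re (f z)) S"
  unfolding locally_Re_def
proof
  fix z assume "z \<in> S"
  then obtain d where "d > 0" "ball z d \<subseteq> S" using assms(2) openE by blast
  then show "\<exists>d>0. ball z d \<subseteq> S \<and> (\<exists>g. g holomorphic_on ball z d \<and> (\<forall>y\<in>ball z d. Re (f y) = Re (g y)))"
    using holomorphic_on_subset[OF assms(1)] by (intro exI[of _ d] conjI exI[of _ f]) auto
qed

lemma locally_Re_ln:
  assumes g: "g holomorphic_on S" "open S" "\<And>z. z \<in> S \<Longrightarrow> g z \<noteq> 0"
  shows "locally_Re (\<lambda>z. ln (cmod (g z))) S"
  unfolding locally_Re_def
proof
  fix z assume "z \<in> S"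
  then obtain d where d: "d > 0" "ball z d \<subseteq> S" using assms(2) openE by blast
  have "contractible (ball z d)" by (simp add: convex_imp_contractible)
  then obtain f where f: "f holomorphic_on ball z d" "\<And>y. y \<in> ball z d \<Longrightarrow> g y = exp (f y)"
    using contractible_imp_holomorphic_log[OF holomorphic_on_subset[OF g(1) d(2)], of thesis] g(3) d(2) by blast
  then show "\<exists>d>0. ball z d \<subseteq> S \<and> (\<exists>f. f holomorphic_on ball z d \<and> (\<forall>y\<in>ball z d. ln (cmod (g y)) = Re (f y)))"
    using d by (intro exI[of _ d] conjI exI[of _ f]) auto
qed

text \<open>On the outer circle only a limiting upper bound of \<open>u\<close> is available. If
  \<open>u\<close> were positive somewhere, the set where it attains its maximum would be nonempty,
  bounded, and both open and closed in the plane.\<close>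

lemma annulus_max_principle:
  assumes cont: "continuous_on {z. a \<le> cmod z \<and> cmod z < 1} u"
    and loc: "locally_Re u {z. a < cmod z \<and> cmod z < 1}"
    and inner: "\<And>z. cmod z = a \<Longrightarrow> u z \<le> 0"
    and outer: "\<And>e. e > 0 \<Longrightarrow> \<exists>r<1. \<forall>z. r < cmod z \<and> cmod z < 1 \<longrightarrow> u z \<le> e"
    and x: "a \<le> cmod x" "cmod x < 1"
  shows "u x \<le> 0"
proof (rule ccontr)
  assume pos: "\<not> u x \<le> 0"
  obtain r where r: "r < 1" "\<And>z. r < cmod z \<Longrightarrow> cmod z < 1 \<Longrightarrow> u z \<le> u x / 2"
    using outer[of "u x / 2"] pos by auto
  \<comment> \<open>Beyond radius \<open>R\<close> the values are at most \<open>u x / 2\<close>,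
    which is less than the maximum over \<open>K\<close>. That maximum is therefore global and
    attained in \<open>K\<close> only.\<close>
  define R where "R = max r (cmod x)"
  define K where "K = {z. a \<le> cmod z \<and> cmod z \<le> R}"
  have R: "R < 1" using r x by (simp add: R_def)
  have "K = cball 0 R - ball 0 a" by (auto simp: K_def)
  then have K: "compact K" by (simp add: compact_diff)
  have cK: "continuous_on K u" by (rule continuous_on_subset[OF cont]) (use R in \<open>auto simp: K_def\<close>)
  have xK: "x \<in> K" using x by (simp add: K_def R_def)
  then obtain m where m: "m \<in> K" "\<And>y. y \<in> K \<Longrightarrow> u y \<le> u m"
    using continuous_attains_sup[OF K _ cK] by blast
  have um: "u m \<ge> u x" using m(2) xK by blast
  have glob: "u y \<le> u m" if "a \<le> cmod y" "cmod y < 1" for y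
  proof (cases "y \<in> K")
    case False
    then have "u y \<le> u x / 2" using that r(2)[of y] by (auto simp: K_def R_def)
    then show ?thesis using um pos by simp
  qed (use m in auto)
  define L where "L = K \<inter> u -` {u m}"
  have "closed L"
    unfolding L_def using continuous_closed_preimage[OF cK compact_imp_closed[OF K]] by simp
  moreover have "open L"
  proof (subst open_subopen, rule ballI)
    fix y assume y: "y \<in> L"
    then have uy: "u y = u m" "a \<le> cmod y" "cmod y < 1" using R by (auto simp: L_def K_def)
    have "cmod y \<noteq> a" using inner[of y] uy um pos by auto
    then have "y \<in> {z. a < cmod z \<and> cmod z < 1}" using uy by auto
    then obtain d f where d: "d > 0" "ball y d \<subseteq> {z. a < cmod z \<and> cmod z < 1}"
        "f holomorphic_on ball y d" "\<forall>w\<in>ball y d. u w = Re (f w)"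
      using loc unfolding locally_Re_def by blast
    \<comment> \<open>\<open>Re f\<close> has a maximum at \<open>y\<close>, hence so has the
      modulus of \<open>exp f\<close>.\<close>
    have "(\<lambda>w. exp (f w)) constant_on ball y d"
    proof (rule maximum_modulus_principle[of _ _ "ball y d" y])
      show "(\<lambda>w. exp (f w)) holomorphic_on ball y d" by (intro holomorphic_intros d)
      show "cmod (exp (f w)) \<le> cmod (exp (f y))" if w: "w \<in> ball y d" for w
      proof -
        have "u w \<le> u y" using glob[of w] d(2) w uy by force
        then show ?thesis using d(4) w d(1) by simp
      qed
    qed (use d in auto)
    then obtain c where c: "\<And>w. w \<in> ball y d \<Longrightarrow> exp (f w) = c" by (auto simp: constant_on_def)
    have const: "u w = u m" if "w \<in> ball y d" for w
    proof -
      have "exp (Re (f w)) = exp (Re (f y))"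
        using c[OF that] c[of y] d(1) by (metis centre_in_ball norm_exp_eq_Re)
      then show ?thesis using d(4) that uy d(1) by simp
    qed
    have "ball y d \<subseteq> L"
    proof
      fix w assume w: "w \<in> ball y d"
      then have "a < cmod w" "cmod w < 1" using d(2) by auto
      moreover have "\<not> R < cmod w"
        using r(2)[of w] const[OF w] um pos \<open>cmod w < 1\<close> by (auto simp: R_def)
      ultimately show "w \<in> L" using const[OF w] by (auto simp: L_def K_def)
    qed
    then show "\<exists>T. open T \<and> y \<in> T \<and> T \<subseteq> L"
      using d(1) by (intro exI[of _ "ball y d"]) auto
  qed
  ultimately have "L = {} \<or> L = UNIV" using clopen by blast
  moreover have "m \<in> L" using m(1) by (simp add: L_def)
  moreover have "bounded L" using K by (auto simp: L_def intro: bounded_subset[of K] compact_imp_bounded)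
  ultimately show False using not_bounded_UNIV[where 'a=complex] by auto
qed

text \<open>
  A harmonic function \<open>u\<close> on the annulus vanishing on the outer circle is compared with the real
  part of a holomorphic function on the disc. The barrier \<open>ln |z|\<close> shows that the maximum
  of \<open>u\<close> is halved from the circle of radius 1/4 to that of radius 1/2, whereas the maximum of
  \<open>Re H\<close> increases.
\<close>

lemma harmonic_comparison_upper:
  assumes cont: "continuous_on {z. 1/4 \<le> cmod z \<and> cmod z < 1} u"
    and loc: "locally_Re u {z. 1/4 < cmod z \<and> cmod z < 1}"
    and outer: "\<And>e. e > 0 \<Longrightarrow> \<exists>r<1. \<forall>z. r < cmod z \<and> cmod z < 1 \<longrightarrow> u z \<le> e"
    and H: "H holomorphic_on ball 0 (1/2)" "continuous_on (cball 0 (1/2)) H"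
    and close: "\<And>z. cmod z = 1/4 \<or> cmod z = 1/2 \<Longrightarrow> \<bar>u z - Re (H z)\<bar> \<le> e"
    and x: "cmod x \<le> 1/4"
  shows "Re (H x) \<le> 3 * e"
proof -
  have maxH: "Re (H y) \<le> B" if "cmod y \<le> s" "s \<le> 1/2" "\<And>z. cmod z = s \<Longrightarrow> Re (H z) \<le> B" for y s B
  proof (rule maximum_real_frontier[of H "cball 0 s"])
    show "H holomorphic_on interior (cball 0 s)"
      using that(2) by (auto intro: holomorphic_on_subset[OF H(1)])
    show "continuous_on (closure (cball 0 s)) H"
      using that(2) by (auto intro: continuous_on_subset[OF H(2)])
  qed (use that in auto)
  have "sphere (0::complex) (1/4) \<noteq> {}" by simp
  moreover have "continuous_on (sphere 0 (1/4)) (\<lambda>z. Re (H z))"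
    by (intro continuous_intros continuous_on_subset[OF H(2)]) auto
  ultimately obtain m where m: "cmod m = 1/4" "\<And>z. cmod z = 1/4 \<Longrightarrow> Re (H z) \<le> Re (H m)"
    using continuous_attains_sup[of "sphere (0::complex) (1/4)" "\<lambda>z. Re (H z)"] by auto
  \<comment> \<open>\<open>P\<close> bounds \<open>u\<close> on the circle of radius 1/4. The
    barrier \<open>- P * ln |z| / ln 4\<close> equals \<open>P\<close> there, \<open>P / 2\<close>
    at radius 1/2, and 0 on the unit circle.\<close>
  define P where "P = max 0 (Re (H m) + e)"
  define w where "w z = u z + P / ln 4 * ln (cmod z)" for z
  have P: "P \<ge> 0" by (simp add: P_def)
  have ln4: "ln (1/4::real) = - ln 4" "ln (4::real) > 0" by (simp_all add: ln_div)
  have ln2: "ln (1/2::real) = - (ln 4 / 2)"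
    using ln_realpow[of "2::real" 2] by (simp add: ln_div)
  have low: "w z \<le> 0" if z: "1/4 \<le> cmod z" "cmod z < 1" for z
  proof (rule annulus_max_principle[of "1/4" w])
    show "continuous_on {z. 1/4 \<le> cmod z \<and> cmod z < 1} w"
      unfolding w_def by (intro continuous_intros cont) auto
    have "locally_Re (\<lambda>z. 1 * u z + P / ln 4 * ln (cmod z)) {z. 1/4 < cmod z \<and> cmod z < 1}"
    proof (intro locally_Re_lincomb loc locally_Re_ln)
      have "{z. 1/4 < cmod z \<and> cmod z < 1} = ball 0 1 - cball 0 (1/4)" by auto
      then show "open {z. 1/4 < cmod z \<and> cmod z < 1}" by (simp add: open_Diff)
    qed (auto intro: holomorphic_intros)
    then show "locally_Re w {z. 1/4 < cmod z \<and> cmod z < 1}" by (simp add: w_def[abs_def])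
    show "w y \<le> 0" if "cmod y = 1/4" for y
    proof -
      have "w y = u y - P" unfolding w_def that ln4(1) using ln4(2) by simp
      then show ?thesis using close[of y] m(2)[OF that] that by (auto simp: P_def)
    qed
    show "\<exists>r<1. \<forall>z. r < cmod z \<and> cmod z < 1 \<longrightarrow> w z \<le> d" if d: "d > 0" for d
    proof -
      obtain r where r: "r < 1" "\<And>z. r < cmod z \<Longrightarrow> cmod z < 1 \<Longrightarrow> u z \<le> d" using outer[OF d] by auto
      have "w z \<le> d" if "max r (1/4) < cmod z" "cmod z < 1" for z
      proof -
        have "ln (cmod z) < 0" using that by (subst ln_less_zero_iff) auto
        then have "P / ln 4 * ln (cmod z) \<le> 0" using P ln4 by (intro mult_nonneg_nonpos) auto
        then show ?thesis using r(2)[of z] that by (simp add: w_def)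
      qed
      then show ?thesis using r(1) by (intro exI[of _ "max r (1/4)"]) auto
    qed
  qed (use z in auto)
  have half: "Re (H z) \<le> P / 2 + e" if z: "cmod z = 1/2" for z
  proof -
    have "u z \<le> P / 2" using low[of z] z ln2 ln4 by (simp add: w_def)
    then show ?thesis using close[of z] z by auto
  qed
  \<comment> \<open>The maximum of \<open>Re H\<close> at radius 1/4 does not exceed that at radius
    1/2. Unless \<open>P = 0\<close>, this reads
    \<open>Re (H m) \<le> (Re (H m) + e) / 2 + e\<close>, and solving for \<open>Re (H m)\<close>
    gives \<open>3 * e\<close>.\<close>
  have mP: "Re (H m) \<le> P / 2 + e" by (rule maxH[of m "1/2"]) (use m half in auto)
  have "0 \<le> e" using close[of "1/2"] by auto
  moreover have "P = 0 \<or> P = Re (H m) + e" by (auto simp: P_def max_def)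
  ultimately have "Re (H m) \<le> 3 * e" using mP by (elim disjE) linarith+
  then show ?thesis using maxH[of x "1/4" "Re (H m)"] x m(2) by auto
qed

lemma harmonic_comparison:
  assumes cont: "continuous_on {z. 1/4 \<le> cmod z \<and> cmod z < 1} u"
    and loc: "locally_Re u {z. 1/4 < cmod z \<and> cmod z < 1}"
    and outer: "\<And>e. e > 0 \<Longrightarrow> \<exists>r<1. \<forall>z. r < cmod z \<and> cmod z < 1 \<longrightarrow> \<bar>u z\<bar> \<le> e"
    and H: "H holomorphic_on ball 0 (1/2)" "continuous_on (cball 0 (1/2)) H"
    and close: "\<And>z. cmod z = 1/4 \<or> cmod z = 1/2 \<Longrightarrow> \<bar>u z - Re (H z)\<bar> \<le> e"
    and x: "cmod x \<le> 1/4"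
  shows "\<bar>Re (H x)\<bar> \<le> 3 * e"
proof -
  have "Re (H x) \<le> 3 * e"
  proof (rule harmonic_comparison_upper[OF cont loc _ H close x])
    show "\<exists>r<1. \<forall>z. r < cmod z \<and> cmod z < 1 \<longrightarrow> u z \<le> e" if "e > 0" for e
      using outer[OF that] by (meson abs_le_D1)
  qed auto
  moreover have "Re (- H x) \<le> 3 * e"
  proof (rule harmonic_comparison_upper[of "\<lambda>z. - u z" "\<lambda>z. - H z", OF _ _ _ _ _ _ x])
    show "continuous_on {z. 1/4 \<le> cmod z \<and> cmod z < 1} (\<lambda>z. - u z)" by (intro continuous_intros cont)
    show "locally_Re (\<lambda>z. - u z) {z. 1/4 < cmod z \<and> cmod z < 1}"
      using locally_Re_lincomb[OF loc loc, of "-1" 0] by simp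
    show "\<exists>r<1. \<forall>z. r < cmod z \<and> cmod z < 1 \<longrightarrow> - u z \<le> e" if "e > 0" for e
      using outer[OF that] by (meson abs_le_D2)
    show "\<bar>- u z - Re (- H z)\<bar> \<le> e" if "cmod z = 1/4 \<or> cmod z = 1/2" for z
      using close[OF that] by auto
  qed (intro holomorphic_intros continuous_intros H)+
  ultimately show ?thesis by auto
qed

text \<open>The quotient \<open>G / (4 * A - G)\<close> maps the half plane
  \<open>Re G < 2 * A\<close> into the unit disc and fixes 0, so Schwarz's lemma applies. At half
  the radius it yields \<open>|G| \<le> 4 * A\<close>, and the real number \<open>H 0\<close>
  contributes at most \<open>A\<close>.\<close>

lemma Borel_Caratheodory_weak:
  assumes H: "H holomorphic_on ball 0 r" "r > 0" "Im (H 0) = 0"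
    and A: "\<And>z. cmod z < r \<Longrightarrow> \<bar>Re (H z)\<bar> < A" and z: "cmod z \<le> r / 2"
  shows "cmod (H z) \<le> 5 * A"
proof -
  have A0: "A > 0" using A[of 0] H(2) by auto
  define G where "G x = H (of_real r * x) - H 0" for x
  define h where "h x = G x / (of_real (4 * A) - G x)" for x
  have sc: "cmod (of_real r * x) < r" if "cmod x < 1" for x
    using mult_strict_left_mono[OF that H(2)] H(2) by (simp add: norm_mult)
  have "(H \<circ> (*) (of_real r)) holomorphic_on ball 0 1"
  proof (rule holomorphic_on_compose_gen[OF _ H(1)])
    show "(*) (of_real r) holomorphic_on ball (0::complex) 1" by (intro holomorphic_intros)
    show "(*) (of_real r) ` ball (0::complex) 1 \<subseteq> ball 0 r" using sc by auto
  qed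
  then have Gh: "G holomorphic_on ball 0 1"
    unfolding G_def[abs_def] o_def by (intro holomorphic_intros)
  have ReG: "Re (G x) < 2 * A" if "cmod x < 1" for x
    using A[OF sc[OF that]] A[of 0] H(2) by (auto simp: G_def)
  have less: "cmod (G x) < cmod (of_real (4 * A) - G x)" if "cmod x < 1" for x
  proof -
    have "8 * A * Re (G x) < 8 * A * (2 * A)" using ReG[OF that] A0 by (intro mult_strict_left_mono) auto
    then have "(cmod (G x))\<^sup>2 < (cmod (of_real (4 * A) - G x))\<^sup>2"
      unfolding cmod_power2 by (simp add: power2_eq_square algebra_simps)
    then show ?thesis by (rule power2_less_imp_less) simp
  qed
  have nz: "of_real (4 * A) - G x \<noteq> 0" if "cmod x < 1" for x using less[OF that] by auto
  have hh: "h holomorphic_on ball 0 1"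
    unfolding h_def[abs_def] using nz by (intro holomorphic_intros Gh) auto
  have h1: "cmod (h x) < 1" if "cmod x < 1" for x
    using less[OF that] nz[OF that] by (simp add: h_def norm_divide)
  have h0: "h 0 = 0" by (simp add: h_def G_def)
  define x where "x = z / of_real r"
  have x: "cmod x \<le> 1/2" using z H(2) by (simp add: x_def norm_divide divide_le_eq)
  have "cmod (h x) \<le> cmod x" using Schwarz_Lemma(1)[where f = h, OF hh h0 h1] x by simp
  then have "cmod (G x) \<le> cmod x * cmod (of_real (4 * A) - G x)"
    using x nz[of x] by (simp add: h_def norm_divide divide_le_eq)
  also have "\<dots> \<le> 1/2 * cmod (of_real (4 * A) - G x)"
    using x by (rule mult_right_mono) simp
  also have "\<dots> \<le> 1/2 * (4 * A + cmod (G x))"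
    using norm_triangle_ineq4[of "of_real (4 * A)" "G x"] A0 by (intro mult_left_mono) auto
  finally have "cmod (G x) \<le> 4 * A" by simp
  moreover have "H z = G x + H 0" using H(2) by (simp add: G_def x_def)
  moreover have "cmod (H 0) \<le> A"
    using A[of 0] H(2,3) cmod_eq_Re[of "H 0"] by simp
  ultimately show ?thesis using norm_triangle_ineq[of "G x" "H 0"] by simp
qed

lemma holomorphic_Lipschitz:
  assumes f: "f holomorphic_on ball 0 R" and B: "\<And>z. cmod z < R \<Longrightarrow> cmod (f z) \<le> B"
    and r: "r < R" and xy: "cmod x \<le> r" "cmod y \<le> r"
  shows "cmod (f x - f y) \<le> 2 * B / (R - r) * cmod (x - y)"
proof (rule field_differentiable_bound[of "cball 0 r" f "deriv f"])
  show "(f has_field_derivative deriv f z) (at z within cball 0 r)" if "z \<in> cball 0 r" for z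
    using r that by (intro holomorphic_derivI[OF f]) auto
  show "cmod (deriv f z) \<le> 2 * B / (R - r)" if z: "z \<in> cball 0 r" for z
  proof -
    have sub: "cball z ((R - r) / 2) \<subseteq> ball 0 R"
    proof
      fix w assume "w \<in> cball z ((R - r) / 2)"
      then have "cmod (w - z) \<le> (R - r) / 2" by (simp add: dist_norm norm_minus_commute)
      moreover have "cmod w \<le> cmod (w - z) + cmod z" using norm_triangle_ineq[of "w - z" z] by simp
      ultimately show "w \<in> ball 0 R" using z r by simp
    qed
    have "cmod ((deriv ^^ 1) f z) \<le> fact 1 * B / ((R - r) / 2) ^ 1"
    proof (rule Cauchy_inequality)
      show "f holomorphic_on ball z ((R - r) / 2)"
        using sub ball_subset_cball by (intro holomorphic_on_subset[OF f]) blast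
      show "continuous_on (cball z ((R - r) / 2)) f"
        using sub by (intro holomorphic_on_imp_continuous_on holomorphic_on_subset[OF f])
      show "cmod (f w) \<le> B" if "cmod (z - w) = (R - r) / 2" for w
        using sub that B[of w] by (auto simp: subset_iff dist_norm)
    qed (use r in auto)
    then show ?thesis by (simp add: mult.commute)
  qed
qed (use xy in auto)

text \<open>The chain rule for difference quotients whose direction \<open>a n\<close> itself
  varies, uniformly in \<open>x\<close>. A closed neighbourhood \<open>C'\<close> of the compact set
  \<open>C\<close> inside \<open>U\<close> bounds the second derivative of \<open>\<psi>\<close>, so
  the Taylor remainder is quadratic in \<open>s n\<close>.\<close>

lemma holomorphic_quotient_uniform_limit:
  assumes psi: "\<psi> holomorphic_on U" "open U" and C: "compact C" "C \<subseteq> U" and w: "w ` X \<subseteq> C"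
    and a: "uniform_limit X a a0 sequentially" and a0: "\<And>x. x \<in> X \<Longrightarrow> cmod (a0 x) \<le> A"
    and s: "s \<longlonglongrightarrow> 0" "\<And>n. s n \<noteq> (0::complex)"
  shows "uniform_limit X (\<lambda>n x. (\<psi> (w x + s n * a n x) - \<psi> (w x)) / s n)
           (\<lambda>x. deriv \<psi> (w x) * a0 x) sequentially"
proof (cases "X = {}")
  case True then show ?thesis by (simp add: uniform_limit_iff)
next
  case False
  then obtain x0 where x0: "x0 \<in> X" by auto
  have A: "A \<ge> 0" using a0[OF x0] norm_ge_zero order_trans by blast
  have nC: "C \<noteq> {}" using w x0 by auto
  obtain d where d: "d > 0" "(\<Union>x\<in>C. cball x d) \<subseteq> U"
    using compact_subset_open_imp_cball_epsilon_subset[OF C(1) psi(2) C(2)] by metis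
  define C' where "C' = {x + y |x y. x \<in> C \<and> y \<in> cball 0 d}"
  have "compact C'" unfolding C'_def using C(1) by (intro compact_sums) auto
  moreover have sub: "C' \<subseteq> U"
    using d(2) by (fastforce simp: C'_def dist_norm)
  ultimately have "compact (\<psi> ` C')"
    by (intro compact_continuous_image continuous_on_subset[OF holomorphic_on_imp_continuous_on[OF psi(1)]])
  then obtain M where M: "\<And>x. x \<in> C' \<Longrightarrow> cmod (\<psi> x) \<le> M"
    using compact_imp_bounded bounded_iff by (metis image_eqI)
  have inC': "x \<in> C'" if "c \<in> C" "cmod (x - c) \<le> d" for x c
    unfolding C'_def mem_Collect_eq using that by (intro exI[of _ c] exI[of _ "x - c"]) simp
  define B where "B = 2 * M / (d / 2)\<^sup>2"
  have M0: "M \<ge> 0" using M[OF inC'[of _ "SOME c. c \<in> C"]] nC d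
    by (metis diff_self less_imp_le norm_ge_zero norm_zero order_trans some_in_eq)
  have B0: "B \<ge> 0" using M0 by (simp add: B_def)
  have B: "cmod ((deriv ^^ 2) \<psi> y) \<le> B" if "c \<in> C" "cmod (y - c) \<le> d / 2" for y c
  proof -
    have in': "x \<in> C'" if "cmod (x - y) \<le> d / 2" for x
    proof (rule inC'[OF \<open>c \<in> C\<close>])
      show "cmod (x - c) \<le> d"
        using norm_triangle_ineq[of "x - y" "y - c"] that \<open>cmod (y - c) \<le> d / 2\<close> by simp
    qed
    have subU: "cball y (d / 2) \<subseteq> U" using in' sub by (auto simp: dist_norm norm_minus_commute)
    have "cmod ((deriv ^^ 2) \<psi> y) \<le> fact 2 * M / (d / 2) ^ 2"
    proof (rule Cauchy_inequality)
      show "\<psi> holomorphic_on ball y (d / 2)"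
        using subU ball_subset_cball by (intro holomorphic_on_subset[OF psi(1)]) blast
      show "continuous_on (cball y (d / 2)) \<psi>"
        using subU by (intro holomorphic_on_imp_continuous_on holomorphic_on_subset[OF psi(1)])
      show "cmod (\<psi> x) \<le> M" if "cmod (y - x) = d / 2" for x
        using that by (intro M in') (simp add: norm_minus_commute)
    qed (use d in auto)
    then show ?thesis by (simp add: B_def)
  qed
  have T: "cmod (\<psi> (c + h) - \<psi> c - deriv \<psi> c * h) \<le> B * (cmod h)\<^sup>2" if c: "c \<in> C" and h: "cmod h \<le> d / 2" for c h
  proof -
    have subU: "cball c (d / 2) \<subseteq> U"
    proof
      fix x assume "x \<in> cball c (d / 2)"
      then show "x \<in> U" using d c sub by (intro subsetD[OF sub] inC'[OF c]) (auto simp: dist_norm norm_minus_commute)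
    qed
    have "cmod ((deriv ^^ 0) \<psi> (c + h) - (\<Sum>i\<le>1. (deriv ^^ i) \<psi> c * (c + h - c) ^ i / fact i)) \<le> B * cmod (c + h - c) ^ Suc 1 / fact 1"
    proof (rule complex_Taylor[of "cball c (d / 2)" 1 "\<lambda>i. (deriv ^^ i) \<psi>"])
      show "((deriv ^^ i) \<psi> has_field_derivative (deriv ^^ Suc i) \<psi> x) (at x within cball c (d / 2))"
        if "x \<in> cball c (d / 2)" for i x
        using that subU psi by (simp) (intro holomorphic_derivI[of _ U] holomorphic_higher_deriv, auto)
      show "cmod ((deriv ^^ Suc 1) \<psi> x) \<le> B" if "x \<in> cball c (d / 2)" for x
        using B[OF c, of x] that by (simp add: dist_norm norm_minus_commute numeral_2_eq_2)
    qed (use h d in \<open>auto simp: dist_norm\<close>)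
    then show ?thesis by (simp add: power2_eq_square algebra_simps)
  qed
  define D where "D = B * (A + 1)\<^sup>2 + M / d"
  have dpsi: "cmod (deriv \<psi> c) \<le> M / d" if c: "c \<in> C" for c
  proof -
    have "cmod ((deriv ^^ 1) \<psi> c) \<le> fact 1 * M / d ^ 1"
    proof (rule Cauchy_inequality)
      have subU: "cball c d \<subseteq> U" using c d(2) by blast
      show "\<psi> holomorphic_on ball c d"
        using subU ball_subset_cball by (intro holomorphic_on_subset[OF psi(1)]) blast
      show "continuous_on (cball c d) \<psi>"
        using subU by (intro holomorphic_on_imp_continuous_on holomorphic_on_subset[OF psi(1)])
      show "cmod (\<psi> x) \<le> M" if "cmod (c - x) = d" for x
        using that by (intro M inC'[OF c]) (simp add: norm_minus_commute)
    qed (use d in auto)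
    then show ?thesis by simp
  qed
  show ?thesis
    unfolding uniform_limit_iff
  proof (intro allI impI)
    fix e :: real assume e: "e > 0"
    \<comment> \<open>\<open>e1\<close> pays for replacing \<open>a n\<close> by \<open>a0\<close>;
      the cap 1 ensures \<open>|a n| \<le> A + 1\<close>.\<close>
    define e1 where "e1 = min 1 (e / (2 * (M / d + 1)))"
    have Md: "M / d \<ge> 0" using M0 d by simp
    have e1: "e1 > 0" "e1 \<le> 1"
      unfolding e1_def using e Md by (auto intro!: divide_pos_pos)
    have "M / d * e1 \<le> M / d * (e / (2 * (M / d + 1)))"
      using Md by (intro mult_left_mono) (auto simp: e1_def)
    also have "\<dots> \<le> e / 2"
    proof -
      have "q * (e / (2 * (q + 1))) \<le> e / 2" if "q \<ge> 0" for q
        using that e by (simp add: field_simps)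
      then show ?thesis using Md .
    qed
    finally have e1': "M / d * e1 \<le> e / 2" .
    \<comment> \<open>\<open>e2\<close> keeps the increments within \<open>d / 2\<close> and makes
      the quadratic remainder smaller than \<open>e / 2\<close>.\<close>
    define e2 where "e2 = min (d / 2 / (A + 1)) (e / (2 * (B * (A + 1)\<^sup>2 + 1)))"
    have BA: "B * (A + 1)\<^sup>2 \<ge> 0" using B0 by simp
    have e2: "e2 > 0" using e d A BA unfolding e2_def by (intro min_less_iff_conj[THEN iffD2] conjI divide_pos_pos) auto
    have "\<forall>\<^sub>F n in sequentially. \<forall>x\<in>X. dist (a n x) (a0 x) < e1" using uniform_limitD[OF a e1(1)] .
    moreover have "\<forall>\<^sub>F n in sequentially. dist (s n) 0 < e2" using tendstoD[OF s(1) e2] .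
    ultimately show "\<forall>\<^sub>F n in sequentially. \<forall>x\<in>X. dist ((\<psi> (w x + s n * a n x) - \<psi> (w x)) / s n) (deriv \<psi> (w x) * a0 x) < e"
    proof eventually_elim
      case (elim n)
      show ?case
      proof
        fix x assume x: "x \<in> X"
        have c: "w x \<in> C" using w x by auto
        have da: "cmod (a n x - a0 x) < e1" using elim(1) x by (simp add: dist_norm)
        have an: "cmod (a n x) \<le> A + 1"
          using norm_triangle_sub[of "a n x" "a0 x"] da a0[OF x] e1(2) by linarith
        have sn: "cmod (s n) < e2" "cmod (s n) > 0" using elim(2) s(2) by auto
        have "cmod (s n * a n x) \<le> cmod (s n) * (A + 1)"
          using an by (simp add: norm_mult mult_left_mono)
        also have "\<dots> \<le> e2 * (A + 1)" using sn A by (intro mult_right_mono) auto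
        also have "\<dots> \<le> d / 2 / (A + 1) * (A + 1)" using A by (intro mult_right_mono) (auto simp: e2_def)
        also have "\<dots> = d / 2" using A by (simp add: field_simps)
        finally have "cmod (\<psi> (w x + s n * a n x) - \<psi> (w x) - deriv \<psi> (w x) * (s n * a n x)) \<le> B * (cmod (s n * a n x))\<^sup>2"
          by (rule T[OF c])
        also have "\<dots> \<le> B * (cmod (s n) * (A + 1))\<^sup>2"
          using an B0 by (intro mult_left_mono power_mono) (auto simp: norm_mult mult_left_mono)
        finally have 1: "cmod ((\<psi> (w x + s n * a n x) - \<psi> (w x) - deriv \<psi> (w x) * (s n * a n x)) / s n) \<le> B * (A + 1)\<^sup>2 * cmod (s n)"
          using sn by (simp add: norm_divide divide_le_eq power2_eq_square algebra_simps)
        have "B * (A + 1)\<^sup>2 * cmod (s n) \<le> B * (A + 1)\<^sup>2 * (e / (2 * (B * (A + 1)\<^sup>2 + 1)))"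
          using sn BA by (intro mult_left_mono) (auto simp: e2_def)
        also have "\<dots> < e / 2" using e BA by (simp add: field_simps)
        finally have 2: "B * (A + 1)\<^sup>2 * cmod (s n) < e / 2" .
        have "cmod (deriv \<psi> (w x) * (a n x - a0 x)) \<le> M / d * e1"
          using dpsi[OF c] da Md unfolding norm_mult by (intro mult_mono) auto
        then have 3: "cmod (deriv \<psi> (w x) * (a n x - a0 x)) \<le> e / 2" using e1' by (rule order_trans)
        have "(\<psi> (w x + s n * a n x) - \<psi> (w x)) / s n - deriv \<psi> (w x) * a0 x =
          (\<psi> (w x + s n * a n x) - \<psi> (w x) - deriv \<psi> (w x) * (s n * a n x)) / s n + deriv \<psi> (w x) * (a n x - a0 x)"
          using s(2)[of n] by (simp add: field_simps)
        then show "dist ((\<psi> (w x + s n * a n x) - \<psi> (w x)) / s n) (deriv \<psi> (w x) * a0 x) < e"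
          unfolding dist_norm using 1 2 3 norm_triangle_ineq[of "(\<psi> (w x + s n * a n x) - \<psi> (w x) - deriv \<psi> (w x) * (s n * a n x)) / s n" "deriv \<psi> (w x) * (a n x - a0 x)"]
          by simp
      qed
    qed
  qed
qed


section \<open>The variation of the Riemann map\<close>

lemma uniform_limit_eventually_in_open:
  fixes w :: "'a \<Rightarrow> complex"
  assumes "uniform_limit X F w sequentially" "w ` X \<subseteq> C" "compact C" "open U" "C \<subseteq> U"
  shows "\<forall>\<^sub>F n in sequentially. \<forall>x\<in>X. F n x \<in> U"
proof -
  obtain e where e: "e > 0" "(\<Union>x\<in>C. cball x e) \<subseteq> U"
    using compact_subset_open_imp_cball_epsilon_subset[OF assms(3,4,5)] by metis
  show ?thesis
    using uniform_limitD[OF assms(1) e(1)]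
  proof eventually_elim
    case (elim n)
    then show ?case using e(2) assms(2) by (fastforce simp: dist_commute)
  qed
qed

lemma vconv_uniform_limit:
  assumes "compact \<gamma>" "uniform_limit \<gamma> f (\<lambda>w. w) sequentially"
  shows "vconv (\<lambda>n. f n ` \<gamma>) \<gamma>"
  unfolding vconv_def
proof (intro conjI allI impI ballI)
  fix W :: "complex set" assume "open W" "\<gamma> \<subseteq> W"
  then have "\<forall>\<^sub>F n in sequentially. \<forall>x\<in>\<gamma>. f n x \<in> W"
    using uniform_limit_eventually_in_open[OF assms(2) _ assms(1)] by simp
  then show "\<forall>\<^sub>F n in sequentially. f n ` \<gamma> \<subseteq> W" by eventually_elim auto
next
  fix w and e :: real assume w: "w \<in> \<gamma>" and "e > 0"
  from uniform_limitD[OF assms(2) this(2)]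
  show "\<forall>\<^sub>F n in sequentially. f n ` \<gamma> \<inter> ball w e \<noteq> {}"
  proof eventually_elim
    case (elim n)
    then have "f n w \<in> f n ` \<gamma> \<inter> ball w e" using w by (auto simp: dist_commute)
    then show ?case by blast
  qed
qed

text \<open>Schwarz's lemma on the disc of radius \<open>r2\<close>, which lies between
  \<open>r\<close> and 1, confines the values to the disc of radius \<open>r1 = r / r2 < 1\<close>,
  independently of \<open>n\<close>. There kernel convergence holds, and the uniform continuity of
  \<open>rinv \<gamma>\<close> turns it into convergence of the inverses.\<close>

lemma rinv_rmap_uniform_limit:
  assumes enc: "encircling \<gamma>" "\<And>n. encircling (g n)" and v: "vconv g \<gamma>" and r: "0 < r" "r < 1"
  shows "uniform_limit (cball 0 r) (\<lambda>n z. rinv (g n) (rmap \<gamma> z)) (\<lambda>z. z) sequentially"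
proof -
  define r2 where "r2 = (1 + r) / 2"
  have r2: "r < r2" "r2 < 1" "0 < r2" using r by (auto simp: r2_def)
  define r1 where "r1 = r / r2"
  have r1: "r1 < 1" "0 < r1" "r \<le> r1" using r r2 by (auto simp: r1_def divide_simps)
  have sub1: "cball 0 r1 \<subseteq> ball (0::complex) 1" using r1 by auto
  have cont: "continuous_on (cball 0 r1) (rmap \<gamma>)"
    by (rule continuous_on_subset[OF holomorphic_on_imp_continuous_on[OF rmap_holomorphic[OF enc(1)]] sub1])
  have ev: "\<forall>\<^sub>F n in sequentially. rmap \<gamma> ` cball 0 r2 \<subseteq> U_plus (g n)"
    by (rule vconv_image_subset[OF v enc r2(2,3)])
  have small: "cmod (rinv (g n) (rmap \<gamma> z)) \<le> r1"
    if sub: "rmap \<gamma> ` cball 0 r2 \<subseteq> U_plus (g n)" and z: "cmod z \<le> r" for n z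
  proof -
    define h where "h x = rinv (g n) (rmap \<gamma> (of_real r2 * x))" for x
    have sc: "cmod (of_real r2 * x) < r2" if "cmod x < 1" for x
      using mult_strict_left_mono[OF that r2(3)] r2(3) by (simp add: norm_mult)
    have in1: "rmap \<gamma> (of_real r2 * x) \<in> U_plus (g n)" if "cmod x < 1" for x
      using sub sc[OF that] by (auto simp: image_subset_iff)
    have "(rmap \<gamma> \<circ> (*) (of_real r2)) holomorphic_on ball 0 1"
    proof (rule holomorphic_on_compose_gen[OF _ rmap_holomorphic[OF enc(1)]])
      show "(*) (of_real r2) holomorphic_on ball (0::complex) 1" by (intro holomorphic_intros)
      show "(*) (of_real r2) ` ball (0::complex) 1 \<subseteq> ball 0 1"
      proof (rule image_subsetI)
        fix x :: complex assume "x \<in> ball 0 1"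
        then have "cmod x < 1" by simp
        from less_trans[OF sc[OF this] r2(2)] show "of_real r2 * x \<in> ball 0 1" by simp
      qed
    qed
    then have "(rinv (g n) \<circ> (rmap \<gamma> \<circ> (*) (of_real r2))) holomorphic_on ball 0 1"
    proof (rule holomorphic_on_compose_gen[OF _ rinv_holomorphic[OF enc(2)]])
      show "(rmap \<gamma> \<circ> (*) (of_real r2)) ` ball 0 1 \<subseteq> U_plus (g n)" using in1 by auto
    qed
    then have hh: "h holomorphic_on ball 0 1" by (simp add: h_def[abs_def] o_def)
    have h0: "h 0 = 0" by (simp add: h_def rmap_0[OF enc(1)] rinv_0[OF enc(2)])
    have h1: "cmod (h x) < 1" if "cmod x < 1" for x
      unfolding h_def by (rule rinv_in[OF enc(2) in1[OF that]])
    have "cmod (z / of_real r2) \<le> r1" using z r2 by (simp add: r1_def norm_divide divide_right_mono)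
    then have "cmod (h (z / of_real r2)) \<le> r1"
      using Schwarz_Lemma(1)[where f = h, OF hh h0 h1, of "z / of_real r2"] r1 by simp
    then show ?thesis using r2 by (simp add: h_def)
  qed
  have subU: "rmap \<gamma> ` cball 0 r1 \<subseteq> U_plus \<gamma>" using rmap_image[OF enc(1)] sub1 by blast
  have uc: "uniformly_continuous_on (rmap \<gamma> ` cball 0 r1) (rinv \<gamma>)"
    by (intro compact_uniformly_continuous compact_continuous_image cont
        continuous_on_subset[OF holomorphic_on_imp_continuous_on[OF rinv_holomorphic[OF enc(1)]] subU]) auto
  have ker: "uniform_limit (cball 0 r1) (\<lambda>n. rmap (g n)) (rmap \<gamma>) sequentially"
    by (rule kernel_convergence[OF v enc compact_cball sub1])
  show ?thesis
    unfolding uniform_limit_iff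
  proof (intro allI impI)
    fix e :: real assume e: "e > 0"
    have "\<exists>d>0. \<forall>x\<in>rmap \<gamma> ` cball 0 r1. \<forall>y\<in>rmap \<gamma> ` cball 0 r1. dist y x < d \<longrightarrow>
        dist (rinv \<gamma> y) (rinv \<gamma> x) < e"
      using uc e unfolding uniformly_continuous_on_def by simp
    then obtain d where d: "d > 0" "\<And>x y. x \<in> rmap \<gamma> ` cball 0 r1 \<Longrightarrow> y \<in> rmap \<gamma> ` cball 0 r1 \<Longrightarrow>
        dist y x < d \<Longrightarrow> dist (rinv \<gamma> y) (rinv \<gamma> x) < e"
      by metis
    show "\<forall>\<^sub>F n in sequentially. \<forall>z\<in>cball 0 r. dist (rinv (g n) (rmap \<gamma> z)) z < e"
      using uniform_limitD[OF ker d(1)] ev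
    proof eventually_elim
      case (elim n)
      show ?case
      proof
        fix z assume z: "z \<in> cball (0::complex) r"
        define y where "y = rinv (g n) (rmap \<gamma> z)"
        have y: "cmod y \<le> r1" using small[OF elim(2), of z] z by (simp add: y_def)
        have "rmap \<gamma> z \<in> U_plus (g n)" using elim(2) z r2 by (auto simp: image_subset_iff)
        then have "rmap (g n) y = rmap \<gamma> z" using rmap_rinv[OF enc(2)] by (simp add: y_def)
        moreover have "dist (rmap (g n) y) (rmap \<gamma> y) < d" using elim(1) y by simp
        ultimately have "dist (rmap \<gamma> y) (rmap \<gamma> z) < d" by (simp add: dist_commute)
        then have "dist (rinv \<gamma> (rmap \<gamma> y)) (rinv \<gamma> (rmap \<gamma> z)) < e"
          using y z r1 by (intro d(2)) auto
        moreover have "rinv \<gamma> (rmap \<gamma> y) = y" "rinv \<gamma> (rmap \<gamma> z) = z"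
          using y z r1 r by (auto intro!: rinv_rmap[OF enc(1)])
        ultimately show "dist (rinv (g n) (rmap \<gamma> z)) z < e" by (simp add: y_def)
      qed
    qed
  qed
qed

lemma connected_half_open_annulus: "connected {z::complex. a \<le> cmod z \<and> cmod z < b}"
proof -
  have "connected {z::complex. a \<le> cmod (z - 0) \<and> cmod (z - 0) < b}"
    by (rule connected_annulus(3)) simp
  then show ?thesis by simp
qed

text \<open>
  The maps \<open>f n\<close> are thought of as \<open>id + t n * v + o(t n)\<close> near the loop. The field
  \<open>\<omega>\<close> generates motions of the unit circle into itself and hence does not move the
  loop, so that only \<open>k\<close> contributes to the variation of the Riemann map.
\<close>

locale loop_variation =
  fixes \<gamma> :: "complex set" and f :: "nat \<Rightarrow> complex \<Rightarrow> complex" and t :: "nat \<Rightarrow> real"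
    and v \<omega> k :: "complex \<Rightarrow> complex" and D :: "complex set" and V :: real
  assumes enc: "encircling \<gamma>"
    and t_lim: "t \<longlonglongrightarrow> 0" and t_nz: "t n \<noteq> 0"
    and D: "open D" "\<gamma> \<subseteq> D"
    and rmap_D: "1/4 \<le> cmod z \<Longrightarrow> cmod z < 1 \<Longrightarrow> rmap \<gamma> z \<in> D"
    and f_hol: "f n holomorphic_on D" and f_inj: "inj_on (f n) D"
    and f_nz: "w \<in> D \<Longrightarrow> f n w \<noteq> 0"
    and enc_f: "encircling (f n ` \<gamma>)"
    and f_lim: "uniform_limit D (\<lambda>n w. (f n w - w) / of_real (t n)) v sequentially"
    and v_bdd: "w \<in> D \<Longrightarrow> cmod (v w) \<le> V"
    and omega: "\<omega> holomorphic_on - {0}" "cmod z = 1 \<Longrightarrow> Re (\<omega> z) = 0"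
    and k: "k holomorphic_on ball 0 1" "Im (k 0) = 0"
    and decomp: "1/4 \<le> cmod z \<Longrightarrow> cmod z < 1 \<Longrightarrow>
      v (rmap \<gamma> z) = z * deriv (rmap \<gamma>) z * (\<omega> z + k z)"
begin

section \<open>Predicted and actual motion in disc coordinates\<close>

abbreviation "p \<equiv> rmap \<gamma>"
abbreviation "q \<equiv> rinv \<gamma>"
abbreviation "s n \<equiv> complex_of_real (t n)"
abbreviation "g n \<equiv> f n ` \<gamma>"

text \<open>\<open>N\<close> is the claimed derivative of the Riemann map. \<open>\<beta>\<close>
  and \<open>\<alpha>\<close> are the predicted and the actual motion read in the disc of
  \<open>\<gamma>\<close>; \<open>\<eta>\<close> is the transition to the disc of the moved loop,
  where they become \<open>\<xi>\<close> and \<open>G\<close>. The goal is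
  \<open>\<xi> n z - z = o(t n)\<close>, whereas \<open>G\<close> is the map whose modulus tends to
  1 at the unit circle.\<close>

definition "N z = z * k z * deriv p z"
definition "\<beta> n z = q (p z + s n * N z)"
definition "\<alpha> n z = q (f n (p z))"
definition "\<eta> n z = rinv (g n) (p z)"
definition "\<xi> n z = \<eta> n (\<beta> n z)"
definition "G n z = rinv (g n) (f n (p z))"

lemma s_lim: "s \<longlonglongrightarrow> 0" and s_nz: "s n \<noteq> 0"
  using tendsto_of_real[OF t_lim] t_nz by auto

lemma f_id: "uniform_limit D f (\<lambda>w. w) sequentially"
proof -
  have "uniform_limit D (\<lambda>n w. s n * ((f n w - w) / s n)) (\<lambda>w. 0 * v w) sequentially"
  proof (intro uniform_lim_mult f_lim uniform_limit_seq_const s_lim)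
    show "bounded (v ` D)" unfolding bounded_iff using v_bdd by blast
    show "bounded ((\<lambda>w. 0::complex) ` D)" by (rule bounded_subset[of "{0}"]) auto
  qed
  then have "uniform_limit D (\<lambda>n w. w + (f n w - w)) (\<lambda>w. w + 0) sequentially"
    using s_nz by (intro uniform_limit_add uniform_limit_const) simp
  then show ?thesis by simp
qed

lemma vconv_g: "vconv g \<gamma>"
  using enc by (intro vconv_uniform_limit uniform_limit_on_subset[OF f_id D(2)]) (simp add: encircling_def)

lemma N_holomorphic: "N holomorphic_on ball 0 1"
  unfolding N_def[abs_def] by (intro holomorphic_intros k rmap_holomorphic[OF enc]) auto

lemma N_0: "N 0 = 0" by (simp add: N_def)

lemma q_deriv:
  assumes "cmod z < 1"
  shows "deriv q (p z) = inverse (deriv p z)"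
  using DERIV_imp_deriv[OF rinv_has_deriv[OF enc rmap_in[OF enc assms]]] rinv_rmap[OF enc assms] by simp

lemma p_cont: "X \<subseteq> ball 0 1 \<Longrightarrow> continuous_on X p"
  by (rule continuous_on_subset[OF holomorphic_on_imp_continuous_on[OF rmap_holomorphic[OF enc]]])

lemma p_compact: "r < 1 \<Longrightarrow> compact (p ` cball 0 r)"
  by (intro compact_continuous_image p_cont) auto

lemma p_sub: "r < 1 \<Longrightarrow> p ` cball 0 r \<subseteq> U_plus \<gamma>"
  using rmap_in[OF enc] by auto

lemma eta_lim: "r < 1 \<Longrightarrow> uniform_limit (cball 0 r) \<eta> (\<lambda>z. z) sequentially"
proof -
  assume r: "r < 1"
  have "uniform_limit (cball 0 (max r (1/2))) \<eta> (\<lambda>z. z) sequentially"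
    using rinv_rmap_uniform_limit[OF enc enc_f vconv_g, of "max r (1/2)"] r by (simp add: \<eta>_def[abs_def])
  then show ?thesis by (rule uniform_limit_on_subset) auto
qed

lemma N_bounded: "\<exists>B. \<forall>z\<in>cball 0 (5/8). cmod (N z) \<le> B"
proof -
  have "compact (N ` cball 0 (5/8))"
    by (intro compact_continuous_image continuous_on_subset[OF holomorphic_on_imp_continuous_on[OF N_holomorphic]]) auto
  from compact_imp_bounded[OF this] show ?thesis by (auto simp: bounded_iff)
qed

text \<open>Reading the prediction through \<open>q\<close> divides \<open>N\<close> by the
  derivative of \<open>p\<close>, which leaves the field \<open>z * k z\<close> on the disc.\<close>

lemma beta_lim: "uniform_limit (cball 0 (5/8)) (\<lambda>n z. (\<beta> n z - z) / s n) (\<lambda>z. z * k z) sequentially"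
proof -
  obtain B where B: "\<And>z. z \<in> cball 0 (5/8) \<Longrightarrow> cmod (N z) \<le> B" using N_bounded by blast
  have "uniform_limit (cball 0 (5/8)) (\<lambda>n z. (q (p z + s n * N z) - q (p z)) / s n) (\<lambda>z. deriv q (p z) * N z) sequentially"
  proof (rule holomorphic_quotient_uniform_limit[where \<psi> = q and w = p and s = s and a = "\<lambda>n. N"
          and ?a0.0 = N and U = "U_plus \<gamma>" and C = "p ` cball 0 (5/8)" and A = B])
    show "q holomorphic_on U_plus \<gamma>" by (rule rinv_holomorphic[OF enc])
    show "open (U_plus \<gamma>)" by (rule open_U_plus[OF enc])
    show "compact (p ` cball 0 (5/8))" by (rule p_compact) simp
    show "p ` cball 0 (5/8) \<subseteq> U_plus \<gamma>" by (rule p_sub) simp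
    show "uniform_limit (cball 0 (5/8)) (\<lambda>n. N) N sequentially" by (rule uniform_limit_const)
    show "cmod (N z) \<le> B" if "z \<in> cball 0 (5/8)" for z using B that by simp
    show "s \<longlonglongrightarrow> 0" by (rule s_lim)
    show "s n \<noteq> 0" for n by (rule s_nz)
  qed auto
  then show ?thesis
  proof (rule uniform_limit_cong'[THEN iffD1, rotated -1])
    fix z :: complex assume z: "z \<in> cball 0 (5/8)"
    show "(q (p z + s n * N z) - q (p z)) / s n = (\<beta> n z - z) / s n" for n
      using rinv_rmap[OF enc, of z] z by (simp add: \<beta>_def)
    show "deriv q (p z) * N z = z * k z"
      using q_deriv[of z] deriv_rmap_nz[OF enc, of z] z by (simp add: N_def)
  qed
qed

text \<open>The actual motion is known only near the loop, by \<open>rmap_D\<close> from radius 1/4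
  on, while the inverse Riemann maps are controlled only on compact parts of the disc.
  \<open>Ann\<close> meets both demands.\<close>

abbreviation "Ann \<equiv> {z::complex. 1/4 \<le> cmod z \<and> cmod z \<le> 1/2}"

lemma alpha_lim: "uniform_limit Ann (\<lambda>n z. (\<alpha> n z - z) / s n) (\<lambda>z. z * (\<omega> z + k z)) sequentially"
proof -
  have "uniform_limit Ann (\<lambda>n z. (f n (p z) - p z) / s n) (\<lambda>z. v (p z)) sequentially"
    using uniform_limit_compose'[OF f_lim, of p Ann] rmap_D by (simp add: o_def)
  then have "uniform_limit Ann (\<lambda>n z. (q (p z + s n * ((f n (p z) - p z) / s n)) - q (p z)) / s n) (\<lambda>z. deriv q (p z) * v (p z)) sequentially"
  proof (rule holomorphic_quotient_uniform_limit[where \<psi> = q and w = p and s = s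
          and a = "\<lambda>n z. (f n (p z) - p z) / s n" and ?a0.0 = "\<lambda>z. v (p z)" and U = "U_plus \<gamma>"
          and C = "p ` cball 0 (1/2)" and A = V, rotated 5])
    show "q holomorphic_on U_plus \<gamma>" by (rule rinv_holomorphic[OF enc])
    show "open (U_plus \<gamma>)" by (rule open_U_plus[OF enc])
    show "compact (p ` cball 0 (1/2))" by (rule p_compact) simp
    show "p ` cball 0 (1/2) \<subseteq> U_plus \<gamma>" by (rule p_sub) simp
    show "p ` Ann \<subseteq> p ` cball 0 (1/2)" by auto
    show "cmod (v (p z)) \<le> V" if "z \<in> Ann" for z using that v_bdd rmap_D by auto
    show "s \<longlonglongrightarrow> 0" by (rule s_lim)
    show "s n \<noteq> 0" for n by (rule s_nz)
  qed
  then show ?thesis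
  proof (rule uniform_limit_cong'[THEN iffD1, rotated -1])
    show "(q (p z + s n * ((f n (p z) - p z) / s n)) - q (p z)) / s n = (\<alpha> n z - z) / s n" if "z \<in> Ann" for n z
      using s_nz[of n] rinv_rmap[OF enc, of z] that by (simp add: \<alpha>_def)
    show "deriv q (p z) * v (p z) = z * (\<omega> z + k z)" if "z \<in> Ann" for z
      using that q_deriv[of z] deriv_rmap_nz[OF enc, of z] decomp[of z] by simp
  qed
qed

lemma quotient_lim_id:
  assumes "uniform_limit X (\<lambda>n z. (F n z - z) / s n) h sequentially" "bounded (h ` X)"
  shows "uniform_limit X F (\<lambda>z. z) sequentially"
proof -
  have "uniform_limit X (\<lambda>n w. s n * ((F n w - w) / s n)) (\<lambda>w. 0 * h w) sequentially"
  proof (intro uniform_lim_mult assms uniform_limit_seq_const s_lim)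
    show "bounded ((\<lambda>w. 0::complex) ` X)" by (rule bounded_subset[of "{0}"]) auto
  qed
  then have "uniform_limit X (\<lambda>n w. w + (F n w - w)) (\<lambda>w. w + 0) sequentially"
    using s_nz by (intro uniform_limit_add uniform_limit_const) simp
  then show ?thesis by simp
qed

lemma bounded_image_cont:
  fixes h :: "complex \<Rightarrow> complex"
  shows "compact X \<Longrightarrow> continuous_on X h \<Longrightarrow> bounded (h ` X)"
  by (intro compact_imp_bounded compact_continuous_image)

lemma k_cont: "X \<subseteq> ball 0 1 \<Longrightarrow> continuous_on X k"
  by (rule continuous_on_subset[OF holomorphic_on_imp_continuous_on[OF k(1)]])

lemma omega_cont: "X \<subseteq> - {0} \<Longrightarrow> continuous_on X \<omega>"
  by (rule continuous_on_subset[OF holomorphic_on_imp_continuous_on[OF omega(1)]])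

lemma compact_Ann: "compact Ann"
proof -
  have "Ann = cball 0 (1/2) - ball 0 (1/4)" by auto
  then show ?thesis by (simp add: compact_diff)
qed

lemma beta_id: "uniform_limit (cball 0 (5/8)) \<beta> (\<lambda>z. z) sequentially"
  by (rule quotient_lim_id[OF beta_lim]) (intro bounded_image_cont continuous_intros k_cont; auto)

lemma alpha_id: "uniform_limit Ann \<alpha> (\<lambda>z. z) sequentially"
  by (rule quotient_lim_id[OF alpha_lim], intro bounded_image_cont continuous_intros k_cont omega_cont compact_Ann) auto

lemma ev_U: "\<forall>\<^sub>F n in sequentially. p ` cball 0 (7/8) \<subseteq> U_plus (g n)"
  by (rule vconv_image_subset[OF vconv_g enc enc_f]) auto

lemma ev_beta: "\<forall>\<^sub>F n in sequentially. \<forall>z\<in>cball 0 (5/8). \<beta> n z \<in> ball 0 (3/4)"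
  by (rule uniform_limit_eventually_in_open[OF beta_id, where C = "cball 0 (5/8)"]) auto

lemma ev_alpha: "\<forall>\<^sub>F n in sequentially. \<forall>z\<in>Ann. \<alpha> n z \<in> ball 0 (3/4)"
  by (rule uniform_limit_eventually_in_open[OF alpha_id, where C = "cball 0 (5/8)"]) auto

lemma ev_beta_U: "\<forall>\<^sub>F n in sequentially. \<forall>z\<in>cball 0 (5/8). p z + s n * N z \<in> U_plus \<gamma>"
proof (rule uniform_limit_eventually_in_open[where w = p and C = "p ` cball 0 (5/8)"])
  have "uniform_limit (cball 0 (5/8)) (\<lambda>n z. p z + s n * N z) (\<lambda>z. p z + 0 * N z) sequentially"
  proof (intro uniform_limit_add uniform_limit_const uniform_lim_mult uniform_limit_seq_const s_lim)
    show "bounded (N ` cball 0 (5/8))" using N_bounded by (auto simp: bounded_iff)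
    show "bounded ((\<lambda>w. 0::complex) ` cball (0::complex) (5/8))" by (rule bounded_subset[of "{0}"]) auto
  qed
  then show "uniform_limit (cball 0 (5/8)) (\<lambda>n z. p z + s n * N z) p sequentially" by simp
qed (use p_compact[of "5/8"] p_sub[of "5/8"] open_U_plus[OF enc] in auto)

lemma ev_alpha_U: "\<forall>\<^sub>F n in sequentially. \<forall>z\<in>Ann. f n (p z) \<in> U_plus \<gamma>"
proof (rule uniform_limit_eventually_in_open[where w = p and C = "p ` cball 0 (1/2)"])
  show "uniform_limit Ann (\<lambda>n z. f n (p z)) p sequentially"
    using uniform_limit_compose'[OF f_id, of p Ann] rmap_D by (simp add: o_def)
qed (use p_compact[of "1/2"] p_sub[of "1/2"] open_U_plus[OF enc] in auto)

text \<open>The eventual conditions under which all compositions below are defined. The radii 1/2,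
  5/8, 3/4, 7/8 increase so that every map close to the identity has room to land in the domain of
  the next one.\<close>

definition nice :: "nat \<Rightarrow> bool" where
  "nice n \<longleftrightarrow> p ` cball 0 (7/8) \<subseteq> U_plus (g n) \<and> (\<forall>z\<in>cball 0 (5/8). \<beta> n z \<in> ball 0 (3/4)) \<and>
     (\<forall>z\<in>Ann. \<alpha> n z \<in> ball 0 (3/4)) \<and> (\<forall>z\<in>cball 0 (5/8). p z + s n * N z \<in> U_plus \<gamma>) \<and>
     (\<forall>z\<in>Ann. f n (p z) \<in> U_plus \<gamma>)"

lemma ev_nice: "\<forall>\<^sub>F n in sequentially. nice n"
  unfolding nice_def by (intro eventually_conj ev_U ev_beta ev_alpha ev_beta_U ev_alpha_U)

lemma eta_holomorphic:
  assumes "nice n" shows "\<eta> n holomorphic_on ball 0 (7/8)"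
proof -
  have "(rinv (g n) \<circ> p) holomorphic_on ball 0 (7/8)"
  proof (rule holomorphic_on_compose_gen[OF _ rinv_holomorphic[OF enc_f]])
    show "p holomorphic_on ball 0 (7/8)"
      by (rule holomorphic_on_subset[OF rmap_holomorphic[OF enc]]) auto
    show "p ` ball 0 (7/8) \<subseteq> U_plus (g n)" using assms by (auto simp: nice_def)
  qed
  then show ?thesis by (simp add: o_def \<eta>_def[abs_def])
qed

lemma beta_holomorphic:
  assumes "nice n" shows "\<beta> n holomorphic_on ball 0 (5/8)"
proof -
  have "(q \<circ> (\<lambda>z. p z + s n * N z)) holomorphic_on ball 0 (5/8)"
  proof (rule holomorphic_on_compose_gen[OF _ rinv_holomorphic[OF enc]])
    show "(\<lambda>z. p z + s n * N z) holomorphic_on ball 0 (5/8)"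
      by (intro holomorphic_intros holomorphic_on_subset[OF rmap_holomorphic[OF enc]]
          holomorphic_on_subset[OF N_holomorphic]) auto
    show "(\<lambda>z. p z + s n * N z) ` ball 0 (5/8) \<subseteq> U_plus \<gamma>" using assms by (auto simp: nice_def)
  qed
  then show ?thesis by (simp add: o_def \<beta>_def[abs_def])
qed

lemma chi_holomorphic:
  assumes "nice n" shows "\<xi> n holomorphic_on ball 0 (5/8)"
proof -
  have "(\<eta> n \<circ> \<beta> n) holomorphic_on ball 0 (5/8)"
  proof (rule holomorphic_on_compose_gen[OF beta_holomorphic[OF assms] eta_holomorphic[OF assms]])
    show "\<beta> n ` ball 0 (5/8) \<subseteq> ball 0 (7/8)"
    proof (rule image_subsetI)
      fix z :: complex assume "z \<in> ball 0 (5/8)"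
      then have "\<beta> n z \<in> ball 0 (3/4)" using assms unfolding nice_def by simp
      then show "\<beta> n z \<in> ball 0 (7/8)" by simp
    qed
  qed
  then show ?thesis by (simp add: o_def \<xi>_def[abs_def])
qed

text \<open>An exact identity rather than an asymptotic one: \<open>\<xi>\<close> is the prediction
  read in the disc of the moved loop. The variation of the Riemann map is thus governed by the
  distance of \<open>\<xi>\<close> from the identity.\<close>

lemma rmap_chi:
  assumes "nice n" "cmod z \<le> 5/8"
  shows "rmap (g n) (\<xi> n z) = p z + s n * N z"
proof -
  have U: "p z + s n * N z \<in> U_plus \<gamma>" and b: "\<beta> n z \<in> ball 0 (3/4)"
    using assms by (auto simp: nice_def)
  have pb: "p (\<beta> n z) = p z + s n * N z" using rmap_rinv[OF enc U] by (simp add: \<beta>_def)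
  have "p (\<beta> n z) \<in> U_plus (g n)" using assms(1) b by (auto simp: nice_def image_subset_iff)
  then have "rmap (g n) (rinv (g n) (p (\<beta> n z))) = p (\<beta> n z)" by (rule rmap_rinv[OF enc_f])
  then show ?thesis by (simp add: \<xi>_def \<eta>_def pb)
qed

lemma chi_lim: "uniform_limit (cball 0 (5/8)) \<xi> (\<lambda>z. z) sequentially"
  unfolding uniform_limit_iff
proof (intro allI impI)
  fix e :: real assume "e > 0"
  then have e: "e / 2 > 0" by simp
  have r: "(7/8::real) < 1" by simp
  show "\<forall>\<^sub>F n in sequentially. \<forall>z\<in>cball 0 (5/8). dist (\<xi> n z) z < e"
    using uniform_limitD[OF eta_lim[OF r] e] uniform_limitD[OF beta_id e] ev_beta
  proof eventually_elim
    case (elim n)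
    show ?case
    proof
      fix z assume z: "z \<in> cball (0::complex) (5/8)"
      have "\<beta> n z \<in> ball 0 (3/4)" using elim(3) z by blast
      then have b: "\<beta> n z \<in> cball 0 (7/8)" by simp
      have "dist (\<xi> n z) (\<beta> n z) < e / 2" unfolding \<xi>_def using elim(1) b by blast
      moreover have "dist (\<beta> n z) z < e / 2" using elim(2) z by blast
      ultimately show "dist (\<xi> n z) z < e"
        using dist_triangle[of "\<xi> n z" z "\<beta> n z"] by linarith
    qed
  qed
qed

lemma G_eq:
  assumes "nice n" "z \<in> Ann"
  shows "G n z = \<eta> n (\<alpha> n z)"
proof -
  have "f n (p z) \<in> U_plus \<gamma>" using assms by (auto simp: nice_def)
  then show ?thesis using rmap_rinv[OF enc] by (simp add: G_def \<eta>_def \<alpha>_def)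
qed

text \<open>The image of the connected annulus avoids \<open>g n\<close> because \<open>f n\<close>
  is injective on \<open>D\<close>, so a single point in the right component suffices. At 1/2 the
  point is \<open>p (\<alpha> n (1/2))\<close>, which lies in the image of the disc of radius
  7/8.\<close>

lemma f_p_in_U:
  assumes n: "nice n" and z: "1/4 \<le> cmod z" "cmod z < 1"
  shows "f n (p z) \<in> U_plus (g n)"
proof -
  let ?A = "{z::complex. 1/4 \<le> cmod z \<and> cmod z < 1}"
  have "(\<lambda>z. f n (p z)) ` ?A \<subseteq> U_plus (g n)"
  proof (rule connected_subset_U_plus)
    have "continuous_on ?A (\<lambda>z. f n (p z))"
      by (rule continuous_on_compose2[OF holomorphic_on_imp_continuous_on[OF f_hol] p_cont])
        (use rmap_D in auto)
    then show "connected ((\<lambda>z. f n (p z)) ` ?A)"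
      by (rule connected_continuous_image[OF _ connected_half_open_annulus])
    show "(\<lambda>z. f n (p z)) ` ?A \<inter> g n = {}"
    proof -
      have "f n (p y) \<noteq> f n w" if "y \<in> ?A" "w \<in> \<gamma>" for y w
      proof
        assume "f n (p y) = f n w"
        then have "p y = w" using inj_onD[OF f_inj] rmap_D that D(2) by blast
        then show False using rmap_in[OF enc, of y] U_plus_disjoint[of \<gamma>] that by auto
      qed
      then show ?thesis by blast
    qed
    show "f n (p (1/2)) \<in> (\<lambda>z. f n (p z)) ` ?A" by (rule imageI) simp
    have half: "1/2 \<in> Ann" by simp
    have "f n (p (1/2)) \<in> U_plus \<gamma>" and a: "\<alpha> n (1/2) \<in> ball 0 (3/4)"
      using n half unfolding nice_def by blast+
    then have "p (\<alpha> n (1/2)) = f n (p (1/2))" using rmap_rinv[OF enc] by (simp add: \<alpha>_def)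
    moreover have "p (\<alpha> n (1/2)) \<in> p ` cball 0 (7/8)" using a by (intro imageI) simp
    then have "p (\<alpha> n (1/2)) \<in> U_plus (g n)" using n unfolding nice_def by blast
    ultimately show "f n (p (1/2)) \<in> U_plus (g n)" by simp
  qed
  then show ?thesis using z by blast
qed

end


section \<open>The logarithmic comparison functions\<close>

context loop_variation
begin

text \<open>The quotient \<open>\<xi> n z / z\<close> with its removable singularity filled in. It
  is close to 1 on the disc of radius 1/2, so that its logarithm \<open>H\<close> is available
  there.\<close>

definition "\<kappa> n z = (if z = 0 then deriv (\<xi> n) 0 else \<xi> n z / z)"

lemma xi_0: "\<xi> n 0 = 0"
  by (simp add: \<xi>_def \<eta>_def \<beta>_def N_0 rmap_0[OF enc] rinv_0[OF enc] rinv_0[OF enc_f])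

lemma xi_eq: "\<xi> n z = z * \<kappa> n z"
  by (simp add: \<kappa>_def xi_0)

lemma kappa_holomorphic:
  assumes "nice n" shows "\<kappa> n holomorphic_on ball 0 (5/8)"
proof -
  have "(\<lambda>z. if z = 0 then deriv (\<xi> n) 0 else (\<xi> n z - \<xi> n 0) / (z - 0)) holomorphic_on ball 0 (5/8)"
    by (rule pole_lemma_open[OF chi_holomorphic[OF assms]]) simp
  moreover have "(\<lambda>z. if z = 0 then deriv (\<xi> n) 0 else (\<xi> n z - \<xi> n 0) / (z - 0)) = \<kappa> n"
    by (auto simp: fun_eq_iff \<kappa>_def xi_0)
  ultimately show ?thesis by simp
qed

lemma kappa_lim: "uniform_limit (cball 0 (1/2)) \<kappa> (\<lambda>z. 1) sequentially"
  unfolding uniform_limit_iff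
proof (intro allI impI)
  fix e :: real assume e: "e > 0"
  then have e4: "e / 4 > 0" by simp
  show "\<forall>\<^sub>F n in sequentially. \<forall>z\<in>cball 0 (1/2). dist (\<kappa> n z) 1 < e"
    using uniform_limitD[OF chi_lim e4] ev_nice
  proof eventually_elim
    case (elim n)
    show ?case
    proof
      fix z assume z: "z \<in> cball (0::complex) (1/2)"
      \<comment> \<open>Division by \<open>z\<close> costs only a factor 2 on the circle of radius
        1/2, and the maximum modulus principle carries the estimate inside.\<close>
      have "cmod (\<kappa> n z - 1) \<le> e / 2"
      proof (rule maximum_modulus_frontier[of "\<lambda>z. \<kappa> n z - 1" "cball 0 (1/2)"])
        show "(\<lambda>z. \<kappa> n z - 1) holomorphic_on interior (cball 0 (1/2))"
          by (intro holomorphic_intros holomorphic_on_subset[OF kappa_holomorphic[OF elim(2)]]) auto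
        have "continuous_on (cball 0 (1/2)) (\<kappa> n)"
          by (rule continuous_on_subset[OF holomorphic_on_imp_continuous_on[OF kappa_holomorphic[OF elim(2)]]]) auto
        then show "continuous_on (closure (cball 0 (1/2))) (\<lambda>z. \<kappa> n z - 1)"
          by (auto intro!: continuous_intros)
        show "cmod (\<kappa> n y - 1) \<le> e / 2" if "y \<in> frontier (cball 0 (1/2))" for y
        proof -
          have y: "cmod y = 1/2" using that by simp
          have "y * (\<kappa> n y - 1) = \<xi> n y - y" by (simp add: xi_eq algebra_simps)
          then have "cmod y * cmod (\<kappa> n y - 1) = cmod (\<xi> n y - y)" by (metis norm_mult)
          moreover have "cmod (\<xi> n y - y) < e / 4" using elim(1) y by (auto simp: dist_norm)
          ultimately show ?thesis using y by simp
        qed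
      qed (use z in auto)
      then show "dist (\<kappa> n z) 1 < e" using e by (simp add: dist_norm)
    qed
  qed
qed

definition nice2 :: "nat \<Rightarrow> bool" where
  "nice2 n \<longleftrightarrow> nice n \<and> (\<forall>z\<in>cball 0 (1/2). cmod (\<kappa> n z - 1) < 1)"

lemma ev_nice2: "\<forall>\<^sub>F n in sequentially. nice2 n"
  using uniform_limitD[OF kappa_lim zero_less_one] ev_nice
  by eventually_elim (simp add: nice2_def dist_norm)

lemma nice2_Re_pos:
  assumes "nice2 n" "z \<in> cball 0 (1/2)" shows "Re (\<kappa> n z) > 0"
proof -
  have "cmod (\<kappa> n z - 1) < 1" using assms unfolding nice2_def by blast
  moreover have "\<bar>Re (\<kappa> n z - 1)\<bar> \<le> cmod (\<kappa> n z - 1)" by (rule abs_Re_le_cmod)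
  ultimately show ?thesis by simp
qed

definition "H n z = Ln (\<kappa> n z)"

lemma H_holomorphic: "nice2 n \<Longrightarrow> H n holomorphic_on ball 0 (1/2)"
  and H_cont: "nice2 n \<Longrightarrow> continuous_on (cball 0 (1/2)) (H n)"
proof -
  assume n: "nice2 n"
  then have nn: "nice n" by (simp add: nice2_def)
  have nonpos: "\<kappa> n z \<notin> \<real>\<^sub>\<le>\<^sub>0" if "z \<in> cball 0 (1/2)" for z
    using nice2_Re_pos[OF n that] by (auto simp: complex_nonpos_Reals_iff)
  show "H n holomorphic_on ball 0 (1/2)"
    unfolding H_def[abs_def]
    by (intro holomorphic_on_Ln' holomorphic_on_subset[OF kappa_holomorphic[OF nn]] nonpos) auto
  have "continuous_on (cball 0 (1/2)) (\<kappa> n)"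
    by (rule continuous_on_subset[OF holomorphic_on_imp_continuous_on[OF kappa_holomorphic[OF nn]]]) auto
  then show "continuous_on (cball 0 (1/2)) (H n)"
    unfolding H_def[abs_def] by (intro continuous_on_Ln' nonpos) auto
qed

lemma exp_H: "nice2 n \<Longrightarrow> z \<in> cball 0 (1/2) \<Longrightarrow> exp (H n z) = \<kappa> n z"
  using nice2_Re_pos[of n z] unfolding H_def by (intro exp_Ln) auto

lemma Re_H: "nice2 n \<Longrightarrow> z \<in> cball 0 (1/2) \<Longrightarrow> Re (H n z) = ln (cmod (\<kappa> n z))"
  using nice2_Re_pos[of n z] unfolding H_def by (intro Re_Ln) auto

text \<open>Differentiating \<open>rmap_chi\<close> at 0 gives \<open>cradius (g n) * \<kappa> n 0 =
  cradius \<gamma> * (1 + t n * k 0)\<close>, which is real because \<open>k 0\<close> is. This is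
  where the normalization of both Riemann maps enters.\<close>

lemma Im_H_0:
  assumes n: "nice2 n" shows "Im (H n 0) = 0"
proof -
  have nn: "nice n" using n by (simp add: nice2_def)
  have "(\<xi> n has_field_derivative \<kappa> n 0) (at 0)"
    using holomorphic_derivI[OF chi_holomorphic[OF nn] open_ball, of 0 UNIV] by (simp add: \<kappa>_def)
  moreover have "(rmap (g n) has_field_derivative of_real (cradius (g n))) (at (\<xi> n 0))"
    using rmap_has_deriv[OF enc_f, of 0] by (simp add: xi_0 deriv_rmap_0[OF enc_f])
  ultimately have "((rmap (g n) \<circ> \<xi> n) has_field_derivative of_real (cradius (g n)) * \<kappa> n 0) (at 0)"
    by (intro DERIV_chain[where f = "rmap (g n)" and g = "\<xi> n" and x = 0])
  then have 1: "((\<lambda>z. p z + s n * N z) has_field_derivative of_real (cradius (g n)) * \<kappa> n 0) (at 0)"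
    by (rule has_field_derivative_transform_within_open[of _ _ _ "ball 0 (5/8)"])
      (auto simp: rmap_chi[OF nn])
  have "(N has_field_derivative deriv N 0) (at 0)"
    by (rule holomorphic_derivI[OF N_holomorphic]) auto
  moreover have "deriv N 0 = k 0 * of_real (cradius \<gamma>)"
  proof -
    have "((\<lambda>z. z * (k z * deriv p z)) has_field_derivative 1 * (k 0 * deriv p 0) + deriv (\<lambda>z. k z * deriv p z) 0 * 0) (at 0)"
    proof (rule DERIV_mult)
      have "(\<lambda>z. k z * deriv p z) holomorphic_on ball 0 1"
        by (intro holomorphic_intros k rmap_holomorphic[OF enc]) auto
      then show "((\<lambda>z. k z * deriv p z) has_field_derivative deriv (\<lambda>z. k z * deriv p z) 0) (at 0)"
        by (rule holomorphic_derivI) auto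
    qed (rule DERIV_ident)
    then show ?thesis
      by (simp add: N_def[abs_def] mult.assoc DERIV_imp_deriv deriv_rmap_0[OF enc])
  qed
  ultimately have "((\<lambda>z. p z + s n * N z) has_field_derivative of_real (cradius \<gamma>) + s n * (k 0 * of_real (cradius \<gamma>))) (at 0)"
    using rmap_has_deriv[OF enc, of 0] by (auto intro!: derivative_eq_intros simp: deriv_rmap_0[OF enc])
  from DERIV_unique[OF 1 this]
  have "of_real (cradius (g n)) * \<kappa> n 0 = of_real (cradius \<gamma>) + s n * (k 0 * of_real (cradius \<gamma>))" .
  then have "Im (of_real (cradius (g n)) * \<kappa> n 0) = 0" using k(2) by simp
  then have "Im (\<kappa> n 0) = 0" using cradius_pos[OF enc_f, of n] by simp
  moreover have "Re (\<kappa> n 0) > 0" using nice2_Re_pos[OF n, of 0] by simp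
  ultimately have "\<kappa> n 0 = of_real (Re (\<kappa> n 0))" "Re (\<kappa> n 0) > 0" by (auto simp: complex_eq_iff)
  then show ?thesis unfolding H_def by (metis Im_complex_of_real Ln_of_real)
qed

text \<open>All three terms tend to 0 at the unit circle, for each fixed \<open>n\<close>. The term
  with \<open>\<omega>\<close> compensates the first-order difference between \<open>G\<close> and
  \<open>\<xi>\<close>, so that \<open>u\<close> is close to \<open>Re H\<close> on
  \<open>Ann\<close>.\<close>

definition "u n z = ln (cmod (G n z)) - ln (cmod z) - t n * Re (\<omega> z)"

lemma G_nz:
  assumes "nice n" "1/4 \<le> cmod z" "cmod z < 1" shows "G n z \<noteq> 0"
proof
  assume "G n z = 0"
  then have "f n (p z) = 0"
    using rmap_rinv[OF enc_f f_p_in_U[OF assms]] rmap_0[OF enc_f] by (simp add: G_def)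
  then show False using f_nz rmap_D assms by blast
qed

lemma G_lt_1: "nice n \<Longrightarrow> 1/4 \<le> cmod z \<Longrightarrow> cmod z < 1 \<Longrightarrow> cmod (G n z) < 1"
  unfolding G_def by (rule rinv_in[OF enc_f f_p_in_U])

lemma G_cont:
  assumes n: "nice n" shows "continuous_on {z. 1/4 \<le> cmod z \<and> cmod z < 1} (G n)"
proof -
  let ?A = "{z::complex. 1/4 \<le> cmod z \<and> cmod z < 1}"
  have "continuous_on ?A (\<lambda>z. f n (p z))"
    by (rule continuous_on_compose2[OF holomorphic_on_imp_continuous_on[OF f_hol] p_cont])
      (use rmap_D in auto)
  then show ?thesis
    unfolding G_def[abs_def]
    by (rule continuous_on_compose2[OF holomorphic_on_imp_continuous_on[OF rinv_holomorphic[OF enc_f]]])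
      (use f_p_in_U[OF n] in auto)
qed

lemma G_holomorphic:
  assumes n: "nice n" shows "G n holomorphic_on {z. 1/4 < cmod z \<and> cmod z < 1}"
proof -
  let ?A = "{z::complex. 1/4 < cmod z \<and> cmod z < 1}"
  have "(f n \<circ> p) holomorphic_on ?A"
  proof (rule holomorphic_on_compose_gen[OF _ f_hol])
    show "p holomorphic_on ?A" by (rule holomorphic_on_subset[OF rmap_holomorphic[OF enc]]) auto
    show "p ` ?A \<subseteq> D" using rmap_D by auto
  qed
  then have "(rinv (g n) \<circ> (f n \<circ> p)) holomorphic_on ?A"
  proof (rule holomorphic_on_compose_gen[OF _ rinv_holomorphic[OF enc_f]])
    show "(f n \<circ> p) ` ?A \<subseteq> U_plus (g n)" using f_p_in_U[OF n] by auto
  qed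
  then show ?thesis by (simp add: G_def[abs_def] o_def)
qed

lemma u_cont: "nice n \<Longrightarrow> continuous_on {z. 1/4 \<le> cmod z \<and> cmod z < 1} (u n)"
  unfolding u_def[abs_def]
  by (intro continuous_intros G_cont omega_cont) (auto simp: G_nz)

lemma u_locally_Re:
  assumes n: "nice n" shows "locally_Re (u n) {z. 1/4 < cmod z \<and> cmod z < 1}"
proof -
  let ?A = "{z::complex. 1/4 < cmod z \<and> cmod z < 1}"
  have "?A = ball 0 1 - cball 0 (1/4)" by auto
  then have op: "open ?A" by (simp add: open_Diff)
  have 1: "locally_Re (\<lambda>z. ln (cmod (G n z))) ?A"
    by (rule locally_Re_ln[OF G_holomorphic[OF n] op]) (simp add: G_nz[OF n])
  have 2: "locally_Re (\<lambda>z. ln (cmod z)) ?A"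
    by (rule locally_Re_ln[OF _ op]) (auto intro: holomorphic_intros)
  have 3: "locally_Re (\<lambda>z. Re (\<omega> z)) ?A"
    by (rule locally_Re_Re[OF _ op], rule holomorphic_on_subset[OF omega(1)]) auto
  have "locally_Re (\<lambda>z. 1 * (1 * ln (cmod (G n z)) + -1 * ln (cmod z)) + - t n * Re (\<omega> z)) ?A"
    by (intro locally_Re_lincomb 1 2 3)
  then show ?thesis by (simp add: u_def[abs_def])
qed

text \<open>The new Riemann map takes the disc of radius \<open>exp (- e)\<close> to a compact set
  \<open>C\<close> off the moved loop. Its complement pulls back under \<open>f n\<close> to a
  neighbourhood of \<open>\<gamma>\<close>, into which \<open>p\<close> maps all points near the
  unit circle.\<close>

lemma G_boundary:
  assumes n: "nice n" and e: "e > 0"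
  shows "\<exists>r<1. 1/4 < r \<and> (\<forall>z. r < cmod z \<and> cmod z < 1 \<longrightarrow> \<bar>ln (cmod (G n z))\<bar> \<le> e)"
proof -
  define \<rho> where "\<rho> = exp (- e)"
  have \<rho>: "0 < \<rho>" "\<rho> < 1" using e by (auto simp: \<rho>_def)
  define C where "C = rmap (g n) ` cball 0 \<rho>"
  have sub: "cball 0 \<rho> \<subseteq> ball (0::complex) 1" using \<rho> by auto
  have "compact C"
    unfolding C_def by (intro compact_continuous_image
        continuous_on_subset[OF holomorphic_on_imp_continuous_on[OF rmap_holomorphic[OF enc_f]] sub]) auto
  then have "open (D \<inter> f n -` (- C))"
    by (intro continuous_open_preimage holomorphic_on_imp_continuous_on[OF f_hol] D(1))
      (simp add: compact_imp_closed open_Compl)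
  moreover have "\<gamma> \<subseteq> D \<inter> f n -` (- C)"
  proof -
    have "C \<subseteq> U_plus (g n)" unfolding C_def using rmap_image[OF enc_f] sub by blast
    then show ?thesis using D(2) U_plus_disjoint[of "g n"] by blast
  qed
  ultimately obtain r where r: "0 < r" "r < 1"
      "\<And>z. r < cmod z \<Longrightarrow> cmod z < 1 \<Longrightarrow> p z \<in> D \<inter> f n -` (- C)"
    using rmap_near_boundary[OF enc] by metis
  have "\<bar>ln (cmod (G n z))\<bar> \<le> e" if z: "max r (1/3) < cmod z" "cmod z < 1" for z
  proof -
    have z4: "1/4 \<le> cmod z" using z by simp
    have "f n (p z) \<notin> C" using r(3)[of z] z by auto
    moreover have "f n (p z) = rmap (g n) (G n z)"
      using rmap_rinv[OF enc_f f_p_in_U[OF n z4 z(2)]] by (simp add: G_def)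
    ultimately have "\<not> cmod (G n z) \<le> \<rho>" by (auto simp: C_def)
    then have "ln \<rho> < ln (cmod (G n z))" using \<rho> by (subst ln_less_cancel_iff) auto
    moreover have "ln (cmod (G n z)) < 0"
      using G_lt_1[OF n z4 z(2)] G_nz[OF n z4 z(2)] by simp
    ultimately show ?thesis by (simp add: \<rho>_def)
  qed
  then show ?thesis using r by (intro exI[of _ "max r (1/3)"]) auto
qed

text \<open>Uniform continuity on a closed annulus, comparing \<open>z\<close> with its radial
  projection \<open>sgn z\<close>, where \<open>Re \<omega>\<close> vanishes.\<close>

lemma omega_boundary:
  assumes e: "e > 0"
  shows "\<exists>r<1. 1/4 < r \<and> (\<forall>z. r < cmod z \<and> cmod z < 1 \<longrightarrow> \<bar>Re (\<omega> z)\<bar> \<le> e)"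
proof -
  have "cball 0 1 - ball 0 (1/2) \<subseteq> - {0::complex}" by auto
  then have "uniformly_continuous_on (cball 0 1 - ball 0 (1/2)) \<omega>"
    by (intro compact_uniformly_continuous omega_cont compact_diff) auto
  then have "\<exists>d>0. \<forall>x\<in>cball 0 1 - ball 0 (1/2). \<forall>y\<in>cball 0 1 - ball 0 (1/2). dist y x < d \<longrightarrow> dist (\<omega> y) (\<omega> x) < e"
    using e unfolding uniformly_continuous_on_def by simp
  then obtain d where d: "d > 0" "\<And>x y. x \<in> cball 0 1 - ball 0 (1/2) \<Longrightarrow> y \<in> cball 0 1 - ball 0 (1/2) \<Longrightarrow>
      dist y x < d \<Longrightarrow> dist (\<omega> y) (\<omega> x) < e" by metis
  have "\<bar>Re (\<omega> z)\<bar> \<le> e" if z: "max (1/2) (1 - d) < cmod z" "cmod z < 1" for z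
  proof -
    define y where "y = sgn z"
    have z0: "z \<noteq> 0" using z by auto
    have y: "cmod y = 1" using z0 by (simp add: y_def norm_sgn)
    have "y - z = of_real (1 - cmod z) * y"
      using z0 by (simp add: y_def sgn_eq field_simps)
    then have "cmod (y - z) = \<bar>1 - cmod z\<bar>" using y by (metis mult.right_neutral norm_mult norm_of_real)
    then have "dist z y < d" using z by (simp add: dist_norm norm_minus_commute)
    then have "dist (\<omega> z) (\<omega> y) < e" using z y by (intro d(2)) auto
    moreover have "\<bar>Re (\<omega> z - \<omega> y)\<bar> \<le> cmod (\<omega> z - \<omega> y)" by (rule abs_Re_le_cmod)
    ultimately show ?thesis using omega(2)[OF y] by (simp add: dist_norm)
  qed
  then show ?thesis using d(1) by (intro exI[of _ "max (1/2) (1 - d)"]) (auto simp: less_max_iff_disj)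
qed

lemma u_outer:
  assumes n: "nice n" and e: "e > 0"
  shows "\<exists>r<1. \<forall>z. r < cmod z \<and> cmod z < 1 \<longrightarrow> \<bar>u n z\<bar> \<le> e"
proof -
  have e3: "e / 3 > 0" "e / (3 * \<bar>t n\<bar>) > 0" using e t_nz[of n] by auto
  obtain r1 where r1: "r1 < 1" "1/4 < r1" "\<forall>z. r1 < cmod z \<and> cmod z < 1 \<longrightarrow> \<bar>ln (cmod (G n z))\<bar> \<le> e / 3"
    using G_boundary[OF n e3(1)] by blast
  obtain r2 where r2: "r2 < 1" "1/4 < r2" "\<forall>z. r2 < cmod z \<and> cmod z < 1 \<longrightarrow> \<bar>Re (\<omega> z)\<bar> \<le> e / (3 * \<bar>t n\<bar>)"
    using omega_boundary[OF e3(2)] by blast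
  define r where "r = max (max r1 r2) (exp (- (e / 3)))"
  have "\<bar>u n z\<bar> \<le> e" if z: "r < cmod z" "cmod z < 1" for z
  proof -
    have "\<bar>ln (cmod (G n z))\<bar> \<le> e / 3" using r1(3) z by (simp add: r_def)
    moreover have "\<bar>ln (cmod z)\<bar> \<le> e / 3"
    proof -
      have "exp (- (e / 3)) < cmod z" using z by (simp add: r_def)
      then have "- (e / 3) < ln (cmod z)" by (metis exp_gt_zero exp_less_cancel_iff exp_ln less_trans)
      moreover have "ln (cmod z) < 0"
        using z exp_gt_zero[of "- (e / 3)"] by (subst ln_less_zero_iff) (auto simp: r_def)
      ultimately show ?thesis by simp
    qed
    moreover have "\<bar>t n * Re (\<omega> z)\<bar> \<le> e / 3"
    proof -
      have "\<bar>t n * Re (\<omega> z)\<bar> \<le> \<bar>t n\<bar> * (e / (3 * \<bar>t n\<bar>))"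
        unfolding abs_mult using r2(3) z by (intro mult_left_mono) (auto simp: r_def)
      then show ?thesis using t_nz[of n] by simp
    qed
    ultimately show ?thesis unfolding u_def by linarith
  qed
  moreover have "r < 1" using r1 r2 e by (simp add: r_def)
  ultimately show ?thesis by blast
qed

end


section \<open>First-order agreement and the variation formula\<close>

context loop_variation
begin

text \<open>\<open>\<eta>\<close> tends to the identity at no known rate, so its values alone say
  nothing at order \<open>t\<close>. Its Lipschitz constant after subtracting the identity is small,
  however, and \<open>\<alpha>\<close> and \<open>\<beta>\<close> differ by \<open>O(t)\<close>
  only. The factor 16 comes from the gap 7/8 - 3/4 between the radii.\<close>

lemma eta_Lipschitz:
  assumes e: "e > 0"
  shows "\<forall>\<^sub>F n in sequentially. \<forall>x\<in>ball 0 (3/4). \<forall>y\<in>ball 0 (3/4).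
    cmod ((\<eta> n x - x) - (\<eta> n y - y)) \<le> e * cmod (x - y)"
proof -
  have e16: "e / 16 > 0" using e by simp
  have r: "(7/8::real) < 1" by simp
  show ?thesis
    using uniform_limitD[OF eta_lim[OF r] e16] ev_nice
  proof eventually_elim
    case (elim n)
    have hol: "(\<lambda>z. \<eta> n z - z) holomorphic_on ball 0 (7/8)"
      by (intro holomorphic_intros eta_holomorphic elim(2))
    have bd: "cmod (\<eta> n z - z) \<le> e / 16" if "cmod z < 7/8" for z
      using elim(1) that by (auto simp: dist_norm intro!: less_imp_le)
    have "cmod ((\<eta> n x - x) - (\<eta> n y - y)) \<le> 2 * (e / 16) / (7/8 - 3/4) * cmod (x - y)"
      if "cmod x \<le> 3/4" "cmod y \<le> 3/4" for x y
      by (rule holomorphic_Lipschitz[where f = "\<lambda>z. \<eta> n z - z", OF hol bd _ that]) auto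
    then show ?case by (auto simp: field_simps)
  qed
qed

lemma omega_bounded: "\<exists>M. \<forall>z\<in>Ann. cmod (\<omega> z) \<le> M"
proof -
  have "bounded (\<omega> ` Ann)" by (intro bounded_image_cont compact_Ann omega_cont) auto
  then show ?thesis by (auto simp: bounded_iff)
qed

lemma Ann_sub: "Ann \<subseteq> cball 0 (5/8)" by auto

text \<open>The contributions of \<open>k\<close> cancel and only the tangential field
  remains.\<close>

lemma alpha_beta_lim: "uniform_limit Ann (\<lambda>n z. (\<alpha> n z - \<beta> n z) / s n) (\<lambda>z. z * \<omega> z) sequentially"
proof -
  have "uniform_limit Ann (\<lambda>n z. (\<alpha> n z - z) / s n - (\<beta> n z - z) / s n) (\<lambda>z. z * (\<omega> z + k z) - z * k z) sequentially"
    by (rule uniform_limit_minus[OF alpha_lim uniform_limit_on_subset[OF beta_lim Ann_sub]])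
  then show ?thesis
    by (rule uniform_limit_cong'[THEN iffD1, rotated -1]) (auto simp: diff_divide_distrib[symmetric] algebra_simps)
qed

lemma eta_difference_lim:
  "uniform_limit Ann (\<lambda>n z. ((\<eta> n (\<alpha> n z) - \<alpha> n z) - (\<eta> n (\<beta> n z) - \<beta> n z)) / s n) (\<lambda>z. 0) sequentially"
  unfolding uniform_limit_iff
proof (intro allI impI)
  fix e :: real assume e: "e > 0"
  obtain M where M: "\<forall>z\<in>Ann. cmod (\<omega> z) \<le> M" using omega_bounded by blast
  have "(1/2::complex) \<in> Ann" by simp
  then have M0: "M \<ge> 0" using M norm_ge_zero order_trans by blast
  have e': "e / (M + 2) > 0" using e M0 by simp
  show "\<forall>\<^sub>F n in sequentially. \<forall>z\<in>Ann. dist (((\<eta> n (\<alpha> n z) - \<alpha> n z) - (\<eta> n (\<beta> n z) - \<beta> n z)) / s n) 0 < e"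
    using eta_Lipschitz[OF e'] uniform_limitD[OF alpha_beta_lim zero_less_one] ev_nice
  proof eventually_elim
    case (elim n)
    show ?case
    proof
      fix z assume z: "z \<in> Ann"
      have a: "\<alpha> n z \<in> ball 0 (3/4)" using elim(3) z unfolding nice_def by blast
      have b: "\<beta> n z \<in> ball 0 (3/4)" using elim(3) z Ann_sub unfolding nice_def by blast
      let ?X = "(\<eta> n (\<alpha> n z) - \<alpha> n z) - (\<eta> n (\<beta> n z) - \<beta> n z)"
      have "cmod ?X \<le> e / (M + 2) * cmod (\<alpha> n z - \<beta> n z)" using elim(1) a b by blast
      then have 1: "cmod (?X / s n) \<le> e / (M + 2) * cmod ((\<alpha> n z - \<beta> n z) / s n)"
        using divide_right_mono[of "cmod ?X" "e / (M + 2) * cmod (\<alpha> n z - \<beta> n z)" "\<bar>t n\<bar>"]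
        by (simp only: norm_divide norm_of_real) simp
      have "cmod (z * \<omega> z) \<le> 1 * M" unfolding norm_mult using M z M0 by (intro mult_mono) auto
      moreover have "cmod ((\<alpha> n z - \<beta> n z) / s n - z * \<omega> z) < 1" using elim(2) z unfolding dist_norm by blast
      ultimately have "cmod ((\<alpha> n z - \<beta> n z) / s n) \<le> M + 1"
        using norm_triangle_sub[of "(\<alpha> n z - \<beta> n z) / s n" "z * \<omega> z"] by linarith
      then have "e / (M + 2) * cmod ((\<alpha> n z - \<beta> n z) / s n) \<le> e / (M + 2) * (M + 1)"
        using e' by (intro mult_left_mono) auto
      also have "\<dots> < e" using e M0 by (simp add: field_simps)
      finally show "dist (?X / s n) 0 < e" using 1 by simp
    qed
  qed
qed

lemma G_xi_lim: "uniform_limit Ann (\<lambda>n z. (G n z - \<xi> n z) / s n) (\<lambda>z. z * \<omega> z) sequentially"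
proof -
  have "uniform_limit Ann (\<lambda>n z. (\<alpha> n z - \<beta> n z) / s n +
      ((\<eta> n (\<alpha> n z) - \<alpha> n z) - (\<eta> n (\<beta> n z) - \<beta> n z)) / s n) (\<lambda>z. z * \<omega> z + 0) sequentially"
    by (rule uniform_limit_add[OF alpha_beta_lim eta_difference_lim])
  then show ?thesis
  proof (rule uniform_limit_cong[THEN iffD1, rotated -1])
    show "\<forall>\<^sub>F n in sequentially. \<forall>z\<in>Ann. (\<alpha> n z - \<beta> n z) / s n +
      ((\<eta> n (\<alpha> n z) - \<alpha> n z) - (\<eta> n (\<beta> n z) - \<beta> n z)) / s n = (G n z - \<xi> n z) / s n"
      using ev_nice
    proof eventually_elim
      case (elim n)
      show ?case
      proof
        fix z assume "z \<in> Ann"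
        from G_eq[OF elim this]
        show "(\<alpha> n z - \<beta> n z) / s n +
          ((\<eta> n (\<alpha> n z) - \<alpha> n z) - (\<eta> n (\<beta> n z) - \<beta> n z)) / s n = (G n z - \<xi> n z) / s n"
          unfolding \<xi>_def by (simp add: add_divide_distrib[symmetric])
      qed
    qed
  qed simp
qed

lemma G_xi_quotient_lim:
  "uniform_limit Ann (\<lambda>n z. (G n z - \<xi> n z) / s n / \<xi> n z) \<omega> sequentially"
proof -
  have "uniform_limit Ann (\<lambda>n z. (G n z - \<xi> n z) / s n / \<xi> n z) (\<lambda>z. z * \<omega> z / z) sequentially"
  proof (rule uniform_lim_divide[OF G_xi_lim uniform_limit_on_subset[OF chi_lim Ann_sub], of "1/4"])
    show "bounded ((\<lambda>z. z * \<omega> z) ` Ann)"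
      by (intro bounded_image_cont compact_Ann continuous_intros omega_cont) auto
  qed auto
  then show ?thesis
    by (rule uniform_limit_cong'[THEN iffD1, rotated -1]) auto
qed

text \<open>Since \<open>(G - \<xi>) / s\<close> tends to \<open>z * \<omega>\<close>, the quotient
  \<open>Ln (G / \<xi>) / s\<close> tends to \<open>\<omega>\<close> uniformly on
  \<open>Ann\<close>. The real part of \<open>Ln (G / \<xi>) - s * \<omega>\<close> regroups to
  \<open>u - Re H\<close>.\<close>

lemma u_close:
  assumes e: "e > 0"
  shows "\<forall>\<^sub>F n in sequentially. \<forall>z\<in>Ann. \<bar>u n z - Re (H n z)\<bar> \<le> e * \<bar>t n\<bar>"
proof -
  obtain M where M: "\<forall>z\<in>Ann. cmod (\<omega> z) \<le> M" using omega_bounded by blast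
  have "uniform_limit Ann (\<lambda>n z. (Ln (1 + s n * ((G n z - \<xi> n z) / s n / \<xi> n z)) - Ln 1) / s n)
     (\<lambda>z. deriv Ln 1 * \<omega> z) sequentially"
  proof (rule holomorphic_quotient_uniform_limit[where \<psi> = Ln and w = "\<lambda>z. 1" and s = s
        and a = "\<lambda>n z. (G n z - \<xi> n z) / s n / \<xi> n z" and ?a0.0 = \<omega> and U = "- \<real>\<^sub>\<le>\<^sub>0" and C = "{1}" and A = M])
    show "Ln holomorphic_on - \<real>\<^sub>\<le>\<^sub>0" by (rule holomorphic_on_Ln) auto
    show "uniform_limit Ann (\<lambda>n z. (G n z - \<xi> n z) / s n / \<xi> n z) \<omega> sequentially"
      by (rule G_xi_quotient_lim)
    show "cmod (\<omega> z) \<le> M" if "z \<in> Ann" for z using M that by blast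
    show "s \<longlonglongrightarrow> 0" by (rule s_lim)
    show "s n \<noteq> 0" for n by (rule s_nz)
  qed auto
  moreover have "deriv Ln 1 = 1"
    using has_field_derivative_Ln[of 1] by (auto dest: DERIV_imp_deriv)
  ultimately have lim: "uniform_limit Ann (\<lambda>n z. Ln (1 + s n * ((G n z - \<xi> n z) / s n / \<xi> n z)) / s n) \<omega> sequentially"
    by simp
  show ?thesis
    using uniform_limitD[OF lim e] ev_nice2
  proof eventually_elim
    case (elim n)
    have n: "nice n" using elim(2) by (simp add: nice2_def)
    show ?case
    proof
      fix z assume z: "z \<in> Ann"
      then have z': "z \<in> cball 0 (1/2)" "z \<noteq> 0" "1/4 \<le> cmod z" "cmod z < 1" by auto
      have Gz: "G n z \<noteq> 0" by (rule G_nz[OF n z'(3,4)])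
      have kz: "\<kappa> n z \<noteq> 0" using nice2_Re_pos[OF elim(2) z'(1)] by auto
      have xz: "\<xi> n z \<noteq> 0" using kz z'(2) by (simp add: xi_eq)
      have "1 + s n * ((G n z - \<xi> n z) / s n / \<xi> n z) = G n z / \<xi> n z"
        using s_nz[of n] xz by (simp add: field_simps)
      moreover have "dist (Ln (1 + s n * ((G n z - \<xi> n z) / s n / \<xi> n z)) / s n) (\<omega> z) < e"
        using elim(1) z by blast
      ultimately have "cmod (Ln (G n z / \<xi> n z) / s n - \<omega> z) < e"
        by (simp only: dist_norm)
      moreover have "Ln (G n z / \<xi> n z) / s n - \<omega> z = (Ln (G n z / \<xi> n z) - s n * \<omega> z) / s n"
        using s_nz[of n] by (simp add: field_simps)
      ultimately have 1: "cmod (Ln (G n z / \<xi> n z) - s n * \<omega> z) < e * \<bar>t n\<bar>"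
        using t_nz[of n] by (simp add: norm_divide divide_less_eq)
      have "Re (Ln (G n z / \<xi> n z) - s n * \<omega> z) = u n z - Re (H n z)"
        using Gz xz kz z'(2)
        by (simp add: u_def Re_H[OF elim(2) z'(1)] xi_eq Re_Ln norm_divide norm_mult ln_div ln_mult)
      then have "\<bar>u n z - Re (H n z)\<bar> \<le> cmod (Ln (G n z / \<xi> n z) - s n * \<omega> z)"
        by (metis abs_Re_le_cmod)
      then show "\<bar>u n z - Re (H n z)\<bar> \<le> e * \<bar>t n\<bar>" using 1 by linarith
    qed
  qed
qed

lemma cmod_exp_minus_1:
  assumes "cmod z \<le> 1" shows "cmod (exp z - 1) \<le> 3 * cmod z"
proof -
  have "cmod (exp z - 1) \<le> exp (cmod z) * cmod z" using Taylor_exp_field[of z 0] by simp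
  also have "\<dots> \<le> 3 * cmod z"
  proof (rule mult_right_mono)
    have "exp (cmod z) \<le> exp 1" using assms by simp
    then show "exp (cmod z) \<le> 3" using exp_le by (rule order_trans)
  qed simp
  finally show ?thesis .
qed

text \<open>The harmonic comparison for \<open>u n\<close> and \<open>H n\<close> with error
  \<open>T = e' * |t n|\<close> shows that \<open>\<xi> n z\<close> differs from \<open>z\<close> by
  \<open>O(T)\<close>. Hence \<open>rmap (g n) z\<close> differs by \<open>O(T)\<close> from
  \<open>rmap (g n) (\<xi> n z)\<close>, which is exactly the prediction.\<close>

theorem rmap_variation:
  "uniform_limit (cball 0 (1/8)) (\<lambda>n z. (rmap (g n) z - p z) / s n) N sequentially"
  unfolding uniform_limit_iff
proof (intro allI impI)
  fix e :: real assume e: "e > 0"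
  obtain b where b: "b > 0" "\<gamma> \<subseteq> ball 0 b"
    using enc bounded_subset_ballD[of \<gamma> 0] by (auto simp: encircling_def compact_imp_bounded)
  have ev_b: "\<forall>\<^sub>F n in sequentially. g n \<subseteq> ball 0 b"
    using vconv_g b(2) unfolding vconv_def by blast
  \<comment> \<open>On the disc of radius 1/8, \<open>|H| \<le> 20 * T\<close> leads to
    \<open>|\<xi> - z| \<le> 8 * T\<close>. The Lipschitz constant of \<open>rmap (g n)\<close> at
    radius 1/2 is \<open>4 * b\<close>, and the factor 64 makes the product
    \<open>e / 2 * |t n|\<close>.\<close>
  define e' where "e' = e / (64 * b)"
  have e': "e' > 0" using e b by (simp add: e'_def)
  have ev_t: "\<forall>\<^sub>F n in sequentially. \<bar>t n\<bar> < 1 / (20 * e')"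
    using tendstoD[OF t_lim, of "1 / (20 * e')"] e' by simp
  show "\<forall>\<^sub>F n in sequentially. \<forall>z\<in>cball 0 (1/8). dist ((rmap (g n) z - p z) / s n) (N z) < e"
    using u_close[OF e'] ev_nice2 ev_b ev_t
  proof eventually_elim
    case (elim n)
    have n: "nice n" using elim(2) by (simp add: nice2_def)
    define T where "T = e' * \<bar>t n\<bar>"
    have T: "T > 0" using e' t_nz[of n] by (simp add: T_def)
    have T20: "20 * T \<le> 1" using elim(4) e' by (simp add: T_def field_simps)
    have ReH: "\<bar>Re (H n x)\<bar> \<le> 3 * T" if "cmod x \<le> 1/4" for x
    proof (rule harmonic_comparison[OF u_cont[OF n] u_locally_Re[OF n] u_outer[OF n] H_holomorphic[OF elim(2)] H_cont[OF elim(2)] _ that])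
      show "\<bar>u n z - Re (H n z)\<bar> \<le> T" if "cmod z = 1/4 \<or> cmod z = 1/2" for z
      proof -
        have "z \<in> Ann" using that by auto
        then show ?thesis using elim(1) unfolding T_def by blast
      qed
    qed
    \<comment> \<open>Harmonic comparison controls the real part only; \<open>Im_H_0\<close> fixes
      the conjugate. The factor 4 instead of 3 makes the required inequality strict.\<close>
    have H20: "cmod (H n z) \<le> 20 * T" if z: "cmod z \<le> 1/8" for z
    proof -
      have "cmod (H n z) \<le> 5 * (4 * T)"
      proof (rule Borel_Caratheodory_weak[where r = "1/4" and H = "H n"])
        show "H n holomorphic_on ball 0 (1/4)"
          by (rule holomorphic_on_subset[OF H_holomorphic[OF elim(2)]]) auto
        show "\<bar>Re (H n x)\<bar> < 4 * T" if "cmod x < 1/4" for x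
          using ReH[of x] that T by simp
      qed (use Im_H_0[OF elim(2)] z in auto)
      then show ?thesis by simp
    qed
    show ?case
    proof
      fix z assume z: "z \<in> cball (0::complex) (1/8)"
      then have z8: "cmod z \<le> 1/8" and z2: "z \<in> cball 0 (1/2)" by auto
      have "\<xi> n z - z = z * (exp (H n z) - 1)"
        using exp_H[OF elim(2) z2] by (simp add: xi_eq algebra_simps)
      then have "cmod (\<xi> n z - z) = cmod z * cmod (exp (H n z) - 1)" by (simp add: norm_mult)
      also have "\<dots> \<le> 1/8 * (3 * (20 * T))"
        using z8 H20[OF z8] cmod_exp_minus_1[of "H n z"] T20 by (intro mult_mono) auto
      finally have d: "cmod (\<xi> n z - z) \<le> 15/2 * T" by simp
      have xi2: "cmod (\<xi> n z) \<le> 1/2"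
        using norm_triangle_sub[of "\<xi> n z" z] d z8 T20 by simp
      have bd: "cmod (rmap (g n) x) \<le> b" if "cmod x < 1" for x
        using elim(3) ball_subset_cball by (intro rmap_bound[OF enc_f _ that]) blast
      have "cmod (rmap (g n) z - rmap (g n) (\<xi> n z)) \<le> 2 * b / (1 - 1/2) * cmod (z - \<xi> n z)"
        by (rule holomorphic_Lipschitz[OF rmap_holomorphic[OF enc_f] bd]) (use z8 xi2 in auto)
      also have "\<dots> \<le> 2 * b / (1 - 1/2) * (8 * T)"
        using b d T by (intro mult_left_mono) (auto simp: norm_minus_commute)
      also have "\<dots> = e / 2 * \<bar>t n\<bar>" using b by (simp add: T_def e'_def)
      finally have L: "cmod (rmap (g n) z - rmap (g n) (\<xi> n z)) \<le> e / 2 * \<bar>t n\<bar>" .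
      have "rmap (g n) (\<xi> n z) = p z + s n * N z" using z8 by (intro rmap_chi[OF n]) simp
      then have "(rmap (g n) z - p z) / s n - N z = (rmap (g n) z - rmap (g n) (\<xi> n z)) / s n"
        using s_nz[of n] by (simp add: field_simps)
      then have "cmod ((rmap (g n) z - p z) / s n - N z) = cmod (rmap (g n) z - rmap (g n) (\<xi> n z)) / \<bar>t n\<bar>"
        by (simp add: norm_divide)
      also have "\<dots> \<le> e / 2" using L t_nz[of n] by (simp add: divide_le_eq)
      finally show "dist ((rmap (g n) z - p z) / s n) (N z) < e" using e by (simp add: dist_norm)
    qed
  qed
qed

corollary deriv_rmap_variation:
  "(\<lambda>n. ((deriv ^^ j) (rmap (g n)) 0 - (deriv ^^ j) p 0) / s n) \<longlonglongrightarrow> (deriv ^^ j) N 0"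
proof -
  let ?B = "ball (0::complex) (1/8)"
  have ph: "p holomorphic_on ?B" by (rule holomorphic_on_subset[OF rmap_holomorphic[OF enc]]) auto
  have gh: "rmap (g n) holomorphic_on ?B" for n
    by (rule holomorphic_on_subset[OF rmap_holomorphic[OF enc_f]]) auto
  have "(\<lambda>n. (deriv ^^ j) (\<lambda>z. (rmap (g n) z - p z) / s n) 0) \<longlonglongrightarrow> (deriv ^^ j) N 0"
  proof (rule higher_deriv_complex_uniform_limit)
    show "uniform_limit ?B (\<lambda>n z. (rmap (g n) z - p z) / s n) N sequentially"
      by (rule uniform_limit_on_subset[OF rmap_variation]) auto
    show "\<forall>\<^sub>F n in sequentially. (\<lambda>z. (rmap (g n) z - p z) / s n) holomorphic_on ?B"
      by (intro always_eventually allI holomorphic_intros gh ph s_nz)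
  qed auto
  moreover have "(deriv ^^ j) (\<lambda>z. (rmap (g n) z - p z) / s n) 0 =
      ((deriv ^^ j) (rmap (g n)) 0 - (deriv ^^ j) p 0) / s n" for n
  proof -
    have "(deriv ^^ j) (\<lambda>z. inverse (s n) * (rmap (g n) z - p z)) 0 =
        inverse (s n) * (deriv ^^ j) (\<lambda>z. rmap (g n) z - p z) 0"
      by (rule higher_deriv_cmult[of _ ?B]) (auto intro!: holomorphic_intros gh ph)
    moreover have "(deriv ^^ j) (\<lambda>z. rmap (g n) z - p z) 0 = (deriv ^^ j) (rmap (g n)) 0 - (deriv ^^ j) p 0"
      by (rule higher_deriv_diff[OF gh ph]) auto
    ultimately show ?thesis by (simp add: field_simps)
  qed
  ultimately show ?thesis by simp
qed

end


section \<open>Splitting off the fields tangent to the circle\<close>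

text \<open>In \<open>G z / z ^ q\<close> the terms \<open>c j * z ^ j / z ^ q\<close> with
  \<open>j < q\<close> are singular at 0. Subtracting \<open>cnj (c j) * z ^ (q - j)\<close>, the
  conjugate of such a term on the unit circle, makes it purely imaginary there. This gives
  \<open>\<omega>\<close>, and \<open>k\<close> receives the subtracted terms back. The last clause
  bounds \<open>k\<close> on a circle by the size of \<open>G\<close>, for the sake of a derivative
  bound that is uniform over loops.\<close>

lemma laurent_split:
  assumes G: "G holomorphic_on ball 0 1"
  obtains \<omega> k where "\<omega> holomorphic_on - {0}" "\<And>z. cmod z = 1 \<Longrightarrow> Re (\<omega> z) = 0"
    "k holomorphic_on ball 0 1" "Im (k 0) = 0"
    "\<And>z. z \<noteq> 0 \<Longrightarrow> cmod z < 1 \<Longrightarrow> G z = z ^ q * (\<omega> z + k z)"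
    "\<And>r B z. 0 < r \<Longrightarrow> r < 1 \<Longrightarrow> (\<And>z. cmod z \<le> r \<Longrightarrow> cmod (G z) \<le> B) \<Longrightarrow> cmod z = r \<Longrightarrow>
       cmod (k z) \<le> (2 * real q + 2) * (B / r ^ q)"
proof -
  define c where "c j = (deriv ^^ j) G 0 / fact j" for j
  have c_sums: "(\<lambda>j. c j * z ^ j) sums G z" if "cmod z < 1" for z
    using holomorphic_power_series[OF G, of z] that by (simp add: c_def)
  define R where "R z = (if z = 0 then c q else (G z - (\<Sum>j<q. c j * z ^ j)) / z ^ q)" for z
  have "R holomorphic_on ball 0 1"
  proof (rule power_series_holomorphic)
    fix z :: complex assume z: "z \<in> ball 0 1"
    show "(\<lambda>j. c (j + q) * (z - 0) ^ j) sums R z"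
    proof (cases "z = 0")
      case True
      then show ?thesis using powser_sums_zero[of "\<lambda>j. c (j + q)"] by (simp add: R_def)
    next
      case False
      have "(\<lambda>j. c (j + q) * z ^ (j + q)) sums (G z - (\<Sum>j<q. c j * z ^ j))"
        using sums_split_initial_segment[OF c_sums[of z], of q] z by simp
      then have "(\<lambda>j. c (j + q) * z ^ (j + q) / z ^ q) sums ((G z - (\<Sum>j<q. c j * z ^ j)) / z ^ q)"
        by (rule sums_divide)
      then show ?thesis using False by (simp add: R_def power_add)
    qed
  qed
  note R = this
  \<comment> \<open>The imaginary constant \<open>\<i> * Im (c q)\<close> is moved into
    \<open>\<omega>\<close>, which makes \<open>k 0\<close> real.\<close>
  define \<omega> where "\<omega> z = (\<Sum>j<q. c j * z ^ j / z ^ q - cnj (c j) * z ^ (q - j)) + \<i> * of_real (Im (c q))" for z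
  define k where "k z = R z - \<i> * of_real (Im (c q)) + (\<Sum>j<q. cnj (c j) * z ^ (q - j))" for z
  have ok: "\<omega> z + k z = (\<Sum>j<q. c j * z ^ j / z ^ q) + R z" for z
    by (simp add: \<omega>_def k_def sum_subtractf)
  have eq: "G z = z ^ q * (\<omega> z + k z)" if "z \<noteq> 0" for z
    unfolding ok using that by (simp add: R_def sum_divide_distrib[symmetric] add_divide_distrib[symmetric])
  show ?thesis
  proof (rule that[of \<omega> k])
    show "\<omega> holomorphic_on - {0}"
      unfolding \<omega>_def[abs_def] by (intro holomorphic_intros) auto
    show "Re (\<omega> z) = 0" if z: "cmod z = 1" for z
    proof -
      have zz: "z * cnj z = 1" using z by (metis complex_norm_square mult.left_neutral of_real_1 power2_eq_square)
      have "Re (c j * z ^ j / z ^ q - cnj (c j) * z ^ (q - j)) = 0" if "j < q" for j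
      proof -
        have z0: "z \<noteq> 0" using z by auto
        have "z ^ (q - j) * (cnj z) ^ (q - j) = 1" using zz by (simp add: power_mult_distrib[symmetric])
        then have cz: "1 / z ^ (q - j) = (cnj z) ^ (q - j)" using z0 by (simp add: field_simps)
        have "z ^ q = z ^ (q - j) * z ^ j" using that by (simp add: power_add[symmetric])
        then have "c j * z ^ j / z ^ q = c j * (1 / z ^ (q - j))" using z0 by simp
        also have "\<dots> = cnj (cnj (c j) * z ^ (q - j))" using cz by simp
        finally have E: "c j * z ^ j / z ^ q = cnj (cnj (c j) * z ^ (q - j))" .
        have "Re (cnj w - w) = 0" for w by simp
        then show ?thesis unfolding E .
      qed
      then show ?thesis by (simp add: \<omega>_def)
    qed
    show "k holomorphic_on ball 0 1"
      unfolding k_def[abs_def] by (intro holomorphic_intros R)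
    have "(\<Sum>j<q. cnj (c j) * 0 ^ (q - j)) = 0" by (rule sum.neutral) auto
    then show "Im (k 0) = 0" by (simp add: k_def R_def)
    show "G z = z ^ q * (\<omega> z + k z)" if "z \<noteq> 0" for z by (rule eq[OF that])
    show "cmod (k z) \<le> (2 * real q + 2) * (B / r ^ q)"
      if r: "0 < r" "r < 1" and B: "\<And>z. cmod z \<le> r \<Longrightarrow> cmod (G z) \<le> B" and z: "cmod z = r" for r B z
    proof -
      have z0: "z \<noteq> 0" using z r by auto
      have B0: "B \<ge> 0" using order_trans[OF norm_ge_zero B[of 0]] r by simp
      have cj: "cmod (c j) \<le> B / r ^ j" for j
      proof -
        have sub: "cball 0 r \<subseteq> ball (0::complex) 1" "ball 0 r \<subseteq> ball (0::complex) 1" using r by auto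
        have "cmod ((deriv ^^ j) G 0) \<le> fact j * B / r ^ j"
          using holomorphic_on_subset[OF G sub(2)]
            continuous_on_subset[OF holomorphic_on_imp_continuous_on[OF G] sub(1)] r(1)
          by (rule Cauchy_inequality) (auto intro: B)
        then show ?thesis by (simp add: c_def norm_divide field_simps)
      qed
      have 1: "cmod (c j * z ^ j / z ^ q) \<le> B / r ^ q" for j
      proof -
        have "cmod (c j * z ^ j / z ^ q) = cmod (c j) * r ^ j / r ^ q"
          by (simp add: norm_mult norm_divide norm_power z)
        also have "\<dots> \<le> B / r ^ j * r ^ j / r ^ q"
          using r cj[of j] by (intro divide_right_mono mult_right_mono) auto
        finally show ?thesis using r by simp
      qed
      have 2: "cmod (cnj (c j) * z ^ (q - j)) \<le> B / r ^ q" if "j < q" for j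
      proof -
        have "cmod (cnj (c j) * z ^ (q - j)) \<le> B / r ^ j * 1"
          unfolding norm_mult using cj[of j] r z B0
          by (intro mult_mono) (auto simp: norm_power power_le_one)
        also have "\<dots> \<le> B / r ^ q"
          using r that B0 by (auto intro!: divide_left_mono power_decreasing mult_pos_pos)
        finally show ?thesis .
      qed
      have "cmod (\<omega> z) \<le> (\<Sum>j<q. 2 * (B / r ^ q)) + B / r ^ q"
        unfolding \<omega>_def
      proof (rule norm_triangle_mono[OF sum_norm_le])
        show "cmod (c j * z ^ j / z ^ q - cnj (c j) * z ^ (q - j)) \<le> 2 * (B / r ^ q)" if "j \<in> {..<q}" for j
          using norm_triangle_ineq4[of "c j * z ^ j / z ^ q" "cnj (c j) * z ^ (q - j)"] 1[of j] 2[of j] that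
          by simp
        have "cmod (\<i> * of_real (Im (c q))) \<le> cmod (c q)" by (simp add: norm_mult abs_Im_le_cmod)
        then show "cmod (\<i> * of_real (Im (c q))) \<le> B / r ^ q" using cj[of q] by simp
      qed
      moreover have "cmod (G z / z ^ q) \<le> B / r ^ q"
        using B[of z] z r by (simp add: norm_divide norm_power divide_right_mono)
      moreover have "k z = G z / z ^ q - \<omega> z" using eq[OF z0] z0 by simp
      ultimately have "cmod (k z) \<le> B / r ^ q + ((\<Sum>j<q. 2 * (B / r ^ q)) + B / r ^ q)"
        using norm_triangle_ineq4[of "G z / z ^ q" "\<omega> z"] by simp
      then show ?thesis by (simp add: algebra_simps)
    qed
  qed
qed

section \<open>The flows of the basis fields\<close>

text \<open>Separating variables in \<open>z' = c * z ^ (n + 1)\<close> gives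
  \<open>z * (1 - n * c * t * z ^ n) ^ (- 1 / n)\<close>. \<open>pphi n\<close> is this factor as a
  function of \<open>x = c * t * z ^ n\<close>, with the principal branch, so the facts below stay
  within \<open>|n * x| < 1\<close>. For \<open>n = 0\<close> it is the exponential.\<close>

definition pphi :: "int \<Rightarrow> complex \<Rightarrow> complex" where
  "pphi n x = (if n = 0 then exp x else exp (- Ln (1 - of_int n * x) / of_int n))"

text \<open>
  The flow of the field \<open>c * z powi (n + 1)\<close> up to time \<open>t\<close> is \<open>pflow n (c * t)\<close>.
\<close>

definition pflow :: "int \<Rightarrow> complex \<Rightarrow> complex \<Rightarrow> complex" where
  "pflow n \<tau> z = z * pphi n (\<tau> * z powi n)"

lemma pphi_nz: "pphi n x \<noteq> 0"
  by (simp add: pphi_def)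

lemma pphi_0 [simp]: "pphi n 0 = 1"
  by (simp add: pphi_def)

lemma one_minus_Re_pos: "cmod y < 1 \<Longrightarrow> Re (1 - y) > 0"
  using complex_Re_le_cmod[of y] by simp

lemma one_minus_nz: "cmod y < 1 \<Longrightarrow> 1 - y \<noteq> 0"
  by auto

lemma pphi_powi:
  assumes "cmod (of_int n * x) < 1"
  shows "pphi n x powi n * (1 - of_int n * x) = 1"
proof (cases "n = 0")
  case False
  have nz: "1 - of_int n * x \<noteq> 0" by (rule one_minus_nz[OF assms])
  have "pphi n x powi n = exp (of_int n * (- Ln (1 - of_int n * x) / of_int n))"
    using False by (simp add: pphi_def exp_power_int)
  also have "\<dots> = inverse (1 - of_int n * x)"
    using False nz by (simp add: exp_minus)
  finally show ?thesis using nz by simp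
qed (simp add: pphi_def)

lemma pphi_has_deriv:
  assumes "cmod (of_int n * x) < 1"
  shows "(pphi n has_field_derivative pphi n x / (1 - of_int n * x)) (at x)"
proof (cases "n = 0")
  case True
  then show ?thesis by (auto simp: pphi_def[abs_def] intro!: derivative_eq_intros)
next
  case False
  have pos: "Re (1 - of_int n * x) > 0" by (rule one_minus_Re_pos[OF assms])
  then have "1 - of_int n * x \<notin> \<real>\<^sub>\<le>\<^sub>0" by (auto simp: complex_nonpos_Reals_iff)
  moreover have "1 - of_int n * x \<noteq> 0" by (rule one_minus_nz[OF assms])
  ultimately have "((\<lambda>x. exp (- Ln (1 - of_int n * x) / of_int n)) has_field_derivative
      exp (- Ln (1 - of_int n * x) / of_int n) / (1 - of_int n * x)) (at x)"
    using False by (auto intro!: derivative_eq_intros simp: field_simps)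
  then show ?thesis using False by (simp add: pphi_def[abs_def])
qed

lemma pphi_holomorphic: "pphi n holomorphic_on {x. cmod (of_int n * x) < 1}"
proof -
  have "open {x. cmod (of_int n * x) < 1}"
    by (intro open_Collect_less continuous_intros)
  then show ?thesis using pphi_has_deriv by (auto simp: holomorphic_on_open)
qed

text \<open>The group law for the factor: after time \<open>x\<close> the power \<open>z ^ n\<close>
  has been divided by \<open>1 - n * x\<close>, which rescales the second argument.\<close>

lemma pphi_mult:
  assumes x: "cmod (of_int n * x) < 1" and xy: "cmod (of_int n * (x + y)) < 1"
  shows "pphi n (y / (1 - of_int n * x)) * pphi n x = pphi n (x + y)"
proof (cases "n = 0")
  case True then show ?thesis by (simp add: pphi_def exp_add mult.commute)
next
  case False
  define a where "a = 1 - of_int n * x"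
  define b where "b = 1 - of_int n * (x + y)"
  have pos: "Re a > 0" "Re b > 0"
    unfolding a_def b_def using one_minus_Re_pos[OF x] one_minus_Re_pos[OF xy] by auto
  then have nz: "a \<noteq> 0" "b \<noteq> 0" by auto
  have "1 - of_int n * (y / a) = (a - of_int n * y) / a" using nz by (simp add: field_simps)
  also have "a - of_int n * y = b" by (simp add: a_def b_def algebra_simps)
  finally have 1: "1 - of_int n * (y / a) = b / a" .
  \<comment> \<open>Both numbers lie in the right half plane, so the difference of their arguments
    stays within \<open>(- pi, pi)\<close>.\<close>
  have "Ln (b / a) = Ln b - Ln a"
  proof (rule Ln_unique)
    show "exp (Ln b - Ln a) = b / a" using nz by (simp add: exp_diff)
    have "\<bar>Im (Ln a)\<bar> < pi / 2" "\<bar>Im (Ln b)\<bar> < pi / 2" using pos Re_Ln_pos_lt_imp by auto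
    then show "- pi < Im (Ln b - Ln a)" "Im (Ln b - Ln a) \<le> pi" by auto
  qed
  then have "pphi n (y / a) * pphi n x = exp (- (Ln b - Ln a) / of_int n + - Ln a / of_int n)"
    using False 1 by (simp add: pphi_def exp_add[symmetric] a_def[symmetric])
  also have "\<dots> = pphi n (x + y)"
    using False by (simp add: pphi_def b_def[symmetric] diff_divide_distrib)
  finally show ?thesis by (simp add: a_def)
qed

lemma pphi_uminus: "pphi (- n) (- x) * pphi n x = 1"
  by (auto simp: pphi_def exp_minus exp_add[symmetric])

lemma pflow_0 [simp]: "pflow n 0 z = z"
  by (simp add: pflow_def)

lemma pflow_nz: "z \<noteq> 0 \<Longrightarrow> pflow n \<tau> z \<noteq> 0"
  by (simp add: pflow_def pphi_nz)

text \<open>Inversion turns the field of index \<open>n\<close> into minus the field of index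
  \<open>- n\<close>. This transfers all results on the interior map to the exterior map.\<close>

lemma pflow_inverse: "z \<noteq> 0 \<Longrightarrow> inverse (pflow n \<tau> z) = pflow (- n) (- \<tau>) (inverse z)"
proof -
  assume z: "z \<noteq> 0"
  have "inverse z powi (- n) = z powi n" by (simp add: power_int_minus power_int_inverse)
  then show ?thesis
    using pphi_uminus[of n "\<tau> * z powi n"] pphi_nz[of n "\<tau> * z powi n"]
    by (simp add: pflow_def inverse_unique mult.commute)
qed

lemma pflow_powi:
  assumes "cmod (of_int n * \<tau> * z powi n) < 1"
  shows "pflow n \<tau> z powi n = z powi n / (1 - of_int n * \<tau> * z powi n)"
proof -
  have nz: "1 - of_int n * \<tau> * z powi n \<noteq> 0" by (rule one_minus_nz[OF assms])
  have "pphi n (\<tau> * z powi n) powi n * (1 - of_int n * \<tau> * z powi n) = 1"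
    using pphi_powi[of n "\<tau> * z powi n"] assms by (simp add: mult.assoc)
  then have "pphi n (\<tau> * z powi n) powi n = 1 / (1 - of_int n * \<tau> * z powi n)"
    using nz by (simp add: field_simps)
  then show ?thesis by (simp add: pflow_def power_int_mult_distrib)
qed

lemma pflow_add:
  assumes "cmod (of_int n * \<tau> * z powi n) < 1" "cmod (of_int n * (\<tau> + \<sigma>) * z powi n) < 1"
  shows "pflow n \<sigma> (pflow n \<tau> z) = pflow n (\<tau> + \<sigma>) z"
proof -
  have "pflow n \<sigma> (pflow n \<tau> z) =
      z * (pphi n (\<sigma> * z powi n / (1 - of_int n * (\<tau> * z powi n))) * pphi n (\<tau> * z powi n))"
    unfolding pflow_def[of n \<sigma>] pflow_powi[OF assms(1)] by (simp add: pflow_def mult.assoc mult.commute mult.left_commute)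
  also have "\<dots> = pflow n (\<tau> + \<sigma>) z"
    using assms by (subst pphi_mult) (auto simp: pflow_def algebra_simps)
  finally show ?thesis .
qed

lemma pflow_inj:
  assumes "\<And>z. z \<in> S \<Longrightarrow> cmod (of_int n * \<tau> * z powi n) < 1"
  shows "inj_on (pflow n \<tau>) S"
proof (rule inj_on_inverseI)
  fix z assume "z \<in> S"
  then show "pflow n (- \<tau>) (pflow n \<tau> z) = z" using pflow_add[of n \<tau> z "- \<tau>"] assms by simp
qed

lemma pflow_holomorphic:
  assumes "\<And>z. z \<in> S \<Longrightarrow> z \<noteq> 0 \<and> cmod (of_int n * \<tau> * z powi n) < 1"
  shows "pflow n \<tau> holomorphic_on S"
proof -
  have "(pphi n \<circ> (\<lambda>z. \<tau> * z powi n)) holomorphic_on S"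
  proof (rule holomorphic_on_compose_gen[OF _ pphi_holomorphic])
    show "(\<lambda>z. \<tau> * z powi n) holomorphic_on S" using assms by (intro holomorphic_intros) auto
    show "(\<lambda>z. \<tau> * z powi n) ` S \<subseteq> {x. cmod (of_int n * x) < 1}"
      using assms by (auto simp: mult.assoc)
  qed
  then show ?thesis unfolding pflow_def[abs_def] o_def by (intro holomorphic_intros)
qed

lemma pflow_has_vector_derivative:
  assumes z: "z \<noteq> 0" and dom: "cmod (of_int n * (c * of_real s) * z powi n) < 1"
  shows "((\<lambda>s. pflow n (c * of_real s) z) has_vector_derivative
    c * pflow n (c * of_real s) z powi (n + 1)) (at s within S)"
proof -
  define x where "x = c * of_real s * z powi n"
  have dx: "cmod (of_int n * x) < 1" using dom by (simp add: x_def mult.assoc)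
  have "(pphi n has_field_derivative pphi n x / (1 - of_int n * x)) (at (c * of_real s * z powi n))"
    using pphi_has_deriv[OF dx] by (simp add: x_def)
  moreover have "((\<lambda>s. c * s * z powi n) has_field_derivative c * z powi n) (at (of_real s))"
    by (auto intro!: derivative_eq_intros)
  ultimately have "((\<lambda>s. pphi n (c * s * z powi n)) has_field_derivative pphi n x / (1 - of_int n * x) * (c * z powi n)) (at (of_real s))"
    by (rule DERIV_chain2[where f = "pphi n" and g = "\<lambda>s. c * s * z powi n"])
  then have "((\<lambda>s. z * pphi n (c * s * z powi n)) has_field_derivative z * (pphi n x / (1 - of_int n * x) * (c * z powi n))) (at (of_real s))"
    by (rule DERIV_cmult)
  then have "((\<lambda>s. z * pphi n (c * of_real s * z powi n)) has_vector_derivative z * (pphi n x / (1 - of_int n * x) * (c * z powi n))) (at s within S)"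
    by (rule has_vector_derivative_real_field)
  moreover have "z * (pphi n x / (1 - of_int n * x) * (c * z powi n)) = c * pflow n (c * of_real s) z powi (n + 1)"
  proof -
    have nz: "pflow n (c * of_real s) z \<noteq> 0" by (rule pflow_nz[OF z])
    have "pflow n (c * of_real s) z powi (n + 1) = pflow n (c * of_real s) z powi n * pflow n (c * of_real s) z"
      using nz by (simp add: power_int_add)
    then show ?thesis using pflow_powi[OF dom] by (simp add: pflow_def x_def[symmetric] mult.assoc mult.left_commute)
        (simp add: x_def mult_ac)
  qed
  ultimately show ?thesis by (simp add: pflow_def)
qed

text \<open>
  Uniqueness: two solutions with the same initial value have the same \<open>n\<close>-th power,
  which makes the derivative of their quotient vanish.
\<close>

lemma flow_eq_pflow:
  assumes z: "z \<noteq> 0" and dom: "cmod (of_int n * (c * of_real t) * z powi n) < 1"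
  shows "flow (\<lambda>z. c * z powi (n + 1)) t z = pflow n (c * of_real t) z"
proof -
  let ?v = "\<lambda>z. c * z powi (n + 1)" and ?S = "closed_segment 0 t"
  define y where "y s = pflow n (c * of_real s) z" for s :: real
  have doms: "cmod (of_int n * (c * of_real s) * z powi n) < 1" if "s \<in> ?S" for s
  proof -
    have "\<bar>s\<bar> \<le> \<bar>t\<bar>" using that by (auto simp: closed_segment_eq_real_ivl split: if_splits)
    then have "\<bar>s\<bar> * cmod (of_int n * c * z powi n) \<le> \<bar>t\<bar> * cmod (of_int n * c * z powi n)"
      by (rule mult_right_mono) simp
    then show ?thesis using dom by (simp add: norm_mult mult_ac)
  qed
  have ynz: "y s \<noteq> 0" for s using pflow_nz[OF z] by (simp add: y_def)
  have yd: "(y has_vector_derivative ?v (y s)) (at s within ?S)" if "s \<in> ?S" for s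
    unfolding y_def[abs_def] by (rule pflow_has_vector_derivative[OF z doms[OF that]])
  have y0: "y 0 = z" by (simp add: y_def)
  have powd: "((\<lambda>s. x s powi (- n)) has_vector_derivative - (of_int n * c)) (at s within ?S)"
    if "x s \<noteq> 0" "(x has_vector_derivative ?v (x s)) (at s within ?S)" for x s
  proof -
    have "((\<lambda>w. w powi (- n)) has_field_derivative of_int (- n) * x s powi (- n - 1)) (at (x s))"
      using that(1) by (auto intro!: derivative_eq_intros)
    from field_vector_diff_chain_within[OF that(2) has_field_derivative_at_within[OF this]]
    have "((\<lambda>w. w powi (- n)) \<circ> x has_vector_derivative ?v (x s) * (of_int (- n) * x s powi (- n - 1))) (at s within ?S)" .
    moreover have "?v (x s) * (of_int (- n) * x s powi (- n - 1)) = - (of_int n * c)"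
    proof -
      have "x s powi (n + 1) * x s powi (- n - 1) = x s powi ((n + 1) + (- n - 1))"
        using that(1) by (subst power_int_add) auto
      then show ?thesis by (simp add: mult_ac)
    qed
    ultimately show ?thesis by (simp only: o_def)
  qed
  have uniq: "x t = y t" if x0: "x 0 = z" and
    x: "\<forall>s\<in>?S. x s \<noteq> 0 \<and> (x has_vector_derivative ?v (x s)) (at s within ?S)" for x
  proof -
    have cvx: "convex ?S" by simp
    have pw: "x s powi n = y s powi n" if s: "s \<in> ?S" for s
    proof -
      have Z: "((\<lambda>s. x s powi (- n) - y s powi (- n)) has_vector_derivative 0) (at r within ?S)" if "r \<in> ?S" for r
      proof -
        have xr: "x r \<noteq> 0" "(x has_vector_derivative ?v (x r)) (at r within ?S)" using x that by blast+
        show ?thesis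
          using has_vector_derivative_diff[OF powd[of x r, OF xr] powd[of y r, OF ynz yd[OF that]]] by simp
      qed
      obtain k where k: "\<And>r. r \<in> ?S \<Longrightarrow> x r powi (- n) - y r powi (- n) = k"
        using has_vector_derivative_zero_constant[OF cvx Z] by metis
      have "k = 0" using k[of 0] x0 y0 by simp
      then have "x s powi (- n) = y s powi (- n)" using k[OF s] by simp
      then show ?thesis by (simp add: power_int_minus)
    qed
    have Z: "((\<lambda>s. x s / y s) has_vector_derivative 0) (at r within ?S)" if r: "r \<in> ?S" for r
    proof -
      have xr: "x r \<noteq> 0" "(x has_vector_derivative ?v (x r)) (at r within ?S)" using x r by blast+
      have "((\<lambda>w. inverse w) has_field_derivative - (inverse (y r) ^ Suc (Suc 0))) (at (y r))"
        by (rule DERIV_inverse[OF ynz])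
      from field_vector_diff_chain_within[OF yd[OF r] has_field_derivative_at_within[OF this]]
      have "((\<lambda>s. inverse (y s)) has_vector_derivative ?v (y r) * - (inverse (y r) ^ Suc (Suc 0))) (at r within ?S)"
        by (simp add: o_def)
      from has_vector_derivative_mult[OF xr(2) this]
      have "((\<lambda>s. x s * inverse (y s)) has_vector_derivative
        x r * (?v (y r) * - (inverse (y r) ^ Suc (Suc 0))) + ?v (x r) * inverse (y r)) (at r within ?S)" .
      moreover have "x r * (?v (y r) * - (inverse (y r) ^ Suc (Suc 0))) + ?v (x r) * inverse (y r) = 0"
        using pw[OF r] xr(1) ynz[of r] by (simp add: power_int_add field_simps)
      ultimately show ?thesis by (simp only: divide_inverse)
    qed
    obtain k where k: "\<And>r. r \<in> ?S \<Longrightarrow> x r / y r = k"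
      using has_vector_derivative_zero_constant[OF cvx Z] by metis
    have "k = 1" using k[of 0] x0 y0 z by simp
    then show ?thesis using k[of t] ynz[of t] by simp
  qed
  show ?thesis
    unfolding flow_def
  proof (rule the_equality)
    show "\<exists>x. x 0 = z \<and> x t = pflow n (c * of_real t) z \<and>
       (\<forall>s\<in>?S. x s \<noteq> 0 \<and> (x has_vector_derivative ?v (x s)) (at s within ?S))"
      using y0 ynz yd by (intro exI[of _ y]) (simp add: y_def)
    show "w = pflow n (c * of_real t) z"
      if "\<exists>x. x 0 = z \<and> x t = w \<and> (\<forall>s\<in>?S. x s \<noteq> 0 \<and> (x has_vector_derivative ?v (x s)) (at s within ?S))" for w
      using that uniq by (auto simp: y_def)
  qed
qed


section \<open>Differentiating the Taylor coefficients along the flow\<close>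

text \<open>Borsuk's criterion: 0 lies in a bounded component of the complement of a compact set
  exactly when radial projection to the circle is essential on that set. The homotopy
  \<open>z * exp (s * E z)\<close> never meets 0, so the property passes to the image.\<close>

lemma encircling_exp_image:
  assumes enc: "encircling \<gamma>" and E: "continuous_on \<gamma> E"
  shows "encircling ((\<lambda>z. z * exp (E z)) ` \<gamma>)"
proof -
  define f where "f z = z * exp (E z)" for z
  define B where "B z = inverse (cmod (z - 0)) *\<^sub>R (z - 0)" for z :: complex
  have 0: "0 \<notin> \<gamma>" by (rule encircling_zero_notin[OF enc])
  have fc: "continuous_on \<gamma> f" unfolding f_def by (intro continuous_intros E)
  have f0: "0 \<notin> f ` \<gamma>" using 0 by (auto simp: f_def)
  have cf: "compact (f ` \<gamma>)" and conf: "connected (f ` \<gamma>)"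
    using enc fc by (auto simp: encircling_def intro: compact_continuous_image connected_continuous_image)
  have Bn: "cmod (B z) = 1" if "z \<noteq> 0" for z using that by (simp add: B_def)
  have Bg: "cmod (B (z * exp x)) = 1" if "z \<in> \<gamma>" for z x using that 0 by (intro Bn) auto
  have hom: "homotopic_with_canon (\<lambda>x. True) \<gamma> (sphere 0 1) B (B \<circ> f)"
    unfolding homotopic_with_def
  proof (intro exI conjI ballI allI)
    let ?h = "\<lambda>y. B (snd y * exp (of_real (fst y) * E (snd y)))"
    have "continuous_on ({0..1} \<times> \<gamma>) ?h"
      unfolding B_def
      by (intro continuous_intros continuous_on_compose2[OF E]) (use 0 in auto)
    moreover have "?h ` ({0..1} \<times> \<gamma>) \<subseteq> sphere 0 1" using Bg by auto
    ultimately show "continuous_map (prod_topology (top_of_set {0..1::real}) (top_of_set \<gamma>)) (top_of_set (sphere 0 1)) ?h"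
      by (auto simp: prod_topology_subtopology_eu)
  qed (auto simp: f_def)
  have "bounded (connected_component_set (- (f ` \<gamma>)) 0)"
  proof (rule ccontr)
    assume "\<not> ?thesis"
    then obtain c where "homotopic_with_canon (\<lambda>x. True) (f ` \<gamma>) (sphere 0 1) B (\<lambda>x. c)"
      using Borsuk_map_essential_bounded_component[OF cf f0] unfolding B_def[abs_def] by blast
    then have "homotopic_with_canon (\<lambda>x. True) \<gamma> (sphere 0 1) (B \<circ> f) ((\<lambda>x. c) \<circ> f)"
      by (intro homotopic_with_compose_continuous_right[OF _ fc]) auto
    from homotopic_with_trans[OF hom this]
    have "homotopic_with_canon (\<lambda>x. True) \<gamma> (sphere 0 1) B (\<lambda>x. c)" by (simp add: o_def)
    moreover have "bounded (connected_component_set (- \<gamma>) 0)"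
      using bounded_U_plus[OF enc] by (simp add: U_plus_def)
    ultimately show False
      using Borsuk_map_essential_bounded_component[of \<gamma> 0] enc 0
      unfolding B_def[abs_def] encircling_def by blast
  qed
  then have "0 \<in> inside (f ` \<gamma>)" using f0 by (simp add: inside_def)
  then show ?thesis using cf conf by (simp add: encircling_def f_def[abs_def])
qed

lemma encircling_pflow:
  assumes enc: "encircling \<gamma>" and dom: "\<And>z. z \<in> \<gamma> \<Longrightarrow> cmod (of_int n * \<tau> * z powi n) < 1"
  shows "encircling (pflow n \<tau> ` \<gamma>)"
proof -
  have 0: "0 \<notin> \<gamma>" by (rule encircling_zero_notin[OF enc])
  define E where "E z = (if n = 0 then \<tau> else - Ln (1 - of_int n * (\<tau> * z powi n)) / of_int n)" for z
  have "continuous_on \<gamma> E"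
  proof (cases "n = 0")
    case False
    have "1 - of_int n * (\<tau> * z powi n) \<notin> \<real>\<^sub>\<le>\<^sub>0" if "z \<in> \<gamma>" for z
      using one_minus_Re_pos[OF dom[OF that]] by (auto simp: complex_nonpos_Reals_iff mult.assoc)
    then have "continuous_on \<gamma> (\<lambda>z. - Ln (1 - of_int n * (\<tau> * z powi n)) / of_int n)"
      using False 0 by (intro continuous_intros) auto
    then show ?thesis using False by (simp add: E_def[abs_def])
  qed (simp add: E_def[abs_def])
  moreover have "pflow n \<tau> z = z * exp (E z)" for z
    by (simp add: pflow_def pphi_def E_def)
  ultimately show ?thesis using encircling_exp_image[OF enc] by simp
qed

lemma powi_bounded_annulus:
  assumes "0 < a"
  obtains Z where "Z > 0" "\<And>z. a \<le> cmod z \<Longrightarrow> cmod z \<le> b \<Longrightarrow> cmod (of_int n * c * z powi n) \<le> Z"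
proof -
  let ?A = "cball 0 b - ball (0::complex) a"
  have "continuous_on ?A (\<lambda>z. of_int n * c * z powi n)" using assms by (intro continuous_intros) auto
  then have "bounded ((\<lambda>z. of_int n * c * z powi n) ` ?A)"
    by (intro compact_imp_bounded compact_continuous_image compact_diff) auto
  then obtain Z where "Z > 0" "\<And>z. z \<in> ?A \<Longrightarrow> cmod (of_int n * c * z powi n) \<le> Z"
    unfolding bounded_pos by blast
  then show ?thesis using that[of Z] by auto
qed

lemma pflow_quotient_lim:
  assumes a: "0 < a" and t: "t \<longlonglongrightarrow> 0" "\<And>k. t k \<noteq> 0"
  shows "uniform_limit {z. a < cmod z \<and> cmod z < b}
    (\<lambda>k w. (pflow n (c * of_real (t k)) w - w) / of_real (t k)) (\<lambda>w. c * w powi (n + 1)) sequentially"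
proof -
  let ?D = "{z. a < cmod z \<and> cmod z < b}"
  let ?s = "\<lambda>k. complex_of_real (t k)"
  let ?U = "{x. cmod (of_int n * x) < 1}"
  \<comment> \<open>The quotient lemma is applied in the variable of \<open>pphi n\<close> at the
    constant base point 0, with direction \<open>c * z powi n\<close>.\<close>
  let ?w0 = "\<lambda>z::complex. 0::complex"
  have bd: "\<exists>Z. \<forall>z\<in>?D. cmod (c * z powi n) \<le> Z"
  proof -
    have "continuous_on (cball 0 b - ball 0 a) (\<lambda>z. c * z powi n)" using a by (intro continuous_intros) auto
    then have "bounded ((\<lambda>z. c * z powi n) ` (cball 0 b - ball 0 a))"
      by (intro compact_imp_bounded compact_continuous_image compact_diff) auto
    then show ?thesis unfolding bounded_iff by force
  qed
  then obtain Z where Z: "\<And>z. z \<in> ?D \<Longrightarrow> cmod (c * z powi n) \<le> Z" by blast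
  have "uniform_limit ?D (\<lambda>k z. (pphi n (?w0 z + ?s k * (c * z powi n)) - pphi n (?w0 z)) / ?s k)
     (\<lambda>z. deriv (pphi n) (?w0 z) * (c * z powi n)) sequentially"
  proof (rule holomorphic_quotient_uniform_limit[where \<psi> = "pphi n" and w = ?w0 and s = ?s
        and a = "\<lambda>k z. c * z powi n" and ?a0.0 = "\<lambda>z. c * z powi n" and U = ?U and C = "{0}" and A = Z])
    show "pphi n holomorphic_on ?U" by (rule pphi_holomorphic)
    show "open ?U" by (intro open_Collect_less continuous_intros)
    show "uniform_limit ?D (\<lambda>k z. c * z powi n) (\<lambda>z. c * z powi n) sequentially" by (rule uniform_limit_const)
    show "cmod (c * z powi n) \<le> Z" if "z \<in> ?D" for z using Z[OF that] .
    show "?s \<longlonglongrightarrow> 0" using tendsto_of_real[OF t(1)] by simp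
    show "?s k \<noteq> 0" for k using t(2) by simp
  qed auto
  moreover have "deriv (pphi n) 0 = 1"
    using pphi_has_deriv[of n 0] by (auto dest: DERIV_imp_deriv)
  ultimately have "uniform_limit ?D (\<lambda>k z. (pphi n (?s k * (c * z powi n)) - 1) / ?s k) (\<lambda>z. c * z powi n) sequentially"
    by simp
  then have "uniform_limit ?D (\<lambda>k z. z * ((pphi n (?s k * (c * z powi n)) - 1) / ?s k)) (\<lambda>z. z * (c * z powi n)) sequentially"
  proof (intro uniform_lim_mult uniform_limit_const)
    show "bounded ((\<lambda>z. z) ` ?D)" unfolding bounded_iff by (intro exI[of _ b]) auto
    show "bounded ((\<lambda>z. c * z powi n) ` ?D)" unfolding bounded_iff using Z by blast
  qed
  then show ?thesis
  proof (rule uniform_limit_cong'[THEN iffD1, rotated -1])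
    fix z assume "z \<in> ?D"
    then have z: "z \<noteq> 0" using a by auto
    show "z * ((pphi n (?s k * (c * z powi n)) - 1) / ?s k) = (pflow n (c * ?s k) z - z) / ?s k" for k
    proof -
      have e: "?s k * (c * z powi n) = c * ?s k * z powi n" by (simp add: mult_ac)
      show ?thesis unfolding e pflow_def by (simp add: right_diff_distrib)
    qed
    show "z * (c * z powi n) = c * z powi (n + 1)" using z by (simp add: power_int_add mult_ac)
  qed
qed

lemma has_vector_derivative_at_0_sequentially:
  fixes F :: "real \<Rightarrow> complex"
  assumes d: "\<delta> > 0" and lim: "\<And>t. (\<And>k. t k \<noteq> 0) \<Longrightarrow> (\<And>k. \<bar>t k\<bar> < \<delta>) \<Longrightarrow> t \<longlonglongrightarrow> 0 \<Longrightarrow>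
    (\<lambda>k. (F (t k) - F 0) / of_real (t k)) \<longlonglongrightarrow> D"
  shows "(F has_vector_derivative D) (at 0)"
proof -
  have "((\<lambda>t. (F t - F 0) / of_real t) \<longlongrightarrow> D) (at 0 within ball 0 \<delta>)"
    unfolding tendsto_at_iff_sequentially
  proof (intro allI impI)
    fix X :: "nat \<Rightarrow> real" assume X: "\<forall>i. X i \<in> ball 0 \<delta> - {0}" "X \<longlonglongrightarrow> 0"
    then show "((\<lambda>t. (F t - F 0) / of_real t) \<circ> X) \<longlonglongrightarrow> D"
      using lim[of X] by (auto simp: o_def)
  qed
  then have L: "((\<lambda>t. (F t - F 0) / of_real t) \<longlongrightarrow> D) (at 0)"
    using d by (simp add: at_within_open[of 0 "ball 0 \<delta>"])
  have "((\<lambda>t. cmod ((F t - F 0) / of_real t - D)) \<longlongrightarrow> 0) (at 0)"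
    using tendsto_norm[OF tendsto_diff[OF L tendsto_const[of D]]] by simp
  then have "((\<lambda>t. cmod (F t - F 0 - (t - 0) *\<^sub>R D) / norm (t - 0)) \<longlongrightarrow> 0) (at 0)"
  proof (rule Lim_transform_eventually)
    show "\<forall>\<^sub>F t in at 0. cmod ((F t - F 0) / of_real t - D) = cmod (F t - F 0 - (t - 0) *\<^sub>R D) / norm (t - 0)"
    proof (rule eventually_at_filter[THEN iffD2], intro always_eventually allI impI)
      fix t :: real assume t: "t \<noteq> 0"
      have "(F t - F 0) / of_real t - D = (F t - F 0 - (t - 0) *\<^sub>R D) / of_real t"
        using t by (simp add: field_simps scaleR_conv_of_real)
      then show "cmod ((F t - F 0) / of_real t - D) = cmod (F t - F 0 - (t - 0) *\<^sub>R D) / norm (t - 0)"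
        by (simp add: norm_divide)
    qed
  qed
  then show ?thesis
    unfolding has_vector_derivative_def has_derivative_iff_norm by (simp add: bounded_linear_scaleR_left)
qed

text \<open>Cauchy's estimate bounds the derivative by \<open>2 * b\<close> on the disc of radius
  1/2, hence its Lipschitz constant by \<open>16 * b\<close> at radius 1/4. The value
  \<open>a / (32 * b)\<close> turns this into a deviation of at most \<open>a / 2\<close>. Since
  \<open>cradius \<gamma> \<ge> a\<close>, the derivative and \<open>rmap \<gamma> z / z\<close>
  stay away from 0.\<close>

lemma rmap_distortion:
  assumes enc: "encircling \<gamma>" and sub: "\<gamma> \<subseteq> cball 0 b - ball 0 a" and a: "0 < a"
    and r: "r = min (1/4) (a / (32 * b))" and z: "cmod z \<le> r"
  shows "cmod (deriv (rmap \<gamma>) z - of_real (cradius \<gamma>)) \<le> a / 2"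
    "cmod (rmap \<gamma> z - of_real (cradius \<gamma>) * z) \<le> a / 2 * cmod z"
proof -
  let ?p = "rmap \<gamma>"
  have subb: "\<gamma> \<subseteq> cball 0 b" using sub by auto
  have ab: "a \<le> b" using sub encircling_nonempty[OF enc] by force
  then have r0: "0 < r" using a r by simp
  have "r \<le> a / (32 * b)" using r by simp
  then have r4: "r \<le> 1/4" "r * (32 * b) \<le> a" using r ab a by (auto simp: pos_le_divide_eq)
  have dp: "cmod (deriv ?p x) \<le> 2 * b" if x: "cmod x < 1/2" for x
  proof -
    have s: "cball x (1/2) \<subseteq> ball 0 1"
    proof
      fix y assume "y \<in> cball x (1/2)"
      then show "y \<in> ball 0 1" using norm_triangle_ineq[of "y - x" x] x by (simp add: dist_norm norm_minus_commute)
    qed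
    have "cmod ((deriv ^^ 1) ?p x) \<le> fact 1 * b / (1/2) ^ 1"
    proof (rule Cauchy_inequality)
      show "?p holomorphic_on ball x (1/2)"
        using s ball_subset_cball by (intro holomorphic_on_subset[OF rmap_holomorphic[OF enc]]) blast
      show "continuous_on (cball x (1/2)) ?p"
        using s by (intro holomorphic_on_imp_continuous_on holomorphic_on_subset[OF rmap_holomorphic[OF enc]])
      show "cmod (?p y) \<le> b" if "cmod (x - y) = 1/2" for y
      proof (rule rmap_bound[OF enc subb])
        have "y \<in> cball x (1/2)" using that by (simp add: dist_norm)
        then show "cmod y < 1" using s by auto
      qed
    qed auto
    then show ?thesis by simp
  qed
  have dh: "deriv ?p holomorphic_on ball 0 (1/2)"
    by (intro holomorphic_deriv holomorphic_on_subset[OF rmap_holomorphic[OF enc]]) auto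
  show 1: "cmod (deriv ?p z - of_real (cradius \<gamma>)) \<le> a / 2"
  proof -
    have "cmod (deriv ?p z - deriv ?p 0) \<le> 2 * (2 * b) / (1/2 - 1/4) * cmod (z - 0)"
      by (rule holomorphic_Lipschitz[where f = "deriv ?p", OF dh dp]) (use z r4 in auto)
    also have "\<dots> \<le> 2 * (2 * b) / (1/2 - 1/4) * r"
      using z ab a by (intro mult_left_mono) auto
    also have "\<dots> \<le> a / 2" using r4 by (simp add: mult_ac)
    finally show ?thesis by (simp add: deriv_rmap_0[OF enc])
  qed
  have d1: "cmod (deriv ?p x - of_real (cradius \<gamma>)) \<le> a / 2" if "cmod x \<le> r" for x
  proof -
    have "cmod (deriv ?p x - deriv ?p 0) \<le> 2 * (2 * b) / (1/2 - 1/4) * cmod (x - 0)"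
      by (rule holomorphic_Lipschitz[where f = "deriv ?p", OF dh dp]) (use that r4 in auto)
    also have "\<dots> \<le> 2 * (2 * b) / (1/2 - 1/4) * r"
      using that ab a by (intro mult_left_mono) auto
    also have "\<dots> \<le> a / 2" using r4 by (simp add: mult_ac)
    finally show ?thesis by (simp add: deriv_rmap_0[OF enc])
  qed
  have "cmod ((?p z - of_real (cradius \<gamma>) * z) - (?p 0 - of_real (cradius \<gamma>) * 0)) \<le> a / 2 * cmod (z - 0)"
  proof (rule field_differentiable_bound[of "cball 0 r" "\<lambda>x. ?p x - of_real (cradius \<gamma>) * x" "\<lambda>x. deriv ?p x - of_real (cradius \<gamma>)"])
    show "((\<lambda>x. ?p x - of_real (cradius \<gamma>) * x) has_field_derivative deriv ?p x - of_real (cradius \<gamma>)) (at x within cball 0 r)"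
      if x: "x \<in> cball 0 r" for x
    proof -
      have "cmod x < 1" using x r4 by simp
      from rmap_has_deriv[OF enc this]
      have "((\<lambda>x. ?p x - of_real (cradius \<gamma>) * x) has_field_derivative deriv ?p x - of_real (cradius \<gamma>)) (at x)"
        by (intro DERIV_diff DERIV_cmult_Id)
      then show ?thesis by (rule has_field_derivative_at_within)
    qed
    show "cmod (deriv ?p x - of_real (cradius \<gamma>)) \<le> a / 2" if "x \<in> cball 0 r" for x
      by (rule d1) (use that in simp)
  qed (use z r0 in auto)
  then show "cmod (?p z - of_real (cradius \<gamma>) * z) \<le> a / 2 * cmod z" by (simp add: rmap_0[OF enc])
qed

lemma powi_bounds:
  assumes "0 < l" "l \<le> cmod w" "cmod w \<le> h"
  shows "cmod (w powi m) \<le> max (h powi m) (l powi m)"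
proof (cases "m \<ge> 0")
  case True
  then have "cmod w powi m \<le> h powi m" using assms by (intro power_int_mono) auto
  then show ?thesis by (simp add: norm_power_int)
next
  case False
  then have "cmod w powi m \<le> l powi m" using assms by (intro power_int_antimono) auto
  then show ?thesis by (simp add: norm_power_int)
qed

text \<open>The constants fixed before the loop, \<open>r\<close>, \<open>B\<close> and
  \<open>BN\<close>, depend on the annulus and the field only. They bound the explicit
  \<open>N\<close> on the circle of radius \<open>r\<close>, and Cauchy's estimate bounds its Taylor
  coefficients. The existence of the derivative comes from \<open>loop_variation\<close>, with a
  domain adapted to the individual loop.\<close>

lemma rmap_taylor_derivative:
  assumes a: "0 < a"
  shows "\<exists>C. \<forall>\<gamma>. encircling \<gamma> \<and> \<gamma> \<subseteq> cball 0 b - ball 0 a \<longrightarrow>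
    (\<exists>d. cmod d \<le> C \<and>
      ((\<lambda>t. (deriv ^^ j) (rmap (pflow n (c * of_real t) ` \<gamma>)) 0) has_vector_derivative d) (at 0))"
proof -
  \<comment> \<open>At least one of \<open>q\<close> and \<open>e\<close> is 0. They separate the
    pole from the zero in \<open>z ^ n = z ^ e / z ^ q\<close>, so that the split can be applied to
    a holomorphic function.\<close>
  define q where "q = nat (- n)"
  define e where "e = nat n"
  define r where "r = min (1/4) (a / (32 * b))"
  define Bs where "Bs = max ((3 * b) powi (n + 1)) ((a / 2) powi (n + 1))"
  define B where "B = cmod c * Bs * (2 / a)"
  define BN where "BN = r * ((2 * real q + 2) * (B / r ^ q)) * (3 * b)"
  have "\<exists>d. cmod d \<le> fact j * BN / r ^ j \<and>
      ((\<lambda>t. (deriv ^^ j) (rmap (pflow n (c * of_real t) ` \<gamma>)) 0) has_vector_derivative d) (at 0)"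
    if enc: "encircling \<gamma>" and sub: "\<gamma> \<subseteq> cball 0 b - ball 0 a" for \<gamma>
  proof -
    let ?p = "rmap \<gamma>"
    note dist = rmap_distortion[OF enc sub a r_def]
    have ab: "a \<le> b" using sub encircling_nonempty[OF enc] by force
    then have r0: "0 < r" using a by (simp add: r_def)
    have r1: "r \<le> 1/4" by (simp add: r_def)
    have \<rho>: "a \<le> cradius \<gamma>" "cradius \<gamma> \<le> 2 * b"
      using cradius_lower[OF enc _ a] cradius_upper[OF enc, of b] sub by auto
    define S where "S z = (if z = 0 then deriv ?p 0 else (?p z - ?p 0) / (z - 0))" for z
    have Sh: "S holomorphic_on ball 0 1"
      unfolding S_def[abs_def] by (rule pole_lemma_open[OF rmap_holomorphic[OF enc]]) simp
    have pS: "?p z = z * S z" for z by (simp add: S_def rmap_0[OF enc])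
    have Snz: "S z \<noteq> 0" if "cmod z < 1" for z
      using that rmap_eq_0_iff[OF enc that] deriv_rmap_nz[OF enc, of 0] by (auto simp: S_def rmap_0[OF enc])
    \<comment> \<open>This is \<open>z ^ q\<close> times the velocity divided by
      \<open>z * deriv ?p z\<close>, written with \<open>?p z = z * S z\<close>; it has no
      singularity at 0.\<close>
    define G where "G z = c * z ^ e * (S z powi (n + 1)) / deriv ?p z" for z
    have Gh: "G holomorphic_on ball 0 1"
      unfolding G_def[abs_def]
      by (intro holomorphic_intros Sh rmap_holomorphic[OF enc]) (use Snz deriv_rmap_nz[OF enc] in auto)
    obtain \<omega> k where \<omega>: "\<omega> holomorphic_on - {0}" "\<And>z. cmod z = 1 \<Longrightarrow> Re (\<omega> z) = 0"
      and k: "k holomorphic_on ball 0 1" "Im (k 0) = 0"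
      and Geq: "\<And>z. z \<noteq> 0 \<Longrightarrow> cmod z < 1 \<Longrightarrow> G z = z ^ q * (\<omega> z + k z)"
      and kb: "\<And>r B z. 0 < r \<Longrightarrow> r < 1 \<Longrightarrow> (\<And>z. cmod z \<le> r \<Longrightarrow> cmod (G z) \<le> B) \<Longrightarrow> cmod z = r \<Longrightarrow>
         cmod (k z) \<le> (2 * real q + 2) * (B / r ^ q)"
      using laurent_split[OF Gh, of q] by metis
    have decomp: "c * ?p z powi (n + 1) = z * deriv ?p z * (\<omega> z + k z)" if z: "z \<noteq> 0" "cmod z < 1" for z
    proof -
      have zz: "z ^ q * z powi (n + 1) = z * z ^ e"
      proof (cases "n \<ge> 0")
        case True
        then have "n = int e" "q = 0" by (auto simp: e_def q_def)
        then show ?thesis using z by (simp add: power_int_add)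
      next
        case False
        then have "n = - int q" "e = 0" by (auto simp: e_def q_def)
        moreover have "z ^ q * z powi (n + 1) = z powi (int q + (n + 1))"
          using z by (subst power_int_add) auto
        ultimately show ?thesis by simp
      qed
      have "z ^ q * (c * ?p z powi (n + 1)) = c * (z ^ q * z powi (n + 1)) * S z powi (n + 1)"
        unfolding pS power_int_mult_distrib by (simp add: mult_ac)
      also have "\<dots> = z * deriv ?p z * G z"
        unfolding zz G_def using deriv_rmap_nz[OF enc z(2)] by simp
      also have "\<dots> = z ^ q * (z * deriv ?p z * (\<omega> z + k z))" using Geq[OF z] by simp
      finally show ?thesis using z(1) by simp
    qed
    define N where "N z = z * k z * deriv ?p z" for z
    have Nh: "N holomorphic_on ball 0 1"
      unfolding N_def[abs_def] by (intro holomorphic_intros k rmap_holomorphic[OF enc]) auto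
    have GB: "cmod (G z) \<le> B" if z: "cmod z \<le> r" for z
    proof -
      have z1: "cmod z < 1" using z r1 by simp
      have S1: "cmod (S z - of_real (cradius \<gamma>)) \<le> a / 2"
      proof (cases "z = 0")
        case True then show ?thesis using a by (simp add: S_def deriv_rmap_0[OF enc])
      next
        case False
        have "S z - of_real (cradius \<gamma>) = (?p z - of_real (cradius \<gamma>) * z) / z"
          using False by (simp add: pS field_simps)
        then show ?thesis using dist(2)[OF z] False by (simp add: norm_divide divide_le_eq)
      qed
      have "cmod (S z) \<le> 3 * b"
        using norm_triangle_sub[of "S z" "of_real (cradius \<gamma>)"] S1 \<rho> ab a by simp
      moreover have "a / 2 \<le> cmod (S z)"
        using norm_triangle_ineq3[of "of_real (cradius \<gamma>)" "S z"] S1 \<rho> a by (simp add: norm_minus_commute)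
      ultimately have "cmod (S z powi (n + 1)) \<le> Bs" unfolding Bs_def using a by (intro powi_bounds) auto
      moreover have dl: "a / 2 \<le> cmod (deriv ?p z)"
        using norm_triangle_ineq3[of "of_real (cradius \<gamma>)" "deriv ?p z"] dist(1)[OF z] \<rho> a by (simp add: norm_minus_commute)
      have ci: "cmod (inverse (deriv ?p z)) \<le> 2 / a"
        using le_imp_inverse_le[OF dl] a unfolding norm_inverse by simp
      have "cmod (c * z ^ e) \<le> cmod c"
        using z1 by (simp add: norm_mult norm_power mult_left_le power_le_one)
      ultimately have "cmod (c * z ^ e) * cmod (S z powi (n + 1)) * cmod (inverse (deriv ?p z)) \<le> cmod c * Bs * (2 / a)"
        using ci order_trans[OF norm_ge_zero \<open>cmod (S z powi (n + 1)) \<le> Bs\<close>]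
        by (intro mult_mono mult_nonneg_nonneg) auto
      then show ?thesis by (simp add: G_def B_def norm_mult norm_divide norm_inverse divide_inverse)
    qed
    have NB: "cmod (N z) \<le> BN" if z: "cmod z = r" for z
    proof -
      have 1: "cmod (k z) \<le> (2 * real q + 2) * (B / r ^ q)"
        by (rule kb[OF r0 _ GB z]) (use r1 in auto)
      have "cmod (deriv ?p z) \<le> 3 * b"
        using norm_triangle_sub[of "deriv ?p z" "of_real (cradius \<gamma>)"] dist(1)[of z] z \<rho> ab a by simp
      then show ?thesis
        unfolding N_def BN_def norm_mult
        using 1 z r0 ab a order_trans[OF norm_ge_zero GB[of 0]]
        by (intro mult_mono mult_nonneg_nonneg) auto
    qed
    have sr: "cball 0 r \<subseteq> ball (0::complex) 1" "ball 0 r \<subseteq> ball (0::complex) 1" using r1 by auto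
    have bound: "cmod ((deriv ^^ j) N 0) \<le> fact j * BN / r ^ j"
      using holomorphic_on_subset[OF Nh sr(2)]
        continuous_on_subset[OF holomorphic_on_imp_continuous_on[OF Nh] sr(1)] r0
      by (rule Cauchy_inequality) (auto intro: NB)
    \<comment> \<open>By injectivity neither the outer part of the disc nor the loop reaches the
      image of the disc of radius 1/4, which contains a ball of radius \<open>r2\<close>. This
      radius depends on the loop, which is harmless because it serves only the existence of the
      limit.\<close>
    have "open (?p ` ball 0 (1/4))"
    proof (rule open_mapping_thm3)
      show "?p holomorphic_on ball 0 (1/4)" by (rule holomorphic_on_subset[OF rmap_holomorphic[OF enc]]) auto
      show "inj_on ?p (ball 0 (1/4))" by (rule inj_on_subset[OF rmap_inj[OF enc]]) auto
    qed simp
    moreover have "0 \<in> ?p ` ball 0 (1/4)" using rmap_0[OF enc] by force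
    ultimately obtain r2 where r2: "r2 > 0" "ball 0 r2 \<subseteq> ?p ` ball 0 (1/4)" using openE by blast
    have far: "r2 \<le> cmod (?p z)" if z: "1/4 \<le> cmod z" "cmod z < 1" for z
    proof (rule ccontr)
      assume "\<not> ?thesis"
      then have "?p z \<in> ?p ` ball 0 (1/4)" using r2(2) by auto
      then obtain y where y: "cmod y < 1/4" "?p z = ?p y" by auto
      then have "z = y" using inj_onD[OF rmap_inj[OF enc], of z y] z by simp
      then show False using y z by simp
    qed
    have far': "r2 \<le> cmod w" if w: "w \<in> \<gamma>" for w
    proof (rule ccontr)
      assume "\<not> ?thesis"
      then have "w \<in> ?p ` ball 0 (1/4)" using r2(2) by auto
      then have "w \<in> U_plus \<gamma>" using rmap_in[OF enc] by force
      then show False using U_plus_disjoint[of \<gamma>] w by blast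
    qed
    define D where "D = {z. r2 / 2 < cmod z \<and> cmod z < b + 1}"
    have opD: "open D" unfolding D_def
      by (intro open_Collect_conj open_Collect_less continuous_intros)
    \<comment> \<open>For times below \<open>1 / Z\<close> the flow formula is valid and injective
      on all of \<open>D\<close>.\<close>
    obtain Z where Z: "Z > 0" "\<And>z. r2 / 2 \<le> cmod z \<Longrightarrow> cmod z \<le> b + 1 \<Longrightarrow> cmod (of_int n * c * z powi n) \<le> Z"
      using powi_bounded_annulus[of "r2 / 2"] r2(1) by (metis half_gt_zero)
    obtain V where V: "\<And>z. z \<in> D \<Longrightarrow> cmod (c * z powi (n + 1)) \<le> V"
    proof -
      have "continuous_on (cball 0 (b + 1) - ball 0 (r2 / 2)) (\<lambda>z. c * z powi (n + 1))"
        using r2 by (intro continuous_intros) auto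
      then have "bounded ((\<lambda>z. c * z powi (n + 1)) ` (cball 0 (b + 1) - ball 0 (r2 / 2)))"
        by (intro compact_imp_bounded compact_continuous_image compact_diff) auto
      then obtain V where "\<And>z. z \<in> cball 0 (b + 1) - ball 0 (r2 / 2) \<Longrightarrow> cmod (c * z powi (n + 1)) \<le> V"
        unfolding bounded_iff by blast
      then show ?thesis using that[of V] by (auto simp: D_def)
    qed
    have \<gamma>D: "\<gamma> \<subseteq> D"
    proof
      fix w assume w: "w \<in> \<gamma>"
      then have "cmod w \<le> b" using sub by auto
      then show "w \<in> D" using far'[OF w] r2(1) by (simp add: D_def)
    qed
    have pD: "?p z \<in> D" if "1/4 \<le> cmod z" "cmod z < 1" for z
    proof -
      have "cmod (?p z) \<le> b" using sub by (intro rmap_bound[OF enc _ that(2)]) auto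
      then show ?thesis using far[OF that] r2(1) by (simp add: D_def)
    qed
    have "((\<lambda>t. (deriv ^^ j) (rmap (pflow n (c * of_real t) ` \<gamma>)) 0) has_vector_derivative (deriv ^^ j) N 0) (at 0)"
    proof (rule has_vector_derivative_at_0_sequentially[of "1 / Z"])
      show "1 / Z > 0" using Z by simp
      fix t :: "nat \<Rightarrow> real"
      assume t: "\<And>m. t m \<noteq> 0" "\<And>m. \<bar>t m\<bar> < 1 / Z" "t \<longlonglongrightarrow> 0"
      have dom: "cmod (of_int n * (c * of_real (t m)) * z powi n) < 1" if "z \<in> D" for z m
      proof -
        have "cmod (of_int n * (c * of_real (t m)) * z powi n) = cmod (of_int n * c * z powi n) * \<bar>t m\<bar>"
          by (simp add: norm_mult)
        also have "\<dots> \<le> Z * \<bar>t m\<bar>" using Z(2)[of z] that by (intro mult_right_mono) (auto simp: D_def)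
        also have "\<dots> < 1" using t(2)[of m] Z(1) by (simp add: field_simps)
        finally show ?thesis .
      qed
      have D0: "z \<noteq> 0" if "z \<in> D" for z using that r2(1) by (auto simp: D_def)
      interpret lv: loop_variation \<gamma> "\<lambda>m. pflow n (c * of_real (t m))" t "\<lambda>w. c * w powi (n + 1)" \<omega> k D V
      proof
        show "pflow n (c * of_real (t m)) holomorphic_on D" for m
          using dom D0 by (intro pflow_holomorphic) auto
        show "inj_on (pflow n (c * of_real (t m))) D" for m by (rule pflow_inj[OF dom])
        show "pflow n (c * of_real (t m)) w \<noteq> 0" if "w \<in> D" for w m by (rule pflow_nz[OF D0[OF that]])
        show "encircling (pflow n (c * of_real (t m)) ` \<gamma>)" for m
          using \<gamma>D by (intro encircling_pflow[OF enc] dom) auto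
        show "uniform_limit D (\<lambda>m w. (pflow n (c * of_real (t m)) w - w) / of_real (t m)) (\<lambda>w. c * w powi (n + 1)) sequentially"
          unfolding D_def using r2(1) t by (intro pflow_quotient_lim) auto
        show "c * rmap \<gamma> z powi (n + 1) = z * deriv (rmap \<gamma>) z * (\<omega> z + k z)" if "1/4 \<le> cmod z" "cmod z < 1" for z
          using that by (intro decomp) auto
      qed (use enc t opD \<gamma>D pD V \<omega> k in auto)
      have "lv.N = N" by (simp add: fun_eq_iff lv.N_def N_def)
      then show "(\<lambda>m. ((deriv ^^ j) (rmap (pflow n (c * of_real (t m)) ` \<gamma>)) 0 -
          (deriv ^^ j) (rmap (pflow n (c * of_real 0) ` \<gamma>)) 0) / of_real (t m)) \<longlonglongrightarrow> (deriv ^^ j) N 0"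
        using lv.deriv_rmap_variation[of j] by simp
    qed
    then show ?thesis using bound by blast
  qed
  then show ?thesis by blast
qed


section \<open>The coordinates of a loop\<close>

definition taylor_ratio :: "complex set \<Rightarrow> nat \<Rightarrow> complex" where
  "taylor_ratio \<gamma> n = (deriv ^^ Suc n) (rmap \<gamma>) 0 / (fact (Suc n) * of_real (cradius \<gamma>))"

lemma deriv_cong_ball:
  assumes "\<And>z. cmod z < 1 \<Longrightarrow> f z = g z"
  shows "(deriv ^^ n) f 0 = (deriv ^^ n) g 0"
proof (rule higher_deriv_cong_ev)
  have "\<forall>\<^sub>F z in nhds 0. z \<in> ball (0::complex) 1" by (intro eventually_nhds_in_open) auto
  then show "\<forall>\<^sub>F z in nhds 0. f z = g z" by eventually_elim (simp add: assms)
qed simp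

lemma is_rmap_deriv:
  assumes "encircling \<gamma>" "is_rmap (U_plus \<gamma>) h"
  shows "(deriv ^^ n) h 0 = (deriv ^^ n) (rmap \<gamma>) 0"
  by (rule deriv_cong_ball) (rule is_rmap_unique[OF assms])

lemma expansion_unique:
  fixes a :: "nat \<Rightarrow> complex"
  assumes "\<And>z. cmod z < 1 \<Longrightarrow> (\<lambda>n. c * z * (a n * z ^ n)) sums h z"
  shows "(deriv ^^ Suc n) h 0 = fact (Suc n) * (c * a n)" "h holomorphic_on ball 0 1" "h 0 = 0"
proof -
  define d where "d m = (case m of 0 \<Rightarrow> 0 | Suc k \<Rightarrow> c * a k)" for m
  have s: "(\<lambda>m. d m * z ^ m) sums h z" if z: "cmod z < 1" for z
  proof -
    have "(\<lambda>n. d (Suc n) * z ^ Suc n) sums h z"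
      using assms[OF z] by (simp add: d_def mult_ac)
    from sums_Suc[OF this] show ?thesis by (simp add: d_def)
  qed
  show "h holomorphic_on ball 0 1" by (rule power_series_holomorphic[of 0 1 d]) (use s in simp)
  show "h 0 = 0" using assms[of 0] sums_unique2[OF sums_zero] by simp
  have "h has_fps_expansion Abs_fps d"
  proof (rule has_fps_expansionI)
    have "\<forall>\<^sub>F z in nhds 0. z \<in> ball (0::complex) 1" by (intro eventually_nhds_in_open) auto
    then show "\<forall>\<^sub>F z in nhds 0. (\<lambda>m. fps_nth (Abs_fps d) m * z ^ m) sums h z"
      by eventually_elim (simp add: s)
  qed
  from fps_nth_fps_expansion[OF this, of "Suc n"]
  have "c * a n = (deriv ^^ Suc n) h 0 / fact (Suc n)" by (simp add: d_def del: funpow.simps)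
  then show "(deriv ^^ Suc n) h 0 = fact (Suc n) * (c * a n)" by (simp del: funpow.simps fact_Suc)
qed

lemma rmap_sums:
  assumes "encircling \<gamma>" "cmod z < 1"
  shows "(\<lambda>n. of_real (cradius \<gamma>) * z * (taylor_ratio \<gamma> n * z ^ n)) sums rmap \<gamma> z"
proof -
  let ?c = "\<lambda>n. (deriv ^^ n) (rmap \<gamma>) 0 / fact n * z ^ n"
  have "?c sums rmap \<gamma> z"
    using holomorphic_power_series[OF rmap_holomorphic[OF assms(1)], of z] assms(2) by simp
  then have "(\<lambda>n. ?c (Suc n)) sums rmap \<gamma> z"
    using sums_Suc_iff[of ?c "rmap \<gamma> z"] rmap_0[OF assms(1)] by simp
  moreover have "?c (Suc n) = of_real (cradius \<gamma>) * z * (taylor_ratio \<gamma> n * z ^ n)" for n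
    using cradius_pos[OF assms(1)] by (simp add: taylor_ratio_def del: funpow.simps fact_Suc)
  ultimately show ?thesis by simp
qed

lemma taylor_ratio_0: "encircling \<gamma> \<Longrightarrow> taylor_ratio \<gamma> 0 = 1"
  using cradius_pos[of \<gamma>] deriv_rmap_0[of \<gamma>] by (simp add: taylor_ratio_def)

text \<open>Comparing first derivatives identifies any admissible map with
  \<open>rmap \<gamma>\<close>, so the definite descriptions in \<open>rho_zero\<close> and
  \<open>u_coeff\<close> denote the intended values.\<close>

lemma phi_plus_unique:
  assumes enc: "encircling \<gamma>" and "phi_plus_normalized \<gamma> \<phi> \<rho> u"
  shows "\<rho> = cradius \<gamma>" "u = taylor_ratio \<gamma>"
proof -
  have \<phi>: "bij_betw \<phi> (ball 0 1) (U_plus \<gamma>)" "\<rho> > 0" "u 0 = 1"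
    "\<And>z. cmod z < 1 \<Longrightarrow> (\<lambda>n. of_real \<rho> * z * (u n * z ^ n)) sums \<phi> z"
    using assms(2) by (auto simp: phi_plus_normalized_def)
  note e = expansion_unique[OF \<phi>(4)]
  have d: "deriv \<phi> 0 = of_real \<rho>" using e(1)[of 0] \<phi>(3) by simp
  then have "is_rmap (U_plus \<gamma>) \<phi>" using e(2,3) \<phi>(1,2) by (simp add: is_rmap_def)
  note r = is_rmap_deriv[OF enc this]
  have "of_real \<rho> = complex_of_real (cradius \<gamma>)" using r[of 1] d deriv_rmap_0[OF enc] by simp
  then show "\<rho> = cradius \<gamma>" by simp
  have "u n = taylor_ratio \<gamma> n" for n
    using e(1)[of n] r[of "Suc n"] \<open>\<rho> = cradius \<gamma>\<close> \<phi>(2)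
    by (simp add: taylor_ratio_def field_simps del: funpow.simps fact_Suc)
  then show "u = taylor_ratio \<gamma>" by auto
qed

lemma phi_plus_exists:
  assumes "encircling \<gamma>"
  shows "phi_plus_normalized \<gamma> (rmap \<gamma>) (cradius \<gamma>) (taylor_ratio \<gamma>)"
  using rmap_holomorphic[OF assms] rmap_bij[OF assms] cradius_pos[OF assms] rmap_sums[OF assms]
    taylor_ratio_0[OF assms]
  by (simp add: phi_plus_normalized_def)

lemma rho_zero_eq: "encircling \<gamma> \<Longrightarrow> rho_zero \<gamma> = cradius \<gamma>"
  unfolding rho_zero_def using phi_plus_exists phi_plus_unique(1) by (intro the_equality) blast+

lemma u_coeff_eq: "encircling \<gamma> \<Longrightarrow> u_coeff \<gamma> = taylor_ratio \<gamma>"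
  unfolding u_coeff_def using phi_plus_exists phi_plus_unique(2) by (intro the_equality) blast+

text \<open>The set \<open>C\<close>, the inverse of the punctured component of 0 off the inverted
  loop, is connected, unbounded and disjoint from \<open>\<gamma>\<close>, hence lies in
  \<open>outside \<gamma>\<close>. It cannot meet the bounded set \<open>U_plus \<gamma>\<close>;
  since the latter contains a ball about 0, the component has no points of large modulus. Both
  claims rest on the same \<open>C\<close>.\<close>

lemma encircling_inverse_aux:
  assumes enc: "encircling \<gamma>"
  shows "encircling (inverse ` \<gamma>)"
    and "w \<in> U_plus (inverse ` \<gamma>) \<Longrightarrow> w \<noteq> 0 \<Longrightarrow> inverse w \<in> outside \<gamma>"
proof -
  let ?g = "inverse ` \<gamma>"
  let ?W = "connected_component_set (- ?g) 0"
  have 0: "0 \<notin> \<gamma>" "0 \<notin> ?g" using encircling_zero_notin[OF enc] by auto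
  have cont: "continuous_on \<gamma> inverse" using 0 by (intro continuous_intros) auto
  have c: "compact ?g" "connected ?g"
    using enc cont by (auto simp: encircling_def intro: compact_continuous_image connected_continuous_image)
  have opW: "open ?W" using c(1) by (intro open_connected_component) (simp add: compact_imp_closed open_Compl)
  have W0: "0 \<in> ?W" using 0 by simp
  have Wg: "?W \<inter> ?g = {}" using connected_component_subset[of "- ?g" 0] by auto
  define C where "C = inverse ` (?W - {0})"
  have conC: "connected C"
    unfolding C_def
    by (intro connected_continuous_image continuous_intros connected_open_delete opW) auto
  have Cg: "C \<inter> \<gamma> = {}"
  proof -
    have "x \<notin> \<gamma>" if x: "x \<in> C" for x
    proof
      assume "x \<in> \<gamma>"
      then have "inverse x \<in> ?g" by blast
      moreover have "inverse x \<in> ?W" using x by (auto simp: C_def)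
      ultimately show False using Wg by blast
    qed
    then show ?thesis by blast
  qed
  have unbC: "\<not> bounded C"
  proof
    assume "bounded C"
    then obtain B where B: "B > 0" "\<And>x. x \<in> C \<Longrightarrow> cmod x \<le> B" by (auto simp: bounded_pos)
    obtain e where e: "e > 0" "ball 0 e \<subseteq> ?W" using opW W0 openE by blast
    define y where "y = min (e / 2) (1 / (2 * B))"
    have y: "y > 0" "y < e" "y \<le> 1 / (2 * B)" using e B by (auto simp: y_def)
    have "complex_of_real y \<in> ball 0 e" using y by simp
    from subsetD[OF e(2) this] y(1) have "complex_of_real y \<in> ?W - {0}" by simp
    then have "inverse (complex_of_real y) \<in> C" unfolding C_def by (rule imageI)
    from B(2)[OF this] have "inverse y \<le> B" using y(1) by (simp add: norm_inverse)
    then have "1 \<le> B * y" using y(1) by (simp add: field_simps)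
    moreover have "B * y \<le> B * (1 / (2 * B))" using y B by (intro mult_left_mono) auto
    ultimately show False using B(1) by simp
  qed
  have Cout: "x \<in> outside \<gamma>" if x: "x \<in> C" for x
  proof -
    have "C \<subseteq> connected_component_set (- \<gamma>) x"
      using conC Cg x by (intro connected_component_maximal) auto
    then have "\<not> bounded (connected_component_set (- \<gamma>) x)" using unbC bounded_subset by blast
    then show ?thesis using Cg x by (auto simp: outside_def)
  qed
  obtain d where d: "d > 0" "ball 0 d \<subseteq> U_plus \<gamma>"
    using open_U_plus[OF enc] zero_in_U_plus[OF enc] openE by blast
  have "bounded ?W"
    unfolding bounded_iff
  proof (intro exI ballI)
    fix w assume w: "w \<in> ?W"
    show "cmod w \<le> 1 / d"
    proof (rule ccontr)
      assume n: "\<not> cmod w \<le> 1 / d"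
      then have w0: "w \<noteq> 0" "cmod w > 1 / d" using d by auto
      then have "cmod (inverse w) < d" using d unfolding norm_inverse by (simp add: field_simps)
      then have "inverse w \<in> U_plus \<gamma>" using d(2) by auto
      moreover have "inverse w \<in> C" using w w0 by (auto simp: C_def)
      ultimately have "C \<subseteq> U_plus \<gamma>" by (intro connected_subset_U_plus[OF conC Cg]) auto
      then show False using unbC bounded_U_plus[OF enc] bounded_subset by blast
    qed
  qed
  then have "0 \<in> inside ?g" using 0 by (simp add: inside_def)
  then show "encircling ?g" using c by (simp add: encircling_def)
  show "inverse w \<in> outside \<gamma>" if "w \<in> U_plus ?g" "w \<noteq> 0" for w
    using that by (intro Cout) (auto simp: C_def U_plus_def)
qed

lemmas encircling_inverse = encircling_inverse_aux(1)

lemma outside_inverse: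
  assumes enc: "encircling \<gamma>" and x: "x \<in> outside \<gamma>"
  shows "x \<noteq> 0" "inverse x \<in> U_plus (inverse ` \<gamma>)"
proof -
  have out0: "0 \<notin> outside \<gamma>" using enc inside_Int_outside[of \<gamma>] unfolding encircling_def by blast
  then show "x \<noteq> 0" using x by auto
  have bd: "bounded \<gamma>" using enc by (simp add: encircling_def compact_imp_bounded)
  have "connected (inverse ` outside \<gamma>)"
    using out0 connected_outside[OF bd] by (intro connected_continuous_image continuous_intros) auto
  moreover have "inverse ` outside \<gamma> \<inter> inverse ` \<gamma> = {}"
  proof -
    have "inverse y \<noteq> inverse z" if "y \<in> outside \<gamma>" "z \<in> \<gamma>" for y z
      using outside_no_overlap[of \<gamma>] that unfolding inverse_eq_iff_eq by blast
    then show ?thesis by blast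
  qed
  moreover obtain e where e: "e > 0" "ball 0 e \<subseteq> U_plus (inverse ` \<gamma>)"
    using open_U_plus[OF encircling_inverse[OF enc]] zero_in_U_plus[OF encircling_inverse[OF enc]] openE by blast
  obtain y where y: "y \<in> outside \<gamma>" "cmod y > 1 / e"
  proof -
    have "\<not> bounded (outside \<gamma>)" using unbounded_outside[OF bd] .
    then show ?thesis using that unfolding bounded_iff by (meson not_le)
  qed
  have "inverse y \<in> U_plus (inverse ` \<gamma>)"
  proof (rule subsetD[OF e(2)])
    have "0 < 1 / e" using e(1) by simp
    then have "0 < cmod y" using y(2) by linarith
    then have "inverse (cmod y) < e" using y(2) e(1) by (simp add: field_simps)
    then show "inverse y \<in> ball 0 e" by (simp only: mem_ball_0 norm_inverse)
  qed
  ultimately have "inverse ` outside \<gamma> \<subseteq> U_plus (inverse ` \<gamma>)"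
    using y(1) by (intro connected_subset_U_plus) auto
  then show "inverse x \<in> U_plus (inverse ` \<gamma>)" using x by blast
qed

text \<open>Conjugating by inversion reduces uniqueness of the exterior map to the interior case,
  and shows that the outer radius is the reciprocal of a conformal radius.\<close>

lemma phi_minus_is_rmap:
  assumes enc: "encircling \<gamma>" and n: "phi_minus_normalized \<gamma> \<phi> \<rho> b"
  shows "is_rmap (U_plus (inverse ` \<gamma>)) (\<lambda>w. if w = 0 then 0 else 1 / \<phi> (1 / w))"
    and "cradius (inverse ` \<gamma>) = 1 / \<rho>"
proof -
  have \<phi>: "bij_betw \<phi> {z. cmod z > 1} (outside \<gamma>)" "\<rho> > 0" "b 0 = 1"
    "\<And>z. cmod z > 1 \<Longrightarrow> (\<lambda>n. of_real \<rho> * z * (b n / z ^ n)) sums \<phi> z"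
    using n by (auto simp: phi_minus_normalized_def U_minus_def)
  define h where "h w = (if w = 0 then 0 else 1 / \<phi> (1 / w))" for w
  \<comment> \<open>\<open>P w = w * \<phi> (1 / w)\<close> is given by the power series with
    coefficients \<open>\<rho> * b n\<close> and has no zeros, so \<open>h w = w / P w\<close> is
    visibly holomorphic at 0.\<close>
  define P where "P w = (if w = 0 then of_real \<rho> else w * \<phi> (1 / w))" for w
  have big: "cmod (1 / w) > 1" if "cmod w < 1" "w \<noteq> 0" for w :: complex
    using that by (simp add: norm_divide less_divide_eq)
  have P_sums: "(\<lambda>n. of_real \<rho> * b n * w ^ n) sums P w" if w: "cmod w < 1" for w
  proof (cases "w = 0")
    case True
    then show ?thesis using powser_sums_zero[of "\<lambda>n. of_real \<rho> * b n"] \<phi>(3) by (simp add: P_def)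
  next
    case False
    from sums_mult[OF \<phi>(4)[OF big[OF w False]], of w] show ?thesis
      using False by (simp add: P_def power_divide mult_ac)
  qed
  have Ph: "P holomorphic_on ball 0 1"
    by (rule power_series_holomorphic[of 0 1 "\<lambda>n. of_real \<rho> * b n"]) (use P_sums in simp)
  have out: "\<phi> (1 / w) \<in> outside \<gamma>" if "cmod w < 1" "w \<noteq> 0" for w
    using bij_betwE[OF \<phi>(1)] big[OF that] by auto
  have Pnz: "P w \<noteq> 0" if "cmod w < 1" for w
    using outside_inverse(1)[OF enc out[OF that]] \<phi>(2) by (auto simp: P_def)
  have hP: "h w = w / P w" for w by (simp add: h_def P_def)
  have hh: "h holomorphic_on ball 0 1"
    unfolding hP[abs_def] using Pnz by (intro holomorphic_intros Ph) auto
  have "((\<lambda>w. w / P w) has_field_derivative (1 * P 0 - 0 * deriv P 0) / (P 0 * P 0)) (at 0)"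
    by (intro DERIV_divide DERIV_ident holomorphic_derivI[OF Ph open_ball]) (use Pnz in auto)
  then have dh: "deriv h 0 = of_real (1 / \<rho>)"
    using \<phi>(2) by (auto simp: hP[abs_def] P_def dest!: DERIV_imp_deriv)
  have bij: "bij_betw h (ball 0 1) (U_plus (inverse ` \<gamma>))"
  proof (rule bij_betw_imageI)
    have inj: "inj_on \<phi> {z. cmod z > 1}" using \<phi>(1) by (simp add: bij_betw_def)
    have h0: "h w = 0 \<longleftrightarrow> w = 0" if "cmod w < 1" for w using Pnz[OF that] by (simp add: hP)
    show "inj_on h (ball 0 1)"
    proof (rule inj_onI)
      fix x y assume xy: "x \<in> ball 0 1" "y \<in> ball 0 1" "h x = h y"
      have x1: "cmod x < 1" "cmod y < 1" using xy by auto
      have E: "x = 0 \<longleftrightarrow> y = 0" using h0[OF x1(1)] h0[OF x1(2)] xy(3) by metis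
      show "x = y"
      proof (cases "x = 0")
        case True then show ?thesis using E by metis
      next
        case False
        then have y0: "y \<noteq> 0" using E by metis
        have "1 / \<phi> (1 / x) = 1 / \<phi> (1 / y)" using xy(3) unfolding h_def if_not_P[OF False] if_not_P[OF y0] .
        then have "\<phi> (1 / x) = \<phi> (1 / y)" by simp
        from inj_onD[OF inj this] have "1 / x = 1 / y" using big[OF x1(1) False] big[OF x1(2) y0] by (simp only: mem_Collect_eq)
        then show ?thesis by simp
      qed
    qed
    show "h ` ball 0 1 = U_plus (inverse ` \<gamma>)"
    proof (intro equalityI subsetI)
      fix v assume "v \<in> h ` ball 0 1"
      then obtain w where w: "cmod w < 1" "v = h w" by auto
      show "v \<in> U_plus (inverse ` \<gamma>)"
      proof (cases "w = 0")
        case True then show ?thesis using w zero_in_U_plus[OF encircling_inverse[OF enc]] by (simp add: h_def)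
      next
        case False
        then show ?thesis
          using w outside_inverse(2)[OF enc out[OF w(1) False]] by (simp add: h_def inverse_eq_divide)
      qed
    next
      fix v assume v: "v \<in> U_plus (inverse ` \<gamma>)"
      show "v \<in> h ` ball 0 1"
      proof (cases "v = 0")
        case True then show ?thesis by (intro image_eqI[of _ _ 0]) (auto simp: h_def)
      next
        case False
        then have "inverse v \<in> outside \<gamma>" using encircling_inverse_aux(2)[OF enc v] by simp
        then obtain z where z: "cmod z > 1" "inverse v = \<phi> z" using \<phi>(1) by (auto simp: bij_betw_def)
        have "h (1 / z) = v" using z False by (auto simp: h_def inverse_eq_divide[symmetric]) (metis inverse_inverse_eq)
        moreover have "1 / z \<in> ball 0 1" using z by (simp add: norm_divide divide_less_eq)
        ultimately show ?thesis by blast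
      qed
    qed
  qed
  have "h 0 = 0" by (simp add: h_def)
  then show r: "is_rmap (U_plus (inverse ` \<gamma>)) (\<lambda>w. if w = 0 then 0 else 1 / \<phi> (1 / w))"
    using hh bij dh \<phi>(2) unfolding h_def[abs_def, symmetric] by (simp add: is_rmap_def)
  have "complex_of_real (cradius (inverse ` \<gamma>)) = of_real (1 / \<rho>)"
    using is_rmap_deriv[OF encircling_inverse[OF enc] r, of 1] dh
      deriv_rmap_0[OF encircling_inverse[OF enc]] unfolding h_def[abs_def, symmetric] by simp
  then show "cradius (inverse ` \<gamma>) = 1 / \<rho>" by (simp only: of_real_eq_iff)
qed

lemma phi_minus_exists:
  assumes enc: "encircling \<gamma>"
  shows "\<exists>b. phi_minus_normalized \<gamma> (\<lambda>z. 1 / rmap (inverse ` \<gamma>) (1 / z)) (1 / cradius (inverse ` \<gamma>)) b"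
proof -
  let ?g = "inverse ` \<gamma>"
  let ?h = "rmap ?g"
  have enc': "encircling ?g" by (rule encircling_inverse[OF enc])
  let ?\<phi> = "\<lambda>z. 1 / ?h (1 / z)"
  define S where "S w = (if w = 0 then deriv ?h 0 else (?h w - ?h 0) / (w - 0))" for w
  have Sh: "S holomorphic_on ball 0 1"
    unfolding S_def[abs_def] by (rule pole_lemma_open[OF rmap_holomorphic[OF enc']]) simp
  have hS: "?h w = w * S w" for w by (simp add: S_def rmap_0[OF enc'])
  have Snz: "S w \<noteq> 0" if "cmod w < 1" for w
    using that rmap_eq_0_iff[OF enc' that] deriv_rmap_nz[OF enc', of 0] by (auto simp: S_def rmap_0[OF enc'])
  have Ih: "(\<lambda>w. 1 / S w) holomorphic_on ball 0 1" using Snz by (intro holomorphic_intros Sh) auto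
  \<comment> \<open>With \<open>?h w = w * S w\<close>, the exterior map is
    \<open>z / S (1 / z)\<close>. Its coefficients are those of \<open>1 / S\<close>, normalized by
    their value \<open>1 / cradius ?g\<close> at index 0.\<close>
  define b where "b n = of_real (cradius ?g) * ((deriv ^^ n) (\<lambda>w. 1 / S w) 0 / fact n)" for n
  have \<rho>: "cradius ?g > 0" by (rule cradius_pos[OF enc'])
  have small: "cmod (1 / z) < 1" "z \<noteq> 0" if "cmod z > 1" for z :: complex
    using that by (auto simp: norm_divide divide_less_eq)
  have "phi_minus_normalized \<gamma> ?\<phi> (1 / cradius ?g) b"
    unfolding phi_minus_normalized_def U_minus_def
  proof (intro conjI allI impI)
    have "(?h \<circ> (\<lambda>z. 1 / z)) holomorphic_on {z. cmod z > 1}"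
    proof (rule holomorphic_on_compose_gen[OF _ rmap_holomorphic[OF enc']])
      show "(\<lambda>z. 1 / z) holomorphic_on {z::complex. cmod z > 1}" using small by (intro holomorphic_intros) auto
      show "(\<lambda>z. 1 / z) ` {z::complex. cmod z > 1} \<subseteq> ball 0 1" using small by auto
    qed
    then show "?\<phi> holomorphic_on {z. cmod z > 1}"
      unfolding o_def using small rmap_eq_0_iff[OF enc'] by (intro holomorphic_on_divide) auto
    show "bij_betw ?\<phi> {z. cmod z > 1} (outside \<gamma>)"
    proof (rule bij_betw_byWitness[where f' = "\<lambda>x. 1 / rinv ?g (1 / x)"])
      show "\<forall>z\<in>{z. cmod z > 1}. 1 / rinv ?g (1 / ?\<phi> z) = z"
        using small rinv_rmap[OF enc'] by auto
      have in': "1 / x \<in> U_plus ?g" "x \<noteq> 0" if "x \<in> outside \<gamma>" for x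
        using outside_inverse[OF enc that] by (auto simp: inverse_eq_divide)
      show "\<forall>x\<in>outside \<gamma>. ?\<phi> (1 / rinv ?g (1 / x)) = x"
        using in' rmap_rinv[OF enc'] by auto
      show "?\<phi> ` {z. cmod z > 1} \<subseteq> outside \<gamma>"
      proof (rule image_subsetI)
        fix z :: complex assume "z \<in> {z. cmod z > 1}"
        then have z: "cmod z > 1" by simp
        have "inverse (?h (1 / z)) \<in> outside \<gamma>"
          using encircling_inverse_aux(2)[OF enc rmap_in[OF enc' small(1)[OF z]]]
            rmap_eq_0_iff[OF enc' small(1)[OF z]] small(2)[OF z] by simp
        then show "?\<phi> z \<in> outside \<gamma>" by (simp add: inverse_eq_divide)
      qed
      show "(\<lambda>x. 1 / rinv ?g (1 / x)) ` outside \<gamma> \<subseteq> {z. cmod z > 1}"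
      proof (rule image_subsetI)
        fix x assume x: "x \<in> outside \<gamma>"
        have "cmod (rinv ?g (1 / x)) < 1" by (rule rinv_in[OF enc' in'(1)[OF x]])
        moreover have "rinv ?g (1 / x) \<noteq> 0"
          using rmap_rinv[OF enc' in'(1)[OF x]] rmap_0[OF enc'] in'(2)[OF x] by auto
        ultimately show "1 / rinv ?g (1 / x) \<in> {z. cmod z > 1}" by (simp add: norm_divide)
      qed
    qed
    show "0 < 1 / cradius ?g" using \<rho> by simp
    have "S 0 = of_real (cradius ?g)" by (simp add: S_def deriv_rmap_0[OF enc'])
    then show "b 0 = 1" using \<rho> by (simp add: b_def)
    fix z :: complex assume z: "cmod z > 1"
    have "(\<lambda>n. (deriv ^^ n) (\<lambda>w. 1 / S w) 0 / fact n * (1 / z) ^ n) sums (1 / S (1 / z))"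
      using holomorphic_power_series[OF Ih, of "1 / z"] small[OF z] by simp
    from sums_mult[OF this, of z]
    have "(\<lambda>n. z * ((deriv ^^ n) (\<lambda>w. 1 / S w) 0 / fact n * (1 / z) ^ n)) sums ?\<phi> z"
      using small[OF z] by (simp add: hS)
    moreover have "z * ((deriv ^^ n) (\<lambda>w. 1 / S w) 0 / fact n * (1 / z) ^ n) =
        of_real (1 / cradius ?g) * z * (b n / z ^ n)" for n
      using \<rho> by (simp add: b_def power_divide)
    ultimately show "(\<lambda>n. of_real (1 / cradius ?g) * z * (b n / z ^ n)) sums ?\<phi> z" by simp
  qed
  then show ?thesis by blast
qed

lemma rho_inf_eq:
  assumes "encircling \<gamma>" shows "rho_inf \<gamma> = 1 / cradius (inverse ` \<gamma>)"
  unfolding rho_inf_def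
proof (rule the_equality)
  show "\<exists>\<phi> b. phi_minus_normalized \<gamma> \<phi> (1 / cradius (inverse ` \<gamma>)) b"
    using phi_minus_exists[OF assms] by blast
  show "\<rho> = 1 / cradius (inverse ` \<gamma>)" if "\<exists>\<phi> b. phi_minus_normalized \<gamma> \<phi> \<rho> b" for \<rho>
    using that phi_minus_is_rmap(2)[OF assms] by fastforce
qed

lemma l_coeff_eq:
  assumes enc: "encircling \<gamma>" shows "l_coeff \<gamma> = taylor_ratio (inverse ` \<gamma>)"
  unfolding l_coeff_def
proof (rule the_equality)
  let ?g = "inverse ` \<gamma>"
  have enc': "encircling ?g" by (rule encircling_inverse[OF enc])
  have "inverted_expansion (\<lambda>z. 1 / rmap ?g (1 / z)) (1 / cradius ?g) (taylor_ratio ?g)"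
    using rmap_sums[OF enc'] taylor_ratio_0[OF enc'] by (simp add: inverted_expansion_def)
  then show "\<exists>\<phi> \<rho> b. phi_minus_normalized \<gamma> \<phi> \<rho> b \<and> inverted_expansion \<phi> \<rho> (taylor_ratio ?g)"
    using phi_minus_exists[OF enc] by blast
  fix l assume "\<exists>\<phi> \<rho> b. phi_minus_normalized \<gamma> \<phi> \<rho> b \<and> inverted_expansion \<phi> \<rho> l"
  then obtain \<phi> \<rho> b where n: "phi_minus_normalized \<gamma> \<phi> \<rho> b" and l: "inverted_expansion \<phi> \<rho> l" by blast
  define h where "h w = (if w = 0 then 0 else 1 / \<phi> (1 / w))" for w
  have "(\<lambda>n. 1 / of_real \<rho> * w * (l n * w ^ n)) sums h w" if "cmod w < 1" for w
  proof (cases "w = 0")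
    case False
    then show ?thesis using l that by (auto simp: inverted_expansion_def h_def)
  qed (simp add: h_def)
  note e = expansion_unique(1)[OF this]
  have \<rho>: "\<rho> > 0" using n by (simp add: phi_minus_normalized_def)
  have "fact (Suc m) * (1 / of_real \<rho> * l m) = (deriv ^^ Suc m) (rmap ?g) 0" for m
    using e[of m] is_rmap_deriv[OF enc' phi_minus_is_rmap(1)[OF enc n], of "Suc m"]
    by (simp add: h_def[abs_def] del: funpow.simps)
  note E = this
  have "l m = taylor_ratio ?g m" for m
  proof -
    have "taylor_ratio ?g m = fact (Suc m) * (1 / of_real \<rho> * l m) / (fact (Suc m) * of_real (1 / \<rho>))"
      unfolding taylor_ratio_def E phi_minus_is_rmap(2)[OF enc n] by (rule refl)
    also have "\<dots> = l m" using \<rho> by (simp del: fact_Suc)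
    finally show ?thesis by (rule sym)
  qed
  then show "l = taylor_ratio ?g" by auto
qed


section \<open>Functionals differentiable along the flows\<close>

abbreviation annular :: "real \<Rightarrow> real \<Rightarrow> complex set \<Rightarrow> bool" where
  "annular a b \<gamma> \<equiv> encircling \<gamma> \<and> \<gamma> \<subseteq> cball 0 b - ball 0 a"

text \<open>Sequential continuity serves measurability, boundedness serves integrability, and the
  derivative clause serves domination. The bounds depend on the annulus but not on the loop.
  Derivatives are required at time 0 only, because the group law recovers the other times. The class
  is closed under algebra, smooth functions and inversion, which reduces test functions to Taylor
  coefficients.\<close>

definition tame :: "(complex set \<Rightarrow> 'a::real_normed_vector) \<Rightarrow> bool" where
  "tame F \<longleftrightarrow>
     (\<forall>g \<gamma>. encircling \<gamma> \<longrightarrow> (\<forall>n. encircling (g n)) \<longrightarrow> vconv g \<gamma> \<longrightarrow> (\<lambda>n. F (g n)) \<longlonglongrightarrow> F \<gamma>) \<and>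
     (\<forall>a b. 0 < a \<longrightarrow> (\<exists>C. \<forall>\<gamma>. annular a b \<gamma> \<longrightarrow> norm (F \<gamma>) \<le> C)) \<and>
     (\<forall>n c a b. 0 < a \<longrightarrow> (\<exists>C. \<forall>\<gamma>. annular a b \<gamma> \<longrightarrow> (\<exists>d. norm d \<le> C \<and>
        ((\<lambda>t. F (pflow n (c * of_real t) ` \<gamma>)) has_vector_derivative d) (at 0))))"

lemma pflow_0_image: "pflow n (c * of_real 0) ` \<gamma> = \<gamma>"
  by simp

lemma tameI:
  assumes "\<And>g \<gamma>. encircling \<gamma> \<Longrightarrow> (\<And>n. encircling (g n)) \<Longrightarrow> vconv g \<gamma> \<Longrightarrow> (\<lambda>n. F (g n)) \<longlonglongrightarrow> F \<gamma>"
    and "\<And>a b. 0 < a \<Longrightarrow> \<exists>C. \<forall>\<gamma>. annular a b \<gamma> \<longrightarrow> norm (F \<gamma>) \<le> C"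
    and "\<And>n c a b. 0 < a \<Longrightarrow> \<exists>C. \<forall>\<gamma>. annular a b \<gamma> \<longrightarrow> (\<exists>d. norm d \<le> C \<and>
        ((\<lambda>t. F (pflow n (c * of_real t) ` \<gamma>)) has_vector_derivative d) (at 0))"
  shows "tame F"
  unfolding tame_def using assms by simp

lemma tame_continuous:
  "tame F \<Longrightarrow> encircling \<gamma> \<Longrightarrow> (\<And>n. encircling (g n)) \<Longrightarrow> vconv g \<gamma> \<Longrightarrow> (\<lambda>n. F (g n)) \<longlonglongrightarrow> F \<gamma>"
  unfolding tame_def by simp

lemma tame_bounded:
  assumes "tame F" "0 < a"
  obtains C where "C > 0" "\<And>\<gamma>. annular a b \<gamma> \<Longrightarrow> norm (F \<gamma>) \<le> C"
proof -
  obtain C where "\<And>\<gamma>. annular a b \<gamma> \<Longrightarrow> norm (F \<gamma>) \<le> C" using assms unfolding tame_def by meson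
  then show ?thesis using that[of "max C 1"] by (meson le_max_iff_disj less_max_iff_disj zero_less_one)
qed

lemma tame_derivative:
  assumes "tame F" "0 < a"
  obtains C where "C > 0" "\<And>\<gamma>. annular a b \<gamma> \<Longrightarrow> \<exists>d. norm d \<le> C \<and>
        ((\<lambda>t. F (pflow n (c * of_real t) ` \<gamma>)) has_vector_derivative d) (at 0)"
proof -
  have "\<exists>C. \<forall>\<gamma>. annular a b \<gamma> \<longrightarrow> (\<exists>d. norm d \<le> C \<and>
        ((\<lambda>t. F (pflow n (c * of_real t) ` \<gamma>)) has_vector_derivative d) (at 0))"
    using assms unfolding tame_def by simp
  then obtain C where C: "\<And>\<gamma>. annular a b \<gamma> \<Longrightarrow> \<exists>d. norm d \<le> C \<and>
        ((\<lambda>t. F (pflow n (c * of_real t) ` \<gamma>)) has_vector_derivative d) (at 0)" by metis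
  show ?thesis
  proof (rule that[of "max C 1"])
    show "\<exists>d. norm d \<le> max C 1 \<and> ((\<lambda>t. F (pflow n (c * of_real t) ` \<gamma>)) has_vector_derivative d) (at 0)"
      if "annular a b \<gamma>" for \<gamma>
      using C[OF that] by (meson le_max_iff_disj)
  qed simp
qed

lemma tame_const: "tame (\<lambda>\<gamma>. k)"
proof (rule tameI)
  show "\<exists>C. \<forall>\<gamma>. annular a b \<gamma> \<longrightarrow> norm k \<le> C" for a b by blast
  show "\<exists>C. \<forall>\<gamma>. annular a b \<gamma> \<longrightarrow> (\<exists>d. norm d \<le> C \<and> ((\<lambda>t. k) has_vector_derivative d) (at 0))" for a b
    by (intro exI[of _ "0::real"] allI impI exI[of _ 0]) simp
qed simp

lemma tame_taylor: "tame (\<lambda>\<gamma>. (deriv ^^ j) (rmap \<gamma>) 0)"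
proof (rule tameI)
  fix g \<gamma> assume enc: "encircling \<gamma>" "\<And>n. encircling (g n)" and v: "vconv g \<gamma>"
  show "(\<lambda>n. (deriv ^^ j) (rmap (g n)) 0) \<longlonglongrightarrow> (deriv ^^ j) (rmap \<gamma>) 0"
  proof (rule higher_deriv_complex_uniform_limit)
    have "cball 0 (1/2) \<subseteq> ball (0::complex) 1" by auto
    from kernel_convergence[OF v enc compact_cball this]
    show "uniform_limit (ball 0 (1/2)) (\<lambda>n. rmap (g n)) (rmap \<gamma>) sequentially"
      by (rule uniform_limit_on_subset) auto
    show "\<forall>\<^sub>F n in sequentially. rmap (g n) holomorphic_on ball 0 (1/2)"
      by (intro always_eventually allI holomorphic_on_subset[OF rmap_holomorphic[OF enc(2)]]) auto
  qed auto
next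
  fix a b :: real
  have "cmod ((deriv ^^ j) (rmap \<gamma>) 0) \<le> fact j * b * 2 ^ j" if "annular a b \<gamma>" for \<gamma>
    using that by (intro rmap_coeff_bound) auto
  then show "\<exists>C. \<forall>\<gamma>. annular a b \<gamma> \<longrightarrow> norm ((deriv ^^ j) (rmap \<gamma>) 0) \<le> C" by blast
next
  fix n c and a b :: real assume "0 < a"
  from rmap_taylor_derivative[OF this]
  show "\<exists>C. \<forall>\<gamma>. annular a b \<gamma> \<longrightarrow> (\<exists>d. norm d \<le> C \<and>
        ((\<lambda>t. (deriv ^^ j) (rmap (pflow n (c * of_real t) ` \<gamma>)) 0) has_vector_derivative d) (at 0))" .
qed

lemma tame_bounded_linear:
  assumes h: "bounded_linear h" and F: "tame F"
  shows "tame (\<lambda>\<gamma>. h (F \<gamma>))"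
proof -
  obtain K where K: "K > 0" "\<And>x. norm (h x) \<le> norm x * K" using bounded_linear.pos_bounded[OF h] by metis
  show ?thesis
  proof (rule tameI)
    show "(\<lambda>n. h (F (g n))) \<longlonglongrightarrow> h (F \<gamma>)"
      if "encircling \<gamma>" "\<And>n. encircling (g n)" "vconv g \<gamma>" for g \<gamma>
      by (rule bounded_linear.tendsto[OF h tame_continuous[OF F that]])
  next
    fix a b :: real assume a: "0 < a"
    obtain C where C: "\<And>\<gamma>. annular a b \<gamma> \<Longrightarrow> norm (F \<gamma>) \<le> C" using tame_bounded[OF F a] by metis
    have "norm (h (F \<gamma>)) \<le> C * K" if "annular a b \<gamma>" for \<gamma>
      using K(2)[of "F \<gamma>"] mult_right_mono[OF C[OF that], of K] K(1) by linarith
    then show "\<exists>C. \<forall>\<gamma>. annular a b \<gamma> \<longrightarrow> norm (h (F \<gamma>)) \<le> C" by blast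
  next
    fix n c and a b :: real assume a: "0 < a"
    obtain C where C: "\<And>\<gamma>. annular a b \<gamma> \<Longrightarrow> \<exists>d. norm d \<le> C \<and>
        ((\<lambda>t. F (pflow n (c * of_real t) ` \<gamma>)) has_vector_derivative d) (at 0)"
      using tame_derivative[OF F a] by metis
    have "\<exists>d. norm d \<le> C * K \<and> ((\<lambda>t. h (F (pflow n (c * of_real t) ` \<gamma>))) has_vector_derivative d) (at 0)"
      if \<gamma>: "annular a b \<gamma>" for \<gamma>
    proof -
      obtain d where d: "norm d \<le> C" "((\<lambda>t. F (pflow n (c * of_real t) ` \<gamma>)) has_vector_derivative d) (at 0)"
        using C[OF \<gamma>] by blast
      have "norm (h d) \<le> C * K" using K(2)[of d] mult_right_mono[OF d(1), of K] K(1) by linarith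
      then show ?thesis using bounded_linear.has_vector_derivative[OF h d(2)] by blast
    qed
    then show "\<exists>C. \<forall>\<gamma>. annular a b \<gamma> \<longrightarrow> (\<exists>d. norm d \<le> C \<and>
        ((\<lambda>t. h (F (pflow n (c * of_real t) ` \<gamma>))) has_vector_derivative d) (at 0))" by blast
  qed
qed

lemma tame_bilinear:
  assumes h: "bounded_bilinear h" and F: "tame F" and G: "tame G"
  shows "tame (\<lambda>\<gamma>. h (F \<gamma>) (G \<gamma>))"
proof -
  obtain K where K: "K > 0" "\<And>x y. norm (h x y) \<le> norm x * norm y * K"
    using bounded_bilinear.pos_bounded[OF h] by metis
  have est: "norm (h x y) \<le> A * B * K" if "norm x \<le> A" "norm y \<le> B" for x y A B
  proof -
    have "norm x * norm y \<le> A * B"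
      using that by (intro mult_mono) (auto intro: order_trans[OF norm_ge_zero])
    then show ?thesis using K(2)[of x y] mult_right_mono[of "norm x * norm y" "A * B" K] K(1) by linarith
  qed
  show ?thesis
  proof (rule tameI)
    show "(\<lambda>n. h (F (g n)) (G (g n))) \<longlonglongrightarrow> h (F \<gamma>) (G \<gamma>)"
      if "encircling \<gamma>" "\<And>n. encircling (g n)" "vconv g \<gamma>" for g \<gamma>
      by (rule bounded_bilinear.tendsto[OF h tame_continuous[OF F that] tame_continuous[OF G that]])
  next
    fix a b :: real assume a: "0 < a"
    obtain A where A: "\<And>\<gamma>. annular a b \<gamma> \<Longrightarrow> norm (F \<gamma>) \<le> A" using tame_bounded[OF F a] by metis
    obtain B where B: "\<And>\<gamma>. annular a b \<gamma> \<Longrightarrow> norm (G \<gamma>) \<le> B" using tame_bounded[OF G a] by metis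
    show "\<exists>C. \<forall>\<gamma>. annular a b \<gamma> \<longrightarrow> norm (h (F \<gamma>) (G \<gamma>)) \<le> C" using est[OF A B] by blast
  next
    fix n c and a b :: real assume a: "0 < a"
    obtain A where A: "\<And>\<gamma>. annular a b \<gamma> \<Longrightarrow> norm (F \<gamma>) \<le> A" using tame_bounded[OF F a] by metis
    obtain B where B: "\<And>\<gamma>. annular a b \<gamma> \<Longrightarrow> norm (G \<gamma>) \<le> B" using tame_bounded[OF G a] by metis
    obtain A' where A': "\<And>\<gamma>. annular a b \<gamma> \<Longrightarrow> \<exists>d. norm d \<le> A' \<and>
        ((\<lambda>t. F (pflow n (c * of_real t) ` \<gamma>)) has_vector_derivative d) (at 0)"
      using tame_derivative[OF F a] by metis
    obtain B' where B': "\<And>\<gamma>. annular a b \<gamma> \<Longrightarrow> \<exists>d. norm d \<le> B' \<and>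
        ((\<lambda>t. G (pflow n (c * of_real t) ` \<gamma>)) has_vector_derivative d) (at 0)"
      using tame_derivative[OF G a] by metis
    have "\<exists>d. norm d \<le> A * B' * K + A' * B * K \<and>
       ((\<lambda>t. h (F (pflow n (c * of_real t) ` \<gamma>)) (G (pflow n (c * of_real t) ` \<gamma>))) has_vector_derivative d) (at 0)"
      if \<gamma>: "annular a b \<gamma>" for \<gamma>
    proof -
      obtain d where d: "norm d \<le> A'" "((\<lambda>t. F (pflow n (c * of_real t) ` \<gamma>)) has_vector_derivative d) (at 0)"
        using A'[OF \<gamma>] by blast
      obtain e where e: "norm e \<le> B'" "((\<lambda>t. G (pflow n (c * of_real t) ` \<gamma>)) has_vector_derivative e) (at 0)"
        using B'[OF \<gamma>] by blast
      have "norm (h (F \<gamma>) e + h d (G \<gamma>)) \<le> A * B' * K + A' * B * K"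
        by (rule norm_triangle_mono[OF est[OF A[OF \<gamma>] e(1)] est[OF d(1) B[OF \<gamma>]]])
      moreover have "((\<lambda>t. h (F (pflow n (c * of_real t) ` \<gamma>)) (G (pflow n (c * of_real t) ` \<gamma>)))
          has_vector_derivative h (F \<gamma>) e + h d (G \<gamma>)) (at 0)"
        using bounded_bilinear.has_vector_derivative[OF h d(2) e(2)] by simp
      ultimately show ?thesis by blast
    qed
    then show "\<exists>C. \<forall>\<gamma>. annular a b \<gamma> \<longrightarrow> (\<exists>d. norm d \<le> C \<and>
        ((\<lambda>t. h (F (pflow n (c * of_real t) ` \<gamma>)) (G (pflow n (c * of_real t) ` \<gamma>))) has_vector_derivative d) (at 0))"
      by blast
  qed
qed

lemma tame_add:
  assumes F: "tame F" and G: "tame G"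
  shows "tame (\<lambda>\<gamma>. F \<gamma> + G \<gamma>)"
proof (rule tameI)
  show "(\<lambda>n. F (g n) + G (g n)) \<longlonglongrightarrow> F \<gamma> + G \<gamma>"
    if "encircling \<gamma>" "\<And>n. encircling (g n)" "vconv g \<gamma>" for g \<gamma>
    by (rule tendsto_add[OF tame_continuous[OF F that] tame_continuous[OF G that]])
next
  fix a b :: real assume a: "0 < a"
  obtain A where A: "\<And>\<gamma>. annular a b \<gamma> \<Longrightarrow> norm (F \<gamma>) \<le> A" using tame_bounded[OF F a] by metis
  obtain B where B: "\<And>\<gamma>. annular a b \<gamma> \<Longrightarrow> norm (G \<gamma>) \<le> B" using tame_bounded[OF G a] by metis
  show "\<exists>C. \<forall>\<gamma>. annular a b \<gamma> \<longrightarrow> norm (F \<gamma> + G \<gamma>) \<le> C" using norm_triangle_mono[OF A B] by blast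
next
  fix n c and a b :: real assume a: "0 < a"
  obtain A' where A': "\<And>\<gamma>. annular a b \<gamma> \<Longrightarrow> \<exists>d. norm d \<le> A' \<and>
      ((\<lambda>t. F (pflow n (c * of_real t) ` \<gamma>)) has_vector_derivative d) (at 0)"
    using tame_derivative[OF F a] by metis
  obtain B' where B': "\<And>\<gamma>. annular a b \<gamma> \<Longrightarrow> \<exists>d. norm d \<le> B' \<and>
      ((\<lambda>t. G (pflow n (c * of_real t) ` \<gamma>)) has_vector_derivative d) (at 0)"
    using tame_derivative[OF G a] by metis
  have "\<exists>d. norm d \<le> A' + B' \<and>
     ((\<lambda>t. F (pflow n (c * of_real t) ` \<gamma>) + G (pflow n (c * of_real t) ` \<gamma>)) has_vector_derivative d) (at 0)"
    if \<gamma>: "annular a b \<gamma>" for \<gamma>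
  proof -
    obtain d where d: "norm d \<le> A'" "((\<lambda>t. F (pflow n (c * of_real t) ` \<gamma>)) has_vector_derivative d) (at 0)"
      using A'[OF \<gamma>] by blast
    obtain e where e: "norm e \<le> B'" "((\<lambda>t. G (pflow n (c * of_real t) ` \<gamma>)) has_vector_derivative e) (at 0)"
      using B'[OF \<gamma>] by blast
    show ?thesis using norm_triangle_mono[OF d(1) e(1)] has_vector_derivative_add[OF d(2) e(2)] by blast
  qed
  then show "\<exists>C. \<forall>\<gamma>. annular a b \<gamma> \<longrightarrow> (\<exists>d. norm d \<le> C \<and>
      ((\<lambda>t. F (pflow n (c * of_real t) ` \<gamma>) + G (pflow n (c * of_real t) ` \<gamma>)) has_vector_derivative d) (at 0))"
    by blast
qed

lemma tame_mult:
  fixes F :: "complex set \<Rightarrow> 'a::real_normed_algebra"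
  shows "tame F \<Longrightarrow> tame G \<Longrightarrow> tame (\<lambda>\<gamma>. F \<gamma> * G \<gamma>)"
  by (rule tame_bilinear[OF bounded_bilinear_mult])

lemma tame_sum: "(\<And>i. i \<in> I \<Longrightarrow> tame (F i)) \<Longrightarrow> tame (\<lambda>\<gamma>. \<Sum>i\<in>I. F i \<gamma>)"
  by (induction I rule: infinite_finite_induct) (auto intro: tame_const tame_add)

lemma tame_power:
  fixes F :: "complex set \<Rightarrow> complex"
  shows "tame F \<Longrightarrow> tame (\<lambda>\<gamma>. F \<gamma> ^ n)"
  by (induction n) (auto intro: tame_const tame_mult)

lemma tame_prod:
  fixes F :: "'i \<Rightarrow> complex set \<Rightarrow> complex"
  shows "(\<And>i. i \<in> I \<Longrightarrow> tame (F i)) \<Longrightarrow> tame (\<lambda>\<gamma>. \<Prod>i\<in>I. F i \<gamma>)"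
  by (induction I rule: infinite_finite_induct) (auto intro: tame_const tame_mult)

lemma tame_Pair: "tame F \<Longrightarrow> tame G \<Longrightarrow> tame (\<lambda>\<gamma>. (F \<gamma>, G \<gamma>))"
proof -
  assume F: "tame F" and G: "tame G"
  have "tame (\<lambda>\<gamma>. (F \<gamma>, 0) + (0, G \<gamma>))"
    by (intro tame_add tame_bounded_linear[OF _ F] tame_bounded_linear[OF _ G] bounded_linear_Pair
        bounded_linear_ident bounded_linear_zero)
  then show ?thesis by simp
qed

lemma tame_compose:
  fixes \<Phi> :: "'a::real_normed_vector \<Rightarrow> 'b::real_normed_vector"
  assumes F: "tame F" and D: "\<And>\<gamma>. encircling \<gamma> \<Longrightarrow> (\<Phi> has_derivative D (F \<gamma>)) (at (F \<gamma>))"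
    and M: "\<And>a b. 0 < a \<Longrightarrow> \<exists>M. \<forall>\<gamma>. annular a b \<gamma> \<longrightarrow> norm (\<Phi> (F \<gamma>)) \<le> M \<and> (\<forall>h. norm (D (F \<gamma>) h) \<le> M * norm h)"
  shows "tame (\<lambda>\<gamma>. \<Phi> (F \<gamma>))"
proof (rule tameI)
  show "(\<lambda>n. \<Phi> (F (g n))) \<longlonglongrightarrow> \<Phi> (F \<gamma>)"
    if "encircling \<gamma>" "\<And>n. encircling (g n)" "vconv g \<gamma>" for g \<gamma>
    using has_derivative_continuous[OF D[OF that(1)]] tame_continuous[OF F that]
    by (rule isCont_tendsto_compose)
next
  fix a b :: real assume "0 < a"
  then show "\<exists>C. \<forall>\<gamma>. annular a b \<gamma> \<longrightarrow> norm (\<Phi> (F \<gamma>)) \<le> C" using M by metis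
next
  fix n c and a b :: real assume a: "0 < a"
  obtain M where M: "\<And>\<gamma> h. annular a b \<gamma> \<Longrightarrow> norm (D (F \<gamma>) h) \<le> M * norm h" using M[OF a] by metis
  obtain C where C: "C > 0" "\<And>\<gamma>. annular a b \<gamma> \<Longrightarrow> \<exists>d. norm d \<le> C \<and>
      ((\<lambda>t. F (pflow n (c * of_real t) ` \<gamma>)) has_vector_derivative d) (at 0)"
    using tame_derivative[OF F a] by metis
  have "\<exists>d. norm d \<le> \<bar>M\<bar> * C \<and> ((\<lambda>t. \<Phi> (F (pflow n (c * of_real t) ` \<gamma>))) has_vector_derivative d) (at 0)"
    if \<gamma>: "annular a b \<gamma>" for \<gamma>
  proof -
    obtain d where d: "norm d \<le> C" "((\<lambda>t. F (pflow n (c * of_real t) ` \<gamma>)) has_vector_derivative d) (at 0)"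
      using C(2)[OF \<gamma>] by blast
    have D\<gamma>: "(\<Phi> has_derivative D (F \<gamma>)) (at (F (pflow n (c * of_real 0) ` \<gamma>)))"
      unfolding pflow_0_image using D \<gamma> by blast
    have "(\<Phi> \<circ> (\<lambda>t. F (pflow n (c * of_real t) ` \<gamma>)) has_derivative D (F \<gamma>) \<circ> (\<lambda>x. x *\<^sub>R d)) (at 0)"
      using diff_chain_at[OF d(2)[unfolded has_vector_derivative_def] D\<gamma>] .
    moreover have "D (F \<gamma>) \<circ> (\<lambda>x. x *\<^sub>R d) = (\<lambda>x. x *\<^sub>R D (F \<gamma>) d)"
    proof -
      have "linear (D (F \<gamma>))" using has_derivative_bounded_linear[OF D\<gamma>] bounded_linear.linear by blast
      then show ?thesis by (simp add: fun_eq_iff linear_scale)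
    qed
    ultimately have "((\<lambda>t. \<Phi> (F (pflow n (c * of_real t) ` \<gamma>))) has_vector_derivative D (F \<gamma>) d) (at 0)"
      by (simp add: has_vector_derivative_def o_def)
    moreover have "norm (D (F \<gamma>) d) \<le> \<bar>M\<bar> * C"
    proof -
      have "norm (D (F \<gamma>) d) \<le> M * norm d" by (rule M[OF \<gamma>])
      also have "\<dots> \<le> \<bar>M\<bar> * C" using d(1) by (intro mult_mono) auto
      finally show ?thesis .
    qed
    ultimately show ?thesis by blast
  qed
  then show "\<exists>C. \<forall>\<gamma>. annular a b \<gamma> \<longrightarrow> (\<exists>d. norm d \<le> C \<and>
      ((\<lambda>t. \<Phi> (F (pflow n (c * of_real t) ` \<gamma>))) has_vector_derivative d) (at 0))" by blast
qed

section \<open>Tameness under inversion and over short times\<close>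

lemma vconv_image:
  assumes f: "continuous_on D f" "open D" and sub: "\<gamma> \<subseteq> D" "\<And>n. g n \<subseteq> D" and v: "vconv g \<gamma>"
  shows "vconv (\<lambda>n. f ` g n) (f ` \<gamma>)"
  unfolding vconv_def
proof (intro conjI allI impI ballI)
  have op: "open (D \<inter> f -` W)" if "open W" for W
    by (rule continuous_open_preimage[OF f that])
  show "\<forall>\<^sub>F n in sequentially. f ` g n \<subseteq> W" if W: "open W" "f ` \<gamma> \<subseteq> W" for W
  proof -
    have "\<gamma> \<subseteq> D \<inter> f -` W" using W sub(1) by auto
    then have "\<forall>\<^sub>F n in sequentially. g n \<subseteq> D \<inter> f -` W"
      using v op[OF W(1)] unfolding vconv_def by blast
    then show ?thesis by eventually_elim auto
  qed
  show "\<forall>\<^sub>F n in sequentially. f ` g n \<inter> ball w e \<noteq> {}" if w: "w \<in> f ` \<gamma>" and e: "e > 0" for w e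
  proof -
    from w obtain x where x: "w = f x" "x \<in> \<gamma>" by (rule imageE)
    have "x \<in> D \<inter> f -` ball w e" using x sub(1) e by auto
    then obtain d where d: "d > 0" "ball x d \<subseteq> D \<inter> f -` ball w e"
      using op[of "ball w e"] openE by blast
    have "\<forall>\<^sub>F n in sequentially. g n \<inter> ball x d \<noteq> {}"
      using v x(2) d(1) unfolding vconv_def by blast
    then show ?thesis
    proof eventually_elim
      case (elim n)
      then obtain y where "y \<in> g n" "y \<in> ball x d" by blast
      then have "f y \<in> f ` g n \<inter> ball w e" using d(2) by blast
      then show ?case by blast
    qed
  qed
qed

lemma vconv_inverse:
  assumes "encircling \<gamma>" "\<And>n. encircling (g n)" "vconv g \<gamma>"
  shows "vconv (\<lambda>n. inverse ` g n) (inverse ` \<gamma>)"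
proof (rule vconv_image[of "- {0}"])
  show "continuous_on (- {0::complex}) inverse" by (intro continuous_intros) auto
qed (use encircling_zero_notin assms in auto)

lemma annular_inverse:
  assumes "annular a b \<gamma>" "0 < a"
  shows "annular (1 / b) (1 / a) (inverse ` \<gamma>)" "0 < b"
proof -
  obtain x where "x \<in> \<gamma>" using encircling_nonempty assms by blast
  then have "a \<le> cmod x" "cmod x \<le> b" using assms by auto
  then show b: "0 < b" using assms by linarith
  have "inverse x \<in> cball 0 (1 / a) - ball 0 (1 / b)" if "x \<in> \<gamma>" for x
  proof -
    have x: "a \<le> cmod x" "cmod x \<le> b" using that assms by auto
    then have "inverse (cmod x) \<le> inverse a" "inverse b \<le> inverse (cmod x)"
      using assms(2) b by (intro le_imp_inverse_le; linarith)+
    then have "cmod (inverse x) \<le> 1 / a" "1 / b \<le> cmod (inverse x)"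
      unfolding norm_inverse by (simp_all add: inverse_eq_divide)
    then show ?thesis by simp
  qed
  then show "annular (1 / b) (1 / a) (inverse ` \<gamma>)" using encircling_inverse assms by blast
qed

lemma pflow_image_inverse:
  assumes "0 \<notin> \<gamma>"
  shows "inverse ` pflow n (c * of_real t) ` \<gamma> = pflow (- n) (- c * of_real t) ` inverse ` \<gamma>"
proof -
  have "inverse (pflow n (c * of_real t) z) = pflow (- n) (- c * of_real t) (inverse z)" if "z \<in> \<gamma>" for z
    using pflow_inverse[of z n "c * of_real t"] that assms by auto
  then show ?thesis by (simp add: image_image)
qed

text \<open>Inversion exchanges the annuli \<open>(a, b)\<close> and \<open>(1 / b, 1 / a)\<close>
  and the fields \<open>(n, c)\<close> and \<open>(- n, - c)\<close>, so the clauses for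
  \<open>F\<close> apply after relabelling. For \<open>b \<le> 0\<close> there are no annular
  loops.\<close>

lemma tame_inverse_image:
  assumes F: "tame F"
  shows "tame (\<lambda>\<gamma>. F (inverse ` \<gamma>))"
proof (rule tameI)
  show "(\<lambda>n. F (inverse ` g n)) \<longlonglongrightarrow> F (inverse ` \<gamma>)"
    if "encircling \<gamma>" "\<And>n. encircling (g n)" "vconv g \<gamma>" for g \<gamma>
    by (rule tame_continuous[OF F encircling_inverse[OF that(1)] encircling_inverse[OF that(2)] vconv_inverse[OF that]])
next
  fix a b :: real assume a: "0 < a"
  show "\<exists>C. \<forall>\<gamma>. annular a b \<gamma> \<longrightarrow> norm (F (inverse ` \<gamma>)) \<le> C"
  proof (cases "0 < b")
    case True
    then have "0 < 1 / b" by simp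
    then obtain C where "\<And>\<gamma>. annular (1 / b) (1 / a) \<gamma> \<Longrightarrow> norm (F \<gamma>) \<le> C" using tame_bounded[OF F] by metis
    then show ?thesis using annular_inverse(1)[OF _ a] by blast
  next
    case False
    then show ?thesis using annular_inverse(2)[OF _ a] by blast
  qed
next
  fix n c and a b :: real assume a: "0 < a"
  show "\<exists>C. \<forall>\<gamma>. annular a b \<gamma> \<longrightarrow> (\<exists>d. norm d \<le> C \<and>
      ((\<lambda>t. F (inverse ` pflow n (c * of_real t) ` \<gamma>)) has_vector_derivative d) (at 0))"
  proof (cases "0 < b")
    case True
    then have b: "0 < 1 / b" by simp
    obtain C where C: "\<And>\<gamma>. annular (1 / b) (1 / a) \<gamma> \<Longrightarrow> \<exists>d. norm d \<le> C \<and>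
        ((\<lambda>t. F (pflow (- n) (- c * of_real t) ` \<gamma>)) has_vector_derivative d) (at 0)"
      using tame_derivative[OF F b, of "1 / a" "- n" "- c"] by metis
    have "\<exists>d. norm d \<le> C \<and> ((\<lambda>t. F (inverse ` pflow n (c * of_real t) ` \<gamma>)) has_vector_derivative d) (at 0)"
      if \<gamma>: "annular a b \<gamma>" for \<gamma>
      using C[OF annular_inverse(1)[OF \<gamma> a]] encircling_zero_notin[of \<gamma>] \<gamma>
      by (simp only: pflow_image_inverse not_False_eq_True)
    then show ?thesis by blast
  next
    case False
    then show ?thesis using annular_inverse(2)[OF _ a] by blast
  qed
qed

text \<open>The factor \<open>pphi n\<close> is continuous at 0 with value 1. On an annulus its
  argument is uniformly small for short times, so moduli change by factors between 1/2 and
  2.\<close>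

lemma pflow_small_time:
  assumes a: "0 < a"
  obtains \<delta> where "\<delta> > 0"
    "\<And>t z. \<bar>t\<bar> < \<delta> \<Longrightarrow> a \<le> cmod z \<Longrightarrow> cmod z \<le> b \<Longrightarrow> cmod (of_int n * (c * of_real t) * z powi n) < 1"
    "\<And>t z. \<bar>t\<bar> < \<delta> \<Longrightarrow> a \<le> cmod z \<Longrightarrow> cmod z \<le> b \<Longrightarrow>
      a / 2 < cmod (pflow n (c * of_real t) z) \<and> cmod (pflow n (c * of_real t) z) < 2 * b"
proof -
  have "continuous (at 0) (pphi n)"
    using pphi_has_deriv[of n 0] by (intro DERIV_isCont) auto
  then have "\<exists>e>0. \<forall>x. dist x 0 < e \<longrightarrow> dist (pphi n x) (pphi n 0) < 1/2"
    unfolding continuous_at_eps_delta by (metis half_gt_zero zero_less_one)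
  then obtain e where e: "e > 0" "\<And>x. cmod x < e \<Longrightarrow> cmod (pphi n x - 1) < 1/2"
    by (auto simp: dist_norm)
  let ?A = "cball 0 b - ball (0::complex) a"
  have "continuous_on ?A (\<lambda>z. c * z powi n)" using a by (intro continuous_intros) auto
  then have "bounded ((\<lambda>z. c * z powi n) ` ?A)"
    by (intro compact_imp_bounded compact_continuous_image compact_diff) auto
  then obtain Z where "Z > 0" "\<And>z. z \<in> ?A \<Longrightarrow> cmod (c * z powi n) \<le> Z"
    unfolding bounded_pos by blast
  then have Z: "Z > 0" "\<And>z. a \<le> cmod z \<Longrightarrow> cmod z \<le> b \<Longrightarrow> cmod (c * z powi n) \<le> Z" by auto
  \<comment> \<open>The second entry ensures \<open>|n| * m < 1\<close>, so the flow formula is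
    valid.\<close>
  define m where "m = min e (1 / (\<bar>real_of_int n\<bar> + 1))"
  have m: "m > 0" "m \<le> e" "\<bar>real_of_int n\<bar> * m < 1"
  proof -
    show "m > 0" using e by (simp add: m_def)
    show "m \<le> e" by (simp add: m_def)
    have "\<bar>real_of_int n\<bar> * m \<le> \<bar>real_of_int n\<bar> * (1 / (\<bar>real_of_int n\<bar> + 1))"
      by (intro mult_left_mono) (auto simp: m_def)
    also have "\<dots> < 1" by (simp add: divide_less_eq)
    finally show "\<bar>real_of_int n\<bar> * m < 1" .
  qed
  have small: "cmod (c * of_real t * z powi n) < m" if "\<bar>t\<bar> < m / Z" "a \<le> cmod z" "cmod z \<le> b" for t z
  proof -
    have "cmod (c * of_real t * z powi n) = \<bar>t\<bar> * cmod (c * z powi n)" by (simp add: norm_mult mult_ac)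
    also have "\<dots> \<le> \<bar>t\<bar> * Z" using Z(2)[OF that(2,3)] by (intro mult_left_mono) auto
    also have "\<dots> < m" using that(1) Z(1) by (simp add: less_divide_eq)
    finally show ?thesis .
  qed
  show ?thesis
  proof (rule that[of "m / Z"])
    show "m / Z > 0" using m Z by simp
    fix t z assume h: "\<bar>t\<bar> < m / Z" "a \<le> cmod z" "cmod z \<le> b"
    have "cmod (of_int n * (c * of_real t) * z powi n) = \<bar>real_of_int n\<bar> * cmod (c * of_real t * z powi n)"
      by (simp add: norm_mult mult_ac)
    also have "\<dots> \<le> \<bar>real_of_int n\<bar> * m" using small[OF h] by (intro mult_left_mono) auto
    finally show "cmod (of_int n * (c * of_real t) * z powi n) < 1" using m(3) by linarith
    have "cmod (pphi n (c * of_real t * z powi n) - 1) < 1/2" using small[OF h] m(2) by (intro e(2)) linarith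
    then have "1/2 < cmod (pphi n (c * of_real t * z powi n))" "cmod (pphi n (c * of_real t * z powi n)) < 2"
      using norm_triangle_ineq2[of 1 "1 - pphi n (c * of_real t * z powi n)"]
        norm_triangle_sub[of "pphi n (c * of_real t * z powi n)" 1] by (auto simp: norm_minus_commute)
    moreover have "cmod (pflow n (c * of_real t) z) = cmod z * cmod (pphi n (c * of_real t * z powi n))"
      by (simp add: pflow_def norm_mult)
    moreover have "0 < cmod z" using h a by linarith
    ultimately have "cmod z * (1/2) < cmod (pflow n (c * of_real t) z)" "cmod (pflow n (c * of_real t) z) < cmod z * 2"
      by (simp_all only: mult_less_cancel_left_pos)
    then show "a / 2 < cmod (pflow n (c * of_real t) z) \<and> cmod (pflow n (c * of_real t) z) < 2 * b" using h by linarith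
  qed
qed

lemma annular_pflow:
  assumes "annular a b \<gamma>"
    and "\<And>z. a \<le> cmod z \<Longrightarrow> cmod z \<le> b \<Longrightarrow> cmod (of_int n * \<tau> * z powi n) < 1"
    and "\<And>z. a \<le> cmod z \<Longrightarrow> cmod z \<le> b \<Longrightarrow> a / 2 < cmod (pflow n \<tau> z) \<and> cmod (pflow n \<tau> z) < 2 * b"
  shows "annular (a / 2) (2 * b) (pflow n \<tau> ` \<gamma>)"
proof -
  have z: "a \<le> cmod z" "cmod z \<le> b" if "z \<in> \<gamma>" for z using assms(1) that by auto
  have "encircling (pflow n \<tau> ` \<gamma>)" using assms(1) z assms(2) by (intro encircling_pflow) auto
  moreover have "pflow n \<tau> ` \<gamma> \<subseteq> cball 0 (2 * b) - ball 0 (a / 2)"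
    using assms(3)[OF z] by (force intro: less_imp_le)
  ultimately show ?thesis by blast
qed

text \<open>By the group law, the derivative at time \<open>s\<close> is the derivative at time 0
  for the loop already moved by \<open>s\<close>. That loop lies in the wider annulus, whose
  constant is used, and the mean value inequality concludes.\<close>

theorem tame_difference_bound:
  assumes F: "tame F" and a: "0 < a"
  obtains C \<delta> where "\<delta> > 0" "\<And>\<gamma> t. annular a b \<gamma> \<Longrightarrow> \<bar>t\<bar> < \<delta> \<Longrightarrow>
    norm (F (pflow n (c * of_real t) ` \<gamma>) - F \<gamma>) \<le> C * \<bar>t\<bar>"
proof -
  obtain \<delta> where \<delta>: "\<delta> > 0"
    "\<And>t z. \<bar>t\<bar> < \<delta> \<Longrightarrow> a \<le> cmod z \<Longrightarrow> cmod z \<le> b \<Longrightarrow> cmod (of_int n * (c * of_real t) * z powi n) < 1"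
    "\<And>t z. \<bar>t\<bar> < \<delta> \<Longrightarrow> a \<le> cmod z \<Longrightarrow> cmod z \<le> b \<Longrightarrow>
      a / 2 < cmod (pflow n (c * of_real t) z) \<and> cmod (pflow n (c * of_real t) z) < 2 * b"
    using pflow_small_time[OF a] by metis
  have a2: "0 < a / 2" using a by simp
  obtain C where C: "C > 0" "\<And>\<gamma>. annular (a / 2) (2 * b) \<gamma> \<Longrightarrow> \<exists>d. norm d \<le> C \<and>
        ((\<lambda>t. F (pflow n (c * of_real t) ` \<gamma>)) has_vector_derivative d) (at 0)"
    using tame_derivative[OF F a2] by metis
  have "norm (F (pflow n (c * of_real t) ` \<gamma>) - F \<gamma>) \<le> C * \<bar>t\<bar>" if \<gamma>: "annular a b \<gamma>" and t: "\<bar>t\<bar> < \<delta>" for \<gamma> t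
  proof -
    define h where "h s = F (pflow n (c * of_real s) ` \<gamma>)" for s
    have z\<gamma>: "a \<le> cmod z" "cmod z \<le> b" if "z \<in> \<gamma>" for z using \<gamma> that by auto
    have hd: "\<exists>d. norm d \<le> C \<and> (h has_vector_derivative d) (at s)" if s: "\<bar>s\<bar> < \<delta>" for s
    proof -
      have "annular (a / 2) (2 * b) (pflow n (c * of_real s) ` \<gamma>)"
        by (rule annular_pflow[OF \<gamma> \<delta>(2,3)[OF s]])
      from C(2)[OF this] obtain d where d: "norm d \<le> C"
        "((\<lambda>t. F (pflow n (c * of_real t) ` pflow n (c * of_real s) ` \<gamma>)) has_vector_derivative d) (at 0)" by blast
      have eq: "pflow n (c * of_real t) ` pflow n (c * of_real s) ` \<gamma> = pflow n (c * of_real (t + s)) ` \<gamma>"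
        if t: "\<bar>t + s\<bar> < \<delta>" for t
      proof -
        have "pflow n (c * of_real t) (pflow n (c * of_real s) z) = pflow n (c * of_real (t + s)) z" if z: "z \<in> \<gamma>" for z
        proof -
          have e: "c * of_real s + c * of_real t = c * complex_of_real (t + s)" by (simp add: algebra_simps)
          show ?thesis
            using pflow_add[of n "c * of_real s" z "c * of_real t"] \<delta>(2)[OF s z\<gamma>[OF z]] \<delta>(2)[OF t z\<gamma>[OF z]]
            unfolding e by blast
        qed
        then show ?thesis by (simp add: image_image)
      qed
      have "((\<lambda>t. h (t + s)) has_vector_derivative d) (at 0)"
      proof (rule has_vector_derivative_transform_within_open[OF d(2)])
        show "open {t. \<bar>t + s\<bar> < \<delta>}" by (intro open_Collect_less continuous_intros)
        show "0 \<in> {t. \<bar>t + s\<bar> < \<delta>}" using s by simp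
        show "F (pflow n (c * of_real t) ` pflow n (c * of_real s) ` \<gamma>) = h (t + s)" if "t \<in> {t. \<bar>t + s\<bar> < \<delta>}" for t
          using eq[of t] that by (simp add: h_def)
      qed
      moreover have "((\<lambda>t. t - s) has_vector_derivative 1) (at s)" by (auto intro!: derivative_eq_intros)
      ultimately have "((\<lambda>t. h (t + s)) \<circ> (\<lambda>t. t - s) has_vector_derivative 1 *\<^sub>R d) (at s)"
        by (intro vector_diff_chain_at) simp_all
      then have "(h has_vector_derivative d) (at s)" by (simp add: o_def)
      then show ?thesis using d(1) by blast
    qed
    then obtain d where d: "\<And>s. \<bar>s\<bar> < \<delta> \<Longrightarrow> norm (d s) \<le> C \<and> (h has_vector_derivative d s) (at s)" by metis
    have "norm (h t - h 0) \<le> C * norm (t - 0)"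
    proof (rule differentiable_bound[of "ball 0 \<delta>" h "\<lambda>s x. x *\<^sub>R d s"])
      show "(h has_derivative (\<lambda>x. x *\<^sub>R d s)) (at s within ball 0 \<delta>)" if "s \<in> ball 0 \<delta>" for s
        using d[of s] that has_vector_derivative_at_within unfolding has_vector_derivative_def[symmetric] by auto
      show "onorm (\<lambda>x. x *\<^sub>R d s) \<le> C" if "s \<in> ball 0 \<delta>" for s
      proof (rule onorm_le)
        show "norm (x *\<^sub>R d s) \<le> C * norm x" for x
          using d[of s] that mult_left_mono[of "norm (d s)" C "\<bar>x\<bar>"] by (simp add: mult.commute)
      qed
    qed (use t \<delta>(1) in auto)
    then show ?thesis by (simp add: h_def)
  qed
  then show ?thesis using that[OF \<delta>(1)] by blast
qed


section \<open>Test functions\<close>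

lemma tame_cradius: "tame cradius"
  using tame_bounded_linear[OF bounded_linear_Re tame_taylor[of 1]] by (simp add: cradius_def[abs_def])

lemma tame_inverse_cradius: "tame (\<lambda>\<gamma>. inverse (cradius \<gamma>))"
proof (rule tame_compose[OF tame_cradius, where D = "\<lambda>x h. - (inverse x * h * inverse x)"])
  show "(inverse has_derivative (\<lambda>h. - (inverse (cradius \<gamma>) * h * inverse (cradius \<gamma>)))) (at (cradius \<gamma>))"
    if "encircling \<gamma>" for \<gamma>
    using cradius_pos[OF that] by (intro has_derivative_inverse') auto
  fix a b :: real assume a: "0 < a"
  have "norm (inverse (cradius \<gamma>)) \<le> inverse a + inverse a * inverse a \<and>
     (\<forall>h. norm (- (inverse (cradius \<gamma>) * h * inverse (cradius \<gamma>))) \<le> (inverse a + inverse a * inverse a) * norm h)"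
    if \<gamma>: "annular a b \<gamma>" for \<gamma>
  proof -
    have "a \<le> cradius \<gamma>" using \<gamma> a by (intro cradius_lower) auto
    then have i: "0 < inverse (cradius \<gamma>)" "inverse (cradius \<gamma>) \<le> inverse a" using a by (auto intro: le_imp_inverse_le)
    have ia: "0 < inverse a" using a by simp
    have ii: "inverse (cradius \<gamma>) * inverse (cradius \<gamma>) \<le> inverse a * inverse a"
      using i ia by (intro mult_mono) linarith+
    have "norm (- (inverse (cradius \<gamma>) * h * inverse (cradius \<gamma>))) \<le> (inverse a + inverse a * inverse a) * norm h" for h
    proof -
      have "norm (- (inverse (cradius \<gamma>) * h * inverse (cradius \<gamma>))) = (inverse (cradius \<gamma>) * inverse (cradius \<gamma>)) * norm h"
        using i(1) by (simp add: abs_mult mult_ac)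
      also have "\<dots> \<le> (inverse a + inverse a * inverse a) * norm h"
      proof (rule mult_right_mono)
        show "inverse (cradius \<gamma>) * inverse (cradius \<gamma>) \<le> inverse a + inverse a * inverse a" using ii ia by linarith
      qed simp
      finally show ?thesis .
    qed
    moreover have "norm (inverse (cradius \<gamma>)) \<le> inverse a + inverse a * inverse a"
      unfolding real_norm_def abs_of_pos[OF i(1)] using i(2) mult_pos_pos[OF ia ia] by linarith
    ultimately show ?thesis by blast
  qed
  then show "\<exists>M. \<forall>\<gamma>. annular a b \<gamma> \<longrightarrow> norm (inverse (cradius \<gamma>)) \<le> M \<and>
     (\<forall>h. norm (- (inverse (cradius \<gamma>) * h * inverse (cradius \<gamma>))) \<le> M * norm h)" by blast
qed

lemma tame_taylor_ratio: "tame (\<lambda>\<gamma>. taylor_ratio \<gamma> n)"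
proof -
  have "tame (\<lambda>\<gamma>. (deriv ^^ Suc n) (rmap \<gamma>) 0 * (of_real (inverse (cradius \<gamma>)) * inverse (fact (Suc n))))"
    by (intro tame_mult tame_taylor tame_const tame_bounded_linear[OF bounded_linear_of_real tame_inverse_cradius])
  moreover have "(deriv ^^ Suc n) (rmap \<gamma>) 0 * (of_real (inverse (cradius \<gamma>)) * inverse (fact (Suc n))) = taylor_ratio \<gamma> n" for \<gamma>
    by (simp add: taylor_ratio_def divide_inverse del: funpow.simps fact_Suc)
  ultimately show ?thesis by simp
qed

text \<open>Explicit counterpart of \<open>coord_val\<close>, with the definite descriptions
  replaced by Taylor coefficients. The two agree for \<open>encircling\<close> sets.\<close>

fun coord_ratio :: "complex set \<Rightarrow> coord \<Rightarrow> complex" where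
  "coord_ratio \<gamma> (Var_u n) = taylor_ratio \<gamma> (Suc n)"
| "coord_ratio \<gamma> (Var_u_bar n) = cnj (taylor_ratio \<gamma> (Suc n))"
| "coord_ratio \<gamma> (Var_l n) = taylor_ratio (inverse ` \<gamma>) (Suc n)"
| "coord_ratio \<gamma> (Var_l_bar n) = cnj (taylor_ratio (inverse ` \<gamma>) (Suc n))"

lemma tame_coord_ratio: "tame (\<lambda>\<gamma>. coord_ratio \<gamma> c)"
proof (cases c)
  case (Var_u n)
  show ?thesis unfolding Var_u coord_ratio.simps by (rule tame_taylor_ratio)
next
  case (Var_u_bar n)
  show ?thesis unfolding Var_u_bar coord_ratio.simps
    by (rule tame_bounded_linear[OF bounded_linear_cnj tame_taylor_ratio])
next
  case (Var_l n)
  show ?thesis unfolding Var_l coord_ratio.simps by (rule tame_inverse_image[OF tame_taylor_ratio])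
next
  case (Var_l_bar n)
  show ?thesis unfolding Var_l_bar coord_ratio.simps
    by (rule tame_bounded_linear[OF bounded_linear_cnj tame_inverse_image[OF tame_taylor_ratio]])
qed

definition radii :: "complex set \<Rightarrow> real \<times> real" where
  "radii \<gamma> = (cradius \<gamma>, inverse (cradius (inverse ` \<gamma>)))"

lemma tame_radii: "tame radii"
  unfolding radii_def[abs_def]
  by (intro tame_Pair tame_cradius tame_inverse_image[OF tame_inverse_cradius])

lemma radii_in: "encircling \<gamma> \<Longrightarrow> radii \<gamma> \<in> {0<..} \<times> {0<..}"
  using cradius_pos[of \<gamma>] cradius_pos[OF encircling_inverse, of \<gamma>] by (simp add: radii_def)

text \<open>The box is a compact subset of the open quadrant once \<open>a\<close> is positive, so
  continuous functions of the radii are bounded over annular loops.\<close>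

lemma radii_in_box:
  assumes \<gamma>: "annular a b \<gamma>" and a: "0 < a"
  shows "radii \<gamma> \<in> {a..2 * b} \<times> {a / 2..b}"
proof -
  have b: "0 < b" and inv: "annular (1 / b) (1 / a) (inverse ` \<gamma>)" using annular_inverse[OF \<gamma> a] by auto
  have "a \<le> cradius \<gamma>" using \<gamma> a by (intro cradius_lower) auto
  moreover have "cradius \<gamma> \<le> 2 * b" using \<gamma> by (intro cradius_upper) auto
  moreover have "1 / b \<le> cradius (inverse ` \<gamma>)" using inv b by (intro cradius_lower) auto
  then have "inverse (cradius (inverse ` \<gamma>)) \<le> inverse (1 / b)" using b by (intro le_imp_inverse_le) auto
  moreover have "cradius (inverse ` \<gamma>) \<le> 2 * (1 / a)" using inv by (intro cradius_upper) auto
  then have "inverse (2 * (1 / a)) \<le> inverse (cradius (inverse ` \<gamma>))"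
    using inv cradius_pos[of "inverse ` \<gamma>"] by (intro le_imp_inverse_le) auto
  ultimately show ?thesis by (simp add: radii_def)
qed

lemma tame_smooth_radii:
  fixes f :: "real \<times> real \<Rightarrow> complex"
  assumes "smooth_on_open ({0<..} \<times> {0<..}) f"
  shows "tame (\<lambda>\<gamma>. f (radii \<gamma>))"
proof (rule tame_compose[OF tame_radii, where D = "\<lambda>x. frechet_derivative f (at x)"])
  let ?S = "{0<..} \<times> {0<..} :: (real \<times> real) set"
  have "times_differentiable_on (Suc 0) ?S f" "times_differentiable_on 0 ?S f"
    using assms unfolding smooth_on_open_def by blast+
  then have d: "\<And>x. x \<in> ?S \<Longrightarrow> f differentiable (at x)" and cf: "continuous_on ?S f"
    and c: "\<And>h. continuous_on ?S (\<lambda>x. frechet_derivative f (at x) h)" by auto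
  have hd: "(f has_derivative frechet_derivative f (at x)) (at x)" if "x \<in> ?S" for x
    using d[OF that] frechet_derivative_works by blast
  show "(f has_derivative frechet_derivative f (at (radii \<gamma>))) (at (radii \<gamma>))" if "encircling \<gamma>" for \<gamma>
    by (rule hd[OF radii_in[OF that]])
  fix a b :: real assume a: "0 < a"
  let ?K = "{a..2 * b} \<times> {a / 2..b}"
  have K: "compact ?K" "?K \<subseteq> ?S" using a by (auto intro: compact_Times)
  have bd: "\<exists>B. \<forall>x\<in>?K. cmod (h x) \<le> B" if "continuous_on ?S h" for h
  proof -
    have "bounded (h ` ?K)"
      using K continuous_on_subset[OF that K(2)] by (intro compact_imp_bounded compact_continuous_image) auto
    then show ?thesis by (auto simp: bounded_iff)
  qed
  obtain B0 where B0: "\<And>x. x \<in> ?K \<Longrightarrow> cmod (f x) \<le> B0" using bd[OF cf] by blast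
  \<comment> \<open>The derivative is linear and each directional derivative is continuous on the
    compact box, so bounds in the two coordinate directions suffice for all
    \<open>h\<close>.\<close>
  obtain B1 where B1: "\<And>x. x \<in> ?K \<Longrightarrow> cmod (frechet_derivative f (at x) (1, 0)) \<le> B1" using bd[OF c] by blast
  obtain B2 where B2: "\<And>x. x \<in> ?K \<Longrightarrow> cmod (frechet_derivative f (at x) (0, 1)) \<le> B2" using bd[OF c] by blast
  have "cmod (f (radii \<gamma>)) \<le> \<bar>B0\<bar> + \<bar>B1\<bar> + \<bar>B2\<bar> \<and>
     (\<forall>h. cmod (frechet_derivative f (at (radii \<gamma>)) h) \<le> (\<bar>B0\<bar> + \<bar>B1\<bar> + \<bar>B2\<bar>) * norm h)" if \<gamma>: "annular a b \<gamma>" for \<gamma>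
  proof (intro conjI allI)
    let ?x = "radii \<gamma>"
    have x: "?x \<in> ?K" by (rule radii_in_box[OF \<gamma> a])
    show "cmod (f ?x) \<le> \<bar>B0\<bar> + \<bar>B1\<bar> + \<bar>B2\<bar>" using B0[OF x] by linarith
    fix h :: "real \<times> real"
    let ?D = "frechet_derivative f (at ?x)"
    have lin: "linear ?D" using hd[OF subsetD[OF K(2) x]] has_derivative_bounded_linear bounded_linear.linear by blast
    have "h = fst h *\<^sub>R (1, 0) + snd h *\<^sub>R (0, 1)" by (cases h) simp
    then have "?D h = ?D (fst h *\<^sub>R (1, 0) + snd h *\<^sub>R (0, 1))" by (rule arg_cong)
    also have "\<dots> = fst h *\<^sub>R ?D (1, 0) + snd h *\<^sub>R ?D (0, 1)"
      unfolding linear_add[OF lin] linear_scale[OF lin] ..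
    finally have "cmod (?D h) \<le> \<bar>fst h\<bar> * cmod (?D (1, 0)) + \<bar>snd h\<bar> * cmod (?D (0, 1))"
      using norm_triangle_ineq[of "fst h *\<^sub>R ?D (1, 0)" "snd h *\<^sub>R ?D (0, 1)"] by simp
    also have "\<dots> \<le> norm h * \<bar>B1\<bar> + norm h * \<bar>B2\<bar>"
    proof (intro add_mono mult_mono)
      show "\<bar>fst h\<bar> \<le> norm h" "\<bar>snd h\<bar> \<le> norm h"
        using norm_fst_le[of "fst h" "snd h"] norm_snd_le[of "snd h" "fst h"] by simp_all
      show "cmod (?D (1, 0)) \<le> \<bar>B1\<bar>" "cmod (?D (0, 1)) \<le> \<bar>B2\<bar>" using B1[OF x] B2[OF x] by linarith+
    qed auto
    also have "\<dots> \<le> (\<bar>B0\<bar> + \<bar>B1\<bar> + \<bar>B2\<bar>) * norm h"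
      using mult_nonneg_nonneg[of "\<bar>B0\<bar>" "norm h"] by (simp add: algebra_simps)
    finally show "cmod (?D h) \<le> (\<bar>B0\<bar> + \<bar>B1\<bar> + \<bar>B2\<bar>) * norm h" .
  qed
  then show "\<exists>M. \<forall>\<gamma>. annular a b \<gamma> \<longrightarrow> norm (f (radii \<gamma>)) \<le> M \<and>
     (\<forall>h. norm (frechet_derivative f (at (radii \<gamma>)) h) \<le> M * norm h)" by blast
qed

definition test_ratio :: "coord_poly \<Rightarrow> (real \<times> real \<Rightarrow> complex) \<Rightarrow> complex set \<Rightarrow> complex" where
  "test_ratio p f \<gamma> = eval_poly (coord_ratio \<gamma>) p * f (radii \<gamma>)"

lemma test_function_eq:
  assumes enc: "encircling \<gamma>"
  shows "test_function p f \<gamma> = test_ratio p f \<gamma>"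
proof -
  have "coord_val \<gamma> c = coord_ratio \<gamma> c" for c
    by (cases c) (simp_all add: u_coeff_eq[OF enc] l_coeff_eq[OF enc])
  then have "coord_val \<gamma> = coord_ratio \<gamma>" by (rule ext)
  then show ?thesis
    by (simp add: test_function_def test_ratio_def radii_def rho_zero_eq[OF enc] rho_inf_eq[OF enc] inverse_eq_divide)
qed

lemma tame_test_ratio:
  assumes "smooth_compact_support ({0<..} \<times> {0<..}) f"
  shows "tame (test_ratio p f)"
  unfolding test_ratio_def[abs_def] eval_poly_def
  by (intro tame_mult tame_sum tame_prod tame_power tame_const tame_coord_ratio tame_smooth_radii)
    (use assms in \<open>simp add: smooth_compact_support_def\<close>)

text \<open>On the support of \<open>f\<close> the conformal radii of the loop and of the inverted
  loop are both bounded below. Koebe's bound, applied to each, keeps the points of the loop away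
  from 0 and from infinity.\<close>

lemma test_ratio_support:
  assumes "smooth_compact_support ({0<..} \<times> {0<..}) f"
  obtains a b where "0 < a" "a < b" "\<And>\<gamma>. encircling \<gamma> \<Longrightarrow> test_ratio p f \<gamma> \<noteq> 0 \<Longrightarrow> annular a b \<gamma>"
proof -
  let ?S = "{0<..} \<times> {0<..} :: (real \<times> real) set"
  from assms have "\<exists>Q. compact Q \<and> Q \<subseteq> ?S \<and> (\<forall>x\<in>?S - Q. f x = 0)"
    unfolding smooth_compact_support_def by (rule conjunct2)
  then obtain Q where Q: "compact Q" "Q \<subseteq> ?S" "\<forall>x\<in>?S - Q. f x = 0"
    by (elim exE conjE)
  have "compact (fst ` Q)" "compact (snd ` Q)"
    using Q(1) by (auto intro!: compact_continuous_image continuous_intros)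
  obtain c where c: "c > 0" "\<And>x. x \<in> Q \<Longrightarrow> c \<le> fst x"
  proof (cases "Q = {}")
    case True then show ?thesis using that[of 1] by simp
  next
    case False
    then obtain x where x: "x \<in> Q" "\<And>y. y \<in> Q \<Longrightarrow> fst x \<le> fst y"
      using continuous_attains_inf[OF Q(1) False continuous_on_fst[OF continuous_on_id]] by blast
    then show ?thesis using that[of "fst x"] Q(2) by auto
  qed
  obtain C where C: "C > 0" "\<And>x. x \<in> Q \<Longrightarrow> snd x \<le> C"
  proof -
    obtain B where "B > 0" "\<And>x. x \<in> snd ` Q \<Longrightarrow> norm x \<le> B"
      using compact_imp_bounded[OF \<open>compact (snd ` Q)\<close>] unfolding bounded_pos by blast
    then show ?thesis using that[of B] by fastforce
  qed
  obtain K where K: "K > 0" "\<And>\<gamma> w. encircling \<gamma> \<Longrightarrow> w \<in> \<gamma> \<Longrightarrow> cradius \<gamma> \<le> K * cmod w"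
    using Koebe_nonsharp by blast
  define a where "a = c / K"
  \<comment> \<open>The entry \<open>2 * a\<close> is there only to ensure
    \<open>a < b\<close>.\<close>
  define b where "b = max (K * C) (2 * a)"
  have a: "0 < a" using c K by (simp add: a_def)
  have "annular a b \<gamma>" if enc: "encircling \<gamma>" and nz: "test_ratio p f \<gamma> \<noteq> 0" for \<gamma>
  proof -
    have "f (radii \<gamma>) \<noteq> 0" using nz by (auto simp: test_ratio_def)
    have rQ: "radii \<gamma> \<in> Q"
    proof (rule ccontr)
      assume "radii \<gamma> \<notin> Q"
      with radii_in[OF enc] have "radii \<gamma> \<in> ?S - Q" by (rule DiffI)
      from bspec[OF Q(3) this] \<open>f (radii \<gamma>) \<noteq> 0\<close> show False by (rule notE[rotated])
    qed
    have r: "c \<le> cradius \<gamma>" "inverse (cradius (inverse ` \<gamma>)) \<le> C"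
      using c(2)[OF rQ] C(2)[OF rQ] by (simp_all add: radii_def)
    have "w \<in> cball 0 b - ball 0 a" if w: "w \<in> \<gamma>" for w
    proof -
      have w0: "0 < cmod w" using w encircling_zero_notin[OF enc] by auto
      have "c \<le> K * cmod w" using K(2)[OF enc w] r(1) by linarith
      then have "a \<le> cmod w" using K(1) by (simp add: a_def divide_le_eq mult.commute)
      moreover have "cmod w \<le> K * C"
      proof -
        have pos: "0 < cradius (inverse ` \<gamma>)" by (rule cradius_pos[OF encircling_inverse[OF enc]])
        have "cradius (inverse ` \<gamma>) \<le> K * cmod (inverse w)"
          using w by (intro K(2)[OF encircling_inverse[OF enc]]) simp
        then have "cradius (inverse ` \<gamma>) * cmod w \<le> K"
          using w0 unfolding norm_inverse by (simp add: field_simps)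
        then have "cmod w \<le> K * inverse (cradius (inverse ` \<gamma>))" using pos by (simp add: field_simps)
        also have "\<dots> \<le> K * C" using r(2) K(1) by (intro mult_left_mono) auto
        finally show ?thesis .
      qed
      ultimately show ?thesis by (simp add: b_def)
    qed
    then show ?thesis using enc by blast
  qed
  moreover have "a < b" using a by (simp add: b_def less_max_iff_disj)
  ultimately show ?thesis using that a by blast
qed


section \<open>The Vietoris topology on loops\<close>

definition circles :: "complex set set" where
  "circles = {K. compact K \<and> top_of_set K homeomorphic_space top_of_set (sphere (0::complex) 1)}"

abbreviation loops_in :: "complex set \<Rightarrow> complex set set" where
  "loops_in D \<equiv> loops (top_of_set D)"

text \<open>Being a circle is intrinsic, so loops in different domains can be compared as plain
  sets.\<close>

lemma loops_in_eq: "loops_in D = {K \<in> circles. K \<subseteq> D}"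
proof -
  have "subtopology (top_of_set D) K = top_of_set K" if "K \<subseteq> D" for K
    using that by (simp add: subtopology_subtopology Int_absorb1)
  then show ?thesis
    by (auto simp: loops_def circles_def compactin_subtopology)
qed

lemma encircling_Loop1:
  assumes "\<gamma> \<in> Loop1" shows "encircling \<gamma>"
proof -
  have \<gamma>: "compact \<gamma>" "top_of_set \<gamma> homeomorphic_space top_of_set (sphere (0::complex) 1)" "0 \<in> inside \<gamma>"
    using assms by (auto simp: Loop1_def loops_in_eq circles_def surrounds_zero_def)
  have cs: "connected_space (top_of_set S) \<longleftrightarrow> connected S" for S :: "complex set"
    unfolding connectedin_iff_connected[symmetric] connectedin_def by simp
  have "connected (sphere (0::complex) 1)" by (rule connected_sphere) simp
  then have "connected \<gamma>"
    using homeomorphic_connected_space[OF \<gamma>(2)] unfolding cs by blast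
  then show ?thesis using \<gamma> by (simp add: encircling_def)
qed

lemma Loop1_eq: "Loop1 = {\<gamma> \<in> loops_in (- {0}). encircling \<gamma>}"
  using encircling_Loop1 by (auto simp: Loop1_def surrounds_zero_def encircling_def)

lemma circles_image:
  assumes "K \<in> circles" "continuous_on K f" "inj_on f K"
  shows "f ` K \<in> circles"
proof -
  have K: "compact K" "top_of_set K homeomorphic_space top_of_set (sphere (0::complex) 1)"
    using assms(1) by (auto simp: circles_def)
  obtain g where g: "homeomorphism K (f ` K) f g"
    using homeomorphism_compact[OF K(1) assms(2) refl assms(3)] by blast
  then have "homeomorphic_maps (top_of_set K) (top_of_set (f ` K)) f g"
    unfolding homeomorphism_def homeomorphic_maps_def
    by (auto simp: continuous_map_in_subtopology continuous_map_subtopology_eu)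
  then have "top_of_set (f ` K) homeomorphic_space top_of_set K"
    using homeomorphic_space_def homeomorphic_space_sym by blast
  then have "top_of_set (f ` K) homeomorphic_space top_of_set (sphere (0::complex) 1)"
    using K(2) by (rule homeomorphic_space_trans)
  then show ?thesis using compact_continuous_image[OF assms(2) K(1)] by (simp add: circles_def)
qed

lemma openin_vietoris_subset: "openin X U \<Longrightarrow> openin (vietoris X) {K. compactin X K \<and> K \<subseteq> U}"
  unfolding vietoris_def
  by (rule topology_generated_by_Basis, rule UnI1, rule CollectI, intro exI conjI, rule refl)

lemma openin_vietoris_hit: "openin X U \<Longrightarrow> openin (vietoris X) {K. compactin X K \<and> K \<inter> U \<noteq> {}}"
  unfolding vietoris_def
  by (rule topology_generated_by_Basis, rule UnI2, rule CollectI, intro exI conjI, rule refl)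

lemma compactin_topspace_vietoris: "compactin X K \<Longrightarrow> K \<in> topspace (vietoris X)"
  using openin_subset[OF openin_vietoris_subset[OF openin_topspace[of X]]] compactin_subset_topspace[of X K]
  by blast

lemma topspace_loop_space: "topspace (loop_space (top_of_set D)) = loops_in D"
proof -
  have "loops_in D \<subseteq> topspace (vietoris (top_of_set D))"
    using compactin_topspace_vietoris unfolding loops_def by blast
  then show ?thesis by (simp add: loop_space_def Int_absorb1)
qed

lemma openin_loops_subset:
  assumes "open U" shows "openin (loop_space (top_of_set D)) {K \<in> loops_in D. K \<subseteq> U}"
proof -
  have "openin (top_of_set D) (D \<inter> U)" using assms by (simp add: openin_open_Int)
  then have "openin (vietoris (top_of_set D)) {K. compactin (top_of_set D) K \<and> K \<subseteq> D \<inter> U}"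
    by (rule openin_vietoris_subset)
  then have "openin (loop_space (top_of_set D)) ({K. compactin (top_of_set D) K \<and> K \<subseteq> D \<inter> U} \<inter> loops_in D)"
    unfolding loop_space_def by (rule openin_subtopology_Int)
  moreover have "{K. compactin (top_of_set D) K \<and> K \<subseteq> D \<inter> U} \<inter> loops_in D = {K \<in> loops_in D. K \<subseteq> U}"
    by (auto simp: loops_def compactin_subtopology)
  ultimately show ?thesis by simp
qed

lemma openin_loops_hit:
  assumes "open U" shows "openin (loop_space (top_of_set D)) {K \<in> loops_in D. K \<inter> U \<noteq> {}}"
proof -
  have "openin (top_of_set D) (D \<inter> U)" using assms by (simp add: openin_open_Int)
  then have "openin (vietoris (top_of_set D)) {K. compactin (top_of_set D) K \<and> K \<inter> (D \<inter> U) \<noteq> {}}"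
    by (rule openin_vietoris_hit)
  then have "openin (loop_space (top_of_set D)) ({K. compactin (top_of_set D) K \<and> K \<inter> (D \<inter> U) \<noteq> {}} \<inter> loops_in D)"
    unfolding loop_space_def by (rule openin_subtopology_Int)
  moreover have "{K. compactin (top_of_set D) K \<and> K \<inter> (D \<inter> U) \<noteq> {}} \<inter> loops_in D = {K \<in> loops_in D. K \<inter> U \<noteq> {}}"
    by (auto simp: loops_def compactin_subtopology)
  ultimately show ?thesis by simp
qed

lemma loop_map_continuous:
  fixes f :: "complex \<Rightarrow> complex"
  assumes f: "continuous_on D f" "inj_on f D" "f ` D \<subseteq> E" and op: "open D" "open E"
  shows "continuous_map (loop_space (top_of_set D)) (loop_space (top_of_set E)) ((`) f)"
  unfolding loop_space_def[of "top_of_set E"] continuous_map_in_subtopology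
proof
  have img: "f ` K \<in> loops_in E" if "K \<in> loops_in D" for K
  proof -
    have K: "K \<in> circles" "K \<subseteq> D" using that by (auto simp: loops_in_eq)
    then have "f ` K \<in> circles"
      by (intro circles_image continuous_on_subset[OF f(1)] inj_on_subset[OF f(2)])
    then show ?thesis using K(2) f(3) by (auto simp: loops_in_eq)
  qed
  then show "(`) f \<in> topspace (loop_space (top_of_set D)) \<rightarrow> loops_in E" by (simp add: topspace_loop_space)
  have pre: "open (D \<inter> f -` U)" if "open U" for U
    using continuous_open_preimage[OF f(1) op(1) that] .
  show "continuous_map (loop_space (top_of_set D)) (vietoris (top_of_set E)) ((`) f)"
    unfolding vietoris_def
  proof (rule continuous_on_generated_topo)
    fix \<U> assume "\<U> \<in> {{K. compactin (top_of_set E) K \<and> K \<subseteq> U} |U. openin (top_of_set E) U} \<union>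
      {{K. compactin (top_of_set E) K \<and> K \<inter> U \<noteq> {}} |U. openin (top_of_set E) U}"
    then obtain U where U: "open U" "\<U> = {K. compactin (top_of_set E) K \<and> K \<subseteq> U} \<or>
        \<U> = {K. compactin (top_of_set E) K \<and> K \<inter> U \<noteq> {}}"
      by (auto simp: openin_open_eq[OF op(2)])
    have cE: "compactin (top_of_set E) (f ` K)" if "K \<in> loops_in D" for K using img[OF that] by (simp add: loops_def)
    have KD: "K \<subseteq> D" if "K \<in> loops_in D" for K using that by (simp add: loops_in_eq)
    from U(2) show "openin (loop_space (top_of_set D)) ((`) f -` \<U> \<inter> topspace (loop_space (top_of_set D)))"
    proof
      assume u: "\<U> = {K. compactin (top_of_set E) K \<and> K \<subseteq> U}"
      have "(`) f -` \<U> \<inter> topspace (loop_space (top_of_set D)) = {K \<in> loops_in D. K \<subseteq> D \<inter> f -` U}"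
        unfolding topspace_loop_space u using cE KD by blast
      then show ?thesis using openin_loops_subset[OF pre[OF U(1)]] by simp
    next
      assume u: "\<U> = {K. compactin (top_of_set E) K \<and> K \<inter> U \<noteq> {}}"
      have "(`) f -` \<U> \<inter> topspace (loop_space (top_of_set D)) = {K \<in> loops_in D. K \<inter> (D \<inter> f -` U) \<noteq> {}}"
        unfolding topspace_loop_space u using cE KD by blast
      then show ?thesis using openin_loops_hit[OF pre[OF U(1)]] by simp
    qed
  next
    have "(`) f ` loops_in D \<subseteq> topspace (vietoris (top_of_set E))"
    proof (rule image_subsetI)
      fix K assume "K \<in> loops_in D"
      then have "compactin (top_of_set E) (f ` K)" using img by (simp add: loops_def)
      then show "f ` K \<in> topspace (vietoris (top_of_set E))" by (rule compactin_topspace_vietoris)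
    qed
    then show "(`) f ` topspace (loop_space (top_of_set D)) \<subseteq>
      \<Union> ({{K. compactin (top_of_set E) K \<and> K \<subseteq> U} |U. openin (top_of_set E) U} \<union>
      {{K. compactin (top_of_set E) K \<and> K \<inter> U \<noteq> {}} |U. openin (top_of_set E) U})"
      unfolding topspace_loop_space vietoris_def topology_generated_by_topspace .
  qed
qed

text \<open>Kernel convergence gives sequential continuity only. These countably many
  neighbourhoods, from which any choice of loops converges to \<open>\<gamma>\<close>, turn it into
  a statement on open sets.\<close>

lemma loop_nhds:
  assumes \<gamma>: "\<gamma> \<in> loops_in D"
  shows "\<exists>B. (\<forall>m::nat. openin (loop_space (top_of_set D)) (B m) \<and> \<gamma> \<in> B m) \<and>
      (\<forall>g. (\<forall>m. g m \<in> B m) \<longrightarrow> vconv g \<gamma>)"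
proof -
  have c: "compact \<gamma>" using \<gamma> by (auto simp: loops_in_eq circles_def)
  have "\<exists>N. finite N \<and> N \<subseteq> \<gamma> \<and> \<gamma> \<subseteq> (\<Union>x\<in>N. ball x (1 / Suc m))" for m :: nat
  proof -
    have "\<gamma> \<subseteq> (\<Union>x\<in>\<gamma>. ball x (1 / Suc m))" by force
    then show ?thesis using compactE_image[OF c, of \<gamma> "\<lambda>x. ball x (1 / Suc m)"] open_ball by metis
  qed
  then obtain N where N: "\<And>m::nat. finite (N m)" "\<And>m. N m \<subseteq> \<gamma>" "\<And>m. \<gamma> \<subseteq> (\<Union>x\<in>N m. ball x (1 / Suc m))" by metis
  \<comment> \<open>A loop in \<open>B m\<close> stays within distance \<open>1 / Suc m\<close> of
    \<open>\<gamma>\<close> and hits all balls about a finite net of \<open>\<gamma>\<close>.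
    Finiteness of the net keeps \<open>B m\<close> open.\<close>
  define B where "B m = {K \<in> loops_in D. K \<subseteq> (\<Union>x\<in>\<gamma>. ball x (1 / Suc m))} \<inter>
    (loops_in D \<inter> (\<Inter>x\<in>N m. {K \<in> loops_in D. K \<inter> ball x (1 / Suc m) \<noteq> {}}))" for m
  have op: "openin (loop_space (top_of_set D)) (B m)" for m
    unfolding B_def
  proof (rule openin_Int)
    show "openin (loop_space (top_of_set D)) {K \<in> loops_in D. K \<subseteq> (\<Union>x\<in>\<gamma>. ball x (1 / Suc m))}"
      by (rule openin_loops_subset) auto
    have "openin (loop_space (top_of_set D)) (loops_in D \<inter> (\<Inter>x\<in>N'. {K \<in> loops_in D. K \<inter> ball x (1 / Suc m) \<noteq> {}}))"
      if "finite N'" for N'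
      using that
    proof induction
      case empty
      have "openin (loop_space (top_of_set D)) (topspace (loop_space (top_of_set D)))" by (rule openin_topspace)
      then show ?case unfolding topspace_loop_space by simp
    next
      case (insert x N')
      have "loops_in D \<inter> (\<Inter>y\<in>insert x N'. {K \<in> loops_in D. K \<inter> ball y (1 / Suc m) \<noteq> {}}) =
        {K \<in> loops_in D. K \<inter> ball x (1 / Suc m) \<noteq> {}} \<inter> (loops_in D \<inter> (\<Inter>y\<in>N'. {K \<in> loops_in D. K \<inter> ball y (1 / Suc m) \<noteq> {}}))"
        by blast
      then show ?case using openin_Int[OF openin_loops_hit[OF open_ball] insert.IH] by simp
    qed
    then show "openin (loop_space (top_of_set D)) (loops_in D \<inter> (\<Inter>x\<in>N m. {K \<in> loops_in D. K \<inter> ball x (1 / Suc m) \<noteq> {}}))"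
      using N(1) by blast
  qed
  have mem: "\<gamma> \<in> B m" for m
  proof -
    have "x \<in> \<gamma> \<inter> ball x (1 / Suc m)" if "x \<in> N m" for x using N(2)[of m] that by auto
    moreover have "\<gamma> \<subseteq> (\<Union>x\<in>\<gamma>. ball x (1 / Suc m))" by force
    ultimately show ?thesis unfolding B_def using \<gamma> by blast
  qed
  have "vconv g \<gamma>" if g: "\<And>m. g m \<in> B m" for g
    unfolding vconv_def
  proof (intro conjI allI impI ballI)
    fix W :: "complex set" assume W: "open W" "\<gamma> \<subseteq> W"
    obtain e where e: "e > 0" "(\<Union>x\<in>\<gamma>. cball x e) \<subseteq> W"
      using compact_subset_open_imp_cball_epsilon_subset[OF c W] by metis
    obtain M where M: "1 / Suc M < e" using nat_approx_posE[OF e(1)] by metis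
    have "g m \<subseteq> W" if m: "m \<ge> M" for m
    proof
      fix y assume y: "y \<in> g m"
      then obtain x where x: "x \<in> \<gamma>" "dist x y < 1 / Suc m" using g[of m] by (auto simp: B_def)
      have "1 / real (Suc m) \<le> 1 / Suc M" using m by (simp add: frac_le)
      then have "y \<in> cball x e" using x(2) M by simp
      then show "y \<in> W" using e(2) x(1) by blast
    qed
    then show "\<forall>\<^sub>F m in sequentially. g m \<subseteq> W" unfolding eventually_sequentially by blast
  next
    fix w and e :: real assume w: "w \<in> \<gamma>" and e: "e > 0"
    then have "e / 2 > 0" by simp
    then obtain M where M: "1 / Suc M < e / 2" using nat_approx_posE by metis
    have "g m \<inter> ball w e \<noteq> {}" if m: "m \<ge> M" for m
    proof -
      have sm: "1 / real (Suc m) \<le> 1 / Suc M" using m by (simp add: frac_le)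
      obtain x where x: "x \<in> N m" "dist x w < 1 / Suc m" using N(3)[of m] w by auto
      have "g m \<inter> ball x (1 / Suc m) \<noteq> {}" using g[of m] x(1) unfolding B_def by blast
      then obtain y where y: "y \<in> g m" "dist x y < 1 / Suc m" by auto
      have "dist w y \<le> dist x w + dist x y" by (rule dist_triangle3)
      then have "dist w y < e" using x(2) y(2) sm M by linarith
      then show ?thesis using y(1) by auto
    qed
    then show "\<forall>\<^sub>F m in sequentially. g m \<inter> ball w e \<noteq> {}" unfolding eventually_sequentially by blast
  qed
  then show "\<exists>B. (\<forall>m::nat. openin (loop_space (top_of_set D)) (B m) \<and> \<gamma> \<in> B m) \<and>
      (\<forall>g. (\<forall>m. g m \<in> B m) \<longrightarrow> vconv g \<gamma>)" using op mem by blast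
qed

section \<open>Measurability from sequential continuity\<close>

lemma borel_loop_space:
  fixes D :: "complex set"
  assumes "borel_measure_on (loop_space (top_of_set D)) M"
  shows "space M = loops_in D" "openin (loop_space (top_of_set D)) V \<Longrightarrow> V \<in> sets M"
    "sets M = sigma_sets (loops_in D) {U. openin (loop_space (top_of_set D)) U}"
  using assms by (auto simp: borel_measure_on_def topspace_loop_space)

text \<open>If \<open>H\<close> violated \<open>Q\<close> in every neighbourhood of a loop, the
  violating loops in the sets \<open>B m\<close> would converge to it. Preimages of open sets are
  therefore relatively open in the measurable set \<open>A\<close>.\<close>

lemma sequentially_continuous_measurable:
  fixes H :: "complex set \<Rightarrow> complex"
  assumes M: "borel_measure_on (loop_space (top_of_set D)) M" and A: "A \<in> sets M"
    and seq: "\<And>g \<gamma>. \<gamma> \<in> A \<Longrightarrow> (\<And>n. g n \<in> A) \<Longrightarrow> vconv g \<gamma> \<Longrightarrow> (\<lambda>n. H (g n)) \<longlonglongrightarrow> H \<gamma>"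
  shows "(\<lambda>\<gamma>. if \<gamma> \<in> A then H \<gamma> else 0) \<in> borel_measurable M"
proof (rule borel_measurableI)
  note b = borel_loop_space[OF M]
  have AL: "A \<subseteq> loops_in D" using sets.sets_into_space[OF A] b(1) by simp
  fix Q :: "complex set" assume Q: "open Q"
  have "\<exists>V. openin (loop_space (top_of_set D)) V \<and> \<gamma> \<in> V \<and> (\<forall>K\<in>V \<inter> A. H K \<in> Q)"
    if \<gamma>: "\<gamma> \<in> A" "H \<gamma> \<in> Q" for \<gamma>
  proof (rule ccontr)
    assume n: "\<not> ?thesis"
    obtain B where B: "\<And>m::nat. openin (loop_space (top_of_set D)) (B m)" "\<And>m. \<gamma> \<in> B m"
        "\<And>g. (\<And>m. g m \<in> B m) \<Longrightarrow> vconv g \<gamma>"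
      using loop_nhds[OF subsetD[OF AL \<gamma>(1)]] by metis
    have "\<exists>K. K \<in> B m \<and> K \<in> A \<and> H K \<notin> Q" for m using n B(1,2) by blast
    then obtain g where g: "\<And>m. g m \<in> B m" "\<And>m. g m \<in> A" "\<And>m. H (g m) \<notin> Q" by metis
    have "(\<lambda>m. H (g m)) \<longlonglongrightarrow> H \<gamma>" by (rule seq[OF \<gamma>(1) g(2) B(3)[OF g(1)]])
    then have "\<forall>\<^sub>F m in sequentially. H (g m) \<in> Q" using topological_tendstoD Q \<gamma>(2) by blast
    then show False using g(3) by (simp add: eventually_sequentially) 
  qed
  then obtain V where V: "\<And>\<gamma>. \<gamma> \<in> A \<Longrightarrow> H \<gamma> \<in> Q \<Longrightarrow> openin (loop_space (top_of_set D)) (V \<gamma>) \<and> \<gamma> \<in> V \<gamma> \<and> (\<forall>K\<in>V \<gamma> \<inter> A. H K \<in> Q)"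
    by metis
  define W where "W = (\<Union>\<gamma>\<in>{\<gamma>\<in>A. H \<gamma> \<in> Q}. V \<gamma>)"
  have "openin (loop_space (top_of_set D)) W" unfolding W_def using V by (intro openin_Union) auto
  then have W: "W \<in> sets M" by (rule b(2))
  have eq: "{\<gamma>\<in>A. H \<gamma> \<in> Q} = W \<inter> A" unfolding W_def using V by blast
  have "(\<lambda>\<gamma>. if \<gamma> \<in> A then H \<gamma> else 0) -` Q \<inter> space M =
     (W \<inter> A) \<union> (if 0 \<in> Q then space M - A else {})"
    unfolding eq[symmetric] using AL b(1) by (auto split: if_splits)
  also have "\<dots> \<in> sets M" using W A by auto
  finally show "(\<lambda>\<gamma>. if \<gamma> \<in> A then H \<gamma> else 0) -` Q \<inter> space M \<in> sets M" .
qed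

text \<open>If \<open>K\<close> does not surround 0, a path off \<open>K\<close> joins 0 to a point
  outside a large ball. Loops inside that ball which also miss the path do not surround 0 either,
  and they form a neighbourhood of \<open>K\<close>.\<close>

lemma Loop1_closed:
  "openin (loop_space (top_of_set (- {0}))) (loops_in (- {0}) - Loop1)"
proof -
  have "\<exists>V. openin (loop_space (top_of_set (- {0}))) V \<and> K \<in> V \<and> V \<subseteq> loops_in (- {0}) - Loop1"
    if K: "K \<in> loops_in (- {0}) - Loop1" for K
  proof -
    have K1: "compact K" "0 \<notin> K" "0 \<notin> inside K"
      using K by (auto simp: Loop1_def loops_in_eq circles_def surrounds_zero_def)
    let ?C = "connected_component_set (- K) 0"
    have unb: "\<not> bounded ?C" using K1 by (simp add: inside_def)
    obtain R where R: "R > 0" "K \<subseteq> ball 0 R"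
      using K1(1) bounded_subset_ballD[of K 0] by (auto simp: compact_imp_bounded)
    obtain y where y: "y \<in> ?C" "cmod y > R" using unb unfolding bounded_iff by (meson not_le)
    have opC: "open ?C" using K1(1) by (intro open_connected_component) (simp add: compact_imp_closed open_Compl)
    have "0 \<in> ?C" using K1 by simp
    then obtain P where P: "path P" "path_image P \<subseteq> ?C" "pathstart P = 0" "pathfinish P = y"
      using connected_open_path_connected[OF opC] y(1) unfolding path_connected_def
      by (metis connected_connected_component)
    define U where "U = ball 0 R - path_image P"
    have U: "open U" unfolding U_def by (intro open_Diff closed_path_image P) auto
    have KU: "K \<subseteq> U" using R(2) P(2) connected_component_subset[of "- K" 0] by (auto simp: U_def)
    have "0 \<notin> inside K'" if K': "K' \<subseteq> U" for K'
    proof -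
      have "connected (- ball 0 R :: complex set)"
        by (rule connected_complement_bounded_convex) auto
      moreover have "y \<in> path_image P" using P(4) pathfinish_in_path_image by metis
      moreover have "connected (path_image P)" by (rule connected_path_image[OF P(1)])
      ultimately have "connected (path_image P \<union> - ball 0 R)"
        using y(2) by (intro connected_Un) auto
      moreover have "0 \<in> path_image P" using P(3) pathstart_in_path_image by metis
      moreover have "path_image P \<union> - ball 0 R \<subseteq> - K'" using K' by (auto simp: U_def)
      ultimately have "path_image P \<union> - ball 0 R \<subseteq> connected_component_set (- K') 0"
        by (intro connected_component_maximal) auto
      then have "- ball 0 R \<subseteq> connected_component_set (- K') 0" by blast
      then have "\<not> bounded (connected_component_set (- K') 0)"
        using cobounded_imp_unbounded[of "ball (0::complex) R"] bounded_subset by (metis bounded_ball double_complement)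
      then show ?thesis by (simp add: inside_def)
    qed
    then have "{K' \<in> loops_in (- {0}). K' \<subseteq> U} \<subseteq> loops_in (- {0}) - Loop1"
      by (auto simp: Loop1_def surrounds_zero_def)
    moreover have "K \<in> {K' \<in> loops_in (- {0}). K' \<subseteq> U}" using K KU by blast
    ultimately show ?thesis using openin_loops_subset[OF U] by blast
  qed
  then show ?thesis by (subst openin_subopen) blast
qed

lemma Loop1_measurable:
  assumes "borel_measure_on (loop_space (top_of_set (- {0}))) M"
  shows "Loop1 \<in> sets M"
proof -
  note b = borel_loop_space[OF assms]
  have "loops_in (- {0}) - Loop1 \<in> sets M" by (rule b(2)[OF Loop1_closed])
  then have "space M - (loops_in (- {0}) - Loop1) \<in> sets M" by (rule sets.compl_sets)
  moreover have "space M - (loops_in (- {0}) - Loop1) = Loop1" unfolding b(1) by (auto simp: Loop1_def)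
  ultimately show ?thesis by simp
qed


section \<open>Conformal restriction on plane domains\<close>

lemma riemann_surface_plane_domain:
  assumes "open D" "connected D" "D \<noteq> {}"
  shows "riemann_surface (plane_domain D)"
proof -
  have "connected_space (top_of_set D)"
    using assms(2) unfolding connectedin_iff_connected[symmetric] connectedin_def by simp
  moreover have "chart (top_of_set D) (D, \<lambda>z. z)"
    using assms(1) homeomorphic_map_id[of "top_of_set D" "top_of_set D"] by (simp add: chart_def id_def subtopology_subtopology)
  moreover have "(\<lambda>z. inv_into D (\<lambda>z. z) z) holomorphic_on D"
    by (rule holomorphic_transform[OF holomorphic_on_ident]) (use f_inv_into_f[of _ "\<lambda>z. z" D] in auto)
  moreover have "Hausdorff_space (top_of_set D)" by (simp add: Hausdorff_space_subtopology)
  ultimately show ?thesis using assms(3) by (simp add: riemann_surface_def plane_domain_def)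
qed

lemma conformal_embedding_plane_domain:
  assumes f: "f holomorphic_on D" "inj_on f D" "f ` D \<subseteq> E"
  shows "conformal_embedding (plane_domain D) (plane_domain E) f"
proof -
  have "(\<lambda>z. f (inv_into D (\<lambda>z. z) z)) holomorphic_on (\<lambda>z. z) ` {x \<in> D. f x \<in> E}"
  proof (rule holomorphic_transform[of f])
    show "f holomorphic_on (\<lambda>z. z) ` {x \<in> D. f x \<in> E}" by (rule holomorphic_on_subset[OF f(1)]) auto
    show "f z = f (inv_into D (\<lambda>z. z) z)" if "z \<in> (\<lambda>z. z) ` {x \<in> D. f x \<in> E}" for z
      using f_inv_into_f[of z "\<lambda>z. z" D] that by auto
  qed
  moreover have "continuous_map (top_of_set D) (top_of_set E) f"
    using f holomorphic_on_imp_continuous_on by (auto simp: continuous_map_in_subtopology continuous_map_subtopology_eu)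
  ultimately show ?thesis using f(2) by (simp add: conformal_embedding_def plane_domain_def)
qed

lemma loops_in_measurable:
  assumes "borel_measure_on (loop_space (top_of_set E)) M" "open U" "U \<subseteq> E"
  shows "loops_in U \<in> sets M"
proof -
  have "{K \<in> loops_in E. K \<subseteq> U} = loops_in U" using assms(3) by (auto simp: loops_in_eq)
  then show ?thesis
    using borel_loop_space(2)[OF assms(1) openin_loops_subset[OF assms(2)]] by simp
qed

section \<open>Change of variables and finiteness for Werner's measure\<close>

context
  fixes \<mu> :: loop_measures
  assumes werner: "werner_family \<mu>"
begin

abbreviation "M \<equiv> \<mu> (plane_domain (- {0}))"

lemma borel_plane_domain:
  assumes "open D" "connected D" "D \<noteq> {}"
  shows "borel_measure_on (loop_space (top_of_set D)) (\<mu> (plane_domain D))"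
  using werner riemann_surface_plane_domain[OF assms]
  by (auto simp: werner_family_def borel_family_def plane_domain_def)

lemma punctured_plane: "open (- {0::complex})" "connected (- {0::complex})" "- {0::complex} \<noteq> {}"
proof -
  show "connected (- {0::complex})" by (rule connected_punctured_universe) simp
  have "1 \<in> - {0::complex}" by simp
  then show "- {0::complex} \<noteq> {}" by blast
qed auto

lemmas borel_M = borel_plane_domain[OF punctured_plane]

lemma restriction:
  assumes D: "open D" "connected D" "D \<noteq> {}"
    and f: "f holomorphic_on D" "inj_on f D" "0 \<notin> f ` D"
    and E: "E \<in> sets (\<mu> (plane_domain D))"
  shows "emeasure (\<mu> (plane_domain D)) E = emeasure M ((`) f ` E)"
proof -
  have "f ` D \<subseteq> - {0}" using f(3) by blast
  then have "conformal_embedding (plane_domain D) (plane_domain (- {0})) f"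
    by (rule conformal_embedding_plane_domain[OF f(1,2)])
  then show ?thesis
    using werner riemann_surface_plane_domain[OF D] riemann_surface_plane_domain[OF punctured_plane] E
    unfolding werner_family_def conformal_restriction_def by blast
qed

lemma loop_map_image:
  assumes D: "open D" and f: "f holomorphic_on D" "inj_on f D" and B: "B \<subseteq> circles"
  shows "(`) f ` ((`) f -` B \<inter> loops_in D) = B \<inter> loops_in (f ` D)"
proof (intro equalityI subsetI)
  fix K assume "K \<in> (`) f ` ((`) f -` B \<inter> loops_in D)"
  then show "K \<in> B \<inter> loops_in (f ` D)" using B by (auto simp: loops_in_eq)
next
  fix K assume K: "K \<in> B \<inter> loops_in (f ` D)"
  then have K': "K \<in> B" "K \<in> circles" "K \<subseteq> f ` D" by (auto simp: loops_in_eq)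
  obtain g where g: "g holomorphic_on (f ` D)" "\<And>z. z \<in> D \<Longrightarrow> g (f z) = z"
    using holomorphic_has_inverse[OF f(1) D f(2)] by metis
  have gD: "g w \<in> D" "f (g w) = w" if "w \<in> f ` D" for w using that g(2) by auto
  have "g ` K \<in> circles"
  proof (rule circles_image[OF K'(2)])
    show "continuous_on K g" by (rule continuous_on_subset[OF holomorphic_on_imp_continuous_on[OF g(1)] K'(3)])
    show "inj_on g K" using gD(2) K'(3) by (metis inj_on_inverseI subsetD)
  qed
  moreover have "g ` K \<subseteq> D" using gD(1) K'(3) by blast
  moreover have fg: "f ` g ` K = K" unfolding image_image using gD(2) K'(3) by (intro image_cong[where g = "\<lambda>x. x", simplified]) auto
  ultimately have "g ` K \<in> (`) f -` B \<inter> loops_in D" using K'(1) by (simp add: loops_in_eq)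
  then show "K \<in> (`) f ` ((`) f -` B \<inter> loops_in D)" using fg by (metis imageI)
qed

lemma loop_map_measurable:
  assumes D: "open D" "connected D" "D \<noteq> {}"
    and f: "f holomorphic_on D" "inj_on f D" "0 \<notin> f ` D"
  shows "(`) f \<in> measurable (\<mu> (plane_domain D)) M"
proof (rule measurable_sigma_sets[OF borel_loop_space(3)[OF borel_M]])
  note bD = borel_loop_space[OF borel_plane_domain[OF D]]
  have f0: "f ` D \<subseteq> - {0}" using f(3) by blast
  have cm: "continuous_map (loop_space (top_of_set D)) (loop_space (top_of_set (- {0}))) ((`) f)"
    by (rule loop_map_continuous[OF holomorphic_on_imp_continuous_on[OF f(1)] f(2) f0 D(1) punctured_plane(1)])
  show "{U. openin (loop_space (top_of_set (- {0}))) U} \<subseteq> Pow (loops_in (- {0}))"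
  proof (rule subsetI, elim CollectE)
    fix V assume "openin (loop_space (top_of_set (- {0::complex}))) V"
    from openin_subset[OF this] show "V \<in> Pow (loops_in (- {0}))"
      unfolding topspace_loop_space by (rule PowI)
  qed
  show "(`) f \<in> space (\<mu> (plane_domain D)) \<rightarrow> loops_in (- {0})"
    using continuous_map_funspace[OF cm] by (simp add: topspace_loop_space bD(1))
  fix V assume "V \<in> {U. openin (loop_space (top_of_set (- {0::complex}))) U}"
  then have "openin (loop_space (top_of_set D)) {K \<in> topspace (loop_space (top_of_set D)). f ` K \<in> V}"
    using openin_continuous_map_preimage[OF cm] by simp
  then have "{K \<in> loops_in D. f ` K \<in> V} \<in> sets (\<mu> (plane_domain D))"
    unfolding topspace_loop_space by (rule bD(2))
  moreover have "(`) f -` V \<inter> space (\<mu> (plane_domain D)) = {K \<in> loops_in D. f ` K \<in> V}"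
    by (auto simp: bD(1))
  ultimately show "(`) f -` V \<inter> space (\<mu> (plane_domain D)) \<in> sets (\<mu> (plane_domain D))" by simp
qed

text \<open>By conformal restriction the push-forward of the measure on \<open>D\<close> is
  \<open>M\<close> cut down to the loops in the image. Used for the identity and for a flow map on
  the same \<open>D\<close>, it compares two integrals over \<open>M\<close>.\<close>

lemma integral_loop_map:
  fixes h :: "complex set \<Rightarrow> complex"
  assumes D: "open D" "connected D" "D \<noteq> {}"
    and f: "f holomorphic_on D" "inj_on f D" "0 \<notin> f ` D"
    and h: "h \<in> borel_measurable M"
  shows "(\<integral>\<gamma>. h (f ` \<gamma>) \<partial>\<mu> (plane_domain D)) = (\<integral>\<gamma>. indicator (loops_in (f ` D)) \<gamma> *\<^sub>R h \<gamma> \<partial>M)"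
proof -
  let ?N = "\<mu> (plane_domain D)"
  note bM = borel_loop_space[OF borel_M] and bD = borel_loop_space[OF borel_plane_domain[OF D]]
  have T: "(`) f \<in> measurable ?N M" by (rule loop_map_measurable[OF D f])
  have f0: "f ` D \<subseteq> - {0}" using f(3) by blast
  have L: "loops_in (f ` D) \<in> sets M"
    by (rule loops_in_measurable[OF borel_M open_mapping_thm3[OF f(1) D(1) f(2)] f0])
  have "distr ?N M ((`) f) = density M (indicator (loops_in (f ` D)))"
  proof (rule measure_eqI)
    fix B assume "B \<in> sets (distr ?N M ((`) f))"
    then have B: "B \<in> sets M" by simp
    have Bc: "B \<subseteq> circles" using sets.sets_into_space[OF B] bM(1) by (auto simp: loops_in_eq)
    have "emeasure (distr ?N M ((`) f)) B = emeasure ?N ((`) f -` B \<inter> space ?N)"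
      by (rule emeasure_distr[OF T B])
    also have "\<dots> = emeasure M ((`) f ` ((`) f -` B \<inter> space ?N))"
      by (rule restriction[OF D f measurable_sets[OF T B]])
    also have "(`) f ` ((`) f -` B \<inter> space ?N) = B \<inter> loops_in (f ` D)"
      unfolding bD(1) by (rule loop_map_image[OF D(1) f(1,2) Bc])
    also have "emeasure M (B \<inter> loops_in (f ` D)) = (\<integral>\<^sup>+ x. indicator (loops_in (f ` D)) x * indicator B x \<partial>M)"
      using B L by (simp add: indicator_inter_arith[symmetric] Int_commute)
    also have "\<dots> = emeasure (density M (indicator (loops_in (f ` D)))) B"
      using L B by (intro emeasure_density[symmetric]) auto
    finally show "emeasure (distr ?N M ((`) f)) B = emeasure (density M (indicator (loops_in (f ` D)))) B" .
  qed simp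
  moreover have "density M (indicator (loops_in (f ` D))) = density M (\<lambda>x. ennreal (indicator (loops_in (f ` D)) x))"
    by (intro arg_cong[where f = "density M"] ext) (simp add: indicator_def)
  ultimately have "(\<integral>\<gamma>. h \<gamma> \<partial>distr ?N M ((`) f)) = (\<integral>\<gamma>. h \<gamma> \<partial>density M (\<lambda>x. ennreal (indicator (loops_in (f ` D)) x)))"
    by simp
  also have "\<dots> = (\<integral>\<gamma>. indicator (loops_in (f ` D)) \<gamma> *\<^sub>R h \<gamma> \<partial>M)"
    using h L by (intro integral_density) auto
  finally show ?thesis using integral_distr[OF T h] by simp
qed

lemma Loop1_scale:
  assumes "\<gamma> \<in> Loop1" "l > 0"
  shows "(*) (complex_of_real l) ` \<gamma> \<in> Loop1"
proof -
  have enc: "encircling \<gamma>" by (rule encircling_Loop1[OF assms(1)])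
  have \<gamma>: "\<gamma> \<in> circles" "0 \<notin> \<gamma>" using assms(1) by (auto simp: Loop1_def loops_in_eq)
  have "(\<lambda>z. z * exp (Ln (complex_of_real l))) ` \<gamma> = (*) (complex_of_real l) ` \<gamma>"
    using assms(2) by (simp add: mult.commute)
  then have "encircling ((*) (complex_of_real l) ` \<gamma>)"
    using encircling_exp_image[OF enc, of "\<lambda>z. Ln (complex_of_real l)"] by simp
  moreover have "(*) (complex_of_real l) ` \<gamma> \<in> circles"
    using assms(2) by (intro circles_image[OF \<gamma>(1)] continuous_intros) (auto simp: inj_on_def)
  moreover have "0 \<notin> (*) (complex_of_real l) ` \<gamma>" using \<gamma>(2) assms(2) by auto
  ultimately show ?thesis by (auto simp: Loop1_eq loops_in_eq)
qed

text \<open>Loops are sorted by their largest modulus. The dilate by \<open>l i\<close> of the set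
  in the nontriviality condition contains the loops around 0 whose largest modulus lies in
  \<open>[a * s ^ i, a * s ^ Suc i)\<close>, and the intervals with \<open>i \<le> m\<close> cover
  \<open>[a, b]\<close>.\<close>

lemma finite_measure_annulus:
  assumes a: "0 < a"
  obtains E where "E \<in> sets M" "emeasure M E < \<infinity>"
    "\<And>\<gamma>. \<gamma> \<in> Loop1 \<Longrightarrow> \<gamma> \<subseteq> cball 0 b - ball 0 a \<Longrightarrow> \<gamma> \<in> E"
proof -
  obtain \<alpha> A :: real where \<alpha>: "0 < \<alpha>" "\<alpha> < A" and
    nt: "let D = {z. 0 < cmod z \<and> cmod z < A};
          E = {\<gamma> \<in> loops (top_of_set D) - loops (top_of_set {z. cmod z < \<alpha>}). surrounds_zero \<gamma>}
      in 0 < emeasure (\<mu> (plane_domain D)) E \<and> emeasure (\<mu> (plane_domain D)) E < \<infinity>"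
    using werner unfolding werner_family_def nontrivial_def by blast
  define D where "D = {z::complex. 0 < cmod z \<and> cmod z < A}"
  define E where "E = {\<gamma> \<in> loops_in D - loops_in {z. cmod z < \<alpha>}. surrounds_zero \<gamma>}"
  have E: "0 < emeasure (\<mu> (plane_domain D)) E" "emeasure (\<mu> (plane_domain D)) E < \<infinity>"
    using nt unfolding Let_def D_def[symmetric] E_def[symmetric] by auto
  \<comment> \<open>Measurability follows from positive measure, because \<open>emeasure\<close> is
    0 off \<open>sets\<close>.\<close>
  have Es: "E \<in> sets (\<mu> (plane_domain D))" using E(1) emeasure_neq_0_sets[of "\<mu> (plane_domain D)" E] by simp
  have Dp: "open D" "connected D" "D \<noteq> {}"
  proof -
    show "open D" unfolding D_def by (intro open_Collect_conj open_Collect_less continuous_intros)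
    have "connected {x::complex. 0 < cmod (x - 0) \<and> cmod (x - 0) < A}" by (rule connected_annulus(1)) simp
    then show "connected D" by (simp add: D_def)
    have "complex_of_real \<alpha> \<in> D" using \<alpha> by (simp add: D_def)
    then show "D \<noteq> {}" by blast
  qed
  have scaled: "(`) ((*) (complex_of_real l)) ` E \<in> sets M \<and> emeasure M ((`) ((*) (complex_of_real l)) ` E) < \<infinity>"
    if l: "l > 0" for l
  proof -
    have "emeasure (\<mu> (plane_domain D)) E = emeasure M ((`) ((*) (complex_of_real l)) ` E)"
      using l by (intro restriction[OF Dp _ _ _ Es]) (auto intro!: holomorphic_intros simp: inj_on_def D_def)
    then show ?thesis using E emeasure_neq_0_sets[of M "(`) ((*) (complex_of_real l)) ` E"] by simp
  qed
  define s where "s = A / \<alpha>"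
  have s: "s > 1" using \<alpha> by (simp add: s_def)
  define l where "l i = a * s ^ i / \<alpha>" for i :: nat
  have l: "l i > 0" for i using a s \<alpha> by (simp add: l_def)
  obtain m where m: "b / a < s ^ m" using real_arch_pow[OF s] by blast
  define E' where "E' = (\<Union>i\<in>{..m}. (`) ((*) (complex_of_real (l i))) ` E)"
  show ?thesis
  proof (rule that[of E'])
    show "E' \<in> sets M" unfolding E'_def using scaled[OF l] by blast
    have "emeasure M E' \<le> (\<Sum>i\<in>{..m}. emeasure M ((`) ((*) (complex_of_real (l i))) ` E))"
      unfolding E'_def using scaled[OF l] by (intro emeasure_subadditive_finite) auto
    also have "\<dots> < \<infinity>" using scaled[OF l] by simp
    finally show "emeasure M E' < \<infinity>" .
    fix \<gamma> assume \<gamma>: "\<gamma> \<in> Loop1" "\<gamma> \<subseteq> cball 0 b - ball 0 a"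
    have enc: "encircling \<gamma>" by (rule encircling_Loop1[OF \<gamma>(1)])
    have "compact \<gamma>" "\<gamma> \<noteq> {}" using enc encircling_nonempty[OF enc] by (simp_all add: encircling_def)
    then obtain w where w: "w \<in> \<gamma>" "\<And>z. z \<in> \<gamma> \<Longrightarrow> cmod z \<le> cmod w"
      using continuous_attains_sup[of \<gamma> cmod] continuous_on_norm_id by blast
    have R: "a \<le> cmod w" "cmod w \<le> b" using \<gamma>(2) w(1) by auto
    have "cmod w < a * s ^ m" using m R a by (simp add: divide_less_eq mult.commute)
    also have "\<dots> \<le> a * s ^ Suc m" using s a by simp
    finally have ex: "cmod w < a * s ^ Suc m" .
    define i where "i = (LEAST i. cmod w < a * s ^ Suc i)"
    have i1: "cmod w < a * s ^ Suc i" unfolding i_def by (rule LeastI[of "\<lambda>i. cmod w < a * s ^ Suc i", OF ex])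
    have im: "i \<le> m" unfolding i_def by (rule Least_le) (rule ex)
    have i2: "a * s ^ i \<le> cmod w"
    proof (cases i)
      case 0 then show ?thesis using R by simp
    next
      case (Suc j)
      then have "\<not> cmod w < a * s ^ Suc j" using not_less_Least[of j "\<lambda>i. cmod w < a * s ^ Suc i"] unfolding i_def by simp
      then show ?thesis using Suc by simp
    qed
    let ?r = "(*) (complex_of_real (1 / l i)) ` \<gamma>"
    have r1: "?r \<in> Loop1" using l by (intro Loop1_scale \<gamma>(1)) simp
    then have rc: "?r \<in> circles" and r0: "0 \<notin> ?r" and rs: "surrounds_zero ?r" by (auto simp: Loop1_def loops_in_eq)
    have lA: "l i * A = a * s ^ Suc i" "l i * \<alpha> = a * s ^ i" using \<alpha> by (simp_all add: l_def s_def)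
    have "?r \<subseteq> D"
    proof
      fix y assume y: "y \<in> ?r"
      then obtain z where z: "z \<in> \<gamma>" "y = complex_of_real (1 / l i) * z" by blast
      have "cmod y = cmod z / l i" using z(2) l[of i] by (simp add: norm_mult norm_divide)
      also have "\<dots> < A" using w(2)[OF z(1)] i1 l[of i] lA(1) by (simp add: divide_less_eq mult.commute)
      finally show "y \<in> D" using y r0 by (auto simp: D_def)
    qed
    moreover have "\<not> ?r \<subseteq> {z. cmod z < \<alpha>}"
    proof
      assume "?r \<subseteq> {z. cmod z < \<alpha>}"
      then have "cmod (complex_of_real (1 / l i) * w) < \<alpha>" using w(1) by blast
      then have "cmod w < l i * \<alpha>" using l[of i] by (simp add: norm_mult norm_divide divide_less_eq mult.commute)
      then show False using i2 lA(2) by simp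
    qed
    ultimately have rE: "?r \<in> E" using rc rs by (auto simp: E_def loops_in_eq)
    have "(*) (complex_of_real (l i)) ` ?r = \<gamma>" using l[of i] by (simp add: image_image)
    then have "\<gamma> \<in> (`) ((*) (complex_of_real (l i))) ` E" using rE by (metis imageI)
    then show "\<gamma> \<in> E'" unfolding E'_def using im by blast
  qed
qed

end


section \<open>Infinitesimal invariance\<close>

lemma pflow_cancel:
  assumes "cmod (of_int n * \<tau> * z powi n) < 1"
  shows "pflow n (- \<tau>) (pflow n \<tau> z) = z"
  using pflow_add[of n \<tau> z "- \<tau>"] assms by simp

lemma pflow_cancel_real:
  assumes "cmod (of_int n * (c * of_real t) * z powi n) < 1"
  shows "pflow n (c * of_real (- t)) (pflow n (c * of_real t) z) = z"
  using pflow_cancel[OF assms] by simp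

lemma encircling_annular:
  assumes enc: "encircling \<gamma>"
  obtains a b where "0 < a" "annular a b \<gamma>"
proof -
  obtain a where a: "a > 0" "ball 0 a \<subseteq> U_plus \<gamma>"
    using open_U_plus[OF enc] zero_in_U_plus[OF enc] openE by blast
  obtain b where "\<gamma> \<subseteq> ball 0 b"
    using enc bounded_subset_ballD[of \<gamma> 0] by (auto simp: encircling_def compact_imp_bounded)
  then have "\<gamma> \<subseteq> cball 0 b - ball 0 a" using a(2) U_plus_disjoint[of \<gamma>] ball_subset_cball by blast
  then show ?thesis using that a(1) enc by blast
qed

definition pderiv_flow :: "int \<Rightarrow> complex \<Rightarrow> (complex set \<Rightarrow> complex) \<Rightarrow> complex set \<Rightarrow> complex" where
  "pderiv_flow n c F \<gamma> = vector_derivative (\<lambda>t. F (pflow n (c * of_real t) ` \<gamma>)) (at 0)"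

lemma tame_has_pderiv:
  assumes F: "tame F" and enc: "encircling \<gamma>"
  shows "((\<lambda>t. F (pflow n (c * of_real t) ` \<gamma>)) has_vector_derivative pderiv_flow n c F \<gamma>) (at 0)"
proof -
  obtain a b where ab: "0 < a" "annular a b \<gamma>" using encircling_annular[OF enc] by metis
  obtain C where "\<And>\<gamma>. annular a b \<gamma> \<Longrightarrow> \<exists>d. norm d \<le> C \<and>
        ((\<lambda>t. F (pflow n (c * of_real t) ` \<gamma>)) has_vector_derivative d) (at 0)"
    using tame_derivative[OF F ab(1)] by metis
  from this[OF ab(2)] obtain d where
    "((\<lambda>t. F (pflow n (c * of_real t) ` \<gamma>)) has_vector_derivative d) (at 0)" by blast
  then show ?thesis unfolding pderiv_flow_def using vector_derivative_at by metis
qed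

lemma has_vector_derivative_sequence:
  fixes F :: "real \<Rightarrow> complex"
  assumes "(F has_vector_derivative d) (at 0)" "t \<longlonglongrightarrow> 0" "\<And>k. t k \<noteq> 0"
  shows "(\<lambda>k. (F (t k) - F 0) / of_real (t k)) \<longlonglongrightarrow> d"
proof -
  have "((\<lambda>x. norm (F x - F 0 - (x - 0) *\<^sub>R d) / norm (x - 0)) \<longlongrightarrow> 0) (at 0)"
    using assms(1) unfolding has_vector_derivative_def has_derivative_iff_norm by blast
  then have "(\<lambda>k. norm (F (t k) - F 0 - (t k - 0) *\<^sub>R d) / norm (t k - 0)) \<longlonglongrightarrow> 0"
    by (rule filterlim_compose) (simp add: filterlim_at assms(2,3))
  moreover have "norm (F (t k) - F 0 - (t k - 0) *\<^sub>R d) / norm (t k - 0) = norm ((F (t k) - F 0) / of_real (t k) - d)" for k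
  proof -
    have "(F (t k) - F 0) / of_real (t k) - d = (F (t k) - F 0 - (t k - 0) *\<^sub>R d) / of_real (t k)"
      using assms(3)[of k] by (simp add: field_simps scaleR_conv_of_real)
    then show ?thesis by (simp add: norm_divide)
  qed
  ultimately have "(\<lambda>k. norm ((F (t k) - F 0) / of_real (t k) - d)) \<longlonglongrightarrow> 0" by simp
  then have "(\<lambda>k. (F (t k) - F 0) / of_real (t k) - d) \<longlonglongrightarrow> 0" by (rule tendsto_norm_zero_cancel)
  then show ?thesis by (rule LIM_zero_cancel)
qed

text \<open>
  In a short time the flow cannot carry a loop that leaves the wider annulus into the annulus
  that supports \<open>F\<close>, so \<open>F\<close> vanishes along the flow of such a loop.
\<close>

lemma pderiv_flow_outside:
  assumes supp: "\<And>\<gamma>. encircling \<gamma> \<Longrightarrow> F \<gamma> \<noteq> 0 \<Longrightarrow> annular a b \<gamma>" and a: "0 < a"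
    and enc: "encircling \<gamma>" and out: "\<not> \<gamma> \<subseteq> {z. a / 4 < cmod z \<and> cmod z < 4 * b}"
  shows "pderiv_flow n c F \<gamma> = 0"
proof -
  obtain a1 b1 where ab1: "0 < a1" "annular a1 b1 \<gamma>" using encircling_annular[OF enc] by metis
  obtain \<delta> where \<delta>: "\<delta> > 0"
    "\<And>t z. \<bar>t\<bar> < \<delta> \<Longrightarrow> a1 \<le> cmod z \<Longrightarrow> cmod z \<le> b1 \<Longrightarrow> cmod (of_int n * (c * of_real t) * z powi n) < 1"
    using pflow_small_time[OF ab1(1)] by metis
  obtain \<delta>0 where \<delta>0: "\<delta>0 > 0"
    "\<And>t z. \<bar>t\<bar> < \<delta>0 \<Longrightarrow> a \<le> cmod z \<Longrightarrow> cmod z \<le> b \<Longrightarrow>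
      a / 2 < cmod (pflow n (c * of_real t) z) \<and> cmod (pflow n (c * of_real t) z) < 2 * b"
    using pflow_small_time[OF a] by metis
  have zero: "F (pflow n (c * of_real t) ` \<gamma>) = 0" if t: "\<bar>t\<bar> < min \<delta> \<delta>0" for t
  proof (rule ccontr)
    assume nz: "F (pflow n (c * of_real t) ` \<gamma>) \<noteq> 0"
    have dom: "cmod (of_int n * (c * of_real t) * z powi n) < 1" if "z \<in> \<gamma>" for z
      using ab1(2) that t by (intro \<delta>(2)) auto
    have "encircling (pflow n (c * of_real t) ` \<gamma>)" by (rule encircling_pflow[OF enc dom])
    then have an: "pflow n (c * of_real t) ` \<gamma> \<subseteq> cball 0 b - ball 0 a" using supp nz by blast
    have "z \<in> {z. a / 4 < cmod z \<and> cmod z < 4 * b}" if z: "z \<in> \<gamma>" for z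
    proof -
      let ?w = "pflow n (c * of_real t) z"
      have w: "a \<le> cmod ?w" "cmod ?w \<le> b" using an z by (auto simp: image_subset_iff)
      have "\<bar>- t\<bar> < \<delta>0" using t by simp
      from \<delta>0(2)[OF this w] have "a / 2 < cmod z \<and> cmod z < 2 * b"
        unfolding pflow_cancel_real[OF dom[OF z]] .
      moreover have "0 < b" using w a by linarith
      ultimately show ?thesis using a by simp
    qed
    then show False using out by blast
  qed
  have "((\<lambda>t. F (pflow n (c * of_real t) ` \<gamma>)) has_vector_derivative 0) (at 0)"
  proof (rule has_vector_derivative_transform_within_open[of "\<lambda>t. 0" _ _ "ball 0 (min \<delta> \<delta>0)"])
    show "0 = F (pflow n (c * of_real t) ` \<gamma>)" if "t \<in> ball 0 (min \<delta> \<delta>0)" for t :: real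
      using zero[of t] that by simp
  qed (use \<delta>(1) \<delta>0(1) in auto)
  then show ?thesis unfolding pderiv_flow_def by (rule vector_derivative_at)
qed

text \<open>The annulus \<open>D\<close> is so wide that, for small times, every loop on which
  \<open>F\<close> is nonzero is the image under the flow of a loop in \<open>D\<close>. The
  difference quotients \<open>G k\<close> then have integral 0 for every \<open>k\<close>. They are
  dominated by a constant on a set of finite measure and converge to the derivative.\<close>

theorem integral_pderiv_flow:
  assumes werner: "werner_family \<mu>" and F: "tame F" and a: "0 < a" and ab: "a < b"
    and supp: "\<And>\<gamma>. encircling \<gamma> \<Longrightarrow> F \<gamma> \<noteq> 0 \<Longrightarrow> annular a b \<gamma>"
  shows "has_bochner_integral (mu0 \<mu>) (pderiv_flow n c F) 0"
proof -
  let ?M = "\<mu> (plane_domain (- {0}))"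
  note borel = borel_M[OF werner]
  let ?P = "\<lambda>t. pflow n (c * of_real t)"
  \<comment> \<open>Short flows change moduli by factors between 1/2 and 2; the factor 4 keeps
    preimages of the supporting annulus strictly inside \<open>D\<close>, and matches
    \<open>pderiv_flow_outside\<close>.\<close>
  define a1 where "a1 = a / 4"
  define b1 where "b1 = 4 * b"
  have a1: "0 < a1" "0 < a1 / 2" "a1 < b1" using a ab by (auto simp: a1_def b1_def)
  define D where "D = {z::complex. a1 < cmod z \<and> cmod z < b1}"
  obtain \<delta>0 where \<delta>0: "\<delta>0 > 0"
    "\<And>t z. \<bar>t\<bar> < \<delta>0 \<Longrightarrow> a \<le> cmod z \<Longrightarrow> cmod z \<le> b \<Longrightarrow> cmod (of_int n * (c * of_real t) * z powi n) < 1"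
    "\<And>t z. \<bar>t\<bar> < \<delta>0 \<Longrightarrow> a \<le> cmod z \<Longrightarrow> cmod z \<le> b \<Longrightarrow> a / 2 < cmod (?P t z) \<and> cmod (?P t z) < 2 * b"
    using pflow_small_time[OF a] by metis
  obtain \<delta>1 where \<delta>1: "\<delta>1 > 0"
    "\<And>t z. \<bar>t\<bar> < \<delta>1 \<Longrightarrow> a1 \<le> cmod z \<Longrightarrow> cmod z \<le> b1 \<Longrightarrow> cmod (of_int n * (c * of_real t) * z powi n) < 1"
    "\<And>t z. \<bar>t\<bar> < \<delta>1 \<Longrightarrow> a1 \<le> cmod z \<Longrightarrow> cmod z \<le> b1 \<Longrightarrow> a1 / 2 < cmod (?P t z) \<and> cmod (?P t z) < 2 * b1"
    using pflow_small_time[OF a1(1)] by metis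
  \<comment> \<open>The flow is also run backwards from the image of \<open>D\<close>, where moduli
    range between \<open>a1 / 2\<close> and \<open>2 * b1\<close>.\<close>
  obtain \<delta>2 where \<delta>2: "\<delta>2 > 0"
    "\<And>t z. \<bar>t\<bar> < \<delta>2 \<Longrightarrow> a1 / 2 \<le> cmod z \<Longrightarrow> cmod z \<le> 2 * b1 \<Longrightarrow> cmod (of_int n * (c * of_real t) * z powi n) < 1"
    using pflow_small_time[OF a1(2)] by metis
  obtain C \<delta>3 where \<delta>3: "\<delta>3 > 0" "\<And>\<gamma> t. annular a1 b1 \<gamma> \<Longrightarrow> \<bar>t\<bar> < \<delta>3 \<Longrightarrow>
    norm (F (?P t ` \<gamma>) - F \<gamma>) \<le> C * \<bar>t\<bar>"
    using tame_difference_bound[OF F a1(1)] by metis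
  define \<delta> where "\<delta> = min (min \<delta>0 \<delta>1) (min \<delta>2 \<delta>3)"
  have \<delta>: "\<delta> > 0" "\<delta> \<le> \<delta>0" "\<delta> \<le> \<delta>1" "\<delta> \<le> \<delta>2" "\<delta> \<le> \<delta>3"
    using \<delta>0 \<delta>1 \<delta>2 \<delta>3 by (auto simp: \<delta>_def)
  have Dp: "open D" "connected D" "D \<noteq> {}"
  proof -
    show "open D" unfolding D_def by (intro open_Collect_conj open_Collect_less continuous_intros)
    have "connected {x::complex. a1 < cmod (x - 0) \<and> cmod (x - 0) < b1}" by (rule connected_annulus(1)) simp
    then show "connected D" by (simp add: D_def)
    have "complex_of_real ((a1 + b1) / 2) \<in> D" using a1 unfolding D_def by (simp only: mem_Collect_eq norm_of_real) simp
    then show "D \<noteq> {}" by blast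
  qed
  have D0: "D \<subseteq> - {0}" using a1 by (auto simp: D_def)
  have Dsub: "a1 \<le> cmod z" "cmod z \<le> b1" if "z \<in> D" for z using that by (auto simp: D_def)
  have dom: "cmod (of_int n * (c * of_real t) * z powi n) < 1" if "\<bar>t\<bar> < \<delta>" "z \<in> D" for t z
    using \<delta>1(2)[of t z] Dsub[OF that(2)] that(1) \<delta>(3) by linarith
  have hol: "?P t holomorphic_on D" and inj: "inj_on (?P t) D" if "\<bar>t\<bar> < \<delta>" for t
    using dom[OF that] D0 by (auto intro!: pflow_holomorphic pflow_inj)
  have nz: "0 \<notin> ?P t ` S" if "S \<subseteq> D" for t S
    using pflow_nz D0 that by (metis ComplD imageE insertI1 subsetD)
  define A where "A = Loop1 \<inter> loops_in D"
  have L1: "Loop1 \<in> sets ?M" by (rule Loop1_measurable[OF borel])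
  have A: "A \<in> sets ?M" unfolding A_def using L1 loops_in_measurable[OF borel Dp(1) D0] by blast
  have Aenc: "encircling \<gamma>" "\<gamma> \<subseteq> D" "annular a1 b1 \<gamma>" if "\<gamma> \<in> A" for \<gamma>
  proof -
    show 1: "encircling \<gamma>" "\<gamma> \<subseteq> D" using that encircling_Loop1[of \<gamma>] by (auto simp: A_def loops_in_eq)
    have "\<gamma> \<subseteq> cball 0 b1 - ball 0 a1" using 1(2) by (auto simp: D_def)
    then show "annular a1 b1 \<gamma>" using 1(1) by blast
  qed
  have Aann: "annular (a1 / 2) (2 * b1) (?P t ` \<gamma>)" if t: "\<bar>t\<bar> < \<delta>" and \<gamma>: "\<gamma> \<in> A" for t \<gamma>
  proof -
    have t1: "\<bar>t\<bar> < \<delta>1" using t \<delta>(3) by linarith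
    show ?thesis by (rule annular_pflow[OF Aenc(3)[OF \<gamma>] \<delta>1(2,3)[OF t1]])
  qed
  have suppD: "\<gamma> \<in> A" if "\<gamma> \<in> Loop1" "F \<gamma> \<noteq> 0" for \<gamma>
  proof -
    have "\<gamma> \<subseteq> cball 0 b - ball 0 a" using supp[OF encircling_Loop1[OF that(1)] that(2)] by blast
    moreover have "cball 0 b - ball 0 a \<subseteq> D" using a ab by (auto simp: D_def a1_def b1_def)
    ultimately show ?thesis using that(1) by (auto simp: A_def Loop1_def loops_in_eq)
  qed
  have suppP: "\<gamma> \<in> loops_in (?P t ` D)" if t: "\<bar>t\<bar> < \<delta>" and \<gamma>: "\<gamma> \<in> Loop1" "F \<gamma> \<noteq> 0" for t \<gamma>
  proof -
    have sub: "\<gamma> \<subseteq> cball 0 b - ball 0 a" using supp[OF encircling_Loop1[OF \<gamma>(1)] \<gamma>(2)] by blast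
    have "z \<in> ?P t ` D" if z: "z \<in> \<gamma>" for z
    proof -
      have za: "a \<le> cmod z" "cmod z \<le> b" using sub z by auto
      have mt: "\<bar>- t\<bar> < \<delta>0" using t \<delta>(2) by simp
      have "?P (- t) z \<in> D" using \<delta>0(3)[OF mt za] a ab by (simp add: D_def a1_def b1_def)
      moreover have "?P t (?P (- t) z) = z" using pflow_cancel_real[OF \<delta>0(2)[OF mt za]] by simp
      ultimately show ?thesis by (metis imageI)
    qed
    then show ?thesis using \<gamma>(1) by (auto simp: Loop1_def loops_in_eq)
  qed
  \<comment> \<open>The converse direction applies \<open>encircling_pflow\<close> to the moved loop
    and the reversed flow.\<close>
  have iff: "?P t ` \<gamma> \<in> Loop1 \<longleftrightarrow> \<gamma> \<in> Loop1" if t: "\<bar>t\<bar> < \<delta>" and \<gamma>: "\<gamma> \<in> loops_in D" for t \<gamma>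
  proof -
    have \<gamma>c: "\<gamma> \<in> circles" "\<gamma> \<subseteq> D" using \<gamma> by (auto simp: loops_in_eq)
    have "?P t ` \<gamma> \<in> circles"
      by (intro circles_image \<gamma>c inj_on_subset[OF inj[OF t]]
          continuous_on_subset[OF holomorphic_on_imp_continuous_on[OF hol[OF t]]])
    then have in0: "?P t ` \<gamma> \<in> loops_in (- {0})" "\<gamma> \<in> loops_in (- {0})"
      using nz[OF \<gamma>c(2)] \<gamma>c D0 by (auto simp: loops_in_eq)
    have "encircling (?P t ` \<gamma>) \<longleftrightarrow> encircling \<gamma>"
    proof
      show "encircling (?P t ` \<gamma>)" if "encircling \<gamma>"
        using \<gamma>c(2) by (intro encircling_pflow[OF that] dom[OF t]) auto
      assume e: "encircling (?P t ` \<gamma>)"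
      have "cmod (of_int n * (c * of_real (- t)) * w powi n) < 1" if w: "w \<in> ?P t ` \<gamma>" for w
      proof -
        from w obtain z where z: "w = ?P t z" "z \<in> \<gamma>" by (rule imageE)
        have zD: "z \<in> D" using z(2) \<gamma>c(2) by blast
        have t1: "\<bar>t\<bar> < \<delta>1" using t \<delta>(3) by linarith
        have "a1 / 2 < cmod w \<and> cmod w < 2 * b1"
          unfolding z(1) by (rule \<delta>1(3)[OF t1 Dsub[OF zD]])
        then show ?thesis using t \<delta>(4) by (intro \<delta>2(2)) auto
      qed
      from encircling_pflow[OF e this] have "encircling (?P (- t) ` ?P t ` \<gamma>)" .
      moreover have "?P (- t) ` ?P t ` \<gamma> = \<gamma>"
      proof -
        have "?P (- t) (?P t z) = z" if "z \<in> \<gamma>" for z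
          using \<gamma>c(2) that by (intro pflow_cancel_real dom[OF t]) auto
        then show ?thesis unfolding image_image by simp
      qed
      ultimately show "encircling \<gamma>" by simp
    qed
    then show ?thesis using in0 by (simp add: Loop1_eq)
  qed
  \<comment> \<open>The offset 2 keeps every time strictly below \<open>\<delta>\<close>, also for
    \<open>k = 0\<close>.\<close>
  define t where "t k = \<delta> / real (k + 2)" for k
  have t: "\<bar>t k\<bar> < \<delta>" "t k > 0" for k
  proof -
    show "t k > 0"
      using \<delta>(1) by (simp add: t_def)
    moreover have "t k \<le> \<delta> / 2"
      unfolding t_def using \<delta>(1) by (intro divide_left_mono) auto
    ultimately show "\<bar>t k\<bar> < \<delta>"
      using \<delta>(1) by linarith
  qed
  have t_lim: "t \<longlonglongrightarrow> 0"
    unfolding t_def by (rule LIMSEQ_ignore_initial_segment[OF lim_const_over_n])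
  \<comment> \<open>The moved function is cut off to \<open>A\<close>, where the flow formula is
    valid. Extension by 0 makes all functions measurable on the whole loop space of the punctured
    plane.\<close>
  define \<Phi> where "\<Phi> k \<gamma> = (if \<gamma> \<in> A then F (?P (t k) ` \<gamma>) else 0)" for k \<gamma>
  define Fz where "Fz \<gamma> = (if \<gamma> \<in> Loop1 then F \<gamma> else 0)" for \<gamma>
  define Dz where "Dz \<gamma> = (if \<gamma> \<in> A then pderiv_flow n c F \<gamma> else 0)" for \<gamma>
  define G where "G k \<gamma> = (\<Phi> k \<gamma> - Fz \<gamma>) / of_real (t k)" for k \<gamma>
  have Fzm: "Fz \<in> borel_measurable ?M"
    unfolding Fz_def[abs_def]
    by (rule sequentially_continuous_measurable[OF borel L1]) (intro tame_continuous[OF F] encircling_Loop1)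
  have \<Phi>m: "\<Phi> k \<in> borel_measurable ?M" for k
    unfolding \<Phi>_def[abs_def]
  proof (rule sequentially_continuous_measurable[OF borel A])
    fix g \<gamma> assume \<gamma>: "\<gamma> \<in> A" and g: "\<And>m. g m \<in> A" and v: "vconv g \<gamma>"
    show "(\<lambda>m. F (?P (t k) ` g m)) \<longlonglongrightarrow> F (?P (t k) ` \<gamma>)"
    proof (rule tame_continuous[OF F])
      show "encircling (?P (t k) ` \<gamma>)" using Aann[OF t(1) \<gamma>] by blast
      show "encircling (?P (t k) ` g m)" for m using Aann[OF t(1) g] by blast
      show "vconv (\<lambda>m. ?P (t k) ` g m) (?P (t k) ` \<gamma>)"
        by (rule vconv_image[OF holomorphic_on_imp_continuous_on[OF hol[OF t(1)]] Dp(1) Aenc(2)[OF \<gamma>] Aenc(2)[OF g] v])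
    qed
  qed
  obtain E where E: "E \<in> sets ?M" "emeasure ?M E < \<infinity>"
    "\<And>\<gamma>. \<gamma> \<in> Loop1 \<Longrightarrow> \<gamma> \<subseteq> cball 0 b1 - ball 0 a1 \<Longrightarrow> \<gamma> \<in> E"
    using finite_measure_annulus[OF werner a1(1)] by metis
  have AE': "\<gamma> \<in> E" if "\<gamma> \<in> A" for \<gamma> using E(3) Aenc(3)[OF that] that by (auto simp: A_def)
  obtain B where B: "B > 0" "\<And>\<gamma>. annular (a1 / 2) (2 * b1) \<gamma> \<Longrightarrow> norm (F \<gamma>) \<le> B"
    using tame_bounded[OF F a1(2)] by metis
  have \<Phi>i: "integrable ?M (\<Phi> k)" for k
  proof (rule integrableI_bounded_set[OF E(1) \<Phi>m E(2), of _ B])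
    show "AE \<gamma> in ?M. \<gamma> \<in> E \<longrightarrow> norm (\<Phi> k \<gamma>) \<le> B"
      using B Aann[OF t(1)] by (intro AE_I2) (auto simp: \<Phi>_def)
    show "AE \<gamma> in ?M. \<gamma> \<notin> E \<longrightarrow> \<Phi> k \<gamma> = 0" using AE' by (intro AE_I2) (auto simp: \<Phi>_def)
  qed
  have FzA: "Fz \<gamma> = (if \<gamma> \<in> A then F \<gamma> else 0)" for \<gamma>
    using suppD[of \<gamma>] by (auto simp: Fz_def A_def)
  have Fzi: "integrable ?M Fz"
  proof (rule integrableI_bounded_set[OF E(1) Fzm E(2), of B])
    have "norm (F \<gamma>) \<le> B" if "\<gamma> \<in> A" for \<gamma>
    proof -
      have "annular (a1 / 2) (2 * b1) (?P 0 ` \<gamma>)" using \<delta>(1) by (intro Aann[OF _ that]) simp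
      then show ?thesis using B(2) by simp
    qed
    then show "AE \<gamma> in ?M. \<gamma> \<in> E \<longrightarrow> norm (Fz \<gamma>) \<le> B" using B(1) by (intro AE_I2) (auto simp: FzA)
    show "AE \<gamma> in ?M. \<gamma> \<notin> E \<longrightarrow> Fz \<gamma> = 0" using AE' by (intro AE_I2) (auto simp: FzA)
  qed
  \<comment> \<open>The measure on the loops in \<open>D\<close> is the pivot: the identity
    embedding leads from \<open>\<Phi> k\<close> to it, the flow embedding leads from it to
    \<open>Fz\<close>. Both cutoffs are invisible, the first because \<open>\<Phi> k\<close>
    vanishes off \<open>A\<close>, the second by \<open>suppP\<close>.\<close>
  have int_eq: "integral\<^sup>L ?M (\<Phi> k) = integral\<^sup>L ?M Fz" for k
  proof -
    let ?N = "\<mu> (plane_domain D)"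
    have "integral\<^sup>L ?M (\<Phi> k) = (\<integral>\<gamma>. indicator (loops_in ((\<lambda>z. z) ` D)) \<gamma> *\<^sub>R \<Phi> k \<gamma> \<partial>?M)"
      by (rule Bochner_Integration.integral_cong) (auto simp: \<Phi>_def A_def indicator_def)
    also have "\<dots> = (\<integral>\<gamma>. \<Phi> k ((\<lambda>z. z) ` \<gamma>) \<partial>?N)"
      by (rule integral_loop_map[OF werner Dp _ _ _ \<Phi>m, symmetric]) (use D0 in auto)
    also have "\<dots> = (\<integral>\<gamma>. Fz (?P (t k) ` \<gamma>) \<partial>?N)"
    proof (rule Bochner_Integration.integral_cong[OF refl])
      fix \<gamma> assume "\<gamma> \<in> space ?N"
      then have \<gamma>: "\<gamma> \<in> loops_in D" using borel_loop_space(1)[OF borel_plane_domain[OF werner Dp]] by simp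
      show "\<Phi> k ((\<lambda>z. z) ` \<gamma>) = Fz (?P (t k) ` \<gamma>)"
        using iff[OF t(1) \<gamma>] \<gamma> by (simp add: \<Phi>_def Fz_def A_def)
    qed
    also have "\<dots> = (\<integral>\<gamma>. indicator (loops_in (?P (t k) ` D)) \<gamma> *\<^sub>R Fz \<gamma> \<partial>?M)"
      by (rule integral_loop_map[OF werner Dp hol[OF t(1)] inj[OF t(1)] nz Fzm]) simp
    also have "\<dots> = integral\<^sup>L ?M Fz"
      by (rule Bochner_Integration.integral_cong) (use suppP[OF t(1)] in \<open>auto simp: Fz_def indicator_def\<close>)
    finally show ?thesis .
  qed
  have Gm: "G k \<in> borel_measurable ?M" for k
    unfolding G_def[abs_def] by (intro borel_measurable_divide borel_measurable_diff \<Phi>m Fzm borel_measurable_const)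
  have G0: "integral\<^sup>L ?M (G k) = 0" for k
    unfolding G_def[abs_def] using \<Phi>i Fzi int_eq by simp
  have GA: "G k \<gamma> = (if \<gamma> \<in> A then (F (?P (t k) ` \<gamma>) - F \<gamma>) / of_real (t k) else 0)" for k \<gamma>
    by (simp add: G_def \<Phi>_def FzA)
  have lim: "(\<lambda>k. G k \<gamma>) \<longlonglongrightarrow> Dz \<gamma>" for \<gamma>
  proof (cases "\<gamma> \<in> A")
    case True
    have tn: "t k \<noteq> 0" for k using t(2)[of k] by simp
    have "(\<lambda>k. (F (?P (t k) ` \<gamma>) - F (?P 0 ` \<gamma>)) / of_real (t k)) \<longlonglongrightarrow> pderiv_flow n c F \<gamma>"
      using has_vector_derivative_sequence[OF tame_has_pderiv[OF F Aenc(1)[OF True]] t_lim tn] .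
    then show ?thesis using True by (simp add: GA Dz_def)
  qed (simp add: GA Dz_def)
  \<comment> \<open>\<open>E\<close> has finite measure, so the Lipschitz constant from
    \<open>tame_difference_bound\<close> times its indicator is an integrable majorant.\<close>
  have wi: "integrable ?M (\<lambda>\<gamma>. \<bar>C\<bar> * indicator E \<gamma>)"
    using E(1,2) by (intro integrable_mult_right integrable_real_indicator) auto
  have bound: "norm (G k \<gamma>) \<le> \<bar>C\<bar> * indicator E \<gamma>" for k \<gamma>
  proof (cases "\<gamma> \<in> A")
    case True
    have "norm (F (?P (t k) ` \<gamma>) - F \<gamma>) \<le> C * \<bar>t k\<bar>"
      using t(1)[of k] \<delta>(5) by (intro \<delta>3(2)[OF Aenc(3)[OF True]]) linarith
    then have "norm (F (?P (t k) ` \<gamma>) - F \<gamma>) / \<bar>t k\<bar> \<le> C" using t(2)[of k] by (simp add: divide_le_eq)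
    then show ?thesis using True AE'[OF True] by (simp add: GA norm_divide)
  qed (simp add: GA)
  have Dm: "Dz \<in> borel_measurable ?M" by (rule borel_measurable_LIMSEQ_metric[OF Gm lim])
  have "integrable ?M Dz"
    by (rule integrable_dominated_convergence[where s = G, OF Dm Gm wi]) (simp_all add: lim bound)
  moreover have "(\<lambda>k. integral\<^sup>L ?M (G k)) \<longlonglongrightarrow> integral\<^sup>L ?M Dz"
    by (rule integral_dominated_convergence[where s = G, OF Dm Gm wi]) (simp_all add: lim bound)
  then have "integral\<^sup>L ?M Dz = 0" unfolding G0 using LIMSEQ_unique tendsto_const by blast
  ultimately have "has_bochner_integral ?M Dz 0" by (simp add: has_bochner_integral_iff)
  moreover have "indicator Loop1 \<gamma> *\<^sub>R pderiv_flow n c F \<gamma> = Dz \<gamma>" for \<gamma>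
  proof (cases "\<gamma> \<in> Loop1")
    case True
    show ?thesis
    proof (cases "\<gamma> \<in> A")
      case False
      have "\<not> \<gamma> \<subseteq> {z. a / 4 < cmod z \<and> cmod z < 4 * b}"
        using False True by (auto simp: A_def D_def a1_def b1_def Loop1_def loops_in_eq)
      from pderiv_flow_outside[OF supp a encircling_Loop1[OF True] this]
      show ?thesis using False by (simp add: Dz_def)
    qed (use True in \<open>simp add: Dz_def\<close>)
  qed (simp add: Dz_def A_def)
  ultimately have "has_bochner_integral ?M (\<lambda>\<gamma>. indicator Loop1 \<gamma> *\<^sub>R pderiv_flow n c F \<gamma>) 0" by simp
  moreover have "Loop1 \<inter> space ?M \<in> sets ?M" using L1 by auto
  ultimately show ?thesis unfolding mu0_def by (simp add: has_bochner_integral_restrict_space)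
qed

text \<open>Two signs cancel: the basis fields are negative multiples of
  \<open>z powi (n + 1)\<close>, and \<open>moved\<close> flows for time \<open>- t\<close>. The
  identification with \<open>pflow\<close> holds for short times only, which suffices for the
  derivative at 0.\<close>

lemma moved_test_function:
  assumes f: "smooth_compact_support ({0<..} \<times> {0<..}) f" and enc: "encircling \<gamma>"
    and v: "\<And>z. v z = - c * z powi (n + 1)"
  shows "(moved v (test_function p f) \<gamma> has_vector_derivative pderiv_flow n c (test_ratio p f) \<gamma>) (at 0)"
proof -
  obtain a b where ab: "0 < a" "annular a b \<gamma>" using encircling_annular[OF enc] by metis
  obtain \<delta> where \<delta>: "\<delta> > 0"
    "\<And>t z. \<bar>t\<bar> < \<delta> \<Longrightarrow> a \<le> cmod z \<Longrightarrow> cmod z \<le> b \<Longrightarrow> cmod (of_int n * (c * of_real t) * z powi n) < 1"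
    using pflow_small_time[OF ab(1)] by metis
  show ?thesis
  proof (rule has_vector_derivative_transform_within_open[OF tame_has_pderiv[OF tame_test_ratio[OF f] enc]])
    fix t :: real assume "t \<in> ball 0 \<delta>"
    then have t: "\<bar>t\<bar> < \<delta>" by simp
    have dom: "cmod (of_int n * (c * of_real t) * z powi n) < 1" if "z \<in> \<gamma>" for z
      using ab(2) that by (intro \<delta>(2)[OF t]) auto
    have "flow v (- t) z = pflow n (c * of_real t) z" if z: "z \<in> \<gamma>" for z
    proof -
      have z0: "z \<noteq> 0" using z encircling_zero_notin[OF enc] by auto
      have "v = (\<lambda>z. (- c) * z powi (n + 1))" using v by auto
      then show ?thesis using flow_eq_pflow[OF z0, of n "- c" "- t"] dom[OF z] by simp
    qed
    then have "flow v (- t) ` \<gamma> = pflow n (c * of_real t) ` \<gamma>" by (rule image_cong[OF refl])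
    then show "test_ratio p f (pflow n (c * of_real t) ` \<gamma>) = moved v (test_function p f) \<gamma> t"
      unfolding moved_def using test_function_eq[OF encircling_pflow[OF enc dom]] by simp
  qed (use \<delta>(1) in auto)
qed

text \<open>\<open>vector_derivative\<close> and the Bochner integral are total, and the latter is 0
  for functions that are not integrable. The first two conjuncts exclude that the third holds for
  this reason. All of it reduces to the real fields \<open>c * z powi (n + 1)\<close> with
  \<open>c = 1\<close> and \<open>c = \<i>\<close>, from which the Witt action is a finite complex
  combination.\<close>

theorem proposition5p1:
  fixes \<mu> :: loop_measures
    and L :: "witt \<times> witt"
    and p :: coord_poly
    and f :: "real \<times> real \<Rightarrow> complex"
  assumes "werner_family \<mu>"
    and "smooth_compact_support ({0<..} \<times> {0<..}) f"
  shows "(\<forall>\<gamma>\<in>Loop1. witt_action_defined L (test_function p f) \<gamma>) \<and>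
    integrable (mu0 \<mu>) (witt_action L (test_function p f)) \<and>
    (\<integral>\<gamma>. witt_action L (test_function p f) \<gamma> \<partial>mu0 \<mu>) = 0"
proof -
  let ?F = "test_function p f"
  let ?T = "test_ratio p f"
  have movL: "(moved (vec_L n) ?F \<gamma> has_vector_derivative pderiv_flow n 1 ?T \<gamma>) (at 0)"
    and moviL: "(moved (vec_iL n) ?F \<gamma> has_vector_derivative pderiv_flow n \<i> ?T \<gamma>) (at 0)"
    if "\<gamma> \<in> Loop1" for n \<gamma>
    by (rule moved_test_function[OF assms(2) encircling_Loop1[OF that]]; simp add: vec_L_def vec_iL_def)+
  have def: "witt_action_defined L ?F \<gamma>" if "\<gamma> \<in> Loop1" for \<gamma>
    unfolding witt_action_defined_def
    using movL[OF that] moviL[OF that] differentiableI_vector by blast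
  obtain a b where ab: "0 < a" "a < b" "\<And>\<gamma>. encircling \<gamma> \<Longrightarrow> ?T \<gamma> \<noteq> 0 \<Longrightarrow> annular a b \<gamma>"
    using test_ratio_support[OF assms(2)] by metis
  have hb: "has_bochner_integral (mu0 \<mu>) (pderiv_flow n c ?T) 0" for n c
    by (rule integral_pderiv_flow[OF assms(1) tame_test_ratio[OF assms(2)] ab])
  define W1 where "W1 n \<gamma> = 1/2 * (pderiv_flow n 1 ?T \<gamma> - \<i> * pderiv_flow n \<i> ?T \<gamma>)" for n \<gamma>
  define W2 where "W2 n \<gamma> = 1/2 * (pderiv_flow n 1 ?T \<gamma> + \<i> * pderiv_flow n \<i> ?T \<gamma>)" for n \<gamma>
  have "has_bochner_integral (mu0 \<mu>) (W1 n) (1/2 * (0 - \<i> * 0))" for n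
    unfolding W1_def[abs_def] by (intro has_bochner_integral_mult_right has_bochner_integral_diff hb)
  then have W1: "has_bochner_integral (mu0 \<mu>) (W1 n) 0" for n by simp
  have "has_bochner_integral (mu0 \<mu>) (W2 n) (1/2 * (0 + \<i> * 0))" for n
    unfolding W2_def[abs_def] by (intro has_bochner_integral_mult_right has_bochner_integral_add hb)
  then have W2: "has_bochner_integral (mu0 \<mu>) (W2 n) 0" for n by simp
  have "has_bochner_integral (mu0 \<mu>)
    (\<lambda>\<gamma>. (\<Sum>n\<in>Poly_Mapping.keys (fst L). Poly_Mapping.lookup (fst L) n * W1 n \<gamma>) +
     (\<Sum>n\<in>Poly_Mapping.keys (snd L). Poly_Mapping.lookup (snd L) n * W2 n \<gamma>))
    ((\<Sum>n\<in>Poly_Mapping.keys (fst L). Poly_Mapping.lookup (fst L) n * 0) +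
     (\<Sum>n\<in>Poly_Mapping.keys (snd L). Poly_Mapping.lookup (snd L) n * 0))"
    by (intro has_bochner_integral_add has_bochner_integral_sum has_bochner_integral_mult_right W1 W2)
  then have "has_bochner_integral (mu0 \<mu>)
    (\<lambda>\<gamma>. (\<Sum>n\<in>Poly_Mapping.keys (fst L). Poly_Mapping.lookup (fst L) n * W1 n \<gamma>) +
     (\<Sum>n\<in>Poly_Mapping.keys (snd L). Poly_Mapping.lookup (snd L) n * W2 n \<gamma>)) 0" by simp
  moreover have "witt_action L ?F \<gamma> = (\<Sum>n\<in>Poly_Mapping.keys (fst L). Poly_Mapping.lookup (fst L) n * W1 n \<gamma>) +
     (\<Sum>n\<in>Poly_Mapping.keys (snd L). Poly_Mapping.lookup (snd L) n * W2 n \<gamma>)" if "\<gamma> \<in> space (mu0 \<mu>)" for \<gamma>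
  proof -
    have \<gamma>: "\<gamma> \<in> Loop1" using that by (simp add: mu0_def space_restrict_space)
    have "pi0 (vec_L n) ?F \<gamma> = pderiv_flow n 1 ?T \<gamma>" "pi0 (vec_iL n) ?F \<gamma> = pderiv_flow n \<i> ?T \<gamma>" for n
      unfolding pi0_def using vector_derivative_at[OF movL[OF \<gamma>]] vector_derivative_at[OF moviL[OF \<gamma>]] by auto
    then show ?thesis by (simp add: witt_action_def act_L_def act_L_bar_def W1_def W2_def)
  qed
  ultimately have "has_bochner_integral (mu0 \<mu>) (witt_action L ?F) 0"
    using has_bochner_integral_cong[OF refl, of "mu0 \<mu>" "witt_action L ?F"] by fastforce
  then show ?thesis using def by (simp add: has_bochner_integral_iff)
qed


end
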